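(* Let $\mathcal{T}$ be a Horn-$\mathcal{ALCHOI}$ TBox, $\mathcal{A}$ an ABox and $q$ a Boolean CQ. Any proof $p$ for $q$ in $\mathfrak{R}_{cq}(\mathcal{T}\cup\mathcal{A},q)$ can be transformed into a proof for $q$ in $\mathfrak{R}_{sk}(\mathcal{T}^s\cup\mathcal{A},q)$ in time polynomial in the sizes of $p$ and $\mathcal{T}$, and conversely any proof $p$ for $q$ in $\mathfrak{R}_{sk}(\mathcal{T}^s\cup\mathcal{A},q)$ can be transformed into a proof for $q$ in $\mathfrak{R}_{cq}(\mathcal{T}\cup\mathcal{A},q)$ in time polynomial in the sizes of $p$ and $\mathcal{T}$. The latter (the transformation from $\mathfrak{R}_{sk}$ to $\mathfrak{R}_{cq}$) also holds for tree proofs.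
   Context: Concept names, role names, individual names are disjoint; a role is $r$ or $r^-$ ($r^-(x,y)$ means $r(y,x)$). A (normalized) Horn-$\mathcal{ALCHOI}$ TBox is a finite set of rules of the forms (i) $A(x)\to B(x)$, (ii) $A(x)\land B(x)\to C(x)$, (iii) $R(x,y)\land A(y)\to B(x)$, (iv) $A(x)\to\exists y.\,R(x,y)\land B(y)$, (v) $A(x)\land R(x,y)\to B(y)$, (vi) $A(x)\to x=a$, (vii) $R_1(x,y)\to R_2(x,y)$ ($\bot$ not used). An ABox is a finite set of facts $A(a)$, $r(a,b)$. A Boolean CQ is $\exists\vec y.\phi(\vec y)$ with $\phi$ a conjunction of atoms (possibly equalities) over variables and individual names. The Skolemization $\mathcal{T}^s$ replaces every rule (iv) by $A(x)\to R(x,f(x))\land B(f(x))$ with a fresh unary function symbol $f$ per rule. A proof of $\mathcal{U}\models\eta$ is a finite acyclic directed labeled hypergraph with hyperedges (inferences) $(S,d)$, leaves labeled by elements of $\mathcal{U}$, sound inferences, exactly one sink labeled $\eta$, at most one incoming hyperedge per vertex; a tree proof is a proof that is a tree; its size is its number of vertices. A proof for $q$ in a derivation structure $\mathfrak{D}$ over $\mathcal{U}$ is a proof of $\mathcal{U}\models q$ all of whose inferences are inferences of $\mathfrak{D}$. $\mathfrak{R}_{sk}(\mathcal{T}^s\cup\mathcal{A},q)$ has all inferences: (MP) from ground atoms $\alpha_1,\dots,\alpha_k$ and $\psi\to\chi\in\mathcal{T}^s$ with a ground substitution $\sigma$, $\sigma(\psi)=\{\alpha_1,\dots,\alpha_k\}$,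 infer any atom of $\sigma(\chi)$; (E) from $\alpha$ and $t_1=t_2$ infer $\alpha[t_1\mapsto t_2]$; (C) from ground atoms infer their conjunction; (G) from a ground conjunction $\gamma$ infer $q$ if a mapping of $q$'s variables to ground terms sends all atoms of $q$ into $\gamma$. $\mathfrak{R}_{cq}(\mathcal{T}\cup\mathcal{A},q)$ has all inferences: (MP$_e$) from a Boolean CQ $\exists\vec x.\phi(\vec x)$ and a rule $\psi(\vec y,\vec z)\to\exists\vec u.\chi(\vec z,\vec u)$ (from $\mathcal{T}$ or produced by (T$_e$)), provided a substitution $\pi$ satisfies $\pi(\psi)\subseteq\phi$, infer $\exists\vec w.\rho(\vec w)$ where $\rho$ is obtained from $\phi$ by replacing any subset of $\pi(\psi)$ by any subset of $\pi(\chi(\vec z,\vec u'))$, $\vec u'$ fresh existentially quantified variables; (T$_e$) with no premises, infer $\phi(\vec x,\vec y)\to\exists\vec x.\phi(\vec x,\vec y)$ for a conjunction of atoms $\phi$; (E$_e$) from $\exists\vec x.\phi(\vec x)\land t_1=t_2$ infer $\exists\vec x.\phi(\vec x)[t_1\mapsto t_2]$; (C$_e$) from $\exists\vec x.\phi(\vec x)$ and $\exists\vec y.\psi(\vec y)$ infer $\exists\vec x,\vec u.\phi(\vec x)\land\psi(\vec u)$ ($\vec y$ renamed apart to $\vec u$); (G$_e$) from $\exists\vec x.\phi(\vec x,\vec a)$ with individual names $\vec a$ infer $\exists\vec x,\vec y.\phi(\vec x,\vec y)$.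
   Formalization: Every inference of a proof, given or produced, records its rule and substitution; the sizes of p and T are written lengths, not numbers of vertices; in (E) and (E_e), [t1 ↦ t2] replaces any chosen argument positions holding t1, never inside Skolem terms. *)

theory Defs
  imports Main "HOL-Library.FSet"
begin

section \<open>Syntax\<close>

text \<open>All names (of concepts, roles, individuals, variables and vertices) are finite words over a
  binary alphabet, so that every object below has an evident written length. Disjointness of the
  kinds of names is provided by the constructors.\<close>

type_synonym name = "bool list"

datatype role = Rn name | Inv name

text \<open>The symbol \<open>Sk A R B\<close> is the Skolem function of the rule
  \<open>A(x) \<rightarrow> \<exists>y. R(x,y) \<and> B(y)\<close>: it is fresh, and distinct rules get distinct symbols.\<close>

datatype fsym = Sk name role name

datatype tm = Var name | Ind name | Fn fsym tm

datatype 't atom = CA name 't | RA name 't 't | EqA 't 't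

text \<open>A conjunction is the finite set of its atoms. Read as a Boolean CQ, all of its variables are
  existentially quantified. A single atom is identified with the singleton conjunction.\<close>

type_synonym conj = "tm atom fset"

text \<open>\<open>Rule \<psi> X \<chi>\<close> is \<open>\<psi> \<rightarrow> \<exists>X. \<chi>\<close>. The variables of \<open>X\<close> are bound in \<open>\<chi>\<close> only; in the
  tautologies \<open>\<phi>(x,y) \<rightarrow> \<exists>x. \<phi>(x,y)\<close> they also occur, universally quantified, in the body.\<close>

datatype formula = CQ conj | Rule conj "name fset" conj

fun tvars :: "tm \<Rightarrow> name set" where
  "tvars (Var x) = {x}"
| "tvars (Ind a) = {}"
| "tvars (Fn f t) = tvars t"

fun flat_tm :: "tm \<Rightarrow> bool" where
  "flat_tm (Fn f t) = False"
| "flat_tm t = True"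

definition vars :: "conj \<Rightarrow> name set" where
  "vars \<phi> = (\<Union>\<alpha>\<in>fset \<phi>. \<Union>t\<in>set_atom \<alpha>. tvars t)"

definition ground :: "conj \<Rightarrow> bool" where
  "ground \<phi> \<longleftrightarrow> vars \<phi> = {}"

definition bcq :: "conj \<Rightarrow> bool" where
  "bcq \<phi> \<longleftrightarrow> \<phi> \<noteq> {||} \<and> (\<forall>\<alpha>\<in>fset \<phi>. \<forall>t\<in>set_atom \<alpha>. flat_tm t)"

fun tsub :: "(name \<Rightarrow> tm) \<Rightarrow> tm \<Rightarrow> tm" where
  "tsub \<sigma> (Var x) = \<sigma> x"
| "tsub \<sigma> (Ind a) = Ind a"
| "tsub \<sigma> (Fn f t) = Fn f (tsub \<sigma> t)"

definition asub :: "(name \<Rightarrow> tm) \<Rightarrow> tm atom \<Rightarrow> tm atom" where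
  "asub \<sigma> = map_atom (tsub \<sigma>)"

definition csub :: "(name \<Rightarrow> tm) \<Rightarrow> conj \<Rightarrow> conj" where
  "csub \<sigma> \<phi> = asub \<sigma> |`| \<phi>"

text \<open>Substitutions are written as finite association lists.\<close>

definition sub :: "(name \<times> tm) list \<Rightarrow> name \<Rightarrow> tm" where
  "sub s x = (case map_of s x of Some t \<Rightarrow> t | None \<Rightarrow> Var x)"

definition ren :: "(name \<times> name) list \<Rightarrow> name \<Rightarrow> name" where
  "ren m x = (case map_of m x of Some y \<Rightarrow> y | None \<Rightarrow> x)"

definition ind_sub :: "(name \<times> name) list \<Rightarrow> name \<Rightarrow> tm" where
  "ind_sub s x = (case map_of s x of Some a \<Rightarrow> Ind a | None \<Rightarrow> Var x)"

text \<open>\<open>repl t1 t2 \<alpha> \<beta>\<close>: \<open>\<beta>\<close> is of the form \<open>\<alpha>[t1 \<mapsto> t2]\<close>. Any selection of the argument positions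
  of \<open>\<alpha>\<close> that hold \<open>t1\<close> may be replaced; \<open>t1\<close> is not replaced inside a Skolem term.\<close>

definition repl :: "tm \<Rightarrow> tm \<Rightarrow> tm atom \<Rightarrow> tm atom \<Rightarrow> bool" where
  "repl t1 t2 = rel_atom (\<lambda>s s'. s' = s \<or> s = t1 \<and> s' = t2)"


section \<open>Ontologies\<close>

datatype axm =
    Sub name name              \<comment> \<open>\<open>A(x) \<rightarrow> B(x)\<close>\<close>
  | Conj name name name        \<comment> \<open>\<open>A(x) \<and> B(x) \<rightarrow> C(x)\<close>\<close>
  | ExL role name name         \<comment> \<open>\<open>R(x,y) \<and> A(y) \<rightarrow> B(x)\<close>\<close>
  | ExR name role name         \<comment> \<open>\<open>A(x) \<rightarrow> \<exists>y. R(x,y) \<and> B(y)\<close>\<close>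
  | AllR name role name         \<comment> \<open>\<open>A(x) \<and> R(x,y) \<rightarrow> B(y)\<close>\<close>
  | Nom name name              \<comment> \<open>\<open>A(x) \<rightarrow> x = a\<close>\<close>
  | RSub role role             \<comment> \<open>\<open>R1(x,y) \<rightarrow> R2(x,y)\<close>\<close>

definition vx :: name where "vx = [False]"
definition vy :: name where "vy = [True]"

fun ratom :: "role \<Rightarrow> tm \<Rightarrow> tm \<Rightarrow> tm atom" where
  "ratom (Rn r) s t = RA r s t"
| "ratom (Inv r) s t = RA r t s"

fun rule_of :: "axm \<Rightarrow> formula" where
  "rule_of (Sub A B) = Rule {|CA A (Var vx)|} {||} {|CA B (Var vx)|}"
| "rule_of (Conj A B C) = Rule {|CA A (Var vx), CA B (Var vx)|} {||} {|CA C (Var vx)|}"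
| "rule_of (ExL R A B) = Rule {|ratom R (Var vx) (Var vy), CA A (Var vy)|} {||} {|CA B (Var vx)|}"
| "rule_of (ExR A R B) = Rule {|CA A (Var vx)|} {|vy|} {|ratom R (Var vx) (Var vy), CA B (Var vy)|}"
| "rule_of (AllR A R B) = Rule {|CA A (Var vx), ratom R (Var vx) (Var vy)|} {||} {|CA B (Var vy)|}"
| "rule_of (Nom A a) = Rule {|CA A (Var vx)|} {||} {|EqA (Var vx) (Ind a)|}"
| "rule_of (RSub R1 R2) = Rule {|ratom R1 (Var vx) (Var vy)|} {||} {|ratom R2 (Var vx) (Var vy)|}"

fun skolem :: "axm \<Rightarrow> formula" where
  "skolem (ExR A R B) = (let fx = Fn (Sk A R B) (Var vx)
     in Rule {|CA A (Var vx)|} {||} {|ratom R (Var vx) fx, CA B fx|})"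
| "skolem ax = rule_of ax"

definition is_tbox :: "axm set \<Rightarrow> bool" where
  "is_tbox T \<longleftrightarrow> finite T"

definition is_abox :: "tm atom set \<Rightarrow> bool" where
  "is_abox A \<longleftrightarrow> finite A \<and>
     (\<forall>\<alpha>\<in>A. (\<exists>B a. \<alpha> = CA B (Ind a)) \<or> (\<exists>r a b. \<alpha> = RA r (Ind a) (Ind b)))"

definition facts :: "tm atom set \<Rightarrow> formula set" where
  "facts A = (\<lambda>\<alpha>. CQ {|\<alpha>|}) ` A"


section \<open>Entailment\<close>

text \<open>Only finite sets of premises in a countable language are considered, so by the downward
  Loewenheim-Skolem theorem it suffices to let the universe range over the nonempty sets of natural
  numbers.\<close>

record interp =
  univ :: "nat set"
  ci :: "name \<Rightarrow> nat set"
  ri :: "name \<Rightarrow> (nat \<times> nat) set"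
  ii :: "name \<Rightarrow> nat"
  fi :: "fsym \<Rightarrow> nat \<Rightarrow> nat"

definition is_interp :: "interp \<Rightarrow> bool" where
  "is_interp I \<longleftrightarrow> univ I \<noteq> {} \<and> (\<forall>a. ii I a \<in> univ I) \<and> (\<forall>f. \<forall>d\<in>univ I. fi I f d \<in> univ I)"

fun val :: "interp \<Rightarrow> (name \<Rightarrow> nat) \<Rightarrow> tm \<Rightarrow> nat" where
  "val I v (Var x) = v x"
| "val I v (Ind a) = ii I a"
| "val I v (Fn f t) = fi I f (val I v t)"

fun sat_atom :: "interp \<Rightarrow> (name \<Rightarrow> nat) \<Rightarrow> tm atom \<Rightarrow> bool" where
  "sat_atom I v (CA B t) \<longleftrightarrow> val I v t \<in> ci I B"
| "sat_atom I v (RA r s t) \<longleftrightarrow> (val I v s, val I v t) \<in> ri I r"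
| "sat_atom I v (EqA s t) \<longleftrightarrow> val I v s = val I v t"

definition sat_conj :: "interp \<Rightarrow> (name \<Rightarrow> nat) \<Rightarrow> conj \<Rightarrow> bool" where
  "sat_conj I v \<phi> \<longleftrightarrow> (\<forall>\<alpha>\<in>fset \<phi>. sat_atom I v \<alpha>)"

fun sat :: "interp \<Rightarrow> formula \<Rightarrow> bool" where
  "sat I (CQ \<phi>) \<longleftrightarrow> (\<exists>v. range v \<subseteq> univ I \<and> sat_conj I v \<phi>)"
| "sat I (Rule \<psi> X \<chi>) \<longleftrightarrow> (\<forall>v. range v \<subseteq> univ I \<longrightarrow> sat_conj I v \<psi> \<longrightarrow>
     (\<exists>w. range w \<subseteq> univ I \<and> (\<forall>x. x |\<notin>| X \<longrightarrow> w x = v x) \<and> sat_conj I w \<chi>))"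

definition entails :: "formula set \<Rightarrow> formula \<Rightarrow> bool" where
  "entails \<Gamma> \<eta> \<longleftrightarrow> (\<forall>I. is_interp I \<longrightarrow> (\<forall>\<gamma>\<in>\<Gamma>. sat I \<gamma>) \<longrightarrow> sat I \<eta>)"


section \<open>Proofs\<close>

text \<open>Vertices are labelled with formulas. Each hyperedge \<open>(S,d)\<close> also carries the inference rule and
  the substitution by which it was obtained: recovering a substitution from the labels alone amounts
  to searching for a homomorphism between CQs.\<close>

record 'j hproof =
  verts :: "name set"
  edges :: "(name set \<times> name) set"
  lab :: "name \<Rightarrow> formula"
  just :: "name set \<times> name \<Rightarrow> 'j"

definition is_leaf :: "'j hproof \<Rightarrow> name \<Rightarrow> bool" where
  "is_leaf p v \<longleftrightarrow> v \<in> verts p \<and> (\<forall>S. (S, v) \<notin> edges p)"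

definition is_sink :: "'j hproof \<Rightarrow> name \<Rightarrow> bool" where
  "is_sink p v \<longleftrightarrow> v \<in> verts p \<and> (\<forall>(S, d)\<in>edges p. v \<notin> S)"

definition is_proof :: "formula set \<Rightarrow> formula \<Rightarrow> 'j hproof \<Rightarrow> bool" where
  "is_proof U \<eta> p \<longleftrightarrow>
     finite (verts p) \<and>
     (\<forall>(S, d)\<in>edges p. S \<subseteq> verts p \<and> d \<in> verts p) \<and>
     acyclic {(s, d). \<exists>S. (S, d) \<in> edges p \<and> s \<in> S} \<and>
     (\<forall>v. is_leaf p v \<longrightarrow> lab p v \<in> U) \<and>
     (\<forall>(S, d)\<in>edges p. entails (lab p ` S) (lab p d)) \<and>
     (\<exists>v. (\<forall>u. is_sink p u \<longleftrightarrow> u = v) \<and> lab p v = \<eta>) \<and>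
     (\<forall>S S' d. (S, d) \<in> edges p \<longrightarrow> (S', d) \<in> edges p \<longrightarrow> S = S')"

text \<open>In an acyclic hypergraph with a single sink, being a tree means that no vertex is used in more
  than one inference.\<close>

definition is_tree :: "'j hproof \<Rightarrow> bool" where
  "is_tree p \<longleftrightarrow> (\<forall>v\<in>verts p. \<forall>e\<in>edges p. \<forall>e'\<in>edges p. v \<in> fst e \<longrightarrow> v \<in> fst e' \<longrightarrow> e = e')"

text \<open>A derivation structure is given by its inferences: \<open>D j \<Gamma> \<eta>\<close> states that \<open>j\<close> justifies the
  inference of \<open>\<eta>\<close> from the premises \<open>\<Gamma>\<close>.\<close>

definition proof_in ::
  "('j \<Rightarrow> formula set \<Rightarrow> formula \<Rightarrow> bool) \<Rightarrow> formula set \<Rightarrow> conj \<Rightarrow> 'j hproof \<Rightarrow> bool" where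
  "proof_in D U q p \<longleftrightarrow> is_proof U (CQ q) p \<and>
     (\<forall>(S, d)\<in>edges p. D (just p (S, d)) (lab p ` S) (lab p d))"


section \<open>The Skolemized derivation structure\<close>

datatype sk_just = ByMP "(name \<times> tm) list" | ByE tm tm | ByC | ByG "(name \<times> tm) list"

inductive sk_inf :: "axm set \<Rightarrow> conj \<Rightarrow> sk_just \<Rightarrow> formula set \<Rightarrow> formula \<Rightarrow> bool"
  for T :: "axm set" and q :: conj where
  MP: "\<lbrakk>ax \<in> T; skolem ax = Rule \<psi> {||} \<chi>;
        ground (csub (sub s) \<psi>); ground (csub (sub s) \<chi>); \<alpha> |\<in>| csub (sub s) \<chi>\<rbrakk>
    \<Longrightarrow> sk_inf T q (ByMP s)
          (insert (skolem ax) {CQ {|\<beta>|} |\<beta>. \<beta> |\<in>| csub (sub s) \<psi>}) (CQ {|\<alpha>|})"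
| E: "\<lbrakk>ground {|\<alpha>, EqA t1 t2|}; repl t1 t2 \<alpha> \<beta>\<rbrakk>
    \<Longrightarrow> sk_inf T q (ByE t1 t2) {CQ {|\<alpha>|}, CQ {|EqA t1 t2|}} (CQ {|\<beta>|})"
| C: "\<lbrakk>ground \<gamma>; \<gamma> \<noteq> {||}\<rbrakk>
    \<Longrightarrow> sk_inf T q ByC {CQ {|\<alpha>|} |\<alpha>. \<alpha> |\<in>| \<gamma>} (CQ \<gamma>)"
| G: "\<lbrakk>ground \<gamma>; ground (csub (sub s) q); csub (sub s) q |\<subseteq>| \<gamma>\<rbrakk>
    \<Longrightarrow> sk_inf T q (ByG s) {CQ \<gamma>} (CQ q)"

definition sk_proof ::
  "axm set \<Rightarrow> tm atom set \<Rightarrow> conj \<Rightarrow> sk_just hproof \<Rightarrow> bool" where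
  "sk_proof T A q = proof_in (sk_inf T q) (skolem ` T \<union> facts A) q"


section \<open>The derivation structure on conjunctive queries\<close>

datatype cq_just =
    ByMPe "(name \<times> tm) list" "(name \<times> name) list"
  | ByTe
  | ByEe tm tm
  | ByCe "(name \<times> name) list"
  | ByGe "(name \<times> name) list"

inductive taut_rule :: "formula \<Rightarrow> bool" where
  "\<lbrakk>bcq \<phi>; fset X \<subseteq> vars \<phi>\<rbrakk> \<Longrightarrow> taut_rule (Rule \<phi> X \<phi>)"

text \<open>In \<open>MPe\<close>, \<open>\<chi>'\<close> is \<open>\<pi>(\<chi>)\<close> with the bound variables \<open>X\<close> renamed by \<open>m\<close> to fresh ones. In
  \<open>Ge\<close>, \<open>s\<close> maps the newly quantified variables of the conclusion back to the individual names that
  they replace.\<close>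

inductive cq_inf :: "axm set \<Rightarrow> cq_just \<Rightarrow> formula set \<Rightarrow> formula \<Rightarrow> bool"
  for T :: "axm set" where
  MPe: "\<lbrakk>bcq \<phi>; Rule \<psi> X \<chi> \<in> rule_of ` T \<or> taut_rule (Rule \<psi> X \<chi>);
         csub (sub s) \<psi> |\<subseteq>| \<phi>;
         inj_on (ren m) (fset X); ren m ` fset X \<inter> vars \<phi> = {};
         \<chi>' = csub (\<lambda>z. if z |\<in>| X then Var (ren m z) else sub s z) \<chi>;
         P |\<subseteq>| csub (sub s) \<psi>; Q |\<subseteq>| \<chi>'; \<rho> = (\<phi> |-| P) |\<union>| Q; bcq \<rho>\<rbrakk>
    \<Longrightarrow> cq_inf T (ByMPe s m) {CQ \<phi>, Rule \<psi> X \<chi>} (CQ \<rho>)"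
| Te: "taut_rule r \<Longrightarrow> cq_inf T ByTe {} r"
| Ee: "\<lbrakk>bcq (finsert (EqA t1 t2) \<phi>); rel_fset (repl t1 t2) \<phi> \<rho>; bcq \<rho>\<rbrakk>
    \<Longrightarrow> cq_inf T (ByEe t1 t2) {CQ (finsert (EqA t1 t2) \<phi>)} (CQ \<rho>)"
| Ce: "\<lbrakk>bcq \<phi>; bcq \<psi>; inj_on (ren m) (vars \<psi>); ren m ` vars \<psi> \<inter> vars \<phi> = {}\<rbrakk>
    \<Longrightarrow> cq_inf T (ByCe m) {CQ \<phi>, CQ \<psi>} (CQ (\<phi> |\<union>| csub (\<lambda>z. Var (ren m z)) \<psi>))"
| Ge: "\<lbrakk>bcq \<phi>; bcq \<rho>; \<phi> = csub (ind_sub s) \<rho>\<rbrakk>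
    \<Longrightarrow> cq_inf T (ByGe s) {CQ \<phi>} (CQ \<rho>)"

definition cq_proof ::
  "axm set \<Rightarrow> tm atom set \<Rightarrow> conj \<Rightarrow> cq_just hproof \<Rightarrow> bool" where
  "cq_proof T A q = proof_in (cq_inf T) (rule_of ` T \<union> facts A) q"


section \<open>Computation\<close>

text \<open>The model of computation is a first-order call-by-value functional language over binary trees
  (pure LISP). A program is a list of function bodies, the first one being the main function. Every
  evaluation step is charged the size of the value that it produces, so running time bounds the size
  of the output and polynomial time coincides with polynomial time on Turing machines.\<close>

datatype bintree = Tip | Bin bintree bintree

fun sz :: "bintree \<Rightarrow> nat" where
  "sz Tip = 1"
| "sz (Bin a b) = 1 + sz a + sz b"

fun hd_tree :: "bintree \<Rightarrow> bintree" where
  "hd_tree Tip = Tip"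
| "hd_tree (Bin a b) = a"

fun tl_tree :: "bintree \<Rightarrow> bintree" where
  "tl_tree Tip = Tip"
| "tl_tree (Bin a b) = b"

definition bool_tree :: "bool \<Rightarrow> bintree" where
  "bool_tree b = (if b then Bin Tip Tip else Tip)"

datatype expr =
    EArg nat
  | ETip
  | EBin expr expr
  | EHd expr
  | ETl expr
  | EEq expr expr
  | EIf expr expr expr
  | ECall nat "expr list"

text \<open>\<open>eval F env e v n\<close>: with arguments \<open>env\<close>, \<open>e\<close> evaluates to \<open>v\<close> at cost \<open>n\<close>.\<close>

inductive eval :: "expr list \<Rightarrow> bintree list \<Rightarrow> expr \<Rightarrow> bintree \<Rightarrow> nat \<Rightarrow> bool"
  and evals :: "expr list \<Rightarrow> bintree list \<Rightarrow> expr list \<Rightarrow> bintree list \<Rightarrow> nat \<Rightarrow> bool"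
  for F :: "expr list" where
  "i < length env \<Longrightarrow> eval F env (EArg i) (env ! i) (sz (env ! i))"
| "eval F env ETip Tip 1"
| "\<lbrakk>eval F env e1 v1 n1; eval F env e2 v2 n2\<rbrakk>
    \<Longrightarrow> eval F env (EBin e1 e2) (Bin v1 v2) (n1 + n2 + sz (Bin v1 v2))"
| "eval F env e v n \<Longrightarrow> eval F env (EHd e) (hd_tree v) (n + sz (hd_tree v))"
| "eval F env e v n \<Longrightarrow> eval F env (ETl e) (tl_tree v) (n + sz (tl_tree v))"
| "\<lbrakk>eval F env e1 v1 n1; eval F env e2 v2 n2; v = bool_tree (v1 = v2)\<rbrakk>
    \<Longrightarrow> eval F env (EEq e1 e2) v (n1 + n2 + sz v)"
| "\<lbrakk>eval F env e v n; v \<noteq> Tip; eval F env e1 v1 n1\<rbrakk>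
    \<Longrightarrow> eval F env (EIf e e1 e2) v1 (n + n1 + sz v1)"
| "\<lbrakk>eval F env e Tip n; eval F env e2 v2 n2\<rbrakk>
    \<Longrightarrow> eval F env (EIf e e1 e2) v2 (n + n2 + sz v2)"
| "\<lbrakk>i < length F; evals F env es vs n; eval F vs (F ! i) v m\<rbrakk>
    \<Longrightarrow> eval F env (ECall i es) v (n + m + sz v)"
| "evals F env [] [] 0"
| "\<lbrakk>eval F env e v n; evals F env es vs m\<rbrakk> \<Longrightarrow> evals F env (e # es) (v # vs) (n + m)"

definition computes_in :: "expr list \<Rightarrow> bintree list \<Rightarrow> bintree \<Rightarrow> nat \<Rightarrow> bool" where
  "computes_in F ins out b \<longleftrightarrow> F \<noteq> [] \<and> (\<exists>n\<le>b. eval F ins (F ! 0) out n)"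


section \<open>Codes\<close>

primrec list_tree :: "bintree list \<Rightarrow> bintree" where
  "list_tree [] = Tip"
| "list_tree (d # ds) = Bin d (list_tree ds)"

definition tag :: "nat \<Rightarrow> bintree list \<Rightarrow> bintree" where
  "tag n ds = Bin ((Bin Tip ^^ n) Tip) (list_tree ds)"

definition enc_name :: "name \<Rightarrow> bintree" where
  "enc_name a = list_tree (map bool_tree a)"

fun enc_role :: "role \<Rightarrow> bintree" where
  "enc_role (Rn r) = tag 0 [enc_name r]"
| "enc_role (Inv r) = tag 1 [enc_name r]"

fun enc_fsym :: "fsym \<Rightarrow> bintree" where
  "enc_fsym (Sk A R B) = list_tree [enc_name A, enc_role R, enc_name B]"

fun enc_tm :: "tm \<Rightarrow> bintree" where
  "enc_tm (Var x) = tag 0 [enc_name x]"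
| "enc_tm (Ind a) = tag 1 [enc_name a]"
| "enc_tm (Fn f t) = tag 2 [enc_fsym f, enc_tm t]"

fun enc_atom :: "tm atom \<Rightarrow> bintree" where
  "enc_atom (CA A t) = tag 0 [enc_name A, enc_tm t]"
| "enc_atom (RA r s t) = tag 1 [enc_name r, enc_tm s, enc_tm t]"
| "enc_atom (EqA s t) = tag 2 [enc_tm s, enc_tm t]"

fun enc_axm :: "axm \<Rightarrow> bintree" where
  "enc_axm (Sub A B) = tag 0 [enc_name A, enc_name B]"
| "enc_axm (Conj A B C) = tag 1 [enc_name A, enc_name B, enc_name C]"
| "enc_axm (ExL R A B) = tag 2 [enc_role R, enc_name A, enc_name B]"
| "enc_axm (ExR A R B) = tag 3 [enc_name A, enc_role R, enc_name B]"
| "enc_axm (AllR A R B) = tag 4 [enc_name A, enc_role R, enc_name B]"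
| "enc_axm (Nom A a) = tag 5 [enc_name A, enc_name a]"
| "enc_axm (RSub R1 R2) = tag 6 [enc_role R1, enc_role R2]"

definition enc_sub :: "(name \<times> tm) list \<Rightarrow> bintree" where
  "enc_sub s = list_tree (map (\<lambda>(x, t). Bin (enc_name x) (enc_tm t)) s)"

definition enc_ren :: "(name \<times> name) list \<Rightarrow> bintree" where
  "enc_ren m = list_tree (map (\<lambda>(x, y). Bin (enc_name x) (enc_name y)) m)"

fun enc_sk_just :: "sk_just \<Rightarrow> bintree" where
  "enc_sk_just (ByMP s) = tag 0 [enc_sub s]"
| "enc_sk_just (ByE t1 t2) = tag 1 [enc_tm t1, enc_tm t2]"
| "enc_sk_just ByC = tag 2 []"
| "enc_sk_just (ByG s) = tag 3 [enc_sub s]"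

fun enc_cq_just :: "cq_just \<Rightarrow> bintree" where
  "enc_cq_just (ByMPe s m) = tag 0 [enc_sub s, enc_ren m]"
| "enc_cq_just ByTe = tag 1 []"
| "enc_cq_just (ByEe t1 t2) = tag 2 [enc_tm t1, enc_tm t2]"
| "enc_cq_just (ByCe m) = tag 3 [enc_ren m]"
| "enc_cq_just (ByGe s) = tag 4 [enc_ren s]"

text \<open>A finite set is coded by the list of the codes of its elements, in any order and without
  repetitions. Hence coding is a relation and not a function; \<open>R x d\<close> means that \<open>d\<close> is a code
  of \<open>x\<close>.\<close>

definition codes_set :: "('a \<Rightarrow> bintree \<Rightarrow> bool) \<Rightarrow> 'a set \<Rightarrow> bintree \<Rightarrow> bool" where
  "codes_set R X d \<longleftrightarrow>
     (\<exists>xs ds. distinct xs \<and> set xs = X \<and> list_all2 R xs ds \<and> d = list_tree ds)"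

definition codes_conj :: "conj \<Rightarrow> bintree \<Rightarrow> bool" where
  "codes_conj \<phi> = codes_set (\<lambda>\<alpha> d. d = enc_atom \<alpha>) (fset \<phi>)"

definition codes_names :: "name set \<Rightarrow> bintree \<Rightarrow> bool" where
  "codes_names = codes_set (\<lambda>x d. d = enc_name x)"

inductive codes_formula :: "formula \<Rightarrow> bintree \<Rightarrow> bool" where
  "codes_conj \<phi> d \<Longrightarrow> codes_formula (CQ \<phi>) (tag 0 [d])"
| "\<lbrakk>codes_conj \<psi> d1; codes_names (fset X) d2; codes_conj \<chi> d3\<rbrakk>
    \<Longrightarrow> codes_formula (Rule \<psi> X \<chi>) (tag 1 [d1, d2, d3])"

definition codes_tbox :: "axm set \<Rightarrow> bintree \<Rightarrow> bool" where
  "codes_tbox = codes_set (\<lambda>ax d. d = enc_axm ax)"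

definition codes_proof :: "('j \<Rightarrow> bintree) \<Rightarrow> 'j hproof \<Rightarrow> bintree \<Rightarrow> bool" where
  "codes_proof enc_j p d \<longleftrightarrow> (\<exists>dv de. d = Bin dv de \<and>
     codes_set (\<lambda>v dv'. \<exists>l. codes_formula (lab p v) l \<and> dv' = list_tree [enc_name v, l])
       (verts p) dv \<and>
     codes_set (\<lambda>(S, v) de'. \<exists>s. codes_names S s \<and>
                  de' = list_tree [s, enc_name v, enc_j (just p (S, v))])
       (edges p) de)"

text \<open>Proofs with property \<open>P\<close> can be transformed in polynomial time into proofs with property \<open>Q\<close>:
  one program and one polynomial serve all TBoxes, ABoxes, queries and proofs, and the program is
  given only the proof and the TBox. Sizes are those of the codes.\<close>

definition polytime_transformable ::
  "(axm set \<Rightarrow> tm atom set \<Rightarrow> conj \<Rightarrow> 'i hproof \<Rightarrow> bool) \<Rightarrow> ('i \<Rightarrow> bintree) \<Rightarrow>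
   (axm set \<Rightarrow> tm atom set \<Rightarrow> conj \<Rightarrow> 'o hproof \<Rightarrow> bool) \<Rightarrow> ('o \<Rightarrow> bintree) \<Rightarrow> bool" where
  "polytime_transformable P enc_i Q enc_o \<longleftrightarrow>
     (\<exists>F c k. \<forall>T A q p dp dT.
        is_tbox T \<longrightarrow> is_abox A \<longrightarrow> bcq q \<longrightarrow> P T A q p \<longrightarrow>
        codes_proof enc_i p dp \<longrightarrow> codes_tbox T dT \<longrightarrow>
        (\<exists>p' dp'. Q T A q p' \<and> codes_proof enc_o p' dp' \<and>
           computes_in F [dp, dT] dp' (c * (sz dp + sz dT) ^ k)))"

end

theory Submission
  imports Defs
begin

text \<open>No program is ever written down. Each type carries its code (\<^term>\<open>enc\<close>), a function between
  such types is \<^term>\<open>pt\<close> if some program computes it on codes in polynomial time, and \<^term>\<open>pt\<close> is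
  closed under composition, case distinction and those recursions on lists whose intermediate
  results stay polynomially bounded. So each transformation is given as a function on lists.

  From CQs to Skolem terms: assign to every variable of every CQ of the proof the ground term that
  the inferences force. It is found by chasing the variable back to the inference that introduced
  it; as Skolem functions are unary, its size is linear in the length of the chase. The instance of
  every atom is then a copy of an atom of a premise, or follows from such atoms by (E) or (MP). A
  final (C) collects all the atoms, so that no vertex is left over, and (G) gives the query.

  From Skolem terms to CQs: run through the inferences in a topological order and keep one growing
  CQ, in which a Skolem term \<open>f(t)\<close> is represented by a variable named after it. The first use of an
  existential rule for \<open>f(t)\<close> introduces both atoms of its head at once, so that a later use of the
  other one has nothing to do. In the end the tautology \<open>q \<and> \<Phi> \<rightarrow> \<exists>x. q \<and> \<Phi>\<close>, where \<open>x\<close> are the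
  variables of the query \<open>q\<close> and \<open>\<Phi>\<close> is the last CQ, replaces \<open>\<Phi>\<close> by \<open>q\<close>. Each CQ is used once, hence
  the result is a tree.\<close>

section \<open>Polynomial-time functions on codable types\<close>

text \<open>The transformations have to be right only on codes of genuine proofs, so they never
  check their input, and every search carries a default value. A code lists a set in arbitrary order
  and a hyperedge has an unordered set of premises; the role of each premise is therefore recovered
  from the labels. Fresh names are not produced by counting. A vertex or variable is named by the
  bit string of the data it stands for, so distinctness is injectivity of the coding, and freshness
  against the query can be decided by comparing lengths. Acyclicity enters through a rank, the
  number of ancestors of a vertex, which is below the number of vertices. This bounds the length of
  a chase as well as the number of rounds of the topological sort. In the last step towards a CQ
  proof, \<Phi> belongs to the body of the tautology because (MP_e) removes only atoms of the body
  instance, and all of \<Phi> has to go. The variables of \<open>q\<close> keep their names there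
  and so must not occur in \<Phi>.\<close>

class codable =
  fixes enc :: "'a \<Rightarrow> bintree"
  assumes inj_enc: "inj enc"

lemma enc_eq_iff [simp]: "enc x = enc y \<longleftrightarrow> x = y"
  by (simp add: inj_eq inj_enc)

abbreviation csz :: "'a::codable \<Rightarrow> nat" where "csz x \<equiv> sz (enc x)"

lemma sz_pos [simp]: "0 < sz t"
  by (cases t) auto

lemma sz_ge_1 [simp]: "Suc 0 \<le> sz t"
  by (cases t) auto

text \<open>Since every code has size at least 1, lower powers are dominated by higher ones and a
  single monomial suffices as a bound; degree 0 gives the constants.\<close>

definition pbound :: "('a::codable \<Rightarrow> nat) \<Rightarrow> bool" where
  "pbound b \<longleftrightarrow> (\<exists>c k. \<forall>x. b x \<le> c * csz x ^ k)"

lemma pbound_mono: "pbound b \<Longrightarrow> (\<And>x. a x \<le> b x) \<Longrightarrow> pbound a"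
  unfolding pbound_def by (meson le_trans)

lemma pbound_const: "pbound (\<lambda>x. c)"
  unfolding pbound_def by (rule exI[of _ c], rule exI[of _ 0]) simp

lemma pbound_csz: "pbound (\<lambda>x. csz x)"
  unfolding pbound_def by (rule exI[of _ 1], rule exI[of _ 1]) simp

lemma pbound_add: assumes "pbound a" "pbound b" shows "pbound (\<lambda>x. a x + b x)"
proof -
  obtain c k d l where a: "\<And>x. a x \<le> c * csz x ^ k" and b: "\<And>x. b x \<le> d * csz x ^ l"
    using assms unfolding pbound_def by metis
  have "a x + b x \<le> (c + d) * csz x ^ (k + l)" for x
  proof -
    have "csz x ^ k \<le> csz x ^ (k + l)" "csz x ^ l \<le> csz x ^ (k + l)"
      by (simp_all add: power_increasing)
    then have "c * csz x ^ k + d * csz x ^ l \<le> (c + d) * csz x ^ (k + l)"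
      unfolding distrib_right by (intro add_mono mult_le_mono2)
    then show ?thesis using a[of x] b[of x] by linarith
  qed
  then show ?thesis unfolding pbound_def by blast
qed

lemma pbound_mult: assumes "pbound a" "pbound b" shows "pbound (\<lambda>x. a x * b x)"
proof -
  obtain c k d l where a: "\<And>x. a x \<le> c * csz x ^ k" and b: "\<And>x. b x \<le> d * csz x ^ l"
    using assms unfolding pbound_def by metis
  have "a x * b x \<le> (c * d) * csz x ^ (k + l)" for x
    using mult_mono[OF a[of x] b[of x]] by (simp add: power_add ac_simps)
  then show ?thesis unfolding pbound_def by blast
qed

lemma pbound_power: "pbound a \<Longrightarrow> pbound (\<lambda>x. a x ^ k)"
  by (induction k) (simp_all add: pbound_const pbound_mult)

lemma pbound_Suc: "pbound a \<Longrightarrow> pbound (\<lambda>x. Suc (a x))"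
  using pbound_add[OF _ pbound_const[of 1]] by simp

lemma pbound_comp:
  assumes "pbound b" "pbound a" "\<And>x. csz (f x) \<le> a x"
  shows "pbound (\<lambda>x. b (f x))"
proof -
  obtain c k where b: "\<And>x. b x \<le> c * csz x ^ k" using assms(1) unfolding pbound_def by metis
  have "b (f x) \<le> c * a x ^ k" for x
    using b[of "f x"] power_mono[OF assms(3)[of x], of k] mult_le_mono2 order_trans by blast
  then show ?thesis
    by (rule pbound_mono[OF pbound_mult[OF pbound_const[of c] pbound_power[OF assms(2), of k]]])
qed

lemmas pbound_intros = pbound_const pbound_csz pbound_add pbound_mult pbound_power pbound_Suc

subsection \<open>Linking programs\<close>

text \<open>A function calls another by its position in the program. Placing a program behind
  \<open>k\<close> other functions therefore relocates its calls by \<open>k\<close>; appending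
  functions at the end changes nothing.\<close>

fun shift :: "nat \<Rightarrow> expr \<Rightarrow> expr" where
  "shift k (EArg i) = EArg i"
| "shift k ETip = ETip"
| "shift k (EBin a b) = EBin (shift k a) (shift k b)"
| "shift k (EHd a) = EHd (shift k a)"
| "shift k (ETl a) = ETl (shift k a)"
| "shift k (EEq a b) = EEq (shift k a) (shift k b)"
| "shift k (EIf a b c) = EIf (shift k a) (shift k b) (shift k c)"
| "shift k (ECall i es) = ECall (k + i) (map (shift k) es)"

lemma eval_append:
  "eval F env e v n \<Longrightarrow> eval (F @ G) env e v n"
  "evals F env es vs m \<Longrightarrow> evals (F @ G) env es vs m"
proof (induction rule: eval_evals.inducts)
  case (9 i env es vs n v m)
  then show ?case using eval_evals.intros(9)[of i "F @ G" env es vs n v m]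
    by (simp add: nth_append)
qed (auto intro: eval_evals.intros simp del: sz.simps One_nat_def)

lemma eval_shift:
  "eval F env e v n \<Longrightarrow> eval (G @ map (shift (length G)) F) env (shift (length G) e) v n"
  "evals F env es vs m \<Longrightarrow>
    evals (G @ map (shift (length G)) F) env (map (shift (length G)) es) vs m"
proof (induction rule: eval_evals.inducts)
  case (9 i env es vs n v m)
  then show ?case
    using eval_evals.intros(9)[of "length G + i" "G @ map (shift (length G)) F" env
        "map (shift (length G)) es" vs n v m]
    by simp
qed (auto intro: eval_evals.intros simp del: sz.simps One_nat_def)

text \<open>Every step is charged the size of its value, so time bounds the size of the output. This
  is what lets polynomial bounds pass through composition.\<close>

lemma eval_cost_ge:
  "eval F env e v n \<Longrightarrow> sz v \<le> n"
  "evals F env es vs m \<Longrightarrow> True"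
  by (induction rule: eval_evals.inducts) auto

text \<open>The index \<open>i\<close> lets several functions share one program; \<open>pt\<close>
  then asks for a program in which the desired function is the main one.\<close>

definition runs :: "expr list \<Rightarrow> nat \<Rightarrow> ('a::codable \<Rightarrow> 'b::codable) \<Rightarrow> ('a \<Rightarrow> nat) \<Rightarrow> bool" where
  "runs F i f b \<longleftrightarrow> i < length F \<and> (\<forall>x. \<exists>n\<le>b x. eval F [enc x] (F ! i) (enc (f x)) n)"

definition pt :: "('a::codable \<Rightarrow> 'b::codable) \<Rightarrow> bool" where
  "pt f \<longleftrightarrow> (\<exists>F b. pbound b \<and> runs F 0 f b)"

lemma runs_append: "runs F i f b \<Longrightarrow> runs (F @ G) i f b"
  unfolding runs_def by (auto simp: nth_append intro: eval_append)

lemma runs_shift: "runs F i f b \<Longrightarrow> runs (G @ map (shift (length G)) F) (length G + i) f b"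
  unfolding runs_def by (auto simp: nth_append) (meson eval_shift(1))

lemma runs_Cons: "runs F i f b \<Longrightarrow> runs (e # map (shift 1) F) (Suc i) f b"
  using runs_shift[of F i f b "[e]"] by simp

lemma runs_size: "runs F i f b \<Longrightarrow> csz (f x) \<le> b x"
  unfolding runs_def by (meson eval_cost_ge(1) le_trans)

text \<open>The factor 2 pays for the call itself: its value is charged once more, and
  \<open>csz (f x) \<le> b x\<close>.\<close>

lemma runs_call:
  assumes "runs F i f b" "eval F env e (enc x) m"
  shows "\<exists>n. eval F env (ECall i [e]) (enc (f x)) n \<and> n \<le> m + 2 * b x"
proof -
  obtain n where n: "n \<le> b x" "eval F [enc x] (F ! i) (enc (f x)) n" and i: "i < length F"
    using assms(1) unfolding runs_def by blast
  have "evals F env [e] [enc x] (m + 0)" by (intro eval_evals.intros assms(2))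
  then have "eval F env (ECall i [e]) (enc (f x)) (m + 0 + n + csz (f x))"
    using eval_evals.intros(9)[OF i _ n(2)] by blast
  moreover have "m + 0 + n + csz (f x) \<le> m + 2 * b x"
    using n(1) runs_size[OF assms(1), of x] by simp
  ultimately show ?thesis by blast
qed

lemma pt_size: assumes "pt f" shows "pbound (\<lambda>x. csz (f x))"
proof -
  obtain F b where "pbound b" "runs F 0 f b" using assms unfolding pt_def by blast
  then show ?thesis using pbound_mono runs_size by meson
qed

lemma pbound_pt: "pbound b \<Longrightarrow> pt f \<Longrightarrow> pbound (\<lambda>x. b (f x))"
  using pbound_comp[OF _ pt_size[of f]] by blast

text \<open>The main function \<open>e\<close> is still open here. It will occupy position 0 and
  refer to the linked functions by \<open>i\<close> and \<open>j\<close>, so these indices and the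
  bounds must not depend on it.\<close>

lemma link2:
  assumes "pt f" "pt g"
  shows "\<exists>F i j a b. pbound a \<and> pbound b \<and> (\<forall>e. runs (e # F) i f a \<and> runs (e # F) j g b)"
proof -
  obtain F a G b where a: "pbound a" "runs F 0 f a" and b: "pbound b" "runs G 0 g b"
    using assms unfolding pt_def by blast
  let ?H = "F @ map (shift (length F)) G"
  have "runs ?H 0 f a" "runs ?H (length F + 0) g b"
    using runs_append[OF a(2)] runs_shift[OF b(2)] by blast+
  then have "runs (e # map (shift 1) ?H) (Suc 0) f a \<and>
      runs (e # map (shift 1) ?H) (Suc (length F + 0)) g b" for e
    by (intro conjI runs_Cons)
  then show ?thesis using a b by blast
qed

lemma link3:
  assumes "pt f" "pt g" "pt h"
  shows "\<exists>F i j k a b c. pbound a \<and> pbound b \<and> pbound c \<and>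
    (\<forall>e. runs (e # F) i f a \<and> runs (e # F) j g b \<and> runs (e # F) k h c)"
proof -
  obtain F i j a b where 1: "pbound a" "pbound b"
    "\<And>e. runs (e # F) i f a \<and> runs (e # F) j g b"
    using link2[OF assms(1,2)] by blast
  obtain G c where 2: "pbound c" "runs G 0 h c" using assms(3) unfolding pt_def by blast
  have "runs (e # F @ map (shift (Suc (length F))) G) i f a"
       "runs (e # F @ map (shift (Suc (length F))) G) j g b" for e
    using runs_append[of "e # F"] 1(3)[of e] by auto
  moreover have "runs (e # F @ map (shift (Suc (length F))) G) (Suc (length F)) h c" for e
    using runs_shift[OF 2(2), of "e # F"] by simp
  ultimately show ?thesis using 1(1,2) 2(1) by blast
qed

subsection \<open>Basic closure properties\<close>

instantiation bintree :: codable begin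
definition enc_bintree_def [simp]: "enc (t::bintree) = t"
instance by standard (simp add: inj_on_def)
end

instantiation unit :: codable begin
definition enc_unit_def [simp]: "enc (u::unit) = Tip"
instance by standard (simp add: inj_on_def)
end

instantiation bool :: codable begin
definition enc_bool_def: "enc b = bool_tree b"
instance by standard (simp add: inj_on_def enc_bool_def bool_tree_def)
end

instantiation prod :: (codable, codable) codable begin
definition enc_prod_def: "enc p = Bin (enc (fst p)) (enc (snd p))"
instance by standard (auto simp add: inj_on_def enc_prod_def)
end

instantiation list :: (codable) codable begin
primrec enc_list where "enc_list [] = Tip" | "enc_list (x # xs) = Bin (enc x) (enc_list xs)"
instance
proof
  have "enc xs = enc ys \<Longrightarrow> xs = ys" for xs ys :: "'a list"
    by (induction xs arbitrary: ys) (case_tac ys; simp)+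
  then show "inj (enc :: 'a list \<Rightarrow> bintree)" by (simp add: inj_on_def)
qed
end

instantiation option :: (codable) codable begin
primrec enc_option where "enc_option None = Tip" | "enc_option (Some x) = Bin Tip (enc x)"
instance
proof
  show "inj (enc :: 'a option \<Rightarrow> bintree)"
    by (rule injI, case_tac x; case_tac y; simp)
qed
end

lemma enc_Pair [simp]: "enc (x, y) = Bin (enc x) (enc y)"
  by (simp add: enc_prod_def)

lemma enc_bool_simps [simp]: "enc True = Bin Tip Tip" "enc False = Tip"
  by (simp_all add: enc_bool_def bool_tree_def)

lemma enc_bool_eq_Tip: "enc b = Tip \<longleftrightarrow> \<not> b"
  by (cases b) auto

lemma enc_list_tree: "enc xs = list_tree (map enc xs)"
  by (induction xs) auto

lemma ptI:
  assumes "\<And>x. \<exists>n\<le>b x. eval (e # F) [enc x] e (enc (f x)) n" "pbound b"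
  shows "pt f"
  unfolding pt_def runs_def using assms by (intro exI[of _ "e # F"] exI[of _ b]) simp

lemma pt_id: "pt (\<lambda>x. x)"
proof (rule ptI)
  show "\<exists>n\<le>csz x. eval [EArg 0] [enc x] (EArg 0) (enc x) n" for x :: 'a
    using eval_evals.intros(1)[of 0 "[enc x]" "[EArg 0]"] by auto
qed (rule pbound_csz)

primrec quote :: "bintree \<Rightarrow> expr" where
  "quote Tip = ETip"
| "quote (Bin a b) = EBin (quote a) (quote b)"

text \<open>The cost depends on the quoted tree only, so a constant function runs in constant
  time.\<close>

lemma eval_quote: "\<exists>n. \<forall>F env. eval F env (quote t) t n"
proof (induction t)
  case Tip
  then show ?case by (auto intro!: eval_evals.intros exI[of _ 1])
next
  case (Bin a b)
  then obtain n m where "\<And>F env. eval F env (quote a) a n" "\<And>F env. eval F env (quote b) b m" by blast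
  then show ?case by (auto intro!: eval_evals.intros exI[of _ "n + m + sz (Bin a b)"])
qed

lemma pt_const: "pt (\<lambda>x. c)"
proof -
  obtain n where "\<And>F env. eval F env (quote (enc c)) (enc c) n" using eval_quote by blast
  then show ?thesis by (intro ptI[where b = "\<lambda>_. n" and F = "[]"]) (auto intro: pbound_const)
qed

lemma eval_arg0: "eval F [x] (EArg 0) x (sz x)"
  using eval_evals.intros(1)[of 0 "[x]" F] by simp

lemma pt_comp: assumes "pt g" "pt f" shows "pt (\<lambda>x. g (f x))"
proof -
  obtain F i j a b where ab: "pbound a" "pbound b"
    and r: "\<And>e. runs (e # F) i f a \<and> runs (e # F) j g b"
    using link2[OF assms(2,1)] by blast
  let ?e = "ECall j [ECall i [EArg 0]]"
  show ?thesis
  proof (rule ptI[of "\<lambda>x. csz x + 2 * a x + 2 * b (f x)" ?e F])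
    fix x
    obtain n where n: "eval (?e # F) [enc x] (ECall i [EArg 0]) (enc (f x)) n" "n \<le> csz x + 2 * a x"
      using runs_call[OF _ eval_arg0] r by blast
    obtain m where "eval (?e # F) [enc x] ?e (enc (g (f x))) m" "m \<le> n + 2 * b (f x)"
      using runs_call[OF _ n(1)] r by blast
    then show "\<exists>n\<le>csz x + 2 * a x + 2 * b (f x). eval (?e # F) [enc x] ?e (enc (g (f x))) n"
      using n(2) by (intro exI[of _ m]) simp
  qed (intro pbound_intros ab pbound_pt[OF ab(2) assms(2)])
qed

lemma pt_Bin: assumes "pt f" "pt g" shows "pt (\<lambda>x. Bin (f x) (g x))"
proof -
  obtain F i j a b where ab: "pbound a" "pbound b"
    and r: "\<And>e. runs (e # F) i f a \<and> runs (e # F) j g b"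
    using link2[OF assms] by blast
  let ?e = "EBin (ECall i [EArg 0]) (ECall j [EArg 0])"
  let ?b = "\<lambda>x. csz x + 2 * a x + (csz x + 2 * b x) + (1 + csz (f x) + csz (g x))"
  show ?thesis
  proof (rule ptI[of ?b ?e F])
    fix x
    obtain n where n: "eval (?e # F) [enc x] (ECall i [EArg 0]) (enc (f x)) n" "n \<le> csz x + 2 * a x"
      using runs_call[OF _ eval_arg0] r by blast
    obtain m where m: "eval (?e # F) [enc x] (ECall j [EArg 0]) (enc (g x)) m" "m \<le> csz x + 2 * b x"
      using runs_call[OF _ eval_arg0] r by blast
    from eval_evals.intros(3)[OF n(1) m(1)] n(2) m(2)
    show "\<exists>n\<le>?b x. eval (?e # F) [enc x] ?e (enc (Bin (f x) (g x))) n"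
      by (intro exI[of _ "n + m + sz (Bin (enc (f x)) (enc (g x)))"]) simp
  qed (intro pbound_intros ab pt_size assms)
qed

lemma pt_eq: assumes "pt f" "pt g" shows "pt (\<lambda>x. f x = g x)"
proof -
  obtain F i j a b where ab: "pbound a" "pbound b"
    and r: "\<And>e. runs (e # F) i f a \<and> runs (e # F) j g b"
    using link2[OF assms] by blast
  let ?e = "EEq (ECall i [EArg 0]) (ECall j [EArg 0])"
  let ?b = "\<lambda>x. csz x + 2 * a x + (csz x + 2 * b x) + 3"
  show ?thesis
  proof (rule ptI[of ?b ?e F])
    fix x
    obtain n where n: "eval (?e # F) [enc x] (ECall i [EArg 0]) (enc (f x)) n" "n \<le> csz x + 2 * a x"
      using runs_call[OF _ eval_arg0] r by blast
    obtain m where m: "eval (?e # F) [enc x] (ECall j [EArg 0]) (enc (g x)) m" "m \<le> csz x + 2 * b x"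
      using runs_call[OF _ eval_arg0] r by blast
    have "sz (enc (f x = g x)) \<le> 3" by (cases "f x = g x") simp_all
    with eval_evals.intros(6)[OF n(1) m(1) refl] n(2) m(2)
    show "\<exists>n\<le>?b x. eval (?e # F) [enc x] ?e (enc (f x = g x)) n"
      by (intro exI[of _ "n + m + sz (enc (f x = g x))"]) (simp add: enc_bool_def)
  qed (intro pbound_intros ab)
qed

lemma pt_if: assumes "pt c" "pt f" "pt g" shows "pt (\<lambda>x. if c x then f x else g x)"
proof -
  obtain F k i j d a b where ab: "pbound d" "pbound a" "pbound b"
    and r: "\<And>e. runs (e # F) k c d \<and> runs (e # F) i f a \<and> runs (e # F) j g b"
    using link3[OF assms] by blast
  let ?e = "EIf (ECall k [EArg 0]) (ECall i [EArg 0]) (ECall j [EArg 0])"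
  let ?b = "\<lambda>x. csz x + 2 * d x + (csz x + 2 * a x + csz (f x)) + (csz x + 2 * b x + csz (g x))"
  show ?thesis
  proof (rule ptI[of ?b ?e F])
    fix x
    obtain l where l: "eval (?e # F) [enc x] (ECall k [EArg 0]) (enc (c x)) l" "l \<le> csz x + 2 * d x"
      using runs_call[OF _ eval_arg0] r by blast
    show "\<exists>n\<le>?b x. eval (?e # F) [enc x] ?e (enc (if c x then f x else g x)) n"
    proof (cases "c x")
      case True
      obtain n where n: "eval (?e # F) [enc x] (ECall i [EArg 0]) (enc (f x)) n" "n \<le> csz x + 2 * a x"
        using runs_call[OF _ eval_arg0] r by blast
      show ?thesis using eval_evals.intros(7)[OF l(1) _ n(1)] l(2) n(2) True
        by (intro exI[of _ "l + n + csz (f x)"]) (simp add: enc_bool_eq_Tip)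
    next
      case False
      obtain n where n: "eval (?e # F) [enc x] (ECall j [EArg 0]) (enc (g x)) n" "n \<le> csz x + 2 * b x"
        using runs_call[OF _ eval_arg0] r by blast
      show ?thesis using eval_evals.intros(8)[OF _ n(1)] l n(2) False
        by (intro exI[of _ "l + n + csz (g x)"]) simp
    qed
  qed (intro pbound_intros ab pt_size assms)
qed

lemma pt_hd_tree: "pt hd_tree"
proof (rule ptI[of "\<lambda>x. csz x + csz x" "EHd (EArg 0)" "[]"])
  fix x :: bintree
  have "sz (hd_tree x) \<le> sz x" by (cases x) auto
  then show "\<exists>n\<le>csz x + csz x. eval [EHd (EArg 0)] [enc x] (EHd (EArg 0)) (enc (hd_tree x)) n"
    using eval_evals.intros(4)[OF eval_arg0[of "[EHd (EArg 0)]" x]]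
    by (intro exI[of _ "sz x + sz (hd_tree x)"]) simp
qed (intro pbound_intros)

lemma pt_tl_tree: "pt tl_tree"
proof (rule ptI[of "\<lambda>x. csz x + csz x" "ETl (EArg 0)" "[]"])
  fix x :: bintree
  have "sz (tl_tree x) \<le> sz x" by (cases x) auto
  then show "\<exists>n\<le>csz x + csz x. eval [ETl (EArg 0)] [enc x] (ETl (EArg 0)) (enc (tl_tree x)) n"
    using eval_evals.intros(5)[OF eval_arg0[of "[ETl (EArg 0)]" x]]
    by (intro exI[of _ "sz x + sz (tl_tree x)"]) simp
qed (intro pbound_intros)

text \<open>Programs see only codes. An operation on any codable type is polynomial as soon as some
  operation, possibly into another type, yields the same codes; constructors and selectors are
  reduced to operations on trees in this way.\<close>

lemma pt_cong_enc:
  assumes "pt g" "\<And>x. enc (g x) = enc (f x)" shows "pt f"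
  using assms unfolding pt_def runs_def by simp

lemma pt_enc: "pt f \<Longrightarrow> pt (\<lambda>x. enc (f x))"
  by (erule pt_cong_enc) simp

lemma pt_hdt: "pt f \<Longrightarrow> pt (\<lambda>x. hd_tree (f x))"
  by (rule pt_comp[OF pt_hd_tree])

lemma pt_tlt: "pt f \<Longrightarrow> pt (\<lambda>x. tl_tree (f x))"
  by (rule pt_comp[OF pt_tl_tree])

named_theorems pt_intros

declare pt_const [pt_intros] pt_id [pt_intros] pt_eq [pt_intros] pt_if [pt_intros]

lemmas pt_tree = pt_const pt_id pt_enc pt_hdt pt_tlt pt_Bin pt_eq pt_if

lemma pt_Pair [pt_intros]: assumes "pt f" "pt g" shows "pt (\<lambda>x. (f x, g x))"
  by (rule pt_cong_enc[where g = "\<lambda>x. Bin (enc (f x)) (enc (g x))"]) (intro pt_tree assms, simp)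

lemma pt_fst [pt_intros]: assumes "pt f" shows "pt (\<lambda>x. fst (f x))"
  by (rule pt_cong_enc[where g = "\<lambda>x. hd_tree (enc (f x))"])
    (intro pt_tree assms, simp add: enc_prod_def)

lemma pt_snd [pt_intros]: assumes "pt f" shows "pt (\<lambda>x. snd (f x))"
  by (rule pt_cong_enc[where g = "\<lambda>x. tl_tree (enc (f x))"])
    (intro pt_tree assms, simp add: enc_prod_def)

text \<open>\<open>pt\<close> is a unary notion. A function of several arguments is handled as a
  function of nested pairs, and the rules of this kind return to the curried form.\<close>

lemma pt_comp2:
  "pt (\<lambda>p. h (fst p) (snd p)) \<Longrightarrow> pt f \<Longrightarrow> pt g \<Longrightarrow> pt (\<lambda>x. h (f x) (g x))"
  using pt_comp[OF _ pt_Pair, of "\<lambda>p. h (fst p) (snd p)" f g] by simp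

lemma pt_comp3:
  "pt (\<lambda>p. h (fst p) (fst (snd p)) (snd (snd p))) \<Longrightarrow> pt f \<Longrightarrow> pt g \<Longrightarrow> pt k \<Longrightarrow>
    pt (\<lambda>x. h (f x) (g x) (k x))"
  using pt_comp[OF _ pt_Pair[OF _ pt_Pair], of "\<lambda>p. h (fst p) (fst (snd p)) (snd (snd p))" f g k]
  by simp

lemma pt_comp4:
  "pt (\<lambda>p. h (fst p) (fst (snd p)) (fst (snd (snd p))) (snd (snd (snd p)))) \<Longrightarrow>
    pt f \<Longrightarrow> pt g \<Longrightarrow> pt k \<Longrightarrow> pt l \<Longrightarrow> pt (\<lambda>x. h (f x) (g x) (k x) (l x))"
  using pt_comp[OF _ pt_Pair[OF _ pt_Pair[OF _ pt_Pair]],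
      of "\<lambda>p. h (fst p) (fst (snd p)) (fst (snd (snd p))) (snd (snd (snd p)))" f g k l]
  by simp

lemma pt_not [pt_intros]: "pt f \<Longrightarrow> pt (\<lambda>x. \<not> f x)"
  by (rule pt_cong_enc[OF pt_if[OF _ pt_const pt_const, of f False True]]) simp_all

lemma pt_conj [pt_intros]: "pt f \<Longrightarrow> pt g \<Longrightarrow> pt (\<lambda>x. f x \<and> g x)"
  by (rule pt_cong_enc[OF pt_if[OF _ _ pt_const, of f g False]]) simp_all

lemma pt_disj [pt_intros]: "pt f \<Longrightarrow> pt g \<Longrightarrow> pt (\<lambda>x. f x \<or> g x)"
  by (rule pt_cong_enc[OF pt_if[OF _ pt_const, of f g True]]) simp_all

subsection \<open>Recursion on lists\<close>

lemma csz_suffix_le: "csz (r :: 'a::codable list) \<le> csz (zs @ r)"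
  by (induction zs) auto

lemma eval_call1:
  assumes "i < length F" "eval F env e x m" "eval F [x] (F ! i) v n"
  shows "eval F env (ECall i [e]) v (m + n + sz v)"
proof -
  have "evals F env [e] [x] (m + 0)" by (intro eval_evals.intros assms(2))
  then show ?thesis using eval_evals.intros(9)[OF assms(1) _ assms(3)] by simp
qed

text \<open>The main function calls itself (\<open>ECall 0\<close>) on the tail. There are
  \<open>length l + 1\<close> activations, and \<open>K\<close> bounds the work of one of them
  outside the recursive call. The size bound \<open>M\<close> is stated at the whole list
  \<open>zs @ r\<close>, although the recursion has only the suffix \<open>r\<close> in view, so
  that one \<open>K\<close> serves at every depth.\<close>

lemma pt_rec_aux:
  fixes b :: "'c::codable \<Rightarrow> 'b::codable" and g :: "'c \<Rightarrow> 'a::codable \<Rightarrow> 'a list \<Rightarrow> 'b \<Rightarrow> 'b"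
  assumes "pt b" and "pt (\<lambda>p. g (fst p) (fst (snd p)) (fst (snd (snd p))) (snd (snd (snd p))))"
    and M: "pbound M"
      "\<And>x zs r. csz (rec_list (b x) (g x) r) \<le> M (x, zs @ r)"
  shows "pt (\<lambda>p. rec_list (b (fst p)) (g (fst p)) (snd p))"
proof -
  let ?g = "\<lambda>p. g (fst p) (fst (snd p)) (fst (snd (snd p))) (snd (snd (snd p)))"
  let ?f = "\<lambda>p. rec_list (b (fst p)) (g (fst p)) (snd p)"
  obtain F i j bb bg where bd: "pbound bb" "pbound bg"
    and r: "\<And>e. runs (e # F) i b bb \<and> runs (e # F) j ?g bg"
    using link2[OF assms(1,2)] by blast
  obtain c k where ck: "\<And>x. bg x \<le> c * csz x ^ k" using bd(2) unfolding pbound_def by blast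
  let ?y = "ETl (EArg 0)"
  let ?e = "EIf ?y
     (ECall j [EBin (EHd (EArg 0)) (EBin (EHd ?y) (EBin (ETl ?y)
         (ECall 0 [EBin (EHd (EArg 0)) (ETl ?y)])))])
     (ECall i [EHd (EArg 0)])"
  \<comment> \<open>\<open>S\<close> bounds the size of the tuple handed to \<open>g\<close>, which
    includes the recursive result; the factor 100 is slack for the copies that evaluation charges.
    In \<open>K\<close>, the term with \<open>c\<close> accounts for running \<open>g\<close> and
    the term with \<open>bb\<close> for the base case.\<close>
  define S where "S p = 100 * (csz p + M p)" for p :: "'c \<times> 'a list"
  define K where "K p = S p + 4 * (c * S p ^ k) + 4 * bb (fst p)" for p
  \<comment> \<open>\<open>zs\<close> is the part of the list consumed so far. The induction
    hypothesis is used at \<open>zs @ [a]\<close>, which leaves the whole list, and hence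
    \<open>K\<close>, unchanged.\<close>
  have loop: "\<exists>n \<le> (length l + 1) * K (x, zs @ l).
      eval (?e # F) [enc (x, l)] ?e (enc (rec_list (b x) (g x) l)) n" for x zs l
  proof (induction l arbitrary: zs)
    case Nil
    let ?G = "?e # F" and ?p = "enc (x, [] :: 'a list)"
    have x: "eval ?G [?p] (EHd (EArg 0)) (enc x) (sz ?p + csz x)"
      using eval_evals.intros(4)[OF eval_arg0[of ?G ?p]] by simp
    obtain n where n: "eval ?G [?p] (ECall i [EHd (EArg 0)]) (enc (b x)) n" "n \<le> sz ?p + csz x + 2 * bb x"
      using runs_call[OF _ x, of i b bb] r by blast
    have y: "eval ?G [?p] ?y Tip (sz ?p + 1)"
      using eval_evals.intros(5)[OF eval_arg0[of ?G ?p]] by simp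
    have "eval ?G [?p] ?e (enc (b x)) (sz ?p + 1 + n + csz (b x))"
      by (rule eval_evals.intros(8)[OF y n(1)])
    moreover have "csz (b x) \<le> bb x" using runs_size r by blast
    moreover have "sz ?p \<le> csz (x, zs)" by simp
    ultimately show ?case using n(2)
      by (intro exI[of _ "sz ?p + 1 + n + csz (b x)"]) (auto simp: K_def S_def)
  next
    case (Cons a l)
    let ?G = "?e # F" and ?p = "enc (x, a # l)"
    let ?r = "rec_list (b x) (g x) l" and ?z = "zs @ a # l"
    obtain m where m: "m \<le> (length l + 1) * K (x, ?z)" "eval ?G [enc (x, l)] ?e (enc ?r) m"
      using Cons.IH[of "zs @ [a]"] by auto
    have ys: "eval ?G [?p] ?y (enc (a # l)) (sz ?p + csz (a # l))"
      using eval_evals.intros(5)[OF eval_arg0[of ?G ?p]] by simp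
    have x: "eval ?G [?p] (EHd (EArg 0)) (enc x) (sz ?p + csz x)"
      using eval_evals.intros(4)[OF eval_arg0[of ?G ?p]] by simp
    have a: "eval ?G [?p] (EHd ?y) (enc a) (sz ?p + csz (a # l) + csz a)"
      using eval_evals.intros(4)[OF ys] by simp
    have l: "eval ?G [?p] (ETl ?y) (enc l) (sz ?p + csz (a # l) + csz l)"
      using eval_evals.intros(5)[OF ys] by simp
    let ?A = "EBin (EHd (EArg 0)) (ETl ?y)"
    have arg: "eval ?G [?p] ?A (enc (x, l)) (sz ?p + csz x + (sz ?p + csz (a # l) + csz l) + csz (x, l))"
      using eval_evals.intros(3)[OF x l] by simp
    have s: "csz ?r \<le> M (x, ?z)" using M(2)[of x l "zs @ [a]"] by simp
    have rc: "eval ?G [?p] (ECall 0 [?A]) (enc ?r)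
        ((sz ?p + csz x + (sz ?p + csz (a # l) + csz l) + csz (x, l)) + m + csz ?r)" (is "eval _ _ _ _ ?N")
      by (rule eval_call1[OF _ arg]) (use m(2) in simp_all)
    let ?B = "EBin (EHd (EArg 0)) (EBin (EHd ?y) (EBin (ETl ?y) (ECall 0 [?A])))"
    let ?q = "(x, a, l, ?r)"
    have q0: "enc ?q = Bin (enc x) (Bin (enc a) (Bin (enc l) (enc ?r)))" by simp
    have "\<exists>n. eval ?G [?p] ?B (enc ?q) n \<and> n \<le> ?N + 20 * sz ?p + 5 * csz ?q"
      apply (intro exI conjI)
       apply (subst q0)
       apply (rule eval_evals.intros(3)[OF x eval_evals.intros(3)[OF a eval_evals.intros(3)[OF l rc]]])
      apply simp
      done
    then obtain n where n: "eval ?G [?p] ?B (enc ?q) n" "n \<le> ?N + 20 * sz ?p + 5 * csz ?q" by blast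
    have q: "csz ?q \<le> S (x, ?z)" and q2: "sz ?p \<le> csz (x, ?z)"
      using s csz_suffix_le[of "a # l" zs] by (simp_all add: S_def)
    obtain w where w: "eval ?G [?p] (ECall j [?B]) (enc (?g ?q)) w" "w \<le> n + 2 * bg ?q"
      using runs_call[OF _ n(1)] r by blast
    have z1: "bg ?q \<le> c * S (x, ?z) ^ k"
      using ck[of ?q] power_mono[OF q, of k] mult_le_mono2 order_trans by blast
    have z2: "csz (?g ?q) \<le> bg ?q" using runs_size r by blast
    have "eval ?G [?p] ?e (enc (?g ?q)) (sz ?p + csz (a # l) + w + csz (?g ?q))"
      by (rule eval_evals.intros(7)[OF ys _ w(1)]) simp
    moreover have "sz ?p + csz (a # l) + w + csz (?g ?q) \<le> (length (a # l) + 1) * K (x, ?z)"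
    proof -
      define A where "A = (length l + 1) * K (x, ?z)"
      define B where "B = c * S (x, ?z) ^ k"
      have e: "csz ?q = csz x + csz a + csz l + csz ?r + 3" "sz ?p = csz x + csz a + csz l + 2"
        "csz (x, l) = csz x + csz l + 1" "csz (a # l) = csz a + csz l + 1" by simp_all
      have "K (x, ?z) \<ge> 100 * csz (x, ?z) + 100 * M (x, ?z) + 4 * B"
        by (simp add: K_def S_def B_def)
      then have "sz ?p + csz (a # l) + w + csz (?g ?q) \<le> A + K (x, ?z)"
      proof -
        have n': "n \<le> m + 40 * csz (x, ?z) + 10 * M (x, ?z)" using n(2) s q2 unfolding e by simp
        have "w \<le> A + 40 * csz (x, ?z) + 10 * M (x, ?z) + 2 * B"
          using n' w(2) m(1) z1 unfolding A_def[symmetric] B_def[symmetric] by linarith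
        moreover have "csz (?g ?q) \<le> B" using z1 z2 unfolding B_def by (rule order_trans[rotated])
        moreover have "csz (a # l) \<le> csz (x, ?z)" using q2 unfolding e by linarith
        ultimately show ?thesis using q2 \<open>K (x, ?z) \<ge> _\<close> by linarith
      qed
      also have "\<dots> = (length (a # l) + 1) * K (x, ?z)" by (simp add: A_def)
      finally show ?thesis .
    qed
    ultimately show ?case by (intro exI conjI) auto
  qed
  show ?thesis
  proof (rule ptI[of "\<lambda>p. csz p * K p" ?e F])
    fix p :: "'c \<times> 'a list"
    obtain x l where p: "p = (x, l)" by (cases p)
    have "length l + 1 \<le> csz l" by (induction l) (auto simp: Suc_le_eq trans_less_add2)
    then have "(length l + 1) * K p \<le> csz p * K p" by (simp add: p)
    moreover obtain n where "n \<le> (length l + 1) * K p"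
        "eval (?e # F) [enc p] ?e (enc (?f p)) n"
      using loop[of l x "[]"] by (auto simp: p)
    ultimately show "\<exists>n\<le>csz p * K p. eval (?e # F) [enc p] ?e (enc (?f p)) n"
      using order_trans by blast
  next
    have "pbound (\<lambda>p. bb (fst p) :: nat)"
      by (rule pbound_pt[OF bd(1) pt_fst[OF pt_id]])
    then show "pbound (\<lambda>p. csz p * K p)"
      unfolding K_def S_def by (intro pbound_intros M)
  qed
qed


text \<open>A step may enlarge the accumulator only by an amount \<open>D\<close> that does not
  depend on the accumulator. Such increments add up to at most the length of the list times a
  polynomial, whereas a step that doubled the accumulator would lead to exponential size.\<close>

lemma pt_rec_list:
  fixes b :: "'c::codable \<Rightarrow> 'b::codable" and g :: "'c \<Rightarrow> 'a::codable \<Rightarrow> 'a list \<Rightarrow> 'b \<Rightarrow> 'b"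
  assumes "pt b" and "pt (\<lambda>p. g (fst p) (fst (snd p)) (fst (snd (snd p))) (snd (snd (snd p))))"
    and "pt l" and D: "pbound D" "\<And>x y ys a. csz (g x y ys a) \<le> csz a + D (x, y, ys)"
  shows "pt (\<lambda>x. rec_list (b x) (g x) (l x))"
proof -
  obtain c k where ck: "\<And>p. D p \<le> c * csz p ^ k" using D(1) unfolding pbound_def by blast
  define M where "M p = csz (b (fst p)) + csz (snd p) * (c * csz p ^ k)" for p :: "'c \<times> 'a list"
  have "csz (rec_list (b x) (g x) r) \<le> csz (b x) + length r * (c * csz (x, zs @ r) ^ k)" for x zs r
  proof (induction r arbitrary: zs)
    case (Cons y ys)
    have "csz (x, y, ys) \<le> csz (x, zs @ y # ys)" using csz_suffix_le[of "y # ys" zs] by simp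
    then have "D (x, y, ys) \<le> c * csz (x, zs @ y # ys) ^ k"
      using ck[of "(x, y, ys)"] power_mono[of "csz (x, y, ys)" _ k] mult_le_mono2 order_trans by blast
    then show ?case using Cons.IH[of "zs @ [y]"] D(2)[of x y ys "rec_list (b x) (g x) ys"] by simp
  qed simp
  moreover have "length r \<le> csz (zs @ r)" for r zs :: "'a list"
  proof -
    have "length r \<le> csz r" by (induction r) auto
    then show ?thesis using csz_suffix_le[of r zs] by simp
  qed
  ultimately have M: "csz (rec_list (b x) (g x) r) \<le> M (x, zs @ r)" for x zs r
    unfolding M_def fst_conv snd_conv by (meson add_left_mono mult_le_mono1 order_trans)
  have "pbound M" unfolding M_def
    by (intro pbound_intros pbound_pt[OF pt_size[OF assms(1)]] pbound_pt[OF pbound_csz]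
        pt_fst pt_snd pt_id)
  from pt_comp[OF pt_rec_aux[OF assms(1,2) this M] pt_Pair[OF pt_id assms(3)]]
  show ?thesis by simp
qed

text \<open>A recursion whose step ignores the accumulator; its increment is the size of the value
  of \<open>g\<close>.\<close>

lemma pt_case_list [pt_intros]:
  assumes "pt b" "pt (\<lambda>p. g (fst p) (fst (snd p)) (snd (snd p)))" "pt l"
  shows "pt (\<lambda>x. case l x of [] \<Rightarrow> b x | y # ys \<Rightarrow> g x y ys)"
proof -
  have *: "pt (\<lambda>p. g (fst p) (fst (snd p)) (fst (snd (snd p))))"
    using pt_comp[OF assms(2), of "\<lambda>p. (fst p, fst (snd p), fst (snd (snd p)))"]
    by (simp add: pt_intros)
  have "pt (\<lambda>x. rec_list (b x) (\<lambda>y ys a. g x y ys) (l x))"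
    by (rule pt_rec_list[where D = "\<lambda>p. csz (g (fst p) (fst (snd p)) (snd (snd p)))"])
      ((intro assms * pt_size)+, simp)
  moreover have "rec_list (b x) (\<lambda>y ys a. g x y ys) (l x) = (case l x of [] \<Rightarrow> b x | y # ys \<Rightarrow> g x y ys)" for x
    by (cases "l x") simp_all
  ultimately show ?thesis by simp
qed

section \<open>Polynomial-time list operations\<close>

lemma pt_Cons [pt_intros]: assumes "pt f" "pt g" shows "pt (\<lambda>x. f x # g x)"
  by (rule pt_cong_enc[where g = "\<lambda>x. Bin (enc (f x)) (enc (g x))"]) (intro pt_tree assms, simp)

lemma pt_append [pt_intros]: assumes "pt f" "pt g" shows "pt (\<lambda>x. f x @ g x)"
proof -
  have "pt (\<lambda>x. rec_list (g x) (\<lambda>y ys a. y # a) (f x))"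
    by (rule pt_rec_list[where D = "\<lambda>p. csz p"]) ((intro assms pt_intros pbound_intros)+, simp)
  moreover have "rec_list b (\<lambda>y ys a. y # a) l = l @ b" for b l :: "'b list" by (induction l) simp_all
  ultimately show ?thesis by simp
qed

lemma csz_append: "csz (xs @ ys) \<le> csz xs + csz ys"
  by (induction xs) auto

lemma pt_concat [pt_intros]: assumes "pt f" shows "pt (\<lambda>x. concat (f x))"
proof -
  have "pt (\<lambda>x. rec_list [] (\<lambda>y ys a. y @ a) (f x))"
  proof (rule pt_rec_list[where D = "\<lambda>p. csz p"])
    show "csz (y @ a) \<le> csz a + csz (x, y, ys)" for x :: 'a and y a :: "'b list" and ys
      using csz_append[of y a] by simp
  qed (intro assms pt_intros pbound_intros)+
  moreover have "rec_list [] (\<lambda>y ys a. y @ a) l = concat l" for l :: "'b list list" by (induction l) simp_all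
  ultimately show ?thesis by simp
qed

lemma pt_map [pt_intros]:
  assumes "pt (\<lambda>p. g (fst p) (snd p))" "pt l" shows "pt (\<lambda>x. map (g x) (l x))"
proof -
  have g1: "pt (\<lambda>p. g (fst p) (fst (snd p)))"
    using pt_comp[OF assms(1), of "\<lambda>p. (fst p, fst (snd p))"] by (simp add: pt_intros)
  then have g2: "pbound (\<lambda>p. 1 + csz (g (fst p) (fst (snd p))))"
    by (intro pbound_intros pt_size)
  have "pt (\<lambda>x. rec_list [] (\<lambda>y ys a. g x y # a) (l x))"
    by (rule pt_rec_list[OF _ _ _ g2])
      ((intro pt_intros g1 assms(2))+, simp)
  moreover have "rec_list [] (\<lambda>y ys a. g x y # a) l = map (g x) l" for x l by (induction l) simp_all
  ultimately show ?thesis by simp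
qed

lemma pt_filter [pt_intros]:
  assumes "pt (\<lambda>p. P (fst p) (snd p))" "pt l" shows "pt (\<lambda>x. filter (P x) (l x))"
proof -
  have "pt (\<lambda>p. P (fst p) (fst (snd p)))"
    using pt_comp[OF assms(1), of "\<lambda>p. (fst p, fst (snd p))"] by (simp add: pt_intros)
  then have "pt (\<lambda>x. rec_list [] (\<lambda>y ys a. if P x y then y # a else a) (l x))"
    by (intro pt_rec_list[where D = "\<lambda>p. csz p"] pt_intros pbound_intros assms(2)) simp_all
  moreover have "rec_list [] (\<lambda>y ys a. if P x y then y # a else a) l = filter (P x) l" for x l
    by (induction l) simp_all
  ultimately show ?thesis by simp
qed

lemma pt_bex [pt_intros]:
  assumes "pt (\<lambda>p. P (fst p) (snd p))" "pt l" shows "pt (\<lambda>x. \<exists>y\<in>set (l x). P x y)"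
proof -
  have "pt (\<lambda>p. P (fst p) (fst (snd p)))"
    using pt_comp[OF assms(1), of "\<lambda>p. (fst p, fst (snd p))"] by (simp add: pt_intros)
  then have "pt (\<lambda>x. rec_list False (\<lambda>y ys a. P x y \<or> a) (l x))"
    by (intro pt_rec_list[where D = "\<lambda>p. 3"] pt_intros pbound_intros assms(2)) (simp_all add: enc_bool_def bool_tree_def)
  moreover have "rec_list False (\<lambda>y ys a. P x y \<or> a) l = (\<exists>y\<in>set l. P x y)" for x l
    by (induction l) simp_all
  ultimately show ?thesis by simp
qed

lemma pt_ball [pt_intros]:
  assumes "pt (\<lambda>p. P (fst p) (snd p))" "pt l" shows "pt (\<lambda>x. \<forall>y\<in>set (l x). P x y)"
  using pt_not[OF pt_bex[OF pt_not[OF assms(1)] assms(2)]] by simp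

lemma pt_member [pt_intros]: assumes "pt f" "pt l" shows "pt (\<lambda>x. f x \<in> set (l x))"
proof -
  have "pt (\<lambda>p. f (fst p) = snd p)" by (intro pt_intros pt_comp[OF assms(1)])
  from pt_bex[OF this assms(2)] show ?thesis by simp
qed

lemma pt_subset [pt_intros]: assumes "pt f" "pt l" shows "pt (\<lambda>x. set (f x) \<subseteq> set (l x))"
proof -
  have "pt (\<lambda>p. snd p \<in> set (l (fst p)))" by (intro pt_intros pt_comp[OF assms(2)])
  from pt_ball[OF this assms(1)] show ?thesis by (simp add: subset_eq)
qed

lemma pt_set_eq [pt_intros]: "pt f \<Longrightarrow> pt l \<Longrightarrow> pt (\<lambda>x. set (f x) = set (l x))"
  by (simp add: set_eq_subset pt_intros)

lemma pt_remdups [pt_intros]: assumes "pt f" shows "pt (\<lambda>x. remdups (f x))"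
proof -
  have "pt (\<lambda>x. rec_list [] (\<lambda>y ys a. if y \<in> set ys then a else y # a) (f x))"
    by (intro pt_rec_list[where D = "\<lambda>p. csz p"] pt_intros pbound_intros assms) simp_all
  moreover have "rec_list [] (\<lambda>y ys a. if y \<in> set ys then a else y # a) l = remdups l" for l :: "'b list"
    by (induction l) simp_all
  ultimately show ?thesis by simp
qed

primrec tails :: "'a list \<Rightarrow> 'a list list" where
  "tails [] = []"
| "tails (x # xs) = (x # xs) # tails xs"

lemma pt_tails [pt_intros]: assumes "pt f" shows "pt (\<lambda>x. tails (f x))"
proof -
  have "pt (\<lambda>x. rec_list [] (\<lambda>y ys a. (y # ys) # a) (f x))"
    by (intro pt_rec_list[where D = "\<lambda>p. 2 + csz p"] pt_intros pbound_intros assms) simp_all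
  moreover have "rec_list [] (\<lambda>y ys a. (y # ys) # a) l = tails l" for l :: "'b list"
    by (induction l) simp_all
  ultimately show ?thesis by simp
qed

subsection \<open>Case distinctions\<close>

definition num_tree :: "nat \<Rightarrow> bintree" where
  "num_tree n = (Bin Tip ^^ n) Tip"

lemma num_tree_eq_iff [simp]: "num_tree n = num_tree m \<longleftrightarrow> n = m"
proof (induction n arbitrary: m)
  case 0
  then show ?case by (cases m) (simp_all add: num_tree_def)
next
  case (Suc n)
  then show ?case by (cases m) (simp_all add: num_tree_def)
qed

lemma tag_num_tree: "tag n ds = Bin (num_tree n) (list_tree ds)"
  by (simp add: tag_def num_tree_def)

text \<open>A view returns the arguments of one constructor as a list of length at most one, so that no
  default values for the arguments of the other constructors are needed.\<close>

definition views :: "('a::codable \<Rightarrow> 'b::codable list) \<Rightarrow> nat \<Rightarrow> bool" where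
  "views v n \<longleftrightarrow> (\<forall>t. (\<exists>y. v t = [y] \<and> enc t = Bin (num_tree n) (enc y)) \<or>
     v t = [] \<and> hd_tree (enc t) \<noteq> num_tree n)"

lemma pt_view: assumes "views v n" "pt f" shows "pt (\<lambda>x. v (f x))"
proof (rule pt_cong_enc)
  show "pt (\<lambda>x. if hd_tree (enc (f x)) = num_tree n then Bin (tl_tree (enc (f x))) Tip else Tip)"
    by (intro pt_tree assms(2))
  fix x
  show "enc (if hd_tree (enc (f x)) = num_tree n then Bin (tl_tree (enc (f x))) Tip else Tip)
      = enc (v (f x))"
    using assms(1)[unfolded views_def, rule_format, of "f x"] by auto
qed

lemma pt_case_view:
  assumes "views v n" "pt f" "pt (\<lambda>p. g (fst p) (snd p))" "pt h"
  shows "pt (\<lambda>x. case v (f x) of y # ys \<Rightarrow> g x y | [] \<Rightarrow> h x)"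
proof -
  have "pt (\<lambda>p. g (fst p) (fst (snd p)))"
    using pt_comp[OF assms(3), of "\<lambda>p. (fst p, fst (snd p))"] by (simp add: pt_intros)
  then show ?thesis by (intro pt_case_list assms(4) pt_view[OF assms(1,2)])
qed

lemma pt_Some [pt_intros]: assumes "pt f" shows "pt (\<lambda>x. Some (f x))"
  by (rule pt_cong_enc[where g = "\<lambda>x. Bin Tip (enc (f x))"]) (intro pt_tree assms, simp)

lemma pt_case_option [pt_intros]:
  assumes "pt h" "pt (\<lambda>p. g (fst p) (snd p))" "pt f"
  shows "pt (\<lambda>x. case f x of None \<Rightarrow> h x | Some y \<Rightarrow> g x y)"
proof -
  let ?v = "case_option [] (\<lambda>y. [y])"
  have v: "pt (\<lambda>x. ?v (f x))"
    by (rule pt_cong_enc[where g = "\<lambda>x. if enc (f x) = Tip then Tip else Bin (tl_tree (enc (f x))) Tip"])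
      (intro pt_tree assms(3), simp split: option.split)
  have "pt (\<lambda>p. g (fst p) (fst (snd p)))"
    using pt_comp[OF assms(2), of "\<lambda>p. (fst p, fst (snd p))"] by (simp add: pt_intros)
  from pt_case_list[OF assms(1) this v] show ?thesis
    by (rule pt_cong_enc) (simp split: option.split)
qed

lemma pt_find [pt_intros]:
  assumes "pt (\<lambda>p. P (fst p) (snd p))" "pt l" shows "pt (\<lambda>x. find (P x) (l x))"
proof -
  have "pt (\<lambda>x. case filter (P x) (l x) of [] \<Rightarrow> None | y # ys \<Rightarrow> Some y)"
    by (intro pt_intros assms)
  moreover have "(case filter (P x) (l x) of [] \<Rightarrow> None | y # ys \<Rightarrow> Some y) = find (P x) (l x)" for x
  proof -
    have "(case filter (P x) xs of [] \<Rightarrow> None | y # ys \<Rightarrow> Some y) = find (P x) xs" for xs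
      by (induction xs) simp_all
    then show ?thesis .
  qed
  ultimately show ?thesis by simp
qed

lemma pt_map_of [pt_intros]:
  fixes l :: "'c::codable \<Rightarrow> ('d::codable \<times> 'e::codable) list"
  assumes "pt l" "pt k" shows "pt (\<lambda>x. map_of (l x) (k x))"
proof -
  have "pt (\<lambda>p. fst (snd p) = k (fst p))" by (intro pt_intros pt_comp[OF assms(2)])
  then have "pt (\<lambda>x. case find (\<lambda>y. fst y = k x) (l x) of None \<Rightarrow> None | Some y \<Rightarrow> Some (snd y))"
    by (intro pt_intros pt_comp[OF assms(2)] assms(1))
  moreover have "(case find (\<lambda>y. fst y = a) xs of None \<Rightarrow> None | Some y \<Rightarrow> Some (snd y)) = map_of xs a"
    for a :: 'd and xs :: "('d \<times> 'e) list"
    by (induction xs) (auto split: option.split)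
  ultimately show ?thesis by simp
qed

subsection \<open>Names for structured data\<close>

text \<open>The preorder bit string of a tree: \<open>True\<close> for an inner node,
  \<open>False\<close> for a leaf. It is a prefix code, which is the content of
  \<open>flat_eqD\<close>; the accumulator avoids repeated appending.\<close>

fun flat :: "bintree \<Rightarrow> name \<Rightarrow> name" where
  "flat Tip acc = False # acc"
| "flat (Bin a b) acc = True # flat a (flat b acc)"

lemma flat_eqD: "flat s a = flat t b \<Longrightarrow> s = t \<and> a = b"
proof (induction s arbitrary: t a b)
  case Tip
  then show ?case by (cases t) auto
next
  case (Bin s1 s2)
  show ?case
  proof (cases t)
    case (Bin t1 t2)
    with Bin.prems have "flat s1 (flat s2 a) = flat t1 (flat t2 b)" by simp
    with Bin.IH(1) have "s1 = t1" "flat s2 a = flat t2 b" by blast+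
    with Bin.IH(2) Bin show ?thesis by blast
  qed (use Bin.prems in simp)
qed

lemma length_flat: "length (flat t a) = sz t + length a"
  by (induction t arbitrary: a) auto

text \<open>One bit is written per node of the tree. A list cell holding \<open>True\<close> costs 1
  + 3, one holding \<open>False\<close> costs 1 + 1.\<close>

lemma csz_flat: "csz (flat t a) \<le> 4 * sz t + csz a"
proof (induction t arbitrary: a)
  case (Bin t1 t2)
  from Bin.IH(1)[of "flat t2 a"] Bin.IH(2)[of a] show ?case by simp
qed simp

text \<open>The recursion branches over a tree, so the scheme for lists does not apply and a program
  with two nested self-calls is evaluated directly. \<open>M\<close> bounds all intermediate
  strings: by \<open>csz_flat\<close>, the condition \<open>4 * sz t + csz a \<le> M\<close> is
  inherited by both calls.\<close>

lemma pt_flat: "pt (\<lambda>p. flat (fst p) (snd p))"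
proof -
  let ?e = "EIf (EHd (EArg 0))
     (EBin (quote (enc True)) (ECall 0 [EBin (EHd (EHd (EArg 0))) (ECall 0 [EBin (ETl (EHd (EArg 0))) (ETl (EArg 0))])]))
     (EBin (quote (enc False)) (ETl (EArg 0)))"
  have loop: "4 * sz t + csz a \<le> M \<Longrightarrow>
      \<exists>n \<le> sz t * (100 * M). eval [?e] [enc (t, a)] ?e (enc (flat t a)) n" for t a M
  proof (induction t arbitrary: a)
    case Tip
    let ?p = "enc (Tip, a)"
    have 1: "eval [?e] [?p] (EHd (EArg 0)) Tip (sz ?p + 1)"
      using eval_evals.intros(4)[OF eval_arg0[of "[?e]" ?p]] by simp
    have 2: "eval [?e] [?p] (ETl (EArg 0)) (enc a) (sz ?p + csz a)"
      using eval_evals.intros(5)[OF eval_arg0[of "[?e]" ?p]] by simp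
    have 3: "eval [?e] [?p] (quote (enc False)) (enc False) 1"
      using eval_evals.intros(2) by simp
    from eval_evals.intros(8)[OF 1 eval_evals.intros(3)[OF 3 2]] Tip
    show ?case
      by (intro exI[of _ "sz ?p + 1 + (1 + (sz ?p + csz a) + sz (Bin (enc False) (enc a)))
        + sz (Bin (enc False) (enc a))"] conjI) simp_all
  next
    case (Bin t1 t2)
    let ?p = "enc (Bin t1 t2, a)"
    obtain n2 where n2: "n2 \<le> sz t2 * (100 * M)" "eval [?e] [enc (t2, a)] ?e (enc (flat t2 a)) n2"
      using Bin.IH(2)[of a] Bin.prems by auto
    obtain n1 where n1: "n1 \<le> sz t1 * (100 * M)"
      "eval [?e] [enc (t1, flat t2 a)] ?e (enc (flat t1 (flat t2 a))) n1"
      using Bin.IH(1)[of "flat t2 a"] Bin.prems csz_flat[of t2 a] by auto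
    have 0: "eval [?e] [?p] (EHd (EArg 0)) (Bin t1 t2) (sz ?p + sz (Bin t1 t2))"
      using eval_evals.intros(4)[OF eval_arg0[of "[?e]" ?p]] by simp
    have 1: "eval [?e] [?p] (EHd (EHd (EArg 0))) t1 (sz ?p + sz (Bin t1 t2) + sz t1)"
      using eval_evals.intros(4)[OF 0] by simp
    have 2: "eval [?e] [?p] (ETl (EHd (EArg 0))) t2 (sz ?p + sz (Bin t1 t2) + sz t2)"
      using eval_evals.intros(5)[OF 0] by simp
    have 3: "eval [?e] [?p] (ETl (EArg 0)) (enc a) (sz ?p + csz a)"
      using eval_evals.intros(5)[OF eval_arg0[of "[?e]" ?p]] by simp
    have 4: "eval [?e] [?p] (quote (enc True)) (enc True) 5"
      using eval_evals.intros(3)[OF eval_evals.intros(2) eval_evals.intros(2), of "[?e]" "[?p]"]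
      by (simp add: numeral_eq_Suc)
    have c2: "eval [?e] [?p] (ECall 0 [EBin (ETl (EHd (EArg 0))) (ETl (EArg 0))]) (enc (flat t2 a))
      ((sz ?p + sz (Bin t1 t2) + sz t2 + (sz ?p + csz a) + sz (Bin t2 (enc a))) + n2 + csz (flat t2 a))"
      by (rule eval_call1[OF _ eval_evals.intros(3)[OF 2 3]]) (use n2 in simp_all)
    let ?n = "(sz ?p + sz (Bin t1 t2) + sz t2 + (sz ?p + csz a) + sz (Bin t2 (enc a))) + n2 + csz (flat t2 a)"
    have c1: "eval [?e] [?p] (ECall 0 [EBin (EHd (EHd (EArg 0))) (ECall 0 [EBin (ETl (EHd (EArg 0))) (ETl (EArg 0))])])
       (enc (flat t1 (flat t2 a)))
      ((sz ?p + sz (Bin t1 t2) + sz t1 + ?n + sz (Bin t1 (enc (flat t2 a)))) + n1 + csz (flat t1 (flat t2 a)))"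
      by (rule eval_call1[OF _ eval_evals.intros(3)[OF 1 c2]]) (use n1 in simp_all)
    have s: "csz (flat t1 (flat t2 a)) \<le> M" "csz (flat t2 a) \<le> M"
      using csz_flat[of t1 "flat t2 a"] csz_flat[of t2 a] Bin.prems by auto
    from eval_evals.intros(7)[OF 0 _ eval_evals.intros(3)[OF 4 c1]]
    show ?case
      apply (intro exI[where x = "sz ?p + sz (Bin t1 t2) + (5 + ((sz ?p + sz (Bin t1 t2) + sz t1 + ?n + sz (Bin t1 (enc (flat t2 a)))) + n1 + csz (flat t1 (flat t2 a))) + sz (Bin (enc True) (enc (flat t1 (flat t2 a))))) + sz (Bin (enc True) (enc (flat t1 (flat t2 a))))"] conjI)
      using s n1(1) n2(1) Bin.prems apply (simp add: distrib_right)
      by simp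
  qed
  show ?thesis
  proof (rule ptI[of "\<lambda>p. csz p * (100 * (4 * csz p))" ?e "[]"])
    fix p :: "bintree \<times> name"
    obtain t a where p: "p = (t, a)" by (cases p)
    have "4 * sz t + csz a \<le> 4 * csz p" by (simp add: p)
    from loop[OF this] obtain n where "n \<le> sz t * (100 * (4 * csz p))"
      "eval [?e] [enc p] ?e (enc (flat (fst p) (snd p))) n"
      unfolding p fst_conv snd_conv by blast
    moreover have "sz t * (100 * (4 * csz p)) \<le> csz p * (100 * (4 * csz p))"
      by (rule mult_le_mono1) (simp add: p)
    ultimately show "\<exists>n\<le>csz p * (100 * (4 * csz p)).
        eval [?e] [enc p] ?e (enc (flat (fst p) (snd p))) n"
      using order_trans by blast
  qed (intro pbound_intros)
qed

text \<open>Names are bit strings, so any value can itself serve as a name. The length of that name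
  is exactly the size of the code, which later decides freshness by comparing lengths.\<close>

definition name_of :: "'a::codable \<Rightarrow> name" where
  "name_of x = flat (enc x) []"

lemma name_of_eq_iff [simp]: "name_of x = name_of y \<longleftrightarrow> x = y"
  unfolding name_of_def using flat_eqD by fastforce

lemma length_name_of: "length (name_of x) = csz x"
  by (simp add: name_of_def length_flat)

lemma pt_name_of [pt_intros]: "pt f \<Longrightarrow> pt (\<lambda>x. name_of (f x))"
  unfolding name_of_def using pt_comp2[OF pt_flat pt_enc pt_const] by blast

section \<open>Codes of the objects of the problem\<close>

lemma enc_name_eq: "enc_name = enc"
  by (rule ext) (simp add: enc_name_def enc_list_tree enc_bool_def[abs_def])

instantiation role :: codable begin
definition enc_role_inst: "enc = enc_role"
instance
proof
  have "enc_role r = enc_role s \<Longrightarrow> r = s" for r s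
    by (cases r; cases s) (simp_all add: enc_name_eq tag_num_tree)
  then show "inj (enc :: role \<Rightarrow> bintree)" by (auto simp: enc_role_inst intro: injI)
qed
end

instantiation fsym :: codable begin
definition enc_fsym_inst: "enc = enc_fsym"
instance
proof
  have "enc_fsym r = enc_fsym s \<Longrightarrow> r = s" for r s
    by (cases r; cases s) (simp_all add: enc_name_eq flip: enc_role_inst)
  then show "inj (enc :: fsym \<Rightarrow> bintree)" by (auto simp: enc_fsym_inst intro: injI)
qed
end

instantiation tm :: codable begin
definition enc_tm_inst: "enc = enc_tm"
instance
proof
  have "enc_tm r = enc_tm s \<Longrightarrow> r = s" for r s
    by (induction r arbitrary: s; case_tac s)
      (simp_all add: enc_name_eq tag_num_tree flip: enc_fsym_inst)
  then show "inj (enc :: tm \<Rightarrow> bintree)" by (auto simp: enc_tm_inst intro: injI)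
qed
end

instantiation atom :: (codable) codable begin
primrec enc_atom where
  "enc_atom (CA A t) = tag 0 [enc A, enc t]"
| "enc_atom (RA r s t) = tag 1 [enc r, enc s, enc t]"
| "enc_atom (EqA s t) = tag 2 [enc s, enc t]"
instance
proof
  have "enc r = enc s \<Longrightarrow> r = s" for r s :: "'a atom"
    by (cases r; cases s) (simp_all add: tag_num_tree)
  then show "inj (enc :: 'a atom \<Rightarrow> bintree)" by (auto intro: injI)
qed
end

lemma enc_atom_inst: "Defs.enc_atom = enc"
  by (rule ext, case_tac x) (simp_all add: enc_name_eq flip: enc_tm_inst)

instantiation axm :: codable begin
definition enc_axm_inst: "enc = enc_axm"
instance
proof
  have "enc_axm r = enc_axm s \<Longrightarrow> r = s" for r s
    by (cases r; cases s) (simp_all add: enc_name_eq tag_num_tree flip: enc_role_inst)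
  then show "inj (enc :: axm \<Rightarrow> bintree)" by (auto simp: enc_axm_inst intro: injI)
qed
end

lemma enc_sub_eq: "enc_sub = enc"
proof
  show "enc_sub s = enc s" for s
    by (induction s) (auto simp: enc_sub_def enc_name_eq simp flip: enc_tm_inst)
qed

lemma enc_ren_eq: "enc_ren = enc"
proof
  show "enc_ren s = enc s" for s
    by (induction s) (auto simp: enc_ren_def enc_name_eq)
qed

instantiation sk_just :: codable begin
definition enc_sk_just_inst: "enc = enc_sk_just"
instance
proof
  have "enc_sk_just r = enc_sk_just s \<Longrightarrow> r = s" for r s
    by (cases r; cases s) (simp_all add: enc_sub_eq tag_num_tree flip: enc_tm_inst)
  then show "inj (enc :: sk_just \<Rightarrow> bintree)" by (auto simp: enc_sk_just_inst intro: injI)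
qed
end

instantiation cq_just :: codable begin
definition enc_cq_just_inst: "enc = enc_cq_just"
instance
proof
  have "enc_cq_just r = enc_cq_just s \<Longrightarrow> r = s" for r s
    by (cases r; cases s) (simp_all add: enc_sub_eq enc_ren_eq tag_num_tree flip: enc_tm_inst)
  then show "inj (enc :: cq_just \<Rightarrow> bintree)" by (auto simp: enc_cq_just_inst intro: injI)
qed
end

datatype lformula = LCQ "tm atom list" | LRule "tm atom list" "name list" "tm atom list"

instantiation lformula :: codable begin
primrec enc_lformula where
  "enc_lformula (LCQ xs) = tag 0 [enc xs]"
| "enc_lformula (LRule xs X ys) = tag 1 [enc xs, enc X, enc ys]"
instance
proof
  have "enc r = enc s \<Longrightarrow> r = s" for r s :: lformula
    by (cases r; cases s) (simp_all add: tag_num_tree)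
  then show "inj (enc :: lformula \<Rightarrow> bintree)" by (auto intro: injI)
qed
end

lemmas enc_insts = enc_role_inst enc_fsym_inst enc_tm_inst enc_axm_inst enc_sk_just_inst enc_cq_just_inst

text \<open>The argument list of a constructor is coded by \<open>list_tree\<close>, which ends in
  \<open>Tip\<close>. A tuple closed by \<open>()\<close> has the same code, so argument lists of
  mixed types become nested pairs.\<close>

lemma enc_simps:
  "enc (Rn n) = Bin (num_tree 0) (enc (n, ()))"
  "enc (Inv n) = Bin (num_tree 1) (enc (n, ()))"
  "enc (Sk n R m) = enc (n, R, m, ())"
  "enc (Var x) = Bin (num_tree 0) (enc (x, ()))"
  "enc (Ind x) = Bin (num_tree 1) (enc (x, ()))"
  "enc (Fn f t) = Bin (num_tree 2) (enc (f, t, ()))"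
  "enc (CA n a) = Bin (num_tree 0) (enc (n, a, ()))"
  "enc (RA n a b) = Bin (num_tree 1) (enc (n, a, b, ()))"
  "enc (EqA a b) = Bin (num_tree 2) (enc (a, b, ()))"
  "enc (Sub x y) = Bin (num_tree 0) (enc (x, y, ()))"
  "enc (Conj x y z) = Bin (num_tree 1) (enc (x, y, z, ()))"
  "enc (ExL R x y) = Bin (num_tree 2) (enc (R, x, y, ()))"
  "enc (ExR x R y) = Bin (num_tree 3) (enc (x, R, y, ()))"
  "enc (AllR x R y) = Bin (num_tree 4) (enc (x, R, y, ()))"
  "enc (Nom x y) = Bin (num_tree 5) (enc (x, y, ()))"
  "enc (RSub R S) = Bin (num_tree 6) (enc (R, S, ()))"
  "enc (ByMP s) = Bin (num_tree 0) (enc (s, ()))"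
  "enc (ByE t u) = Bin (num_tree 1) (enc (t, u, ()))"
  "enc ByC = Bin (num_tree 2) (enc ())"
  "enc (ByG s) = Bin (num_tree 3) (enc (s, ()))"
  "enc (ByMPe s w) = Bin (num_tree 0) (enc (s, w, ()))"
  "enc ByTe = Bin (num_tree 1) (enc ())"
  "enc (ByEe t u) = Bin (num_tree 2) (enc (t, u, ()))"
  "enc (ByCe w) = Bin (num_tree 3) (enc (w, ()))"
  "enc (ByGe w) = Bin (num_tree 4) (enc (w, ()))"
  "enc (LCQ xs) = Bin (num_tree 0) (enc (xs, ()))"
  "enc (LRule xs X ys) = Bin (num_tree 1) (enc (xs, X, ys, ()))"
  by (simp_all add: enc_insts tag_num_tree enc_name_eq enc_sub_eq enc_ren_eq)

text \<open>The views of the constructors are tried one after the other; the final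
  \<open>undefined\<close> stands for the case that none of them applies, which does not occur. The
  case rules for the other types follow the same pattern.\<close>

lemma pt_case_role [pt_intros]:
  assumes "pt (\<lambda>p. g0 (fst p) (snd p))"
    "pt (\<lambda>p. g1 (fst p) (snd p))"
    "pt f"
  shows "pt (\<lambda>x. case f x of Rn a \<Rightarrow> g0 x a | Inv a \<Rightarrow> g1 x a)"
proof -
  let ?v0 = "\<lambda>t :: role. case t of Rn a \<Rightarrow> [(a, ())] | Inv a \<Rightarrow> []"
  let ?v1 = "\<lambda>t :: role. case t of Rn a \<Rightarrow> [] | Inv a \<Rightarrow> [(a, ())]"
  have v0: "views ?v0 0"
    unfolding views_def by (auto simp: enc_simps tag_num_tree split: role.split)
  have v1: "views ?v1 1"
    unfolding views_def by (auto simp: enc_simps tag_num_tree split: role.split)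

  have h0: "pt (\<lambda>p::_ \<times> (_ \<times> unit). g0 (fst p) (fst (snd p)))"
    using pt_comp[OF assms(1), of "\<lambda>p. (fst p, fst (snd p))"] by (simp add: pt_intros)

  have h1: "pt (\<lambda>p::_ \<times> (_ \<times> unit). g1 (fst p) (fst (snd p)))"
    using pt_comp[OF assms(2), of "\<lambda>p. (fst p, fst (snd p))"] by (simp add: pt_intros)

  have "pt (\<lambda>x. (case ?v0 (f x) of y # ys \<Rightarrow> g0 x (fst y) | [] \<Rightarrow> (case ?v1 (f x) of y # ys \<Rightarrow> g1 x (fst y) | [] \<Rightarrow> undefined))
    )"
    by (intro pt_case_view[OF v0 assms(3) h0] pt_case_view[OF v1 assms(3) h1] pt_const)
  then show ?thesis by (rule pt_cong_enc) (simp split: role.split)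
qed

lemma pt_Var [pt_intros]:
  assumes "pt f" shows "pt (\<lambda>x. Var (f x))"
  by (rule pt_cong_enc[where g = "\<lambda>x. Bin (num_tree 0) (enc (f x, ()))"])
    ((intro pt_tree pt_Pair assms)+, simp add: enc_simps tag_num_tree)

lemma pt_Ind [pt_intros]:
  assumes "pt f" shows "pt (\<lambda>x. Ind (f x))"
  by (rule pt_cong_enc[where g = "\<lambda>x. Bin (num_tree 1) (enc (f x, ()))"])
    ((intro pt_tree pt_Pair assms)+, simp add: enc_simps tag_num_tree)

lemma pt_Fn [pt_intros]:
  assumes "pt f" "pt g" shows "pt (\<lambda>x. Fn (f x) (g x))"
  by (rule pt_cong_enc[where g = "\<lambda>x. Bin (num_tree 2) (enc (f x, g x, ()))"])
    ((intro pt_tree pt_Pair assms)+, simp add: enc_simps tag_num_tree)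

lemma pt_case_tm [pt_intros]:
  assumes "pt (\<lambda>p. g0 (fst p) (snd p))"
    "pt (\<lambda>p. g1 (fst p) (snd p))"
    "pt (\<lambda>p. g2 (fst p) (fst (snd p)) (snd (snd p)))"
    "pt f"
  shows "pt (\<lambda>x. case f x of Var a \<Rightarrow> g0 x a | Ind a \<Rightarrow> g1 x a | Fn a b \<Rightarrow> g2 x a b)"
proof -
  let ?v0 = "\<lambda>t :: tm. case t of Var a \<Rightarrow> [(a, ())] | Ind a \<Rightarrow> [] | Fn a b \<Rightarrow> []"
  let ?v1 = "\<lambda>t :: tm. case t of Var a \<Rightarrow> [] | Ind a \<Rightarrow> [(a, ())] | Fn a b \<Rightarrow> []"
  let ?v2 = "\<lambda>t :: tm. case t of Var a \<Rightarrow> [] | Ind a \<Rightarrow> [] | Fn a b \<Rightarrow> [(a, b, ())]"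
  have v0: "views ?v0 0"
    unfolding views_def by (auto simp: enc_simps tag_num_tree split: tm.split)
  have v1: "views ?v1 1"
    unfolding views_def by (auto simp: enc_simps tag_num_tree split: tm.split)
  have v2: "views ?v2 2"
    unfolding views_def by (auto simp: enc_simps tag_num_tree split: tm.split)

  have h0: "pt (\<lambda>p::_ \<times> (_ \<times> unit). g0 (fst p) (fst (snd p)))"
    using pt_comp[OF assms(1), of "\<lambda>p. (fst p, fst (snd p))"] by (simp add: pt_intros)

  have h1: "pt (\<lambda>p::_ \<times> (_ \<times> unit). g1 (fst p) (fst (snd p)))"
    using pt_comp[OF assms(2), of "\<lambda>p. (fst p, fst (snd p))"] by (simp add: pt_intros)

  have h2: "pt (\<lambda>p::_ \<times> (_ \<times> _ \<times> unit). g2 (fst p) (fst (snd p)) (fst (snd (snd p))))"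
    using pt_comp[OF assms(3), of "\<lambda>p. (fst p, fst (snd p), fst (snd (snd p)))"] by (simp add: pt_intros)

  have "pt (\<lambda>x. (case ?v0 (f x) of y # ys \<Rightarrow> g0 x (fst y) | [] \<Rightarrow> (case ?v1 (f x) of y # ys \<Rightarrow> g1 x (fst y) | [] \<Rightarrow> (case ?v2 (f x) of y # ys \<Rightarrow> g2 x (fst y) (fst (snd y)) | [] \<Rightarrow> undefined)))
    )"
    by (intro pt_case_view[OF v0 assms(4) h0] pt_case_view[OF v1 assms(4) h1] pt_case_view[OF v2 assms(4) h2] pt_const)
  then show ?thesis by (rule pt_cong_enc) (simp split: tm.split)
qed

lemma pt_CA [pt_intros]:
  assumes "pt f" "pt g" shows "pt (\<lambda>x. CA (f x) (g x))"
  by (rule pt_cong_enc[where g = "\<lambda>x. Bin (num_tree 0) (enc (f x, g x, ()))"])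
    ((intro pt_tree pt_Pair assms)+, simp add: enc_simps tag_num_tree)

lemma pt_RA [pt_intros]:
  assumes "pt f" "pt g" "pt h" shows "pt (\<lambda>x. RA (f x) (g x) (h x))"
  by (rule pt_cong_enc[where g = "\<lambda>x. Bin (num_tree 1) (enc (f x, g x, h x, ()))"])
    ((intro pt_tree pt_Pair assms)+, simp add: enc_simps tag_num_tree)

lemma pt_EqA [pt_intros]:
  assumes "pt f" "pt g" shows "pt (\<lambda>x. EqA (f x) (g x))"
  by (rule pt_cong_enc[where g = "\<lambda>x. Bin (num_tree 2) (enc (f x, g x, ()))"])
    ((intro pt_tree pt_Pair assms)+, simp add: enc_simps tag_num_tree)

lemma pt_case_atom [pt_intros]:
  fixes f :: "'x::codable \<Rightarrow> 'c::codable atom"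
  assumes "pt (\<lambda>p. g0 (fst p) (fst (snd p)) (snd (snd p)))"
    "pt (\<lambda>p. g1 (fst p) (fst (snd p)) (fst (snd (snd p))) (snd (snd (snd p))))"
    "pt (\<lambda>p. g2 (fst p) (fst (snd p)) (snd (snd p)))"
    "pt f"
  shows "pt (\<lambda>x. case f x of CA a b \<Rightarrow> g0 x a b | RA a b c \<Rightarrow> g1 x a b c | EqA a b \<Rightarrow> g2 x a b)"
proof -
  let ?v0 = "\<lambda>t :: 'c::codable atom. case t of CA a b \<Rightarrow> [(a, b, ())] | RA a b c \<Rightarrow> [] | EqA a b \<Rightarrow> []"
  let ?v1 = "\<lambda>t :: 'c::codable atom. case t of CA a b \<Rightarrow> [] | RA a b c \<Rightarrow> [(a, b, c, ())] | EqA a b \<Rightarrow> []"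
  let ?v2 = "\<lambda>t :: 'c::codable atom. case t of CA a b \<Rightarrow> [] | RA a b c \<Rightarrow> [] | EqA a b \<Rightarrow> [(a, b, ())]"
  have v0: "views ?v0 0"
    unfolding views_def by (auto simp: enc_simps tag_num_tree split: atom.split)
  have v1: "views ?v1 1"
    unfolding views_def by (auto simp: enc_simps tag_num_tree split: atom.split)
  have v2: "views ?v2 2"
    unfolding views_def by (auto simp: enc_simps tag_num_tree split: atom.split)

  have h0: "pt (\<lambda>p::_ \<times> (_ \<times> _ \<times> unit). g0 (fst p) (fst (snd p)) (fst (snd (snd p))))"
    using pt_comp[OF assms(1), of "\<lambda>p. (fst p, fst (snd p), fst (snd (snd p)))"] by (simp add: pt_intros)

  have h1: "pt (\<lambda>p::_ \<times> (_ \<times> _ \<times> _ \<times> unit). g1 (fst p) (fst (snd p)) (fst (snd (snd p))) (fst (snd (snd (snd p)))))"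
    using pt_comp[OF assms(2), of "\<lambda>p. (fst p, fst (snd p), fst (snd (snd p)), fst (snd (snd (snd p))))"] by (simp add: pt_intros)

  have h2: "pt (\<lambda>p::_ \<times> (_ \<times> _ \<times> unit). g2 (fst p) (fst (snd p)) (fst (snd (snd p))))"
    using pt_comp[OF assms(3), of "\<lambda>p. (fst p, fst (snd p), fst (snd (snd p)))"] by (simp add: pt_intros)

  have "pt (\<lambda>x. (case ?v0 (f x) of y # ys \<Rightarrow> g0 x (fst y) (fst (snd y)) | [] \<Rightarrow> (case ?v1 (f x) of y # ys \<Rightarrow> g1 x (fst y) (fst (snd y)) (fst (snd (snd y))) | [] \<Rightarrow> (case ?v2 (f x) of y # ys \<Rightarrow> g2 x (fst y) (fst (snd y)) | [] \<Rightarrow> undefined)))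
    )"
    by (intro pt_case_view[OF v0 assms(4) h0] pt_case_view[OF v1 assms(4) h1] pt_case_view[OF v2 assms(4) h2] pt_const)
  then show ?thesis by (rule pt_cong_enc) (simp split: atom.split)
qed

lemma pt_case_axm [pt_intros]:
  assumes "pt (\<lambda>p. g0 (fst p) (fst (snd p)) (snd (snd p)))"
    "pt (\<lambda>p. g1 (fst p) (fst (snd p)) (fst (snd (snd p))) (snd (snd (snd p))))"
    "pt (\<lambda>p. g2 (fst p) (fst (snd p)) (fst (snd (snd p))) (snd (snd (snd p))))"
    "pt (\<lambda>p. g3 (fst p) (fst (snd p)) (fst (snd (snd p))) (snd (snd (snd p))))"
    "pt (\<lambda>p. g4 (fst p) (fst (snd p)) (fst (snd (snd p))) (snd (snd (snd p))))"
    "pt (\<lambda>p. g5 (fst p) (fst (snd p)) (snd (snd p)))"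
    "pt (\<lambda>p. g6 (fst p) (fst (snd p)) (snd (snd p)))"
    "pt f"
  shows "pt (\<lambda>x. case f x of Sub a b \<Rightarrow> g0 x a b | Conj a b c \<Rightarrow> g1 x a b c | ExL a b c \<Rightarrow> g2 x a b c | ExR a b c \<Rightarrow> g3 x a b c | AllR a b c \<Rightarrow> g4 x a b c | Nom a b \<Rightarrow> g5 x a b | RSub a b \<Rightarrow> g6 x a b)"
proof -
  let ?v0 = "\<lambda>t :: axm. case t of Sub a b \<Rightarrow> [(a, b, ())] | Conj a b c \<Rightarrow> [] | ExL a b c \<Rightarrow> [] | ExR a b c \<Rightarrow> [] | AllR a b c \<Rightarrow> [] | Nom a b \<Rightarrow> [] | RSub a b \<Rightarrow> []"
  let ?v1 = "\<lambda>t :: axm. case t of Sub a b \<Rightarrow> [] | Conj a b c \<Rightarrow> [(a, b, c, ())] | ExL a b c \<Rightarrow> [] | ExR a b c \<Rightarrow> [] | AllR a b c \<Rightarrow> [] | Nom a b \<Rightarrow> [] | RSub a b \<Rightarrow> []"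
  let ?v2 = "\<lambda>t :: axm. case t of Sub a b \<Rightarrow> [] | Conj a b c \<Rightarrow> [] | ExL a b c \<Rightarrow> [(a, b, c, ())] | ExR a b c \<Rightarrow> [] | AllR a b c \<Rightarrow> [] | Nom a b \<Rightarrow> [] | RSub a b \<Rightarrow> []"
  let ?v3 = "\<lambda>t :: axm. case t of Sub a b \<Rightarrow> [] | Conj a b c \<Rightarrow> [] | ExL a b c \<Rightarrow> [] | ExR a b c \<Rightarrow> [(a, b, c, ())] | AllR a b c \<Rightarrow> [] | Nom a b \<Rightarrow> [] | RSub a b \<Rightarrow> []"
  let ?v4 = "\<lambda>t :: axm. case t of Sub a b \<Rightarrow> [] | Conj a b c \<Rightarrow> [] | ExL a b c \<Rightarrow> [] | ExR a b c \<Rightarrow> [] | AllR a b c \<Rightarrow> [(a, b, c, ())] | Nom a b \<Rightarrow> [] | RSub a b \<Rightarrow> []"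
  let ?v5 = "\<lambda>t :: axm. case t of Sub a b \<Rightarrow> [] | Conj a b c \<Rightarrow> [] | ExL a b c \<Rightarrow> [] | ExR a b c \<Rightarrow> [] | AllR a b c \<Rightarrow> [] | Nom a b \<Rightarrow> [(a, b, ())] | RSub a b \<Rightarrow> []"
  let ?v6 = "\<lambda>t :: axm. case t of Sub a b \<Rightarrow> [] | Conj a b c \<Rightarrow> [] | ExL a b c \<Rightarrow> [] | ExR a b c \<Rightarrow> [] | AllR a b c \<Rightarrow> [] | Nom a b \<Rightarrow> [] | RSub a b \<Rightarrow> [(a, b, ())]"
  have v0: "views ?v0 0"
    unfolding views_def by (auto simp: enc_simps tag_num_tree split: axm.split)
  have v1: "views ?v1 1"
    unfolding views_def by (auto simp: enc_simps tag_num_tree split: axm.split)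
  have v2: "views ?v2 2"
    unfolding views_def by (auto simp: enc_simps tag_num_tree split: axm.split)
  have v3: "views ?v3 3"
    unfolding views_def by (auto simp: enc_simps tag_num_tree split: axm.split)
  have v4: "views ?v4 4"
    unfolding views_def by (auto simp: enc_simps tag_num_tree split: axm.split)
  have v5: "views ?v5 5"
    unfolding views_def by (auto simp: enc_simps tag_num_tree split: axm.split)
  have v6: "views ?v6 6"
    unfolding views_def by (auto simp: enc_simps tag_num_tree split: axm.split)

  have h0: "pt (\<lambda>p::_ \<times> (_ \<times> _ \<times> unit). g0 (fst p) (fst (snd p)) (fst (snd (snd p))))"
    using pt_comp[OF assms(1), of "\<lambda>p. (fst p, fst (snd p), fst (snd (snd p)))"] by (simp add: pt_intros)

  have h1: "pt (\<lambda>p::_ \<times> (_ \<times> _ \<times> _ \<times> unit). g1 (fst p) (fst (snd p)) (fst (snd (snd p))) (fst (snd (snd (snd p)))))"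
    using pt_comp[OF assms(2), of "\<lambda>p. (fst p, fst (snd p), fst (snd (snd p)), fst (snd (snd (snd p))))"] by (simp add: pt_intros)

  have h2: "pt (\<lambda>p::_ \<times> (_ \<times> _ \<times> _ \<times> unit). g2 (fst p) (fst (snd p)) (fst (snd (snd p))) (fst (snd (snd (snd p)))))"
    using pt_comp[OF assms(3), of "\<lambda>p. (fst p, fst (snd p), fst (snd (snd p)), fst (snd (snd (snd p))))"] by (simp add: pt_intros)

  have h3: "pt (\<lambda>p::_ \<times> (_ \<times> _ \<times> _ \<times> unit). g3 (fst p) (fst (snd p)) (fst (snd (snd p))) (fst (snd (snd (snd p)))))"
    using pt_comp[OF assms(4), of "\<lambda>p. (fst p, fst (snd p), fst (snd (snd p)), fst (snd (snd (snd p))))"] by (simp add: pt_intros)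

  have h4: "pt (\<lambda>p::_ \<times> (_ \<times> _ \<times> _ \<times> unit). g4 (fst p) (fst (snd p)) (fst (snd (snd p))) (fst (snd (snd (snd p)))))"
    using pt_comp[OF assms(5), of "\<lambda>p. (fst p, fst (snd p), fst (snd (snd p)), fst (snd (snd (snd p))))"] by (simp add: pt_intros)

  have h5: "pt (\<lambda>p::_ \<times> (_ \<times> _ \<times> unit). g5 (fst p) (fst (snd p)) (fst (snd (snd p))))"
    using pt_comp[OF assms(6), of "\<lambda>p. (fst p, fst (snd p), fst (snd (snd p)))"] by (simp add: pt_intros)

  have h6: "pt (\<lambda>p::_ \<times> (_ \<times> _ \<times> unit). g6 (fst p) (fst (snd p)) (fst (snd (snd p))))"
    using pt_comp[OF assms(7), of "\<lambda>p. (fst p, fst (snd p), fst (snd (snd p)))"] by (simp add: pt_intros)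

  have "pt (\<lambda>x. (case ?v0 (f x) of y # ys \<Rightarrow> g0 x (fst y) (fst (snd y)) | [] \<Rightarrow> (case ?v1 (f x) of y # ys \<Rightarrow> g1 x (fst y) (fst (snd y)) (fst (snd (snd y))) | [] \<Rightarrow> (case ?v2 (f x) of y # ys \<Rightarrow> g2 x (fst y) (fst (snd y)) (fst (snd (snd y))) | [] \<Rightarrow> (case ?v3 (f x) of y # ys \<Rightarrow> g3 x (fst y) (fst (snd y)) (fst (snd (snd y))) | [] \<Rightarrow> (case ?v4 (f x) of y # ys \<Rightarrow> g4 x (fst y) (fst (snd y)) (fst (snd (snd y))) | [] \<Rightarrow> (case ?v5 (f x) of y # ys \<Rightarrow> g5 x (fst y) (fst (snd y)) | [] \<Rightarrow> (case ?v6 (f x) of y # ys \<Rightarrow> g6 x (fst y) (fst (snd y)) | [] \<Rightarrow> undefined)))))))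
    )"
    by (intro pt_case_view[OF v0 assms(8) h0] pt_case_view[OF v1 assms(8) h1] pt_case_view[OF v2 assms(8) h2] pt_case_view[OF v3 assms(8) h3] pt_case_view[OF v4 assms(8) h4] pt_case_view[OF v5 assms(8) h5] pt_case_view[OF v6 assms(8) h6] pt_const)
  then show ?thesis by (rule pt_cong_enc) (simp split: axm.split)
qed

lemma pt_ByMP [pt_intros]:
  assumes "pt f" shows "pt (\<lambda>x. ByMP (f x))"
  by (rule pt_cong_enc[where g = "\<lambda>x. Bin (num_tree 0) (enc (f x, ()))"])
    ((intro pt_tree pt_Pair assms)+, simp add: enc_simps tag_num_tree)

lemma pt_ByE [pt_intros]:
  assumes "pt f" "pt g" shows "pt (\<lambda>x. ByE (f x) (g x))"
  by (rule pt_cong_enc[where g = "\<lambda>x. Bin (num_tree 1) (enc (f x, g x, ()))"])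
    ((intro pt_tree pt_Pair assms)+, simp add: enc_simps tag_num_tree)

lemma pt_ByG [pt_intros]:
  assumes "pt f" shows "pt (\<lambda>x. ByG (f x))"
  by (rule pt_cong_enc[where g = "\<lambda>x. Bin (num_tree 3) (enc (f x, ()))"])
    ((intro pt_tree pt_Pair assms)+, simp add: enc_simps tag_num_tree)

lemma pt_case_sk_just [pt_intros]:
  assumes "pt (\<lambda>p. g0 (fst p) (snd p))"
    "pt (\<lambda>p. g1 (fst p) (fst (snd p)) (snd (snd p)))"
    "pt g2"
    "pt (\<lambda>p. g3 (fst p) (snd p))"
    "pt f"
  shows "pt (\<lambda>x. case f x of ByMP a \<Rightarrow> g0 x a | ByE a b \<Rightarrow> g1 x a b | ByC \<Rightarrow> g2 x  | ByG a \<Rightarrow> g3 x a)"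
proof -
  let ?v0 = "\<lambda>t :: sk_just. case t of ByMP a \<Rightarrow> [(a, ())] | ByE a b \<Rightarrow> [] | ByC \<Rightarrow> [] | ByG a \<Rightarrow> []"
  let ?v1 = "\<lambda>t :: sk_just. case t of ByMP a \<Rightarrow> [] | ByE a b \<Rightarrow> [(a, b, ())] | ByC \<Rightarrow> [] | ByG a \<Rightarrow> []"
  let ?v2 = "\<lambda>t :: sk_just. case t of ByMP a \<Rightarrow> [] | ByE a b \<Rightarrow> [] | ByC \<Rightarrow> [()] | ByG a \<Rightarrow> []"
  let ?v3 = "\<lambda>t :: sk_just. case t of ByMP a \<Rightarrow> [] | ByE a b \<Rightarrow> [] | ByC \<Rightarrow> [] | ByG a \<Rightarrow> [(a, ())]"
  have v0: "views ?v0 0"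
    unfolding views_def by (auto simp: enc_simps tag_num_tree split: sk_just.split)
  have v1: "views ?v1 1"
    unfolding views_def by (auto simp: enc_simps tag_num_tree split: sk_just.split)
  have v2: "views ?v2 2"
    unfolding views_def by (auto simp: enc_simps tag_num_tree split: sk_just.split)
  have v3: "views ?v3 3"
    unfolding views_def by (auto simp: enc_simps tag_num_tree split: sk_just.split)

  have h0: "pt (\<lambda>p::_ \<times> (_ \<times> unit). g0 (fst p) (fst (snd p)))"
    using pt_comp[OF assms(1), of "\<lambda>p. (fst p, fst (snd p))"] by (simp add: pt_intros)

  have h1: "pt (\<lambda>p::_ \<times> (_ \<times> _ \<times> unit). g1 (fst p) (fst (snd p)) (fst (snd (snd p))))"
    using pt_comp[OF assms(2), of "\<lambda>p. (fst p, fst (snd p), fst (snd (snd p)))"] by (simp add: pt_intros)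

  have h2: "pt (\<lambda>p::_ \<times> unit. g2 (fst p))"
    by (intro pt_comp[OF assms(3)] pt_intros)

  have h3: "pt (\<lambda>p::_ \<times> (_ \<times> unit). g3 (fst p) (fst (snd p)))"
    using pt_comp[OF assms(4), of "\<lambda>p. (fst p, fst (snd p))"] by (simp add: pt_intros)

  have "pt (\<lambda>x. (case ?v0 (f x) of y # ys \<Rightarrow> g0 x (fst y) | [] \<Rightarrow> (case ?v1 (f x) of y # ys \<Rightarrow> g1 x (fst y) (fst (snd y)) | [] \<Rightarrow> (case ?v2 (f x) of y # ys \<Rightarrow> g2 x | [] \<Rightarrow> (case ?v3 (f x) of y # ys \<Rightarrow> g3 x (fst y) | [] \<Rightarrow> undefined))))
    )"
    by (intro pt_case_view[OF v0 assms(5) h0] pt_case_view[OF v1 assms(5) h1] pt_case_view[OF v2 assms(5) h2] pt_case_view[OF v3 assms(5) h3] pt_const)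
  then show ?thesis by (rule pt_cong_enc) (simp split: sk_just.split)
qed

lemma pt_ByMPe [pt_intros]:
  assumes "pt f" "pt g" shows "pt (\<lambda>x. ByMPe (f x) (g x))"
  by (rule pt_cong_enc[where g = "\<lambda>x. Bin (num_tree 0) (enc (f x, g x, ()))"])
    ((intro pt_tree pt_Pair assms)+, simp add: enc_simps tag_num_tree)

lemma pt_ByEe [pt_intros]:
  assumes "pt f" "pt g" shows "pt (\<lambda>x. ByEe (f x) (g x))"
  by (rule pt_cong_enc[where g = "\<lambda>x. Bin (num_tree 2) (enc (f x, g x, ()))"])
    ((intro pt_tree pt_Pair assms)+, simp add: enc_simps tag_num_tree)

lemma pt_ByCe [pt_intros]:
  assumes "pt f" shows "pt (\<lambda>x. ByCe (f x))"
  by (rule pt_cong_enc[where g = "\<lambda>x. Bin (num_tree 3) (enc (f x, ()))"])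
    ((intro pt_tree pt_Pair assms)+, simp add: enc_simps tag_num_tree)

lemma pt_ByGe [pt_intros]:
  assumes "pt f" shows "pt (\<lambda>x. ByGe (f x))"
  by (rule pt_cong_enc[where g = "\<lambda>x. Bin (num_tree 4) (enc (f x, ()))"])
    ((intro pt_tree pt_Pair assms)+, simp add: enc_simps tag_num_tree)

lemma pt_case_cq_just [pt_intros]:
  assumes "pt (\<lambda>p. g0 (fst p) (fst (snd p)) (snd (snd p)))"
    "pt g1"
    "pt (\<lambda>p. g2 (fst p) (fst (snd p)) (snd (snd p)))"
    "pt (\<lambda>p. g3 (fst p) (snd p))"
    "pt (\<lambda>p. g4 (fst p) (snd p))"
    "pt f"
  shows "pt (\<lambda>x. case f x of ByMPe a b \<Rightarrow> g0 x a b | ByTe \<Rightarrow> g1 x  | ByEe a b \<Rightarrow> g2 x a b | ByCe a \<Rightarrow> g3 x a | ByGe a \<Rightarrow> g4 x a)"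
proof -
  let ?v0 = "\<lambda>t :: cq_just. case t of ByMPe a b \<Rightarrow> [(a, b, ())] | ByTe \<Rightarrow> [] | ByEe a b \<Rightarrow> [] | ByCe a \<Rightarrow> [] | ByGe a \<Rightarrow> []"
  let ?v1 = "\<lambda>t :: cq_just. case t of ByMPe a b \<Rightarrow> [] | ByTe \<Rightarrow> [()] | ByEe a b \<Rightarrow> [] | ByCe a \<Rightarrow> [] | ByGe a \<Rightarrow> []"
  let ?v2 = "\<lambda>t :: cq_just. case t of ByMPe a b \<Rightarrow> [] | ByTe \<Rightarrow> [] | ByEe a b \<Rightarrow> [(a, b, ())] | ByCe a \<Rightarrow> [] | ByGe a \<Rightarrow> []"
  let ?v3 = "\<lambda>t :: cq_just. case t of ByMPe a b \<Rightarrow> [] | ByTe \<Rightarrow> [] | ByEe a b \<Rightarrow> [] | ByCe a \<Rightarrow> [(a, ())] | ByGe a \<Rightarrow> []"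
  let ?v4 = "\<lambda>t :: cq_just. case t of ByMPe a b \<Rightarrow> [] | ByTe \<Rightarrow> [] | ByEe a b \<Rightarrow> [] | ByCe a \<Rightarrow> [] | ByGe a \<Rightarrow> [(a, ())]"
  have v0: "views ?v0 0"
    unfolding views_def by (auto simp: enc_simps tag_num_tree split: cq_just.split)
  have v1: "views ?v1 1"
    unfolding views_def by (auto simp: enc_simps tag_num_tree split: cq_just.split)
  have v2: "views ?v2 2"
    unfolding views_def by (auto simp: enc_simps tag_num_tree split: cq_just.split)
  have v3: "views ?v3 3"
    unfolding views_def by (auto simp: enc_simps tag_num_tree split: cq_just.split)
  have v4: "views ?v4 4"
    unfolding views_def by (auto simp: enc_simps tag_num_tree split: cq_just.split)

  have h0: "pt (\<lambda>p::_ \<times> (_ \<times> _ \<times> unit). g0 (fst p) (fst (snd p)) (fst (snd (snd p))))"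
    using pt_comp[OF assms(1), of "\<lambda>p. (fst p, fst (snd p), fst (snd (snd p)))"] by (simp add: pt_intros)

  have h1: "pt (\<lambda>p::_ \<times> unit. g1 (fst p))"
    by (intro pt_comp[OF assms(2)] pt_intros)

  have h2: "pt (\<lambda>p::_ \<times> (_ \<times> _ \<times> unit). g2 (fst p) (fst (snd p)) (fst (snd (snd p))))"
    using pt_comp[OF assms(3), of "\<lambda>p. (fst p, fst (snd p), fst (snd (snd p)))"] by (simp add: pt_intros)

  have h3: "pt (\<lambda>p::_ \<times> (_ \<times> unit). g3 (fst p) (fst (snd p)))"
    using pt_comp[OF assms(4), of "\<lambda>p. (fst p, fst (snd p))"] by (simp add: pt_intros)

  have h4: "pt (\<lambda>p::_ \<times> (_ \<times> unit). g4 (fst p) (fst (snd p)))"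
    using pt_comp[OF assms(5), of "\<lambda>p. (fst p, fst (snd p))"] by (simp add: pt_intros)

  have "pt (\<lambda>x. (case ?v0 (f x) of y # ys \<Rightarrow> g0 x (fst y) (fst (snd y)) | [] \<Rightarrow> (case ?v1 (f x) of y # ys \<Rightarrow> g1 x | [] \<Rightarrow> (case ?v2 (f x) of y # ys \<Rightarrow> g2 x (fst y) (fst (snd y)) | [] \<Rightarrow> (case ?v3 (f x) of y # ys \<Rightarrow> g3 x (fst y) | [] \<Rightarrow> (case ?v4 (f x) of y # ys \<Rightarrow> g4 x (fst y) | [] \<Rightarrow> undefined)))))
    )"
    by (intro pt_case_view[OF v0 assms(6) h0] pt_case_view[OF v1 assms(6) h1] pt_case_view[OF v2 assms(6) h2] pt_case_view[OF v3 assms(6) h3] pt_case_view[OF v4 assms(6) h4] pt_const)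
  then show ?thesis by (rule pt_cong_enc) (simp split: cq_just.split)
qed

lemma pt_LCQ [pt_intros]:
  assumes "pt f" shows "pt (\<lambda>x. LCQ (f x))"
  by (rule pt_cong_enc[where g = "\<lambda>x. Bin (num_tree 0) (enc (f x, ()))"])
    ((intro pt_tree pt_Pair assms)+, simp add: enc_simps tag_num_tree)

lemma pt_LRule [pt_intros]:
  assumes "pt f" "pt g" "pt h" shows "pt (\<lambda>x. LRule (f x) (g x) (h x))"
  by (rule pt_cong_enc[where g = "\<lambda>x. Bin (num_tree 1) (enc (f x, g x, h x, ()))"])
    ((intro pt_tree pt_Pair assms)+, simp add: enc_simps tag_num_tree)

lemma pt_case_lformula [pt_intros]:
  assumes "pt (\<lambda>p. g0 (fst p) (snd p))"
    "pt (\<lambda>p. g1 (fst p) (fst (snd p)) (fst (snd (snd p))) (snd (snd (snd p))))"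
    "pt f"
  shows "pt (\<lambda>x. case f x of LCQ a \<Rightarrow> g0 x a | LRule a b c \<Rightarrow> g1 x a b c)"
proof -
  let ?v0 = "\<lambda>t :: lformula. case t of LCQ a \<Rightarrow> [(a, ())] | LRule a b c \<Rightarrow> []"
  let ?v1 = "\<lambda>t :: lformula. case t of LCQ a \<Rightarrow> [] | LRule a b c \<Rightarrow> [(a, b, c, ())]"
  have v0: "views ?v0 0"
    unfolding views_def by (auto simp: enc_simps tag_num_tree split: lformula.split)
  have v1: "views ?v1 1"
    unfolding views_def by (auto simp: enc_simps tag_num_tree split: lformula.split)

  have h0: "pt (\<lambda>p::_ \<times> (_ \<times> unit). g0 (fst p) (fst (snd p)))"
    using pt_comp[OF assms(1), of "\<lambda>p. (fst p, fst (snd p))"] by (simp add: pt_intros)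

  have h1: "pt (\<lambda>p::_ \<times> (_ \<times> _ \<times> _ \<times> unit). g1 (fst p) (fst (snd p)) (fst (snd (snd p))) (fst (snd (snd (snd p)))))"
    using pt_comp[OF assms(2), of "\<lambda>p. (fst p, fst (snd p), fst (snd (snd p)), fst (snd (snd (snd p))))"] by (simp add: pt_intros)

  have "pt (\<lambda>x. (case ?v0 (f x) of y # ys \<Rightarrow> g0 x (fst y) | [] \<Rightarrow> (case ?v1 (f x) of y # ys \<Rightarrow> g1 x (fst y) (fst (snd y)) (fst (snd (snd y))) | [] \<Rightarrow> undefined))
    )"
    by (intro pt_case_view[OF v0 assms(3) h0] pt_case_view[OF v1 assms(3) h1] pt_const)
  then show ?thesis by (rule pt_cong_enc) (simp split: lformula.split)
qed


lemma pt_Sk [pt_intros]: assumes "pt f" "pt g" "pt h" shows "pt (\<lambda>x. Sk (f x) (g x) (h x))"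
  by (rule pt_cong_enc[where g = "\<lambda>x. (f x, g x, h x, ())"])
    ((intro pt_intros assms)+, simp add: enc_simps(3))


lemma pt_map_atom [pt_intros]:
  assumes "pt (\<lambda>p. g (fst p) (snd p))" "pt f" shows "pt (\<lambda>x. map_atom (g x) (f x))"
proof -
  have "pt (\<lambda>x. case f x of CA a b \<Rightarrow> CA a (g x b) | RA a b c \<Rightarrow> RA a (g x b) (g x c)
      | EqA a b \<Rightarrow> EqA (g x a) (g x b))"
    by (intro pt_intros pt_comp2[OF assms(1)] assms(2))
  then show ?thesis by (rule pt_cong_enc) (simp split: atom.split)
qed

subsection \<open>Proofs as lists\<close>

fun form :: "lformula \<Rightarrow> formula" where
  "form (LCQ xs) = CQ (fset_of_list xs)"
| "form (LRule xs X ys) = Rule (fset_of_list xs) (fset_of_list X) (fset_of_list ys)"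

fun ldistinct :: "lformula \<Rightarrow> bool" where
  "ldistinct (LCQ xs) \<longleftrightarrow> distinct xs"
| "ldistinct (LRule xs X ys) \<longleftrightarrow> distinct xs \<and> distinct X \<and> distinct ys"

text \<open>The unit components stand for the \<open>Tip\<close> at the end of the code of a vertex
  or an edge.\<close>

type_synonym 'j lproof =
  "(name \<times> lformula \<times> unit) list \<times> (name list \<times> name \<times> 'j \<times> unit) list"

text \<open>A proof has many codes, one for each way of listing its sets. \<open>repr p l\<close>
  says that \<open>l\<close> is such a listing; together with \<open>enc\<close> it factors the
  coding relation, see \<open>codes_proof_enc\<close>.\<close>

definition repr :: "'j hproof \<Rightarrow> 'j lproof \<Rightarrow> bool" where
  "repr p l \<longleftrightarrow> distinct (map fst (fst l)) \<and> fst ` set (fst l) = verts p \<and>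
     (\<forall>(v, f, u)\<in>set (fst l). form f = lab p v \<and> ldistinct f) \<and>
     distinct (map (\<lambda>(S, d, j, u). (set S, d)) (snd l)) \<and>
     (\<lambda>(S, d, j, u). (set S, d)) ` set (snd l) = edges p \<and>
     (\<forall>(S, d, j, u)\<in>set (snd l). distinct S \<and> j = just p (set S, d))"

lemma codes_set_enc: "codes_set (\<lambda>x d. d = enc x) X d \<longleftrightarrow> (\<exists>xs. distinct xs \<and> set xs = X \<and> d = enc xs)"
proof -
  have "list_all2 (\<lambda>x d. d = enc x) xs ds \<longleftrightarrow> ds = map enc xs" for xs :: "'a list" and ds
    by (auto simp: list_all2_conv_all_nth list_eq_iff_nth_eq)
  then show ?thesis by (simp add: codes_set_def enc_list_tree)
qed

lemma codes_conj_enc: "codes_conj \<phi> d \<longleftrightarrow> (\<exists>xs. distinct xs \<and> fset_of_list xs = \<phi> \<and> d = enc xs)"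
  unfolding codes_conj_def enc_atom_inst codes_set_enc by (metis fset_inverse fset_of_list.rep_eq)

lemma codes_names_enc: "codes_names X d \<longleftrightarrow> (\<exists>xs. distinct xs \<and> set xs = X \<and> d = enc xs)"
  unfolding codes_names_def enc_name_eq codes_set_enc ..

lemma codes_formula_enc: "codes_formula \<phi> d \<longleftrightarrow> (\<exists>l. ldistinct l \<and> form l = \<phi> \<and> d = enc l)"
proof
  assume "codes_formula \<phi> d"
  then show "\<exists>l. ldistinct l \<and> form l = \<phi> \<and> d = enc l"
  proof cases
    case (1 \<psi> c)
    then obtain xs where "distinct xs" "fset_of_list xs = \<psi>" "c = enc xs"
      unfolding codes_conj_enc by blast
    then show ?thesis using 1 by (intro exI[of _ "LCQ xs"]) simp
  next
    case (2 \<psi> d1 X d2 \<chi> d3)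
    then obtain xs Xs ys where "distinct xs" "fset_of_list xs = \<psi>" "d1 = enc xs"
      "distinct Xs" "set Xs = fset X" "d2 = enc Xs"
      "distinct ys" "fset_of_list ys = \<chi>" "d3 = enc ys"
      unfolding codes_conj_enc codes_names_enc by blast
    moreover from this have "fset_of_list Xs = X" by (metis fset_inverse fset_of_list.rep_eq)
    ultimately show ?thesis using 2 by (intro exI[of _ "LRule xs Xs ys"]) simp
  qed
next
  assume "\<exists>l. ldistinct l \<and> form l = \<phi> \<and> d = enc l"
  then obtain l where l: "ldistinct l" "form l = \<phi>" "d = enc l" by blast
  then show "codes_formula \<phi> d"
  proof (cases l)
    case (LCQ xs)
    then have "codes_conj (fset_of_list xs) (enc xs)" using l codes_conj_enc by auto
    then show ?thesis using codes_formula.intros(1) l LCQ by auto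
  next
    case (LRule xs X ys)
    then have "codes_conj (fset_of_list xs) (enc xs)" "codes_conj (fset_of_list ys) (enc ys)"
      "codes_names (fset (fset_of_list X)) (enc X)"
      using l unfolding codes_conj_enc codes_names_enc by (auto simp: fset_of_list.rep_eq)
    then show ?thesis using codes_formula.intros(2) l LRule by auto
  qed
qed

lemma codes_tbox_enc: "codes_tbox T d \<longleftrightarrow> (\<exists>xs. distinct xs \<and> set xs = T \<and> d = enc xs)"
  unfolding codes_tbox_def enc_axm_inst[symmetric] codes_set_enc ..

lemma list_all2_ex_map:
  "list_all2 (\<lambda>x d. \<exists>z. P x z \<and> d = enc z) xs ds \<longleftrightarrow> (\<exists>zs. list_all2 P xs zs \<and> ds = map enc zs)"
proof -
  have "(\<lambda>x d. \<exists>z. P x z \<and> d = enc z) = P OO (\<lambda>z d. d = enc z)" by auto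
  moreover have "list_all2 (\<lambda>z d. d = enc z) zs ds \<longleftrightarrow> ds = map enc zs" for zs :: "'b list"
    by (auto simp: list_all2_conv_all_nth list_eq_iff_nth_eq)
  ultimately show ?thesis by (auto simp: list.rel_compp)
qed

lemma ex_codes_list:
  fixes g :: "'z::codable list \<Rightarrow> 'y list"
  shows "(\<exists>xs ds. distinct xs \<and> set xs = X \<and> (\<exists>zs. (xs = g zs \<and> Q zs) \<and> ds = map enc zs) \<and> d = list_tree ds)
    \<longleftrightarrow> (\<exists>zs. distinct (g zs) \<and> set (g zs) = X \<and> Q zs \<and> d = enc zs)"
  unfolding enc_list_tree by blast

lemma ex_enc_Pair:
  "(\<exists>a b. d = Bin a b \<and> (\<exists>x. P x \<and> a = enc x) \<and> (\<exists>y. Q y \<and> b = enc y)) \<longleftrightarrow>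
    (\<exists>z. P (fst z) \<and> Q (snd z) \<and> d = enc z)"
  by (auto simp: enc_prod_def)

lemma codes_proof_enc:
  "codes_proof enc p d \<longleftrightarrow> (\<exists>l. repr p l \<and> d = enc l)"
proof -
  have vrel: "(\<lambda>v dv'. \<exists>l. codes_formula (lab p v) l \<and> dv' = list_tree [enc_name v, l])
     = (\<lambda>v d. \<exists>z. (fst z = v \<and> form (fst (snd z)) = lab p v \<and> ldistinct (fst (snd z))) \<and> d = enc (z :: name \<times> lformula \<times> unit))"
    by (intro ext) (auto simp: codes_formula_enc enc_name_eq)
  have erel: "(\<lambda>(S, v) de'. \<exists>s. codes_names S s \<and> de' = list_tree [s, enc_name v, enc (just p (S, v))])
     = (\<lambda>e d. \<exists>z. ((set (fst z), fst (snd z)) = e \<and> distinct (fst z) \<and> fst (snd (snd z)) = just p e)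
         \<and> d = enc (z :: name list \<times> name \<times> 'a \<times> unit))"
    by (intro ext) (auto simp: codes_names_enc enc_name_eq)
  have v: "list_all2 (\<lambda>v z. fst z = v \<and> form (fst (snd z)) = lab p v \<and> ldistinct (fst (snd z))) xs zs \<longleftrightarrow>
    xs = map fst zs \<and> (\<forall>(v, f, u)\<in>set zs. form f = lab p v \<and> ldistinct f)"
    for xs and zs :: "(name \<times> lformula \<times> unit) list"
    by (induction zs arbitrary: xs) (auto simp: list_all2_Cons2)
  have e: "list_all2 (\<lambda>e z. (set (fst z), fst (snd z)) = e \<and> distinct (fst z) \<and> fst (snd (snd z)) = just p e) xs zs \<longleftrightarrow>
    xs = map (\<lambda>(S, d, j, u). (set S, d)) zs \<and> (\<forall>(S, d, j, u)\<in>set zs. distinct S \<and> j = just p (set S, d))"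
    for xs and zs :: "(name list \<times> name \<times> 'a \<times> unit) list"
    by (induction zs arbitrary: xs) (auto simp: list_all2_Cons2)
  have sv: "codes_set (\<lambda>v dv'. \<exists>l. codes_formula (lab p v) l \<and> dv' = list_tree [enc_name v, l]) X d \<longleftrightarrow>
    (\<exists>zs :: (name \<times> lformula \<times> unit) list. distinct (map fst zs) \<and> fst ` set zs = X \<and> (\<forall>(v, f, u)\<in>set zs. form f = lab p v \<and> ldistinct f) \<and> d = enc zs)"
    for X d
    unfolding codes_set_def vrel list_all2_ex_map v ex_codes_list list.set_map ..
  have se: "codes_set (\<lambda>(S, v) de'. \<exists>s. codes_names S s \<and> de' = list_tree [s, enc_name v, enc (just p (S, v))]) X d \<longleftrightarrow>
    (\<exists>zs :: (name list \<times> name \<times> 'a \<times> unit) list. distinct (map (\<lambda>(S, d, j, u). (set S, d)) zs) \<and> (\<lambda>(S, d, j, u). (set S, d)) ` set zs = X \<and>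
      (\<forall>(S, d, j, u)\<in>set zs. distinct S \<and> j = just p (set S, d)) \<and> d = enc zs)"
    for X d
    unfolding codes_set_def erel list_all2_ex_map e ex_codes_list list.set_map ..
  show ?thesis
    unfolding codes_proof_def sv se repr_def
    using ex_enc_Pair[of d "\<lambda>zs. distinct (map fst zs) \<and> fst ` set zs = verts p \<and>
          (\<forall>(v, f, u)\<in>set zs. form f = lab p v \<and> ldistinct f)"
        "\<lambda>zs. distinct (map (\<lambda>(S, d, j, u). (set S, d)) zs) \<and> (\<lambda>(S, d, j, u). (set S, d)) ` set zs = edges p \<and>
          (\<forall>(S, d, j, u)\<in>set zs. distinct S \<and> j = just p (set S, d))"]
    unfolding conj_assoc .
qed

text \<open>The justification is looked up by the target alone. This is unambiguous when no two
  edges of the list share a target, which is the hypothesis of \<open>just_mkproof\<close>.\<close>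

definition mkproof :: "'j lproof \<Rightarrow> 'j hproof" where
  "mkproof l = \<lparr>verts = fst ` set (fst l), edges = (\<lambda>(S, d, j, u). (set S, d)) ` set (snd l),
     lab = (\<lambda>v. form (fst (the (map_of (fst l) v)))),
     just = (\<lambda>(S, d). the (map_of (map (\<lambda>(S, d, j, u). (d, j)) (snd l)) d))\<rparr>"

lemma mkproof_simps:
  "verts (mkproof l) = fst ` set (fst l)"
  "edges (mkproof l) = (\<lambda>(S, d, j, u). (set S, d)) ` set (snd l)"
  by (simp_all add: mkproof_def)

lemma lab_mkproof: "distinct (map fst (fst l)) \<Longrightarrow> (v, f, u) \<in> set (fst l) \<Longrightarrow> lab (mkproof l) v = form f"
  by (simp add: mkproof_def)

lemma just_mkproof:
  assumes "distinct (map (\<lambda>(S, d, j, u). d) (snd l))" "(S, d, j, u) \<in> set (snd l)"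
  shows "just (mkproof l) (set S, d) = j"
proof -
  have "map fst (map (\<lambda>(S, d, j, u). (d, j)) (snd l)) = map (\<lambda>(S, d, j, u). d) (snd l)"
    by (induction "snd l") (auto simp: comp_def case_prod_unfold)
  then have "map_of (map (\<lambda>(S, d, j, u). (d, j)) (snd l)) d = Some j"
    by (intro map_of_is_SomeI) (simp_all only: assms(1), use assms(2) in force)
  then show ?thesis by (simp add: mkproof_def)
qed

lemma repr_mkproof:
  assumes "distinct (map fst (fst l))" "distinct (map (\<lambda>(S, d, j, u). d) (snd l))"
    "\<And>v f u. (v, f, u) \<in> set (fst l) \<Longrightarrow> ldistinct f"
    "\<And>S d j u. (S, d, j, u) \<in> set (snd l) \<Longrightarrow> distinct S"
  shows "repr (mkproof l) l"
proof -
  have "map (\<lambda>(S, d, j, u). d) (snd l) = map snd (map (\<lambda>(S, d, j, u). (set S, d)) (snd l))"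
    by (auto simp: comp_def case_prod_unfold)
  then have "distinct (map (\<lambda>(S, d, j, u). (set S, d)) (snd l))"
    using assms(2) distinct_map by metis
  then show ?thesis
    unfolding repr_def using assms lab_mkproof[OF assms(1)] just_mkproof[OF assms(2)]
    by (auto simp: mkproof_simps)
qed

text \<open>From here on programs and trees are out of sight: a polynomial function on listings has
  to be correct for every listing of the proof and of the TBox. A new main function pairs the two
  program arguments.\<close>

lemma polytime_transformableI:
  fixes f :: "('i::codable) lproof \<times> axm list \<Rightarrow> ('o::codable) lproof"
  assumes "pt f"
    and "\<And>T A q p l ts. is_tbox T \<Longrightarrow> is_abox A \<Longrightarrow> bcq q \<Longrightarrow> P T A q p \<Longrightarrow> repr p l \<Longrightarrow> set ts = T \<Longrightarrow>
      \<exists>p'. Q T A q p' \<and> repr p' (f (l, ts))"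
  shows "polytime_transformable P enc Q enc"
proof -
  obtain F b where b: "pbound b" "runs F 0 f b" using assms(1) unfolding pt_def by blast
  obtain c k where ck: "\<And>x. b x \<le> c * csz x ^ k" using b(1) unfolding pbound_def by blast
  let ?e = "ECall 1 [EBin (EArg 0) (EArg 1)]"
  let ?F = "?e # map (shift 1) F"
  \<comment> \<open>The factor \<open>2 ^ k\<close> comes from
    \<open>csz (l, ts) = 1 + n \<le> 2 * n\<close>, where \<open>n\<close> is the sum of the two
    sizes; the exponent \<open>k + 1\<close> absorbs the linear cost of pairing also when
    \<open>k = 0\<close>.\<close>
  have run: "computes_in ?F [enc l, enc ts] (enc (f (l, ts))) ((6 + 2 * c * 2 ^ k) * (csz l + csz ts) ^ (k + 1))"
    (is "computes_in _ _ _ ?B") for l and ts :: "axm list"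
  proof -
    let ?n = "csz l + csz ts"
    have n: "1 \<le> ?n" "1 + ?n \<le> 2 * ?n" by (simp_all add: Suc_le_eq)
    have "eval ?F [enc l, enc ts] (EBin (EArg 0) (EArg 1)) (enc (l, ts)) (csz l + csz ts + csz (l, ts))"
      using eval_evals.intros(3)[OF eval_evals.intros(1)[of 0 "[enc l, enc ts]" ?F]
          eval_evals.intros(1)[of 1 "[enc l, enc ts]" ?F]] by simp
    then obtain m where m: "eval ?F [enc l, enc ts] ?e (enc (f (l, ts))) m"
      "m \<le> csz l + csz ts + csz (l, ts) + 2 * b (l, ts)"
      using runs_call[OF runs_Cons[OF b(2)]] by fastforce
    have "csz (l, ts) ^ k \<le> (2 * ?n) ^ k" using n by (intro power_mono) simp_all
    then have "b (l, ts) \<le> c * (2 ^ k * ?n ^ k)"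
      using ck[of "(l, ts)"] mult_le_mono2[of _ _ c] unfolding power_mult_distrib
      by (rule_tac order_trans)
    also have "\<dots> \<le> c * (2 ^ k * ?n ^ (k + 1))"
      by (intro mult_le_mono2 power_increasing n) simp
    finally have bb: "2 * b (l, ts) \<le> 2 * c * 2 ^ k * ?n ^ (k + 1)" by (simp add: ac_simps)
    have "?n \<le> ?n ^ (k + 1)" using power_increasing[OF _ n(1), of 1 "k + 1"] by simp
    moreover have "csz (l, ts) = 1 + ?n" by simp
    ultimately have "csz l + csz ts + csz (l, ts) \<le> 6 * ?n ^ (k + 1)"
      using n unfolding \<open>csz (l, ts) = _\<close> by presburger
    with bb m(2) have "m \<le> ?B" unfolding distrib_right by linarith
    then show ?thesis unfolding computes_in_def using m(1) by auto
  qed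
  show ?thesis
    unfolding polytime_transformable_def codes_proof_enc codes_tbox_enc
    by (rule exI[of _ ?F], rule exI[of _ "6 + 2 * c * 2 ^ k"], rule exI[of _ "k + 1"])
      (metis run assms(2))
qed

section \<open>Soundness of the inferences\<close>

lemma val_tsub: "val I v (tsub \<sigma> t) = val I (\<lambda>x. val I v (\<sigma> x)) t"
  by (induction t) simp_all

lemma sat_atom_asub: "sat_atom I v (asub \<sigma> \<alpha>) \<longleftrightarrow> sat_atom I (\<lambda>x. val I v (\<sigma> x)) \<alpha>"
  by (cases \<alpha>) (simp_all add: asub_def val_tsub)

lemma sat_conj_csub: "sat_conj I v (csub \<sigma> \<phi>) \<longleftrightarrow> sat_conj I (\<lambda>x. val I v (\<sigma> x)) \<phi>"
  by (simp add: sat_conj_def csub_def sat_atom_asub)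

lemma val_cong: "(\<And>x. x \<in> tvars t \<Longrightarrow> v x = w x) \<Longrightarrow> val I v t = val I w t"
  by (induction t) simp_all

definition avars :: "tm atom \<Rightarrow> name set" where
  "avars \<alpha> = (\<Union>t\<in>set_atom \<alpha>. tvars t)"

lemma avars_simps [simp]:
  "avars (CA A t) = tvars t" "avars (RA r s t) = tvars s \<union> tvars t" "avars (EqA s t) = tvars s \<union> tvars t"
  by (auto simp: avars_def)

lemma vars_avars: "vars \<phi> = (\<Union>\<alpha>\<in>fset \<phi>. avars \<alpha>)"
  by (simp add: vars_def avars_def)

lemma sat_atom_cong:
  assumes "\<And>x. x \<in> avars \<alpha> \<Longrightarrow> v x = w x" shows "sat_atom I v \<alpha> \<longleftrightarrow> sat_atom I w \<alpha>"
proof -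
  have "val I v t = val I w t" if "t \<in> set_atom \<alpha>" for t
    using that assms by (intro val_cong) (auto simp: avars_def)
  then show ?thesis by (cases \<alpha>) simp_all
qed

lemma sat_conj_cong:
  assumes "\<And>x. x \<in> vars \<phi> \<Longrightarrow> v x = w x" shows "sat_conj I v \<phi> \<longleftrightarrow> sat_conj I w \<phi>"
  unfolding sat_conj_def by (intro ball_cong sat_atom_cong) (use assms vars_avars in auto)

lemma val_univ: "is_interp I \<Longrightarrow> range v \<subseteq> univ I \<Longrightarrow> val I v t \<in> univ I"
  by (induction t) (auto simp: is_interp_def)

lemma sat_ground: "ground \<phi> \<Longrightarrow> sat I (CQ \<phi>) \<Longrightarrow> sat_conj I v \<phi>"
  unfolding ground_def by (auto cong: sat_conj_cong) (metis empty_iff sat_conj_cong)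

lemma sat_atom_repl:
  assumes "repl t1 t2 \<alpha> \<beta>" "val I v t1 = val I v t2" shows "sat_atom I v \<alpha> \<longleftrightarrow> sat_atom I v \<beta>"
  using assms by (cases \<alpha>; cases \<beta>) (auto simp: repl_def)

text \<open>The definition of a proof demands that every hyperedge be an entailment, besides being
  an inference of the derivation structure. For (MP), the substitution lemma turns the ground
  instance into an assignment at which the rule is evaluated.\<close>

lemma sk_inf_sound:
  assumes "sk_inf T q j \<Gamma> \<eta>" shows "entails \<Gamma> \<eta>"
  unfolding entails_def
proof (intro allI impI)
  fix I assume I: "is_interp I" and sat: "\<forall>\<gamma>\<in>\<Gamma>. sat I \<gamma>"
  obtain d0 where d0: "d0 \<in> univ I" using I unfolding is_interp_def by blast
  \<comment> \<open>Ground conjunctions do not depend on the assignment, so a constant one evaluates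
    all premises at once.\<close>
  define v :: "name \<Rightarrow> nat" where "v = (\<lambda>_. d0)"
  have v: "range v \<subseteq> univ I" using d0 by (auto simp: v_def)
  have CQ: "sat I (CQ \<phi>)" if "sat_conj I v \<phi>" for \<phi> using that v by auto
  show "sat I \<eta>" using assms
  proof cases
    case (MP ax \<psi> \<chi> s \<alpha>)
    let ?u = "\<lambda>x. val I v (sub s x)"
    have u: "range ?u \<subseteq> univ I" using val_univ[OF I v] by auto
    have "sat_atom I v \<beta>" if "\<beta> |\<in>| csub (sub s) \<psi>" for \<beta>
    proof -
      have "ground {|\<beta>|}"
        using \<open>ground (csub (sub s) \<psi>)\<close> that by (auto simp: ground_def vars_avars)
      moreover have "sat I (CQ {|\<beta>|})" using sat MP(2) that by auto
      ultimately have "sat_conj I v {|\<beta>|}" by (rule sat_ground)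
      then show ?thesis by (simp add: sat_conj_def)
    qed
    then have "sat_conj I ?u \<psi>" unfolding sat_conj_csub[symmetric] by (simp add: sat_conj_def)
    moreover have "sat I (Rule \<psi> {||} \<chi>)" using sat MP by auto
    ultimately obtain w where "\<forall>x. w x = ?u x" "sat_conj I w \<chi>"
      using u by (metis fempty_iff sat.simps(2))
    then have "sat_conj I ?u \<chi>" using sat_conj_cong by metis
    then have "sat_atom I v \<alpha>" using MP unfolding sat_conj_csub[symmetric] by (simp add: sat_conj_def)
    then have "sat_conj I v {|\<alpha>|}" by (simp add: sat_conj_def)
    then show ?thesis unfolding MP(3) by (rule CQ)
  next
    case (E \<alpha> t1 t2 \<beta>)
    have "sat_conj I v {|\<alpha>|}" "sat_conj I v {|EqA t1 t2|}"
      using E sat by (auto intro!: sat_ground simp del: sat.simps simp: ground_def vars_avars)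
    then have "sat_conj I v {|\<beta>|}" using sat_atom_repl[OF E(5), of I v] by (simp add: sat_conj_def)
    then show ?thesis unfolding E(3) by (rule CQ)
  next
    case (C \<gamma>)
    have "sat_atom I v \<alpha>" if "\<alpha> |\<in>| \<gamma>" for \<alpha>
    proof -
      have "ground {|\<alpha>|}" using C that by (auto simp: ground_def vars_avars)
      moreover have "sat I (CQ {|\<alpha>|})" using sat that unfolding C(2) by blast
      ultimately have "sat_conj I v {|\<alpha>|}" by (rule sat_ground)
      then show ?thesis by (simp add: sat_conj_def)
    qed
    then have "sat_conj I v \<gamma>" by (simp add: sat_conj_def)
    then show ?thesis unfolding C(3) by (rule CQ)
  next
    case (G \<gamma> s)
    have "sat_conj I v \<gamma>" using G sat by (auto intro!: sat_ground simp del: sat.simps)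
    then have "sat_conj I v (csub (sub s) q)" using G by (auto simp: sat_conj_def)
    moreover have "range (\<lambda>x. val I v (sub s x)) \<subseteq> univ I" using val_univ[OF I v] by auto
    ultimately show ?thesis
      unfolding G(3) sat_conj_csub sat.simps by (intro exI[of _ "\<lambda>x. val I v (sub s x)"] conjI)
  qed
qed

section \<open>Soundness of the inferences on conjunctive queries\<close>

lemma tvars_tsub: "tvars (tsub \<sigma> t) = (\<Union>x\<in>tvars t. tvars (\<sigma> x))"
  by (induction t) auto

lemma avars_asub: "avars (asub \<sigma> \<alpha>) = (\<Union>x\<in>avars \<alpha>. tvars (\<sigma> x))"
  by (cases \<alpha>) (auto simp: asub_def tvars_tsub)

lemma vars_csub: "vars (csub \<sigma> \<phi>) = (\<Union>x\<in>vars \<phi>. tvars (\<sigma> x))"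
  by (auto simp: vars_avars csub_def avars_asub)

lemma vars_mono: "\<phi> |\<subseteq>| \<psi> \<Longrightarrow> vars \<phi> \<subseteq> vars \<psi>"
  by (auto simp: vars_avars)

text \<open>Rules are safe: a head variable is bound or occurs in the body. Thus the image of an
  unbound head variable uses only variables of the CQ, whose values are not disturbed when the fresh
  variables are assigned.\<close>

lemma rule_vars:
  assumes "Rule \<psi> X \<chi> = rule_of ax \<or> taut_rule (Rule \<psi> X \<chi>)"
  shows "vars \<chi> \<subseteq> vars \<psi> \<union> fset X"
proof -
  have r: "avars (ratom R s t) = tvars s \<union> tvars t" for R s t by (cases R) auto
  from assms show ?thesis
  proof
    assume "Rule \<psi> X \<chi> = rule_of ax"
    then show ?thesis by (cases ax) (simp_all add: vars_avars r)
  next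
    assume "taut_rule (Rule \<psi> X \<chi>)"
    then show ?thesis by cases simp
  qed
qed

lemma cq_inf_sound:
  assumes "cq_inf T j \<Gamma> \<eta>" shows "entails \<Gamma> \<eta>"
  unfolding entails_def
proof (intro allI impI)
  fix I assume I: "is_interp I" and sat: "\<forall>\<gamma>\<in>\<Gamma>. sat I \<gamma>"
  show "sat I \<eta>" using assms
  proof cases
    case (MPe \<phi> \<psi> X \<chi> s m \<chi>' P Q \<rho>)
    obtain v where v: "range v \<subseteq> univ I" "sat_conj I v \<phi>" using sat MPe by auto
    let ?u = "\<lambda>x. val I v (sub s x)"
    have u: "range ?u \<subseteq> univ I" using val_univ[OF I v(1)] by auto
    have "sat_conj I ?u \<psi>" unfolding sat_conj_csub[symmetric] using v(2) MPe(6) by (auto simp: sat_conj_def)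
    moreover have "sat I (Rule \<psi> X \<chi>)" using sat MPe by auto
    ultimately obtain w where w: "range w \<subseteq> univ I" "\<And>x. x |\<notin>| X \<Longrightarrow> w x = ?u x" "sat_conj I w \<chi>"
      using u by (metis sat.simps(2))
    \<comment> \<open>The assignment of the CQ is overridden on the renamed bound variables by the
      witnesses of the rule. Injectivity of the renaming makes this well defined, and freshness
      keeps the CQ true.\<close>
    define v' where "v' y = (if y \<in> ren m ` fset X then w (the_inv_into (fset X) (ren m) y) else v y)" for y
    have v': "range v' \<subseteq> univ I" using v(1) w(1) by (auto simp: v'_def)
    have v'X: "v' (ren m x) = w x" if "x |\<in>| X" for x
      using that MPe(7) by (simp add: v'_def the_inv_into_f_f)
    have v'\<phi>: "v' y = v y" if "y \<in> vars \<phi>" for y using that MPe(8) by (auto simp: v'_def)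
    have \<phi>: "sat_conj I v' \<phi>" using v(2) sat_conj_cong[of \<phi> v' v I] v'\<phi> by blast
    have "vars \<chi> \<subseteq> vars \<psi> \<union> fset X" using MPe(5) rule_vars by blast
    moreover have "tvars (sub s z) \<subseteq> vars \<phi>" if "z \<in> vars \<psi>" for z
      using that vars_mono[OF MPe(6)] unfolding vars_csub by blast
    ultimately have "w z = val I v' (if z |\<in>| X then Var (ren m z) else sub s z)" if "z \<in> vars \<chi>" for z
      using that v'X w(2)[of z] val_cong[of "sub s z" v' v I] v'\<phi> by (auto simp: subset_iff)
    then have "sat_conj I v' \<chi>'"
      unfolding MPe(9) sat_conj_csub using w(3) sat_conj_cong by (metis (no_types, lifting))
    then have "sat_conj I v' \<rho>" using \<phi> MPe by (auto simp: sat_conj_def)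
    then show ?thesis using MPe v' by auto
  next
    case Te
    from this(3) show ?thesis by cases auto
  next
    case (Ee t1 t2 \<phi> \<rho>)
    obtain v where v: "range v \<subseteq> univ I" "sat_conj I v (finsert (EqA t1 t2) \<phi>)" using sat Ee by auto
    have eq: "val I v t1 = val I v t2" using v(2) by (simp add: sat_conj_def)
    have "sat_atom I v \<beta>" if "\<beta> |\<in>| \<rho>" for \<beta>
    proof -
      obtain \<alpha> where "\<alpha> |\<in>| \<phi>" "repl t1 t2 \<alpha> \<beta>"
        using Ee(5) \<open>\<beta> |\<in>| \<rho>\<close> unfolding rel_fset_alt by blast
      then show ?thesis using v(2) sat_atom_repl[OF _ eq] by (auto simp: sat_conj_def)
    qed
    then show ?thesis using Ee v(1) by (auto simp: sat_conj_def)
  next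
    case (Ce \<phi> \<psi> m)
    obtain v w where v: "range v \<subseteq> univ I" "sat_conj I v \<phi>" and w: "range w \<subseteq> univ I" "sat_conj I w \<psi>"
      using sat Ce by auto
    \<comment> \<open>As for (MP_e): the values of \<open>w\<close> are placed on the renamed
      variables of the second CQ.\<close>
    define v' where "v' y = (if y \<in> ren m ` vars \<psi> then w (the_inv_into (vars \<psi>) (ren m) y) else v y)" for y
    have v': "range v' \<subseteq> univ I" using v(1) w(1) by (auto simp: v'_def)
    have "v' x = v x" if "x \<in> vars \<phi>" for x using that Ce(7) by (auto simp: v'_def)
    then have "sat_conj I v' \<phi>" using v(2) sat_conj_cong by blast
    moreover have "val I v' (Var (ren m z)) = w z" if "z \<in> vars \<psi>" for z
      using that Ce(6) by (simp add: v'_def the_inv_into_f_f)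
    then have "sat_conj I v' (csub (\<lambda>z. Var (ren m z)) \<psi>)"
      unfolding sat_conj_csub using w(2) sat_conj_cong[of \<psi> w "\<lambda>z. val I v' (Var (ren m z))" I]
      by simp
    ultimately show ?thesis using Ce v' by (auto simp: sat_conj_def)
  next
    case (Ge \<phi> \<rho> s)
    obtain v where v: "range v \<subseteq> univ I" "sat_conj I v \<phi>" using sat Ge by auto
    have "range (\<lambda>x. val I v (ind_sub s x)) \<subseteq> univ I" using val_univ[OF I v(1)] by auto
    with v(2) show ?thesis using Ge
      by (auto simp: sat_conj_csub intro!: exI[of _ "\<lambda>x. val I v (ind_sub s x)"])
  qed
qed

section \<open>Assembling proofs\<close>

lemma acyclic_measure:
  fixes f :: "'a \<Rightarrow> nat"
  assumes "\<And>s d. (s, d) \<in> r \<Longrightarrow> f s < f d" shows "acyclic r"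
proof -
  have "r \<subseteq> measure f" using assms by auto
  then show ?thesis using wf_acyclic wf_measure wf_subset by blast
qed

text \<open>The rank of a vertex is the number of its proper ancestors. A premise has fewer of them
  than the conclusion, being an ancestor of the conclusion but not of itself. The bound by the
  number of vertices later provides the fuel of the chase and the number of sorting rounds.\<close>

lemma proof_rank:
  assumes "is_proof U \<eta> p"
  obtains rank :: "name \<Rightarrow> nat" where
    "\<And>S d s. (S, d) \<in> edges p \<Longrightarrow> s \<in> S \<Longrightarrow> rank s < rank d"
    "\<And>v. v \<in> verts p \<Longrightarrow> rank v < card (verts p)"
proof -
  let ?R = "{(s, d). \<exists>S. (S, d) \<in> edges p \<and> s \<in> S}"
  have fin: "finite (verts p)" and ac: "acyclic ?R" and sub: "\<And>S d. (S, d) \<in> edges p \<Longrightarrow> S \<subseteq> verts p \<and> d \<in> verts p"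
    using assms unfolding is_proof_def by auto
  define rank where "rank v = card {u. (u, v) \<in> ?R\<^sup>+}" for v
  have anc: "{u. (u, v) \<in> ?R\<^sup>+} \<subseteq> verts p - {v}" for v
  proof -
    have "u \<in> verts p" if "(u, v) \<in> ?R\<^sup>+" for u using that sub by (induction rule: converse_trancl_induct) auto
    then show ?thesis using ac unfolding acyclic_def by auto
  qed
  show ?thesis
  proof
    fix S d s assume e: "(S, d) \<in> edges p" "s \<in> S"
    then have sd: "(s, d) \<in> ?R" by auto
    then have "{u. (u, s) \<in> ?R\<^sup>+} \<subseteq> {u. (u, d) \<in> ?R\<^sup>+}" by (auto intro: trancl_into_trancl)
    moreover have "s \<in> {u. (u, d) \<in> ?R\<^sup>+}" "s \<notin> {u. (u, s) \<in> ?R\<^sup>+}"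
      using sd anc[of s] by blast+
    ultimately have "{u. (u, s) \<in> ?R\<^sup>+} \<subset> {u. (u, d) \<in> ?R\<^sup>+}" by blast
    moreover have "finite {u. (u, d) \<in> ?R\<^sup>+}" using anc[of d] fin finite_subset by blast
    ultimately show "rank s < rank d" unfolding rank_def by (rule psubset_card_mono[rotated])
  next
    fix v assume v: "v \<in> verts p"
    have "rank v \<le> card (verts p - {v})" unfolding rank_def using anc fin by (intro card_mono) auto
    also have "\<dots> < card (verts p)" using v fin by (meson card_Diff1_less)
    finally show "rank v < card (verts p)" .
  qed
qed

text \<open>All conditions are stated on the lists: acyclicity through a rank \<open>f\<close>, at
  most one incoming hyperedge through distinct targets, and uniqueness of the sink through the
  demand that every vertex other than \<open>v0\<close> be a premise.\<close>

lemma proof_in_mkproof: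
  fixes l :: "'j lproof" and f :: "name \<Rightarrow> nat"
  assumes dv: "distinct (map fst (fst l))" and de: "distinct (map (\<lambda>(S, d, j, u). d) (snd l))"
    and wf: "\<And>S d j u. (S, d, j, u) \<in> set (snd l) \<Longrightarrow> set S \<subseteq> fst ` set (fst l) \<and> d \<in> fst ` set (fst l)"
    and rank: "\<And>S d j u s. (S, d, j, u) \<in> set (snd l) \<Longrightarrow> s \<in> set S \<Longrightarrow> f s < f d"
    and leaf: "\<And>v fm u. (v, fm, u) \<in> set (fst l) \<Longrightarrow> (\<And>S j w. (S, v, j, w) \<notin> set (snd l)) \<Longrightarrow> form fm \<in> U"
    and inf: "\<And>S d j u. (S, d, j, u) \<in> set (snd l) \<Longrightarrow> D j (lab (mkproof l) ` set S) (lab (mkproof l) d)"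
    and sound: "\<And>j \<Gamma> \<eta>. D j \<Gamma> \<eta> \<Longrightarrow> entails \<Gamma> \<eta>"
    and sink: "(v0, fm0, u0) \<in> set (fst l)" "form fm0 = CQ q"
      "\<And>S d j u. (S, d, j, u) \<in> set (snd l) \<Longrightarrow> v0 \<notin> set S"
      "\<And>v fm u. (v, fm, u) \<in> set (fst l) \<Longrightarrow> v \<noteq> v0 \<Longrightarrow> \<exists>S d j w. (S, d, j, w) \<in> set (snd l) \<and> v \<in> set S"
  shows "proof_in D U q (mkproof l)"
proof -
  let ?p = "mkproof l"
  have e: "\<exists>S' j u. S = set S' \<and> (S', d, j, u) \<in> set (snd l)" if "(S, d) \<in> edges ?p" for S d
    using that by (auto simp: mkproof_simps)
  have D: "D (just ?p (S, d)) (lab ?p ` S) (lab ?p d)" if "(S, d) \<in> edges ?p" for S d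
    using e[OF that] inf just_mkproof[OF de] by fastforce
  have "is_sink ?p u \<longleftrightarrow> u = v0" for u
  proof
    assume u: "is_sink ?p u"
    then obtain fm w where "(u, fm, w) \<in> set (fst l)" by (auto simp: is_sink_def mkproof_simps)
    with u show "u = v0" using sink(4) by (force simp: is_sink_def mkproof_simps)
  next
    assume "u = v0"
    then show "is_sink ?p u" using sink(1,3) by (force simp: is_sink_def mkproof_simps)
  qed
  moreover have "lab ?p v0 = CQ q" using lab_mkproof[OF dv sink(1)] sink(2) by simp
  moreover have "acyclic {(s, d). \<exists>S. (S, d) \<in> edges ?p \<and> s \<in> S}"
    by (rule acyclic_measure[of _ f]) (use e rank in fastforce)
  moreover have "lab ?p v \<in> U" if v: "is_leaf ?p v" for v
  proof -
    obtain fm u where m: "(v, fm, u) \<in> set (fst l)" using v by (auto simp: is_leaf_def mkproof_simps)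
    have "(S, v, j, w) \<notin> set (snd l)" for S j w using v by (force simp: is_leaf_def mkproof_simps)
    then show ?thesis using leaf[OF m] lab_mkproof[OF dv m] by simp
  qed
  moreover have "S = S'" if d: "(S, d) \<in> edges ?p" "(S', d) \<in> edges ?p" for S S' d
  proof -
    obtain A j u B k w where AB: "S = set A" "(A, d, j, u) \<in> set (snd l)" "S' = set B" "(B, d, k, w) \<in> set (snd l)"
      using e[OF d(1)] e[OF d(2)] by blast
    have "inj_on (\<lambda>(S, d, j, u). d) (set (snd l))" using de by (simp add: distinct_map)
    from inj_onD[OF this _ AB(2,4)] AB show ?thesis by auto
  qed
  moreover have "S \<subseteq> verts ?p \<and> d \<in> verts ?p" if d: "(S, d) \<in> edges ?p" for S d
    using e[OF d] wf unfolding mkproof_simps(1) by blast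
  moreover have "finite (verts ?p)" by (simp add: mkproof_simps)
  moreover have "entails (lab ?p ` S) (lab ?p d)" if "(S, d) \<in> edges ?p" for S d
    using D[OF that] by (rule sound)
  ultimately have "is_proof U (CQ q) ?p"
    unfolding is_proof_def case_prod_unfold
    by (intro conjI ballI allI impI exI[of _ v0]; (metis prod.collapse | simp))
  then show ?thesis using D by (auto simp: proof_in_def)
qed


section \<open>Syntactic operations on lists\<close>

lemma fset_of_list_eq_iff: "fset_of_list xs = fset_of_list ys \<longleftrightarrow> set xs = set ys"
  by (metis fset_inverse fset_of_list.rep_eq)

lemma fset_of_list_remdups [simp]: "fset_of_list (remdups xs) = fset_of_list xs"
  by (simp add: fset_of_list_eq_iff)

text \<open>A substitution that reaches one level below a function symbol. The TBoxes and their
  Skolemizations contain no deeper terms, so recursion on terms is never needed.\<close>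

definition tsub1 :: "(name \<Rightarrow> tm) \<Rightarrow> tm \<Rightarrow> tm" where
  "tsub1 \<sigma> t = (case t of Var x \<Rightarrow> \<sigma> x | Ind a \<Rightarrow> Ind a
     | Fn f t' \<Rightarrow> Fn f (case t' of Var x \<Rightarrow> \<sigma> x | Ind a \<Rightarrow> Ind a | Fn g s \<Rightarrow> t'))"

definition asub1 :: "(name \<Rightarrow> tm) \<Rightarrow> tm atom \<Rightarrow> tm atom" where
  "asub1 \<sigma> = map_atom (tsub1 \<sigma>)"

definition shallow :: "tm \<Rightarrow> bool" where
  "shallow t \<longleftrightarrow> flat_tm t \<or> (\<exists>f s. t = Fn f s \<and> flat_tm s)"

lemma flat_shallow: "flat_tm t \<Longrightarrow> shallow t"
  by (simp add: shallow_def)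

lemma tsub1_tsub: "shallow t \<Longrightarrow> tsub1 \<sigma> t = tsub \<sigma> t"
  by (cases t) (auto simp: shallow_def tsub1_def split: tm.splits)

lemma asub1_asub: "(\<And>t. t \<in> set_atom \<alpha> \<Longrightarrow> shallow t) \<Longrightarrow> asub1 \<sigma> \<alpha> = asub \<sigma> \<alpha>"
  unfolding asub1_def asub_def by (intro atom.map_cong0 tsub1_tsub)

lemma asub1_flat: "(\<And>t. t \<in> set_atom \<alpha> \<Longrightarrow> flat_tm t) \<Longrightarrow> asub1 \<sigma> \<alpha> = asub \<sigma> \<alpha>"
  using asub1_asub flat_shallow by blast

lemma pt_tsub1 [pt_intros]:
  assumes "pt (\<lambda>p. \<sigma> (fst p) (snd p))" "pt f" shows "pt (\<lambda>x. tsub1 (\<sigma> x) (f x))"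
  unfolding tsub1_def by (intro pt_intros pt_comp2[OF assms(1)] assms(2))

lemma pt_asub1 [pt_intros]:
  assumes "pt (\<lambda>p. \<sigma> (fst p) (snd p))" "pt f" shows "pt (\<lambda>x. asub1 (\<sigma> x) (f x))"
  unfolding asub1_def by (intro pt_intros pt_comp2[OF assms(1)] assms(2))

lemma pt_sub [pt_intros]: "pt f \<Longrightarrow> pt g \<Longrightarrow> pt (\<lambda>x. sub (f x) (g x))"
  unfolding sub_def by (intro pt_intros)

lemma pt_ren [pt_intros]: "pt f \<Longrightarrow> pt g \<Longrightarrow> pt (\<lambda>x. ren (f x) (g x))"
  unfolding ren_def by (intro pt_intros)

lemma pt_ind_sub [pt_intros]: "pt f \<Longrightarrow> pt g \<Longrightarrow> pt (\<lambda>x. ind_sub (f x) (g x))"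
  unfolding ind_sub_def by (intro pt_intros)

text \<open>Right for flat terms only; the empty list for \<open>Fn\<close> is a default.\<close>

definition tvars1 :: "tm \<Rightarrow> name list" where
  "tvars1 t = (case t of Var x \<Rightarrow> [x] | Ind a \<Rightarrow> [] | Fn f s \<Rightarrow> [])"

definition avars1 :: "tm atom \<Rightarrow> name list" where
  "avars1 \<alpha> = (case \<alpha> of CA A t \<Rightarrow> tvars1 t | RA r s t \<Rightarrow> tvars1 s @ tvars1 t | EqA s t \<Rightarrow> tvars1 s @ tvars1 t)"

definition lvars :: "tm atom list \<Rightarrow> name list" where
  "lvars xs = concat (map avars1 xs)"

lemma pt_lvars [pt_intros]: assumes "pt f" shows "pt (\<lambda>x. lvars (f x))"
  unfolding lvars_def avars1_def tvars1_def by (intro pt_intros assms)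

lemma set_tvars1: "flat_tm t \<Longrightarrow> set (tvars1 t) = tvars t"
  by (cases t) (simp_all add: tvars1_def)

lemma set_lvars: "bcq (fset_of_list xs) \<Longrightarrow> set (lvars xs) = vars (fset_of_list xs)"
proof -
  assume b: "bcq (fset_of_list xs)"
  have "set (avars1 \<alpha>) = avars \<alpha>" if "\<alpha> \<in> set xs" for \<alpha>
  proof -
    have "\<forall>t\<in>set_atom \<alpha>. flat_tm t" using b that by (auto simp: bcq_def fset_of_list.rep_eq)
    then show ?thesis by (cases \<alpha>) (simp_all add: avars1_def set_tvars1)
  qed
  then show ?thesis by (simp add: lvars_def vars_avars fset_of_list.rep_eq)
qed

definition ratom1 :: "role \<Rightarrow> tm \<Rightarrow> tm \<Rightarrow> tm atom" where
  "ratom1 R s t = (case R of Rn r \<Rightarrow> RA r s t | Inv r \<Rightarrow> RA r t s)"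

lemma ratom1_eq: "ratom1 = ratom"
  by (intro ext) (simp add: ratom1_def split: role.split)

text \<open>In \<open>Conj\<close> the two body atoms may coincide, hence \<open>remdups\<close>:
  listings of sets have no repetitions. The other two-atom bodies and heads consist of a role atom
  and a concept atom.\<close>

definition rule_of_l :: "axm \<Rightarrow> lformula" where
  "rule_of_l ax = (case ax of
     Sub A B \<Rightarrow> LRule [CA A (Var vx)] [] [CA B (Var vx)]
   | Conj A B C \<Rightarrow> LRule (remdups [CA A (Var vx), CA B (Var vx)]) [] [CA C (Var vx)]
   | ExL R A B \<Rightarrow> LRule [ratom1 R (Var vx) (Var vy), CA A (Var vy)] [] [CA B (Var vx)]
   | ExR A R B \<Rightarrow> LRule [CA A (Var vx)] [vy] [ratom1 R (Var vx) (Var vy), CA B (Var vy)]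
   | AllR A R B \<Rightarrow> LRule [CA A (Var vx), ratom1 R (Var vx) (Var vy)] [] [CA B (Var vy)]
   | Nom A a \<Rightarrow> LRule [CA A (Var vx)] [] [EqA (Var vx) (Ind a)]
   | RSub R S \<Rightarrow> LRule [ratom1 R (Var vx) (Var vy)] [] [ratom1 S (Var vx) (Var vy)])"

definition skolem_l :: "axm \<Rightarrow> lformula" where
  "skolem_l ax = (case ax of
     Sub A B \<Rightarrow> rule_of_l ax | Conj A B C \<Rightarrow> rule_of_l ax | ExL R A B \<Rightarrow> rule_of_l ax
   | ExR A R B \<Rightarrow> LRule [CA A (Var vx)] []
       [ratom1 R (Var vx) (Fn (Sk A R B) (Var vx)), CA B (Fn (Sk A R B) (Var vx))]
   | AllR A R B \<Rightarrow> rule_of_l ax | Nom A a \<Rightarrow> rule_of_l ax | RSub R S \<Rightarrow> rule_of_l ax)"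

lemma pt_ratom1 [pt_intros]: "pt f \<Longrightarrow> pt g \<Longrightarrow> pt h \<Longrightarrow> pt (\<lambda>x. ratom1 (f x) (g x) (h x))"
proof -
  have "pt (\<lambda>p. ratom1 (fst p) (fst (snd p)) (snd (snd p)))"
    unfolding ratom1_def by (intro pt_intros)
  then show "pt f \<Longrightarrow> pt g \<Longrightarrow> pt h \<Longrightarrow> ?thesis" by (rule pt_comp3)
qed

lemma pt_rule_of_l [pt_intros]: "pt f \<Longrightarrow> pt (\<lambda>x. rule_of_l (f x))"
  unfolding rule_of_l_def by (intro pt_intros)

lemma pt_skolem_l [pt_intros]: assumes "pt f" shows "pt (\<lambda>x. skolem_l (f x))"
proof -
  have "pt (\<lambda>ax. skolem_l ax)" unfolding skolem_l_def by (intro pt_intros)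
  from pt_comp[OF this assms] show ?thesis .
qed

lemma form_rule_of_l [simp]: "form (rule_of_l ax) = rule_of ax"
  by (cases ax) (simp_all add: rule_of_l_def ratom1_eq)

lemma form_skolem_l [simp]: "form (skolem_l ax) = skolem ax"
proof (cases "\<exists>A R B. ax = ExR A R B")
  case True
  then show ?thesis by (auto simp: skolem_l_def Let_def ratom1_eq)
next
  case False
  then have "skolem_l ax = rule_of_l ax" "skolem ax = rule_of ax"
    by (cases ax; simp add: skolem_l_def)+
  then show ?thesis by simp
qed

lemma ratom_neq [simp]: "ratom R s t \<noteq> CA A u" "CA A u \<noteq> ratom R s t"
  by (cases R; simp)+

lemma ldistinct_rule_of_l [simp]: "ldistinct (rule_of_l ax)"
  by (cases ax) (simp_all add: rule_of_l_def ratom1_eq)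

lemma ldistinct_skolem_l [simp]: "ldistinct (skolem_l ax)"
  by (cases ax) (simp_all add: skolem_l_def ratom1_eq)

lemma pt_form_eq [pt_intros]: assumes "pt f" "pt g" shows "pt (\<lambda>x. form (f x) = form (g x))"
proof -
  have "pt (\<lambda>x. case f x of
      LCQ xs \<Rightarrow> (case g x of LCQ ys \<Rightarrow> set xs = set ys | LRule a b c \<Rightarrow> False)
    | LRule a b c \<Rightarrow> (case g x of LCQ ys \<Rightarrow> False
        | LRule a' b' c' \<Rightarrow> set a = set a' \<and> set b = set b' \<and> set c = set c'))"
    by (intro pt_intros pt_comp[OF assms(2)] assms(1))
  then show ?thesis by (rule pt_cong_enc) (simp add: fset_of_list_eq_iff split: lformula.split)
qed

section \<open>From proofs on conjunctive queries to Skolemized proofs\<close>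

text \<open>Each of these pairs becomes one vertex of the Skolemized proof. The source vertex is
  part of the key because the same atom may have different ground instances in different
  CQs.\<close>

definition keys :: "(name \<times> lformula \<times> unit) list \<Rightarrow> (name \<times> tm atom) list" where
  "keys lv = concat (map (\<lambda>x. case fst (snd x) of LCQ xs \<Rightarrow> map (Pair (fst x)) xs | LRule a b c \<Rightarrow> []) lv)"

lemma set_keys: "(v, \<alpha>) \<in> set (keys lv) \<longleftrightarrow> (\<exists>xs u. (v, LCQ xs, u) \<in> set lv \<and> \<alpha> \<in> set xs)"
  by (force simp: keys_def split: lformula.splits)

lemma distinct_keys:
  assumes "distinct (map fst lv)" "\<And>v f u. (v, f, u) \<in> set lv \<Longrightarrow> ldistinct f"
  shows "distinct (keys lv)"
  using assms
proof (induction lv)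
  case (Cons x lv)
  obtain v f where x: "x = (v, f, ())" by (cases x) auto
  have "distinct (keys lv)" using Cons by auto
  moreover have "\<not> (v, \<alpha>) \<in> set (keys lv)" for \<alpha>
    using Cons.prems(1) unfolding set_keys x by force
  moreover have "ldistinct f" using Cons.prems(2) x by auto
  ultimately show ?case
    by (cases f) (auto simp: keys_def x distinct_map inj_on_def)
qed (simp add: keys_def)

text \<open>The two bits separate the kinds of vertices: ground atoms, rules, the final conjunction
  and the query. The last two exist only once and carry dummy data.\<close>

definition vname :: "bool \<times> bool \<Rightarrow> name \<Rightarrow> tm atom \<Rightarrow> name" where
  "vname k v \<alpha> = name_of (k, v, \<alpha>)"

lemma vname_eq_iff [simp]: "vname k v \<alpha> = vname k' v' \<alpha>' \<longleftrightarrow> k = k' \<and> v = v' \<and> \<alpha> = \<alpha>'"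
  by (simp add: vname_def)

abbreviation atom_vertex :: "name \<times> tm atom \<Rightarrow> name" where
  "atom_vertex x \<equiv> vname (False, False) (fst x) (snd x)"

abbreviation rule_vertex :: "name \<times> tm atom \<Rightarrow> name" where
  "rule_vertex x \<equiv> vname (False, True) (fst x) (snd x)"

definition conj_vertex :: name where
  "conj_vertex = vname (True, False) [] (EqA (Ind []) (Ind []))"

definition query_vertex :: name where
  "query_vertex = vname (True, True) [] (EqA (Ind []) (Ind []))"

text \<open>How a key is inferred: the keys of the premises, the justification, and the labels of
  further premises, namely the at most one rule of (MP), which gets a leaf of its own. A key without
  a step is an ABox fact.\<close>

type_synonym step = "(name \<times> tm atom) list \<times> sk_just \<times> lformula list"

definition sk_verts ::
  "(name \<times> tm atom) list \<Rightarrow> (name \<times> tm atom \<Rightarrow> tm atom) \<Rightarrow> (name \<times> tm atom \<Rightarrow> step list) \<Rightarrow>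
    tm atom list \<Rightarrow> (name \<times> lformula \<times> unit) list" where
  "sk_verts K g pf lq =
     map (\<lambda>x. (atom_vertex x, LCQ [g x], ())) K @
     concat (map (\<lambda>x. concat (map (\<lambda>st. map (\<lambda>r. (rule_vertex x, r, ())) (snd (snd st))) (pf x))) K) @
     [(conj_vertex, LCQ (remdups (map g K)), ()), (query_vertex, LCQ lq, ())]"

definition sk_edges ::
  "(name \<times> tm atom) list \<Rightarrow> (name \<times> tm atom \<Rightarrow> step list) \<Rightarrow>
    (name \<times> tm) list \<Rightarrow> (name list \<times> name \<times> sk_just \<times> unit) list" where
  "sk_edges K pf s =
     concat (map (\<lambda>x. map (\<lambda>st. (remdups (map atom_vertex (fst st) @ map (\<lambda>r. rule_vertex x) (snd (snd st))),
       atom_vertex x, fst (snd st), ())) (pf x)) K) @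
     [(map atom_vertex K, conj_vertex, ByC, ()), ([conj_vertex], query_vertex, ByG s, ())]"

lemma distinct_concat_singletons:
  assumes "distinct K" "\<And>x. x \<in> set K \<Longrightarrow> length (h x) \<le> 1" "\<And>x y. y \<in> set (h x) \<Longrightarrow> f y = k x" "inj k"
  shows "distinct (map f (concat (map h K)))"
  using assms(1,2)
proof (induction K)
  case (Cons x K)
  have "distinct (map f (h x))" using Cons.prems(2)[of x] by (cases "h x") auto
  moreover have "f ` set (h x) \<inter> f ` (\<Union>y\<in>set K. set (h y)) = {}"
    using assms(3,4) Cons.prems(1) by (fastforce dest: injD)
  ultimately show ?case using Cons by auto
qed simp

text \<open>Separates the shape of the result from the choice of the instances \<open>g\<close> and
  the steps \<open>pf\<close>. Every atom vertex is a premise of the final (C), which makes the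
  query vertex the only sink. A vertex used in a step is used again there, so the result is in
  general no tree.\<close>

lemma sk_assemble:
  fixes rank :: "name \<Rightarrow> nat"
  assumes K: "distinct K" "K \<noteq> []"
    and N: "\<And>x. x \<in> set K \<Longrightarrow> rank (fst x) < N"
    and one: "\<And>x. x \<in> set K \<Longrightarrow> length (pf x) \<le> 1"
    and step: "\<And>x pr j rs. x \<in> set K \<Longrightarrow> (pr, j, rs) \<in> set (pf x) \<Longrightarrow>
      set pr \<subseteq> set K \<and> (\<forall>y\<in>set pr. rank (fst y) < rank (fst x)) \<and> length rs \<le> 1 \<and>
      (\<forall>r\<in>set rs. ldistinct r \<and> form r \<in> U) \<and>
      sk_inf T q j ((\<lambda>y. CQ {|g y|}) ` set pr \<union> form ` set rs) (CQ {|g x|})"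
    and leaf: "\<And>x. x \<in> set K \<Longrightarrow> pf x = [] \<Longrightarrow> CQ {|g x|} \<in> U"
    and gr: "\<And>x. x \<in> set K \<Longrightarrow> ground {|g x|}"
    and lq: "distinct lq" "fset_of_list lq = q" "fset (csub (sub s) q) \<subseteq> g ` set K"
  defines "l \<equiv> (sk_verts K g pf lq, sk_edges K pf s)"
  shows "proof_in (sk_inf T q) U q (mkproof l) \<and> repr (mkproof l) l"
proof -
  let ?lv = "sk_verts K g pf lq" and ?le = "sk_edges K pf s"
  have fst_lv: "map fst ?lv = map atom_vertex K @
      map fst (concat (map (\<lambda>x. concat (map (\<lambda>st. map (\<lambda>r. (rule_vertex x, r, ())) (snd (snd st))) (pf x))) K)) @
      [conj_vertex, query_vertex]"
    by (simp add: sk_verts_def comp_def)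
  have one': "length (concat (map (\<lambda>st. map (\<lambda>r. (rule_vertex x, r, ())) (snd (snd st))) (pf x))) \<le> 1"
    if "x \<in> set K" for x
  proof (cases "pf x")
    case (Cons st sts)
    then have "sts = []" using one[OF that] by simp
    moreover obtain pr j rs where "st = (pr, j, rs)" by (cases st)
    moreover from this have "length rs \<le> 1" using step[OF that] Cons by auto
    ultimately show ?thesis using Cons by simp
  qed simp
  have dv: "distinct (map fst ?lv)"
  proof -
    have "distinct (map fst (concat (map (\<lambda>x. concat (map (\<lambda>st. map (\<lambda>r. (rule_vertex x, r, ())) (snd (snd st))) (pf x))) K)))"
      by (rule distinct_concat_singletons[where k = rule_vertex]) (use K one' in \<open>auto simp: inj_def\<close>)
    moreover have "distinct (map atom_vertex K)" using K by (simp add: distinct_map inj_on_def prod_eq_iff)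
    ultimately show ?thesis unfolding fst_lv
      by (auto simp: conj_vertex_def query_vertex_def)
  qed
  have de: "distinct (map (\<lambda>(S, d, j, u). d) ?le)"
  proof -
    have "distinct (map (\<lambda>(S, d, j, u). d) (concat (map (\<lambda>x. map (\<lambda>st. (remdups (map atom_vertex (fst st) @ map (\<lambda>r. rule_vertex x) (snd (snd st))),
       atom_vertex x, fst (snd st), ())) (pf x)) K)))"
      by (rule distinct_concat_singletons[where k = atom_vertex]) (use K one in \<open>auto simp: inj_def\<close>)
    then show ?thesis
      by (auto simp: sk_edges_def conj_vertex_def query_vertex_def)
  qed
  have edge: "(\<exists>x pr rs. x \<in> set K \<and> (pr, j, rs) \<in> set (pf x) \<and> d = atom_vertex x \<and>
        set S = atom_vertex ` set pr \<union> (\<lambda>r. rule_vertex x) ` set rs) \<or>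
      (set S = atom_vertex ` set K \<and> d = conj_vertex \<and> j = ByC) \<or>
      (set S = {conj_vertex} \<and> d = query_vertex \<and> j = ByG s)"
    and edge_distinct: "distinct S"
    if mem: "(S, d, j, u) \<in> set ?le" for S d j u
  proof -
    show "(\<exists>x pr rs. x \<in> set K \<and> (pr, j, rs) \<in> set (pf x) \<and> d = atom_vertex x \<and>
        set S = atom_vertex ` set pr \<union> (\<lambda>r. rule_vertex x) ` set rs) \<or>
      (set S = atom_vertex ` set K \<and> d = conj_vertex \<and> j = ByC) \<or>
      (set S = {conj_vertex} \<and> d = query_vertex \<and> j = ByG s)"
    proof -
      consider x st where "x \<in> set K" "st \<in> set (pf x)" "d = atom_vertex x" "j = fst (snd st)"
          "S = remdups (map atom_vertex (fst st) @ map (\<lambda>r. rule_vertex x) (snd (snd st)))"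
        | "S = map atom_vertex K" "d = conj_vertex" "j = ByC"
        | "S = [conj_vertex]" "d = query_vertex" "j = ByG s"
        using mem unfolding sk_edges_def by auto
      then show ?thesis
      proof cases
        case (1 x st)
        then show ?thesis
          by (intro disjI1 exI[of _ x] exI[of _ "fst st"] exI[of _ "snd (snd st)"]) auto
      qed simp_all
    qed
    show "distinct S"
      using that K(1) unfolding sk_edges_def by (auto simp: distinct_map inj_on_def prod_eq_iff)
  qed
  have vert: "(\<exists>x. x \<in> set K \<and> v = atom_vertex x \<and> f = LCQ [g x]) \<or>
      (\<exists>x pr j rs. x \<in> set K \<and> (pr, j, rs) \<in> set (pf x) \<and> f \<in> set rs \<and> v = rule_vertex x) \<or>
      (v = conj_vertex \<and> f = LCQ (remdups (map g K))) \<or> (v = query_vertex \<and> f = LCQ lq)"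
    if mem: "(v, f, u) \<in> set ?lv" for v f u
  proof -
    consider x where "x \<in> set K" "v = atom_vertex x" "f = LCQ [g x]"
      | x st where "x \<in> set K" "st \<in> set (pf x)" "f \<in> set (snd (snd st))" "v = rule_vertex x"
      | "v = conj_vertex" "f = LCQ (remdups (map g K))"
      | "v = query_vertex" "f = LCQ lq"
      using mem unfolding sk_verts_def by auto
    then show ?thesis
    proof cases
      case (2 x st)
      then show ?thesis
        by (intro disjI2 disjI1 exI[of _ x] exI[of _ "fst st"] exI[of _ "fst (snd st)"]
            exI[of _ "snd (snd st)"]) auto
    qed blast+
  qed
  have v1: "(atom_vertex x, LCQ [g x], ()) \<in> set ?lv" if "x \<in> set K" for x
    using that by (auto simp: sk_verts_def)
  have v2: "(rule_vertex x, r, ()) \<in> set ?lv" if "x \<in> set K" "(pr, j, rs) \<in> set (pf x)" "r \<in> set rs" for x pr j rs r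
    using that unfolding sk_verts_def by force
  have v3: "(conj_vertex, LCQ (remdups (map g K)), ()) \<in> set ?lv" "(query_vertex, LCQ lq, ()) \<in> set ?lv"
    by (auto simp: sk_verts_def)
  have w1: "atom_vertex x \<in> fst ` set ?lv" if "x \<in> set K" for x
    using v1[OF that] by (rule image_eqI[rotated]) simp
  have w2: "rule_vertex x \<in> fst ` set ?lv"
    if "x \<in> set K" "(pr, j, rs) \<in> set (pf x)" "r \<in> set rs" for x pr j rs r
    using v2[OF that] by (rule image_eqI[rotated]) simp
  have w3: "conj_vertex \<in> fst ` set ?lv" "query_vertex \<in> fst ` set ?lv"
    using v3 by (auto intro: image_eqI[rotated])
  have e3: "(map atom_vertex K, conj_vertex, ByC, ()) \<in> set ?le" "([conj_vertex], query_vertex, ByG s, ()) \<in> set ?le"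
    by (auto simp: sk_edges_def)
  have dv': "distinct (map fst (fst l))" using dv by (simp add: l_def)
  have L1: "lab (mkproof l) (atom_vertex x) = CQ {|g x|}" if "x \<in> set K" for x
    using lab_mkproof[OF dv'] v1[OF that] by (fastforce simp: l_def)
  have L2: "lab (mkproof l) (rule_vertex x) = form r" if "x \<in> set K" "(pr, j, rs) \<in> set (pf x)" "r \<in> set rs" for x pr j rs r
    using lab_mkproof[OF dv'] v2[OF that] by (fastforce simp: l_def)
  have L3: "lab (mkproof l) conj_vertex = CQ (fset_of_list (map g K))" "lab (mkproof l) query_vertex = CQ q"
    using lab_mkproof[OF dv'] v3 lq(2) by (fastforce simp: l_def fset_of_list_remdups)+
  \<comment> \<open>Rule leaves get 0, and atoms get the successor of the rank of their source
    vertex, so they lie above their rule leaf. All of these stay below \<open>N + 1\<close>, the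
    value of the conjunction. The function \<open>f\<close> below reads the data back from a
    name.\<close>
  define r where "r = (\<lambda>((k1, k2), v, \<alpha> :: tm atom). if \<not> k1 then if k2 then 0 else Suc (rank v)
      else if k2 then N + 2 else N + 1)"
  define f where "f y = r (the_inv name_of y)" for y
  have f: "f (vname k v \<alpha>) = r (k, v, \<alpha>)" for k v \<alpha>
    by (simp add: f_def vname_def the_inv_f_f inj_def)
  have r: "r ((False, False), v, \<alpha>) = Suc (rank v)" "r ((False, True), v, \<alpha>) = 0"
    "r ((True, False), v, \<alpha>) = N + 1" "r ((True, True), v, \<alpha>) = N + 2" for v \<alpha>
    by (simp_all add: r_def)
  have fr: "f (vname (False, False) v \<alpha>) = Suc (rank v)" "f (vname (False, True) v \<alpha>) = 0"
    "f conj_vertex = N + 1" "f query_vertex = N + 2" for v \<alpha>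
    by (simp_all only: f r conj_vertex_def query_vertex_def)
  have gK: "ground (fset_of_list (map g K))" using gr by (auto simp: ground_def vars_avars fset_of_list.rep_eq)
  have "proof_in (sk_inf T q) U q (mkproof l)"
  proof (rule proof_in_mkproof[where f = f and ?v0.0 = query_vertex and ?fm0.0 = "LCQ lq" and ?u0.0 = "()"])
    show "distinct (map fst (fst l))" by (rule dv')
    show "distinct (map (\<lambda>(S, d, j, u). d) (snd l))" using de by (simp add: l_def)
    show "set S \<subseteq> fst ` set (fst l) \<and> d \<in> fst ` set (fst l)" if "(S, d, j, u) \<in> set (snd l)" for S d j u
    proof -
      have "(S, d, j, u) \<in> set ?le" using that by (simp add: l_def)
      from edge[OF this] show ?thesis
      proof (elim disjE exE conjE)
        fix x pr rs assume a: "x \<in> set K" "(pr, j, rs) \<in> set (pf x)" "d = atom_vertex x"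
          "set S = atom_vertex ` set pr \<union> (\<lambda>r. rule_vertex x) ` set rs"
        have "set pr \<subseteq> set K" using step a by blast
        then show ?thesis unfolding a(3,4) l_def fst_conv
          using w1 w2[OF a(1,2)] a(1) by (intro conjI Un_least image_subsetI) blast+
      qed (use w1 w3 in \<open>auto simp: l_def simp del: vname_eq_iff\<close>)
    qed
    show "f s' < f d" if "(S, d, j, u) \<in> set (snd l)" "s' \<in> set S" for S d j u s'
    proof -
      have "(S, d, j, u) \<in> set ?le" using that by (simp add: l_def)
      from edge[OF this] show ?thesis
      proof (elim disjE exE conjE)
        fix x pr rs assume a: "x \<in> set K" "(pr, j, rs) \<in> set (pf x)" "d = atom_vertex x"
          "set S = atom_vertex ` set pr \<union> (\<lambda>r. rule_vertex x) ` set rs"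
        then show ?thesis using step[OF a(1,2)] that(2) by (auto simp: fr)
      qed (use that(2) N in \<open>auto simp: fr\<close>)
    qed
    show "form fm \<in> U" if a: "(v, fm, u) \<in> set (fst l)" "\<And>S j w. (S, v, j, w) \<notin> set (snd l)" for v fm u
    proof -
      have "(v, fm, u) \<in> set ?lv" using a by (simp add: l_def)
      from vert[OF this] show ?thesis
      proof (elim disjE exE conjE)
        fix x assume x: "x \<in> set K" "v = atom_vertex x" "fm = LCQ [g x]"
        have "pf x = []"
        proof (rule ccontr)
          assume "pf x \<noteq> []"
          then obtain st where "st \<in> set (pf x)" by (cases "pf x") auto
          then have "(remdups (map atom_vertex (fst st) @ map (\<lambda>r. rule_vertex x) (snd (snd st))),
             atom_vertex x, fst (snd st), ()) \<in> set ?le" using x by (auto simp: sk_edges_def)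
          then show False using a(2) x by (auto simp: l_def)
        qed
        then show ?thesis using leaf x by simp
      next
        fix x pr j rs assume x: "x \<in> set K" "(pr, j, rs) \<in> set (pf x)" "fm \<in> set rs"
        then show ?thesis using step by blast
      qed (use a(2) e3 in \<open>auto simp: l_def\<close>)
    qed
    show "sk_inf T q j (lab (mkproof l) ` set S) (lab (mkproof l) d)" if "(S, d, j, u) \<in> set (snd l)" for S d j u
    proof -
      have "(S, d, j, u) \<in> set ?le" using that by (simp add: l_def)
      from edge[OF this] show ?thesis
      proof (elim disjE exE conjE)
        fix x pr rs assume a: "x \<in> set K" "(pr, j, rs) \<in> set (pf x)" "d = atom_vertex x"
          "set S = atom_vertex ` set pr \<union> (\<lambda>r. rule_vertex x) ` set rs"
        have "set pr \<subseteq> set K" using step a by blast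
        then have "lab (mkproof l) ` (atom_vertex ` set pr) = (\<lambda>y. CQ {|g y|}) ` set pr"
          unfolding image_image using L1 by (intro image_cong) auto
        moreover have "lab (mkproof l) ` ((\<lambda>r. rule_vertex x) ` set rs) = form ` set rs"
          unfolding image_image using L2[OF a(1,2)] by (intro image_cong) auto
        ultimately show ?thesis using step[OF a(1,2)] L1[OF a(1)] unfolding a(3,4) image_Un by simp
      next
        assume a: "set S = atom_vertex ` set K" "d = conj_vertex" "j = ByC"
        have "lab (mkproof l) ` set S = {CQ {|\<alpha>|} |\<alpha>. \<alpha> |\<in>| fset_of_list (map g K)}"
          unfolding a image_image using L1 by (auto simp: fset_of_list.rep_eq)
        moreover have "fset_of_list (map g K) \<noteq> {||}" using K(2) by (cases K) auto
        ultimately show ?thesis using sk_inf.C[OF gK] a L3 by simp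
      next
        assume a: "set S = {conj_vertex}" "d = query_vertex" "j = ByG s"
        have s: "csub (sub s) q |\<subseteq>| fset_of_list (map g K)"
          using lq(3) by (auto simp: fset_of_list.rep_eq)
        then have "ground (csub (sub s) q)" using gK vars_mono[OF s] by (auto simp: ground_def)
        then show ?thesis using sk_inf.G[OF gK _ s] a L3 by simp
      qed
    qed
    show "entails \<Gamma> \<eta>" if "sk_inf T q j \<Gamma> \<eta>" for j \<Gamma> \<eta> using that by (rule sk_inf_sound)
    show "(query_vertex, LCQ lq, ()) \<in> set (fst l)" using v3 by (simp add: l_def)
    show "form (LCQ lq) = CQ q" using lq by simp
    show "query_vertex \<notin> set S" if "(S, d, j, u) \<in> set (snd l)" for S d j u
    proof -
      have "(S, d, j, u) \<in> set ?le" using that by (simp add: l_def)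
      have "query_vertex \<noteq> atom_vertex y" "query_vertex \<noteq> rule_vertex y" "query_vertex \<noteq> conj_vertex" for y
        by (simp_all add: query_vertex_def conj_vertex_def)
      with edge[OF \<open>(S, d, j, u) \<in> set ?le\<close>] show ?thesis
        by (elim disjE exE conjE) (simp_all add: image_iff)
    qed
    show "\<exists>S d j w. (S, d, j, w) \<in> set (snd l) \<and> v \<in> set S"
      if a: "(v, fm, u) \<in> set (fst l)" "v \<noteq> query_vertex" for v fm u
    proof -
      have "(v, fm, u) \<in> set ?lv" using a by (simp add: l_def)
      from vert[OF this] show ?thesis
      proof (elim disjE exE conjE)
        fix x assume x: "x \<in> set K" "v = atom_vertex x"
        then have "v \<in> set (map atom_vertex K)" by simp
        then show ?thesis using e3(1) unfolding l_def snd_conv by blast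
      next
        fix x pr j rs assume x: "x \<in> set K" "(pr, j, rs) \<in> set (pf x)" "fm \<in> set rs" "v = rule_vertex x"
        let ?S = "remdups (map atom_vertex pr @ map (\<lambda>r. rule_vertex x) rs)"
        have "(?S, atom_vertex x, j, ()) \<in> set ?le"
          using x(1) imageI[OF x(2), of "\<lambda>st. (remdups (map atom_vertex (fst st) @ map (\<lambda>r. rule_vertex x) (snd (snd st))),
            atom_vertex x, fst (snd st), ())"]
          by (auto simp: sk_edges_def)
        moreover have "v \<in> set ?S" using x by auto
        ultimately show ?thesis unfolding l_def snd_conv by blast
      next
        assume "v = conj_vertex"
        then have "v \<in> set [conj_vertex]" by simp
        then show ?thesis using e3(2) unfolding l_def snd_conv by blast
      qed (use a in simp)
    qed
  qed
  moreover have "repr (mkproof l) l"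
  proof (rule repr_mkproof[OF dv'])
    show "distinct (map (\<lambda>(S, d, j, u). d) (snd l))" using de by (simp add: l_def)
    show "ldistinct fm" if "(v, fm, u) \<in> set (fst l)" for v fm u
    proof -
      have "(v, fm, u) \<in> set ?lv" using that by (simp add: l_def)
      from vert[OF this] show ?thesis using step lq(1) by auto
    qed
    show "distinct S" if "(S, d, j, u) \<in> set (snd l)" for S d j u
      using that edge_distinct by (simp add: l_def)
  qed
  ultimately show ?thesis ..
qed

subsection \<open>Origins of variables and atoms\<close>

type_synonym vlist = "(name \<times> lformula \<times> unit) list"

definition cqs_of :: "vlist \<Rightarrow> name list \<Rightarrow> (name \<times> tm atom list) list" where
  "cqs_of lv S = concat (map (\<lambda>v. case map_of lv v of None \<Rightarrow> []
     | Some x \<Rightarrow> (case fst x of LCQ xs \<Rightarrow> [(v, xs)] | LRule a b c \<Rightarrow> [])) S)"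

definition rules_of :: "vlist \<Rightarrow> name list \<Rightarrow> (tm atom list \<times> name list \<times> tm atom list) list" where
  "rules_of lv S = concat (map (\<lambda>v. case map_of lv v of None \<Rightarrow> []
     | Some x \<Rightarrow> (case fst x of LCQ xs \<Rightarrow> [] | LRule a b c \<Rightarrow> [(a, b, c)])) S)"

definition latoms :: "vlist \<Rightarrow> name \<Rightarrow> tm atom list" where
  "latoms lv v = (case map_of lv v of None \<Rightarrow> []
     | Some x \<Rightarrow> (case fst x of LCQ xs \<Rightarrow> xs | LRule a b c \<Rightarrow> []))"

text \<open>The premises of a hyperedge are an unordered set of vertices, some of which may share a
  label. Except in (C_e), all CQ premises carry the same label, so the first one found is as good as
  any other.\<close>

definition src :: "vlist \<Rightarrow> name list \<Rightarrow> name \<times> tm atom list" where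
  "src lv S = (case cqs_of lv S of [] \<Rightarrow> ([], []) | x # xs \<Rightarrow> x)"

definition rsrc :: "vlist \<Rightarrow> name list \<Rightarrow> tm atom list \<times> name list \<times> tm atom list" where
  "rsrc lv S = (case rules_of lv S of [] \<Rightarrow> ([], [], []) | x # xs \<Rightarrow> x)"

text \<open>(C_e) has two CQ premises, and the justification does not say which of them is renamed.
  Any ordered pair that reproduces the conclusion and meets the freshness conditions is accepted. It
  may use one vertex twice, since two premises with the same label can be a single vertex.\<close>

definition ce_ok :: "(name \<times> name) list \<Rightarrow> tm atom list \<Rightarrow> tm atom list \<Rightarrow> tm atom list \<Rightarrow> bool" where
  "ce_ok m xs ys \<rho> \<longleftrightarrow> set \<rho> = set (xs @ map (asub1 (\<lambda>z. Var (ren m z))) ys) \<and>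
     (\<forall>y\<in>set (lvars ys). ren m y \<notin> set (lvars xs)) \<and>
     (\<forall>y\<in>set (lvars ys). \<forall>z\<in>set (lvars ys). ren m y = ren m z \<longrightarrow> y = z)"

definition ce_src ::
  "vlist \<Rightarrow> name list \<Rightarrow> (name \<times> name) list \<Rightarrow> tm atom list \<Rightarrow> (name \<times> tm atom list) \<times> (name \<times> tm atom list)" where
  "ce_src lv S m \<rho> = (case filter (\<lambda>x. ce_ok m (snd (fst x)) (snd (snd x)) \<rho>)
      (concat (map (\<lambda>a. map (Pair a) (cqs_of lv S)) (cqs_of lv S))) of
     [] \<Rightarrow> (([], []), ([], [])) | x # xs \<Rightarrow> x)"

text \<open>Different axioms can have the same rule, for instance \<open>Conj A A B\<close> and
  \<open>Sub A B\<close>; any axiom with this rule will do.\<close>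

definition rule_axm :: "axm list \<Rightarrow> tm atom list \<times> name list \<times> tm atom list \<Rightarrow> axm option" where
  "rule_axm ts r = find (\<lambda>ax. form (rule_of_l ax) = form (LRule (fst r) (fst (snd r)) (snd (snd r)))) ts"

text \<open>The value \<open>(fs, v, t)\<close> for a variable of a CQ says that its ground term is obtained from that
  of \<open>t\<close> at the premise \<open>v\<close> by applying the Skolem functions \<open>fs\<close>.\<close>

definition orig ::
  "vlist \<Rightarrow> axm list \<Rightarrow> name list \<Rightarrow> cq_just \<Rightarrow> tm atom list \<Rightarrow> name \<Rightarrow> fsym list \<times> name \<times> tm" where
  "orig lv ts S j \<rho> z = (case j of
     ByMPe s m \<Rightarrow>
       (if z \<in> set (lvars (snd (src lv S))) then ([], fst (src lv S), Var z)
        else case find (\<lambda>x. ren m x = z) (fst (snd (rsrc lv S))) of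
          None \<Rightarrow> ([], fst (src lv S), Ind [])
        | Some x \<Rightarrow> if set (fst (rsrc lv S)) = set (snd (snd (rsrc lv S))) then ([], fst (src lv S), sub s x)
            else case rule_axm ts (rsrc lv S) of
              None \<Rightarrow> ([], fst (src lv S), Ind [])
            | Some ax \<Rightarrow> (case ax of ExR A R B \<Rightarrow> ([Sk A R B], fst (src lv S), sub s vx)
                | _ \<Rightarrow> ([], fst (src lv S), Ind [])))
   | ByTe \<Rightarrow> ([], [], Ind [])
   | ByEe t1 t2 \<Rightarrow> ([], fst (src lv S), Var z)
   | ByCe m \<Rightarrow>
       (if z \<in> set (lvars (snd (fst (ce_src lv S m \<rho>)))) then ([], fst (fst (ce_src lv S m \<rho>)), Var z)
        else case find (\<lambda>y. ren m y = z) (lvars (snd (snd (ce_src lv S m \<rho>)))) of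
          None \<Rightarrow> ([], [], Ind [])
        | Some y \<Rightarrow> ([], fst (snd (ce_src lv S m \<rho>)), Var y))
   | ByGe s \<Rightarrow> ([], fst (src lv S), ind_sub s z))"

type_synonym table = "((name \<times> name) \<times> fsym list \<times> name \<times> tm) list"

definition orig_table :: "vlist \<Rightarrow> (name list \<times> name \<times> cq_just \<times> unit) list \<Rightarrow> axm list \<Rightarrow> table" where
  "orig_table lv le ts = concat (map (\<lambda>e. map (\<lambda>z. ((fst (snd e), z),
       orig lv ts (fst e) (fst (snd (snd e))) (latoms lv (fst (snd e))) z))
     (lvars (latoms lv (fst (snd e))))) le)"

definition nxt :: "table \<Rightarrow> name \<times> tm \<Rightarrow> fsym list \<times> name \<times> tm" where
  "nxt tb p = (case snd p of
     Var z \<Rightarrow> (case map_of tb (fst p, z) of None \<Rightarrow> ([], fst p, Ind []) | Some y \<Rightarrow> y)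
   | Ind a \<Rightarrow> ([], p) | Fn f t \<Rightarrow> ([], p))"

text \<open>The default \<open>Ind []\<close> keeps the chase ground on every input, even when the
  fuel runs out.\<close>

definition base_tm :: "tm \<Rightarrow> tm" where
  "base_tm t = (case t of Var z \<Rightarrow> Ind [] | Ind a \<Rightarrow> Ind a | Fn f s \<Rightarrow> Ind [])"

text \<open>The counter is fuel, since on an arbitrary table the chase could run in circles. In
  \<open>tau\<close> it is the number of vertices, which exceeds the rank of every vertex.\<close>

primrec chase :: "table \<Rightarrow> nat \<Rightarrow> name \<times> tm \<Rightarrow> tm" where
  "chase tb 0 p = base_tm (snd p)"
| "chase tb (Suc n) p = foldr Fn (fst (nxt tb p)) (chase tb n (snd (nxt tb p)))"

definition tau :: "table \<Rightarrow> vlist \<Rightarrow> name \<Rightarrow> tm \<Rightarrow> tm" where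
  "tau tb lv v t = chase tb (length lv) (v, t)"

text \<open>Copies of atoms are inferences by (C) with a single premise.\<close>

definition prem ::
  "table \<Rightarrow> vlist \<Rightarrow> axm list \<Rightarrow> name list \<Rightarrow> cq_just \<Rightarrow> tm atom list \<Rightarrow> tm atom \<Rightarrow> step" where
  "prem tb lv ts S j \<rho> \<alpha> = (case j of
     ByMPe s m \<Rightarrow>
       (if \<alpha> \<in> set (snd (src lv S)) then ([(fst (src lv S), \<alpha>)], ByC, [])
        else if set (fst (rsrc lv S)) = set (snd (snd (rsrc lv S))) then
          (case find (\<lambda>\<beta>. asub1 (\<lambda>z. if z \<in> set (fst (snd (rsrc lv S))) then Var (ren m z) else sub s z) \<beta> = \<alpha>)
              (fst (rsrc lv S)) of
             None \<Rightarrow> ([], ByC, []) | Some \<beta> \<Rightarrow> ([(fst (src lv S), asub1 (sub s) \<beta>)], ByC, []))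
        else (map (\<lambda>\<beta>. (fst (src lv S), asub1 (sub s) \<beta>)) (fst (rsrc lv S)),
          ByMP [(vx, tau tb lv (fst (src lv S)) (sub s vx)), (vy, tau tb lv (fst (src lv S)) (sub s vy))],
          case rule_axm ts (rsrc lv S) of None \<Rightarrow> [] | Some ax \<Rightarrow> [skolem_l ax]))
   | ByTe \<Rightarrow> ([], ByC, [])
   | ByEe t1 t2 \<Rightarrow> (case find (\<lambda>\<beta>. repl t1 t2 \<beta> \<alpha>) (snd (src lv S)) of
        None \<Rightarrow> ([], ByC, [])
      | Some \<beta> \<Rightarrow> ([(fst (src lv S), \<beta>), (fst (src lv S), EqA t1 t2)],
          ByE (tau tb lv (fst (src lv S)) t1) (tau tb lv (fst (src lv S)) t2), []))
   | ByCe m \<Rightarrow>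
       (if \<alpha> \<in> set (snd (fst (ce_src lv S m \<rho>))) then ([(fst (fst (ce_src lv S m \<rho>)), \<alpha>)], ByC, [])
        else case find (\<lambda>\<beta>. asub1 (\<lambda>z. Var (ren m z)) \<beta> = \<alpha>) (snd (snd (ce_src lv S m \<rho>))) of
          None \<Rightarrow> ([], ByC, []) | Some \<beta> \<Rightarrow> ([(fst (snd (ce_src lv S m \<rho>)), \<beta>)], ByC, []))
   | ByGe s \<Rightarrow> ([(fst (src lv S), asub1 (ind_sub s) \<alpha>)], ByC, []))"

definition prems :: "table \<Rightarrow> vlist \<Rightarrow> (name list \<times> name \<times> cq_just \<times> unit) list \<Rightarrow> axm list \<Rightarrow>
    name \<times> tm atom \<Rightarrow> step list" where
  "prems tb lv le ts x = map (\<lambda>e. prem tb lv ts (fst e) (fst (snd (snd e))) (latoms lv (fst x)) (snd x))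
     (filter (\<lambda>e. fst (snd e) = fst x) le)"

definition gat :: "table \<Rightarrow> vlist \<Rightarrow> name \<times> tm atom \<Rightarrow> tm atom" where
  "gat tb lv x = map_atom (tau tb lv (fst x)) (snd x)"

text \<open>The program receives neither the query nor the ABox. The query is recovered as the label
  of the vertex that is a premise of no inference.\<close>

definition sink_vertex :: "vlist \<Rightarrow> (name list \<times> name \<times> 'j \<times> unit) list \<Rightarrow> name" where
  "sink_vertex lv le = (case find (\<lambda>x. \<forall>e\<in>set le. fst x \<notin> set (fst e)) lv of None \<Rightarrow> [] | Some x \<Rightarrow> fst x)"

definition to_sk :: "cq_just lproof \<times> axm list \<Rightarrow> sk_just lproof" where
  "to_sk x = (let lv = fst (fst x); le = snd (fst x); ts = snd x; tb = orig_table lv le ts;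
      v = sink_vertex lv le
    in (sk_verts (keys lv) (gat tb lv) (prems tb lv le ts) (latoms lv v),
        sk_edges (keys lv) (prems tb lv le ts) (map (\<lambda>z. (z, tau tb lv v (Var z))) (lvars (latoms lv v)))))"

subsubsection \<open>Polynomial time\<close>

lemma pt_repl [pt_intros]:
  assumes "pt t1" "pt t2" "pt f" "pt g" shows "pt (\<lambda>x. repl (t1 x) (t2 x) (f x) (g x))"
proof -
  let ?r = "\<lambda>p :: tm \<times> tm \<times> tm atom \<times> tm atom. \<lambda>s s'. s' = s \<or> s = fst p \<and> s' = fst (snd p)"
  have "pt (\<lambda>p :: tm \<times> tm \<times> tm atom \<times> tm atom. case fst (snd (snd p)) of
      CA A a \<Rightarrow> (case snd (snd (snd p)) of CA B b \<Rightarrow> A = B \<and> ?r p a b | RA B b b' \<Rightarrow> False | EqA b b' \<Rightarrow> False)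
    | RA A a a' \<Rightarrow> (case snd (snd (snd p)) of CA B b \<Rightarrow> False | RA B b b' \<Rightarrow> A = B \<and> ?r p a b \<and> ?r p a' b' | EqA b b' \<Rightarrow> False)
    | EqA a a' \<Rightarrow> (case snd (snd (snd p)) of CA B b \<Rightarrow> False | RA B b b' \<Rightarrow> False | EqA b b' \<Rightarrow> ?r p a b \<and> ?r p a' b'))"
    by (intro pt_intros)
  then have "pt (\<lambda>p. repl (fst p) (fst (snd p)) (fst (snd (snd p))) (snd (snd (snd p))))"
    by (rule pt_cong_enc) (auto simp: repl_def split: atom.split)
  then show ?thesis using assms by (rule pt_comp4)
qed

lemma pt_cqs_of [pt_intros]: "pt f \<Longrightarrow> pt g \<Longrightarrow> pt (\<lambda>x. cqs_of (f x) (g x))"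
  by (rule pt_comp2[of cqs_of]) (unfold cqs_of_def, intro pt_intros)

lemma pt_rules_of [pt_intros]: "pt f \<Longrightarrow> pt g \<Longrightarrow> pt (\<lambda>x. rules_of (f x) (g x))"
  by (rule pt_comp2[of rules_of]) (unfold rules_of_def, intro pt_intros)

lemma pt_latoms [pt_intros]: "pt f \<Longrightarrow> pt g \<Longrightarrow> pt (\<lambda>x. latoms (f x) (g x))"
  by (rule pt_comp2[of latoms]) (unfold latoms_def, intro pt_intros)

lemma pt_src [pt_intros]: "pt f \<Longrightarrow> pt g \<Longrightarrow> pt (\<lambda>x. src (f x) (g x))"
  by (rule pt_comp2[of src]) (unfold src_def, intro pt_intros)

lemma pt_rsrc [pt_intros]: "pt f \<Longrightarrow> pt g \<Longrightarrow> pt (\<lambda>x. rsrc (f x) (g x))"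
  by (rule pt_comp2[of rsrc]) (unfold rsrc_def, intro pt_intros)

lemma pt_imp [pt_intros]: "pt f \<Longrightarrow> pt g \<Longrightarrow> pt (\<lambda>x. f x \<longrightarrow> g x)"
  unfolding imp_conv_disj by (intro pt_intros)

lemma pt_ce_src [pt_intros]:
  "pt f \<Longrightarrow> pt g \<Longrightarrow> pt h \<Longrightarrow> pt k \<Longrightarrow> pt (\<lambda>x. ce_src (f x) (g x) (h x) (k x))"
  by (rule pt_comp4[of ce_src]) (unfold ce_src_def ce_ok_def, intro pt_intros)

lemma pt_rule_axm [pt_intros]: "pt f \<Longrightarrow> pt g \<Longrightarrow> pt (\<lambda>x. rule_axm (f x) (g x))"
  by (rule pt_comp2[of rule_axm]) (unfold rule_axm_def, intro pt_intros)

lemma pt_comp6: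
  "pt (\<lambda>p. h (fst p) (fst (snd p)) (fst (snd (snd p))) (fst (snd (snd (snd p))))
     (fst (snd (snd (snd (snd p))))) (snd (snd (snd (snd (snd p)))))) \<Longrightarrow>
    pt f \<Longrightarrow> pt g \<Longrightarrow> pt k \<Longrightarrow> pt l \<Longrightarrow> pt m \<Longrightarrow> pt n \<Longrightarrow>
    pt (\<lambda>x. h (f x) (g x) (k x) (l x) (m x) (n x))"
  using pt_comp[OF _ pt_Pair[OF _ pt_Pair[OF _ pt_Pair[OF _ pt_Pair[OF _ pt_Pair]]]],
      of "\<lambda>p. h (fst p) (fst (snd p)) (fst (snd (snd p))) (fst (snd (snd (snd p))))
     (fst (snd (snd (snd (snd p))))) (snd (snd (snd (snd (snd p)))))" f g k l m n]
  by simp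

lemma pt_orig [pt_intros]:
  "pt f \<Longrightarrow> pt g \<Longrightarrow> pt h \<Longrightarrow> pt k \<Longrightarrow> pt l \<Longrightarrow> pt m \<Longrightarrow>
    pt (\<lambda>x. orig (f x) (g x) (h x) (k x) (l x) (m x))"
  by (rule pt_comp6[of orig]) (unfold orig_def, intro pt_intros)

lemma pt_orig_table [pt_intros]:
  "pt f \<Longrightarrow> pt g \<Longrightarrow> pt h \<Longrightarrow> pt (\<lambda>x. orig_table (f x) (g x) (h x))"
  by (rule pt_comp3[of orig_table]) (unfold orig_table_def, intro pt_intros)

lemma pt_foldr_Fn [pt_intros]: assumes "pt f" "pt g" shows "pt (\<lambda>x. foldr Fn (f x) (g x))"
proof -
  have "pt (\<lambda>x. rec_list (g x) (\<lambda>y ys a. Fn y a) (f x))"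
    by (intro pt_rec_list[where D = "\<lambda>p. 10 + csz p"] pt_intros pbound_intros assms)
      (simp add: enc_simps num_tree_def numeral_eq_Suc)
  moreover have "rec_list a (\<lambda>y ys a. Fn y a) l = foldr Fn l a" for a l by (induction l) simp_all
  ultimately show ?thesis by simp
qed

text \<open>The chase as an iteration: the function symbols are collected in a list and applied only
  at the end. A round then only moves on and appends, so the iteration fits list recursion, with
  \<open>lv\<close> as the clock.\<close>

definition chase_step :: "table \<Rightarrow> (name \<times> tm) \<times> fsym list \<Rightarrow> (name \<times> tm) \<times> fsym list" where
  "chase_step tb a = (snd (nxt tb (fst a)), snd a @ fst (nxt tb (fst a)))"

lemma chase_step_iter:
  "foldr Fn (snd ((chase_step tb ^^ n) (p, fs))) (base_tm (snd (fst ((chase_step tb ^^ n) (p, fs))))) =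
    foldr Fn fs (chase tb n p)"
proof (induction n arbitrary: p fs)
  case (Suc n)
  have "(chase_step tb ^^ Suc n) (p, fs) = (chase_step tb ^^ n) (snd (nxt tb p), fs @ fst (nxt tb p))"
    by (simp only: funpow_Suc_right comp_def) (simp add: chase_step_def)
  then show ?case using Suc.IH[of "snd (nxt tb p)" "fs @ fst (nxt tb p)"] by simp
qed simp

lemma csz_map_of: "map_of tb k = Some y \<Longrightarrow> csz y \<le> csz tb"
  by (induction tb) (auto split: if_splits simp: enc_prod_def)

text \<open>A round replaces the current position by an entry of the table and appends the function
  symbols of that entry, so the increment is independent of the state, as list recursion requires.
  The constant 20 is room for the default \<open>Ind []\<close> and for pairing.\<close>

lemma csz_chase_step: "csz (chase_step tb a) \<le> csz a + (csz tb + 20)"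
proof -
  obtain v t fs where a: "a = ((v, t), fs)" by (metis surj_pair)
  have "csz (snd (nxt tb (v, t))) + csz (fst (nxt tb (v, t))) \<le> csz (v, t) + csz tb + 15"
  proof (cases t)
    case (Var z)
    show ?thesis
    proof (cases "map_of tb (v, z)")
      case (Some y)
      then show ?thesis using csz_map_of[OF Some] Var by (auto simp: nxt_def enc_prod_def)
    qed (simp add: nxt_def Var enc_simps num_tree_def)
  qed (simp_all add: nxt_def)
  moreover have "csz (fs @ fst (nxt tb (v, t))) \<le> csz fs + csz (fst (nxt tb (v, t)))" by (rule csz_append)
  ultimately show ?thesis by (simp add: a chase_step_def)
qed

lemma pt_tau [pt_intros]: "pt f \<Longrightarrow> pt g \<Longrightarrow> pt h \<Longrightarrow> pt k \<Longrightarrow> pt (\<lambda>x. tau (f x) (g x) (h x) (k x))"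
proof (rule pt_comp4[of tau])
  let ?c = "\<lambda>p. rec_list (snd (snd p), []) (\<lambda>y ys a. chase_step (fst p) a) (fst (snd p))"
  have "pt (\<lambda>p. ?c (p :: table \<times> vlist \<times> name \<times> tm))"
    by (intro pt_rec_list[where D = "\<lambda>p. csz (fst (fst p)) + 20"])
      (unfold chase_step_def nxt_def, (intro pt_intros pbound_intros pt_size | (insert csz_chase_step, simp add: chase_step_def nxt_def))+)
  then have *: "pt (\<lambda>p :: table \<times> vlist \<times> name \<times> tm. foldr Fn (snd (?c p)) (base_tm (snd (fst (?c p)))))"
    unfolding base_tm_def by (intro pt_intros)
  have "rec_list a (\<lambda>y ys a. f a) l = (f ^^ length l) a" for a :: "(name \<times> tm) \<times> fsym list" and f and l :: vlist
    by (induction l) simp_all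
  with * show "pt (\<lambda>p. tau (fst p) (fst (snd p)) (fst (snd (snd p))) (snd (snd (snd p))))"
    by (simp add: tau_def chase_step_iter)
qed

lemma pt_prem [pt_intros]:
  assumes "pt f1" "pt f2" "pt f3" "pt f4" "pt f5" "pt f6" "pt f7"
  shows "pt (\<lambda>x. prem (f1 x) (f2 x) (f3 x) (f4 x) (f5 x) (f6 x) (f7 x))"
proof -
  have "pt (\<lambda>p. prem (fst (fst p)) (snd (fst p)) (fst (snd p)) (fst (snd (snd p))) (fst (snd (snd (snd p))))
     (fst (snd (snd (snd (snd p))))) (snd (snd (snd (snd (snd p))))))"
    unfolding prem_def by (intro pt_intros)
  from pt_comp6[OF this pt_Pair[OF assms(1,2)] assms(3-)] show ?thesis by simp
qed

lemma pt_prems [pt_intros]: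
  assumes "pt f1" "pt f2" "pt f3" "pt f4" "pt f5"
  shows "pt (\<lambda>x. prems (f1 x) (f2 x) (f3 x) (f4 x) (f5 x))"
proof -
  have "pt (\<lambda>p. prems (fst (fst p)) (snd (fst p)) (fst (snd p)) (fst (snd (snd p))) (snd (snd (snd p))))"
    unfolding prems_def by (intro pt_intros)
  from pt_comp4[OF this pt_Pair[OF assms(1,2)] assms(3-)] show ?thesis by simp
qed

lemma pt_gat [pt_intros]: "pt f \<Longrightarrow> pt g \<Longrightarrow> pt h \<Longrightarrow> pt (\<lambda>x. gat (f x) (g x) (h x))"
  by (rule pt_comp3[of gat]) (unfold gat_def, intro pt_intros)

lemma pt_keys [pt_intros]: "pt f \<Longrightarrow> pt (\<lambda>x. keys (f x))"
  unfolding keys_def by (intro pt_intros)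

lemma pt_sink_vertex [pt_intros]: "pt f \<Longrightarrow> pt g \<Longrightarrow> pt (\<lambda>x. sink_vertex (f x) (g x))"
  by (rule pt_comp2[of sink_vertex]) (unfold sink_vertex_def, intro pt_intros)

lemma pt_to_sk: "pt to_sk"
  unfolding to_sk_def sk_verts_def sk_edges_def vname_def conj_vertex_def query_vertex_def Let_def
  by (intro pt_intros)

subsubsection \<open>Correctness\<close>

lemma find_SomeE:
  assumes "x \<in> set xs" "P x" obtains y where "find P xs = Some y" "y \<in> set xs" "P y"
  using assms by (cases "find P xs") (auto simp: find_None_iff find_Some_iff)

text \<open>Shared by both directions: only the derivation structure \<open>D\<close>, the premises
  \<open>U\<close> and the type of justifications vary.\<close>

locale repr_proof =
  fixes U q and D :: "'j \<Rightarrow> formula set \<Rightarrow> formula \<Rightarrow> bool" and p :: "'j hproof" and lv :: vlist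
    and le :: "(name list \<times> name \<times> 'j \<times> unit) list"
  assumes pin: "proof_in D U q p" and repr: "repr p (lv, le)"
begin

lemma repr_simps:
  "distinct (map fst lv)" "fst ` set lv = verts p"
  "\<And>x. x \<in> set lv \<Longrightarrow> form (fst (snd x)) = lab p (fst x) \<and> ldistinct (fst (snd x))"
  "distinct (map (\<lambda>(S, d, j, u). (set S, d)) le)" "(\<lambda>(S, d, j, u). (set S, d)) ` set le = edges p"
  "\<And>x. x \<in> set le \<Longrightarrow> distinct (fst x) \<and> fst (snd (snd x)) = just p (set (fst x), fst (snd x))"
  using repr unfolding repr_def fst_conv snd_conv case_prod_unfold by blast+

lemmas distinct_lv = repr_simps(1)

lemma lv_verts: "(v, f, u) \<in> set lv \<Longrightarrow> v \<in> verts p \<and> lab p v = form f \<and> ldistinct f"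
  using repr_simps(3)[of "(v, f, u)"] imageI[of "(v, f, u)" "set lv" fst] unfolding repr_simps(2) by simp

lemma map_of_lv: "(v, f, u) \<in> set lv \<Longrightarrow> map_of lv v = Some (f, u)"
  using distinct_lv by (rule map_of_is_SomeI)

lemma verts_lv: "v \<in> verts p \<Longrightarrow> \<exists>f. (v, f, ()) \<in> set lv"
  unfolding repr_simps(2)[symmetric] by auto

lemma le_edges: "(S, d, j, u) \<in> set le \<Longrightarrow> (set S, d) \<in> edges p \<and> distinct S \<and> j = just p (set S, d)"
  using repr_simps(6)[of "(S, d, j, u)"] imageI[of "(S, d, j, u)" "set le" "\<lambda>(S, d, j, u). (set S, d)"]
  unfolding repr_simps(5) by simp

lemma edges_le: "(S, d) \<in> edges p \<Longrightarrow> \<exists>S' j u. S = set S' \<and> (S', d, j, u) \<in> set le"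
  unfolding repr_simps(5)[symmetric] by auto

lemma isp: "is_proof U (CQ q) p"
  using pin by (simp add: proof_in_def)

lemma edge_verts: "(S, d, j, u) \<in> set le \<Longrightarrow> set S \<subseteq> verts p \<and> d \<in> verts p"
  using le_edges isp unfolding is_proof_def by fast

lemma edge_inf: "(S, d, j, u) \<in> set le \<Longrightarrow> D j (lab p ` set S) (lab p d)"
  using le_edges[of S d j u] pin unfolding proof_in_def by fast

lemma edge_unique:
  assumes "(S, d, j, u) \<in> set le" "(S', d, j', u') \<in> set le"
  shows "(S, d, j, u) = (S', d, j', u')"
proof -
  have "set S = set S'" using le_edges[OF assms(1)] le_edges[OF assms(2)] isp unfolding is_proof_def by blast
  moreover have "inj_on (\<lambda>(S, d, j, u). (set S, d)) (set le)" using repr_simps(4) by (simp add: distinct_map)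
  ultimately show ?thesis
    using inj_onD[of "\<lambda>(S, d, j, u). (set S, d)" "set le", OF _ _ assms] by simp
qed

lemma distinct_le: "distinct (map (\<lambda>(S, d, j, u). d) le)"
proof -
  have "distinct le" using repr_simps(4) by (simp add: distinct_map)
  moreover have "inj_on (\<lambda>(S, d, j, u). d) (set le)"
    by (rule inj_onI) (use edge_unique in auto)
  ultimately show ?thesis by (simp add: distinct_map)
qed

lemma leaf_lab:
  assumes "v \<in> verts p" "\<And>S j u. (S, v, j, u) \<notin> set le" shows "lab p v \<in> U"
proof -
  have "is_leaf p v" unfolding is_leaf_def using assms edges_le by blast
  then show ?thesis using isp unfolding is_proof_def by blast
qed

lemma ex_rank:
  obtains rank :: "name \<Rightarrow> nat" where
    "\<And>S d j u s. (S, d, j, u) \<in> set le \<Longrightarrow> s \<in> set S \<Longrightarrow> rank s < rank d"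
    "\<And>v. v \<in> verts p \<Longrightarrow> rank v < length lv"
proof -
  have "verts p = set (map fst lv)" using repr_simps(2) by simp
  then have "card (verts p) = length lv" using distinct_card[OF distinct_lv] by simp
  then show ?thesis using proof_rank[OF isp] le_edges that by metis
qed

lemma sink:
  obtains f where "(sink_vertex lv le, f, ()) \<in> set lv" "form f = CQ q"
proof -
  have "\<exists>v. (\<forall>u. is_sink p u \<longleftrightarrow> u = v) \<and> lab p v = CQ q" using isp by (simp add: is_proof_def)
  then obtain v where v: "is_sink p v" "lab p v = CQ q" and "\<And>u. is_sink p u \<Longrightarrow> u = v" by blast
  have isk: "is_sink p (fst x) \<longleftrightarrow> (\<forall>e\<in>set le. fst x \<notin> set (fst e))" if "x \<in> set lv" for x
    using imageI[OF that, of fst] unfolding repr_simps(2)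
    by (simp add: is_sink_def repr_simps(5)[symmetric] case_prod_unfold)
  obtain f where f: "(v, f, ()) \<in> set lv" using v verts_lv unfolding is_sink_def by blast
  obtain x where x: "find (\<lambda>x. \<forall>e\<in>set le. fst x \<notin> set (fst e)) lv = Some x" "x \<in> set lv"
      "\<forall>e\<in>set le. fst x \<notin> set (fst e)"
    using find_SomeE[OF f, of "\<lambda>x. \<forall>e\<in>set le. fst x \<notin> set (fst e)"] isk[OF f] v by auto
  then have "fst x = v" using isk \<open>\<And>u. is_sink p u \<Longrightarrow> u = v\<close> by blast
  then show ?thesis using that[of f] f x lv_verts[OF f] v by (simp add: sink_vertex_def)
qed

lemma cqs_of: "(v, xs) \<in> set (cqs_of lv S) \<longleftrightarrow> v \<in> set S \<and> (v, LCQ xs, ()) \<in> set lv"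
proof
  assume "(v, xs) \<in> set (cqs_of lv S)"
  then show "v \<in> set S \<and> (v, LCQ xs, ()) \<in> set lv"
    using map_of_SomeD[of lv]
    by (auto simp: cqs_of_def split: option.splits lformula.splits)
next
  assume "v \<in> set S \<and> (v, LCQ xs, ()) \<in> set lv"
  then show "(v, xs) \<in> set (cqs_of lv S)"
    using map_of_lv by (auto simp: cqs_of_def intro!: bexI[of _ v])
qed

lemma rules_of: "(a, b, c) \<in> set (rules_of lv S) \<longleftrightarrow> (\<exists>v\<in>set S. (v, LRule a b c, ()) \<in> set lv)"
proof
  assume "(a, b, c) \<in> set (rules_of lv S)"
  then show "\<exists>v\<in>set S. (v, LRule a b c, ()) \<in> set lv"
    using map_of_SomeD[of lv]
    by (auto simp: rules_of_def split: option.splits lformula.splits) (metis)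
next
  assume "\<exists>v\<in>set S. (v, LRule a b c, ()) \<in> set lv"
  then obtain v where "v \<in> set S" "(v, LRule a b c, ()) \<in> set lv" by blast
  then show "(a, b, c) \<in> set (rules_of lv S)"
    using map_of_lv by (auto simp: rules_of_def intro!: bexI[of _ v])
qed

lemma lab_cq: "v \<in> verts p \<Longrightarrow> lab p v = CQ \<phi> \<Longrightarrow> \<exists>xs. (v, LCQ xs, ()) \<in> set lv \<and> fset_of_list xs = \<phi>"
  using verts_lv[of v] lv_verts by (metis form.simps(2) formula.distinct(1) formula.inject(1) form.simps(1) lformula.exhaust)

lemma lab_rule: "v \<in> verts p \<Longrightarrow> lab p v = Rule \<psi> X \<chi> \<Longrightarrow>
    \<exists>a b c. (v, LRule a b c, ()) \<in> set lv \<and> fset_of_list a = \<psi> \<and> fset_of_list b = X \<and> fset_of_list c = \<chi>"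
  using verts_lv[of v] lv_verts by (metis form.simps(2) formula.distinct(1) formula.inject(2) form.simps(1) lformula.exhaust)

lemma latoms: "(v, LCQ xs, u) \<in> set lv \<Longrightarrow> latoms lv v = xs"
  using map_of_lv by (simp add: latoms_def)

lemma src:
  assumes e: "(S, d, j, u) \<in> set le" and l: "CQ \<phi> \<in> lab p ` set S"
    and uniq: "\<And>\<phi>'. CQ \<phi>' \<in> lab p ` set S \<Longrightarrow> \<phi>' = \<phi>"
  shows "\<exists>v xs. src lv S = (v, xs) \<and> v \<in> set S \<and> (v, LCQ xs, ()) \<in> set lv \<and> fset_of_list xs = \<phi>"
proof -
  obtain v where v: "v \<in> set S" "lab p v = CQ \<phi>" using l by (auto simp: image_iff)
  then obtain xs where "(v, LCQ xs, ()) \<in> set lv" using lab_cq edge_verts[OF e] by blast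
  then have "cqs_of lv S \<noteq> []" using v cqs_of[of v xs S] by auto
  then obtain x r where x: "cqs_of lv S = x # r" by (cases "cqs_of lv S") auto
  obtain w ys where w: "x = (w, ys)" by (cases x)
  have m: "w \<in> set S" "(w, LCQ ys, ()) \<in> set lv" using cqs_of[of w ys S] x w by auto
  then have "CQ (fset_of_list ys) \<in> lab p ` set S" using lv_verts[of w "LCQ ys"] by (force simp: image_iff)
  then show ?thesis using uniq m x w by (auto simp: src_def)
qed

lemma rsrc:
  assumes e: "(S, d, j, u) \<in> set le" and l: "Rule \<psi> X \<chi> \<in> lab p ` set S"
    and uniq: "\<And>\<psi>' X' \<chi>'. Rule \<psi>' X' \<chi>' \<in> lab p ` set S \<Longrightarrow> Rule \<psi>' X' \<chi>' = Rule \<psi> X \<chi>"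
  shows "\<exists>a b c. rsrc lv S = (a, b, c) \<and> fset_of_list a = \<psi> \<and> fset_of_list b = X \<and> fset_of_list c = \<chi>"
proof -
  obtain v where v: "v \<in> set S" "lab p v = Rule \<psi> X \<chi>" using l by (auto simp: image_iff)
  then obtain a b c where "(v, LRule a b c, ()) \<in> set lv" using lab_rule edge_verts[OF e] by blast
  then have "rules_of lv S \<noteq> []" using v rules_of[of a b c S] by auto
  then obtain x r where x: "rules_of lv S = x # r" by (cases "rules_of lv S") auto
  obtain a b c where w: "x = (a, b, c)" by (cases x)
  obtain w where m: "w \<in> set S" "(w, LRule a b c, ()) \<in> set lv" using rules_of[of a b c S] x w by auto
  then have "form (LRule a b c) \<in> lab p ` set S" using lv_verts[of w "LRule a b c"] by (force simp: image_iff)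
  then show ?thesis using uniq m x w by (auto simp: rsrc_def)
qed

end

section \<open>The data of an inference recovered from the listing\<close>

lemma fset_csub: "fset (csub \<sigma> (fset_of_list xs)) = asub \<sigma> ` set xs"
  by (simp add: csub_def fset_of_list.rep_eq)

lemma bcq_flat: "bcq (fset_of_list xs) \<Longrightarrow> \<alpha> \<in> set xs \<Longrightarrow> t \<in> set_atom \<alpha> \<Longrightarrow> flat_tm t"
  by (auto simp: bcq_def fset_of_list.rep_eq)

lemma set_atom_asub: "set_atom (asub \<sigma> \<alpha>) = tsub \<sigma> ` set_atom \<alpha>"
  by (simp add: asub_def atom.set_map)

lemma avars_vars: "\<alpha> \<in> set xs \<Longrightarrow> avars \<alpha> \<subseteq> vars (fset_of_list xs)"
  by (auto simp: vars_avars fset_of_list.rep_eq)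

lemma flat_tsub: "flat_tm t \<Longrightarrow> (\<And>x. flat_tm (\<sigma> x)) \<Longrightarrow> flat_tm (tsub \<sigma> t)"
  by (cases t) auto

lemma bcq_csub: "bcq \<phi> \<Longrightarrow> (\<And>x. flat_tm (\<sigma> x)) \<Longrightarrow> bcq (csub \<sigma> \<phi>)"
  by (auto simp: bcq_def csub_def set_atom_asub flat_tsub)

lemma bcq_funion: "bcq \<phi> \<Longrightarrow> bcq \<psi> \<Longrightarrow> bcq (\<phi> |\<union>| \<psi>)"
  by (auto simp: bcq_def)

locale cq_input = repr_proof "rule_of ` T \<union> facts A" q "cq_inf T" p lv le
  for T A q p lv le +
  fixes ts :: "axm list"
  assumes abox: "is_abox A" and bq: "bcq q" and ts: "set ts = T"
begin

text \<open>A label is the conclusion of an inference, whose side conditions make it a BCQ (for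
  (C_e), as a union of two), or it belongs to a leaf, and is then a fact because rules are no CQs.
  Hence all terms in CQ labels are flat.\<close>

lemma lab_bcq:
  assumes "(v, LCQ xs, u) \<in> set lv" shows "bcq (fset_of_list xs)"
proof -
  have v: "v \<in> verts p" "lab p v = CQ (fset_of_list xs)" using lv_verts[OF assms] by auto
  show ?thesis
  proof (cases "\<exists>S j u. (S, v, j, u) \<in> set le")
    case True
    then obtain S j u where "(S, v, j, u) \<in> set le" by blast
    from edge_inf[OF this] show ?thesis unfolding v(2)
    proof cases
      case (Ce \<phi> \<psi> m)
      have "bcq (csub (\<lambda>z. Var (ren m z)) \<psi>)" by (rule bcq_csub[OF Ce(5)]) simp
      with Ce(4) show ?thesis unfolding Ce(3)[unfolded formula.inject] by (rule bcq_funion)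
    qed (auto elim: taut_rule.cases)
  next
    case False
    then have "lab p v \<in> rule_of ` T \<union> facts A" using leaf_lab v by blast
    moreover have "rule_of ax \<noteq> CQ \<phi>" for ax \<phi> by (cases ax) auto
    ultimately have "CQ (fset_of_list xs) \<in> facts A" using v by (auto simp: image_iff) metis
    then show ?thesis using abox by (fastforce simp: facts_def is_abox_def bcq_def)
  qed
qed

lemma lvars_vars: "(v, LCQ xs, u) \<in> set lv \<Longrightarrow> set (lvars xs) = vars (fset_of_list xs)"
  using set_lvars lab_bcq by blast

lemma lab_flat: "(v, LCQ xs, u) \<in> set lv \<Longrightarrow> \<alpha> \<in> set xs \<Longrightarrow> t \<in> set_atom \<alpha> \<Longrightarrow> flat_tm t"
  using lab_bcq bcq_flat by blast

text \<open>The removed set \<open>P\<close> and the selected subset \<open>Q\<close> are forgotten.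
  For tracing atoms it is enough that each atom of the conclusion is old or an instance of a head
  atom, so only an inclusion is kept.\<close>

lemma MPe_data:
  assumes "(S, d, ByMPe s m, u) \<in> set le" "(d, LCQ \<rho>, w) \<in> set lv"
  obtains v xs a b c where "src lv S = (v, xs)" "v \<in> set S" "(v, LCQ xs, ()) \<in> set lv"
    "rsrc lv S = (a, b, c)"
    "form (LRule a b c) \<in> rule_of ` T \<or> taut_rule (form (LRule a b c))"
    "asub (sub s) ` set a \<subseteq> set xs"
    "inj_on (ren m) (set b)" "ren m ` set b \<inter> set (lvars xs) = {}"
    "set \<rho> \<subseteq> set xs \<union> asub (\<lambda>z. if z \<in> set b then Var (ren m z) else sub s z) ` set c"
proof -
  have ld: "lab p d = CQ (fset_of_list \<rho>)" using lv_verts[OF assms(2)] by simp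
  from edge_inf[OF assms(1)] show ?thesis
  proof cases
    case (MPe \<phi> \<psi> X \<chi> \<chi>' P Q \<rho>')
    obtain v xs where v: "src lv S = (v, xs)" "v \<in> set S" "(v, LCQ xs, ()) \<in> set lv" "fset_of_list xs = \<phi>"
      using src[OF assms(1), of \<phi>, unfolded MPe(1)] by blast
    obtain a b c where r: "rsrc lv S = (a, b, c)" "fset_of_list a = \<psi>" "fset_of_list b = X" "fset_of_list c = \<chi>"
      using rsrc[OF assms(1), of \<psi> X \<chi>, unfolded MPe(1)] by blast
    show ?thesis
    proof (rule that[OF v(1-3) r(1)])
      show "form (LRule a b c) \<in> rule_of ` T \<or> taut_rule (form (LRule a b c))" using MPe r by simp
      show "asub (sub s) ` set a \<subseteq> set xs"
        using MPe(5) unfolding r(2)[symmetric] v(4)[symmetric] less_eq_fset.rep_eq fset_csub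
        by (simp add: fset_of_list.rep_eq)
      show "inj_on (ren m) (set b)" using MPe(6) r(3) by (auto simp: fset_of_list.rep_eq)
      show "ren m ` set b \<inter> set (lvars xs) = {}"
        using MPe(7) unfolding r(3)[symmetric] v(4)[symmetric] lvars_vars[OF v(3)]
        by (simp add: fset_of_list.rep_eq)
      have "fset_of_list \<rho> = (\<phi> |-| P) |\<union>| Q" using MPe(2,11) ld by simp
      then have "fset (fset_of_list \<rho>) = (fset \<phi> - fset P) \<union> fset Q" by simp
      then have "fset (fset_of_list \<rho>) \<subseteq> fset \<phi> \<union> fset \<chi>'"
        using MPe(10) by (auto simp: less_eq_fset.rep_eq)
      then show "set \<rho> \<subseteq> set xs \<union> asub (\<lambda>z. if z \<in> set b then Var (ren m z) else sub s z) ` set c"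
        unfolding MPe(8) r(3,4)[symmetric] v(4)[symmetric] fset_csub
        by (simp add: fset_of_list.rep_eq)
    qed
  qed
qed

lemma Ee_data:
  assumes "(S, d, ByEe t1 t2, u) \<in> set le" "(d, LCQ \<rho>, w) \<in> set lv"
  obtains v xs where "src lv S = (v, xs)" "v \<in> set S" "(v, LCQ xs, ()) \<in> set lv"
    "EqA t1 t2 \<in> set xs" "\<forall>\<beta>\<in>set \<rho>. \<exists>\<alpha>\<in>set xs. repl t1 t2 \<alpha> \<beta>"
proof -
  have ld: "lab p d = CQ (fset_of_list \<rho>)" using lv_verts[OF assms(2)] by simp
  from edge_inf[OF assms(1)] show ?thesis
  proof cases
    case (Ee \<phi> \<rho>')
    obtain v xs where v: "src lv S = (v, xs)" "v \<in> set S" "(v, LCQ xs, ()) \<in> set lv"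
        "fset_of_list xs = finsert (EqA t1 t2) \<phi>"
      using src[OF assms(1), of "finsert (EqA t1 t2) \<phi>", unfolded Ee(1)] by blast
    then have xs: "set xs = insert (EqA t1 t2) (fset \<phi>)" by (metis finsert.rep_eq fset_of_list.rep_eq)
    have \<rho>: "fset \<rho>' = set \<rho>" using ld Ee(2) by (metis formula.inject(1) fset_of_list.rep_eq)
    show ?thesis
      by (rule that[OF v(1-3)]) (use xs \<rho> Ee(4) in \<open>auto simp: rel_fset_alt\<close>)
  qed
qed

lemma Ce_data:
  assumes "(S, d, ByCe m, u) \<in> set le" "(d, LCQ \<rho>, w) \<in> set lv"
  obtains v xs v' ys where "ce_src lv S m \<rho> = ((v, xs), (v', ys))" "v \<in> set S" "(v, LCQ xs, ()) \<in> set lv"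
    "v' \<in> set S" "(v', LCQ ys, ()) \<in> set lv"
    "set \<rho> = set xs \<union> asub (\<lambda>z. Var (ren m z)) ` set ys"
    "inj_on (ren m) (set (lvars ys))" "ren m ` set (lvars ys) \<inter> set (lvars xs) = {}"
proof -
  have ld: "lab p d = CQ (fset_of_list \<rho>)" using lv_verts[OF assms(2)] by simp
  let ?P = "\<lambda>x. ce_ok m (snd (fst x)) (snd (snd x)) \<rho>"
  let ?C = "concat (map (\<lambda>a. map (Pair a) (cqs_of lv S)) (cqs_of lv S))"
  from edge_inf[OF assms(1)] show ?thesis
  proof cases
    case (Ce \<phi> \<psi>)
    have "CQ \<phi> \<in> lab p ` set S" "CQ \<psi> \<in> lab p ` set S" using Ce(1) by auto
    then obtain v1 v2 where v12: "v1 \<in> set S" "lab p v1 = CQ \<phi>" "v2 \<in> set S" "lab p v2 = CQ \<psi>"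
      by (auto simp: image_iff)
    obtain xs where xs: "(v1, LCQ xs, ()) \<in> set lv" "fset_of_list xs = \<phi>"
      using lab_cq[of v1] v12 edge_verts[OF assms(1)] by blast
    obtain ys where ys: "(v2, LCQ ys, ()) \<in> set lv" "fset_of_list ys = \<psi>"
      using lab_cq[of v2] v12 edge_verts[OF assms(1)] by blast
    have asub1: "asub1 \<sigma> \<beta> = asub \<sigma> \<beta>" if "\<beta> \<in> set zs" "(z, LCQ zs, ()) \<in> set lv" for \<sigma> \<beta> zs z
      using lab_flat[OF that(2,1)] by (rule asub1_flat)
    have "fset (fset_of_list \<rho>) = fset \<phi> \<union> fset (csub (\<lambda>z. Var (ren m z)) \<psi>)" using Ce ld by simp
    then have "set \<rho> = set xs \<union> asub (\<lambda>z. Var (ren m z)) ` set ys"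
      unfolding xs(2)[symmetric] ys(2)[symmetric] fset_csub by (simp add: fset_of_list.rep_eq)
    also have "asub (\<lambda>z. Var (ren m z)) ` set ys = asub1 (\<lambda>z. Var (ren m z)) ` set ys"
      using asub1[OF _ ys(1)] by (intro image_cong) simp_all
    finally have "?P ((v1, xs), (v2, ys))"
      using Ce(5,6) lvars_vars[OF xs(1)] lvars_vars[OF ys(1)] xs(2) ys(2)
      by (auto simp: ce_ok_def inj_on_def)
    moreover have "((v1, xs), (v2, ys)) \<in> set ?C"
      using cqs_of[of v1 xs S] cqs_of[of v2 ys S] v12 xs ys by auto
    ultimately have "filter ?P ?C \<noteq> []" unfolding filter_empty_conv by blast
    then obtain x r where x: "filter ?P ?C = x # r" by (cases "filter ?P ?C") auto
    obtain v xs v' ys where xx: "x = ((v, xs), (v', ys))" by (metis surj_pair)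
    have "x \<in> set (filter ?P ?C)" using x by simp
    then have m: "(v, xs) \<in> set (cqs_of lv S)" "(v', ys) \<in> set (cqs_of lv S)" and ok: "ce_ok m xs ys \<rho>"
      unfolding xx by auto
    have ys: "(v', LCQ ys, ()) \<in> set lv" using m cqs_of by blast
    have eq: "asub1 (\<lambda>z. Var (ren m z)) ` set ys = asub (\<lambda>z. Var (ren m z)) ` set ys"
      using asub1[OF _ ys] by (intro image_cong) simp_all
    show ?thesis
    proof (rule that)
      show "ce_src lv S m \<rho> = ((v, xs), (v', ys))" unfolding ce_src_def x xx by simp
      show "set \<rho> = set xs \<union> asub (\<lambda>z. Var (ren m z)) ` set ys"
        using ok eq by (simp add: ce_ok_def)
      show "inj_on (ren m) (set (lvars ys))" "ren m ` set (lvars ys) \<inter> set (lvars xs) = {}"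
        using ok by (auto simp: ce_ok_def inj_on_def)
    qed (use m cqs_of in blast)+
  qed
qed

lemma Ge_data:
  assumes "(S, d, ByGe s, u) \<in> set le" "(d, LCQ \<rho>, w) \<in> set lv"
  obtains v xs where "src lv S = (v, xs)" "v \<in> set S" "(v, LCQ xs, ()) \<in> set lv"
    "set xs = asub (ind_sub s) ` set \<rho>"
proof -
  have ld: "lab p d = CQ (fset_of_list \<rho>)" using lv_verts[OF assms(2)] by simp
  from edge_inf[OF assms(1)] show ?thesis
  proof cases
    case (Ge \<phi> \<rho>')
    obtain v xs where v: "src lv S = (v, xs)" "v \<in> set S" "(v, LCQ xs, ()) \<in> set lv" "fset_of_list xs = \<phi>"
      using src[OF assms(1), of \<phi>, unfolded Ge(1)] by blast
    have "set xs = asub (ind_sub s) ` set \<rho>"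
      using v(4) Ge ld fset_csub by (metis formula.inject(1) fset_of_list.rep_eq)
    then show ?thesis using that v by blast
  qed
qed

end

context cq_input
begin

lemma rule_flat:
  assumes "form (LRule a b c) \<in> rule_of ` T \<or> taut_rule (form (LRule a b c))"
    and "\<beta> \<in> set a \<union> set c" "t \<in> set_atom \<beta>" shows "flat_tm t"
  using assms(1)
proof
  assume "form (LRule a b c) \<in> rule_of ` T"
  then obtain ax where ax: "Rule (fset_of_list a) (fset_of_list b) (fset_of_list c) = rule_of ax" by auto
  have r: "t \<in> set_atom (ratom R x y) \<Longrightarrow> t = x \<or> t = y" for R x y by (cases R) auto
  have "\<beta> |\<in>| fset_of_list a \<or> \<beta> |\<in>| fset_of_list c" using assms(2) by (auto simp: fset_of_list.rep_eq)
  then show ?thesis using ax assms(3) r by (cases ax) (auto dest!: r)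
next
  assume "taut_rule (form (LRule a b c))"
  then have "bcq (fset_of_list a)" "fset_of_list c = fset_of_list a" by (auto elim: taut_rule.cases)
  then show ?thesis using assms(2,3) bcq_flat by (auto simp: fset_of_list_eq_iff)
qed

lemma rule_axm_ok:
  assumes "form (LRule a b c) \<in> rule_of ` T \<or> taut_rule (form (LRule a b c))" "set a \<noteq> set c"
  obtains ax where "rule_axm ts (a, b, c) = Some ax" "ax \<in> T" "rule_of ax = form (LRule a b c)"
proof -
  have "\<not> taut_rule (form (LRule a b c))"
    using assms(2) by (auto elim!: taut_rule.cases simp: fset_of_list_eq_iff)
  then obtain ax where "ax \<in> set ts" "rule_of ax = form (LRule a b c)" using assms(1) ts by auto
  from find_SomeE[of ax ts "\<lambda>ax. form (rule_of_l ax) = form (LRule a b c)"] this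
  show ?thesis using that ts unfolding rule_axm_def by auto
qed

text \<open>In a flat atom a variable is itself an argument, so its image is an argument of the
  instance, which is an atom of a labelled CQ.\<close>

lemma sub_flat:
  assumes "(v, LCQ xs, w) \<in> set lv" "asub (sub s) \<beta> \<in> set xs" "\<And>t. t \<in> set_atom \<beta> \<Longrightarrow> flat_tm t" "x \<in> avars \<beta>"
  shows "flat_tm (sub s x) \<and> tvars (sub s x) \<subseteq> set (lvars xs)"
proof -
  obtain t where t: "t \<in> set_atom \<beta>" "x \<in> tvars t" using assms(4) by (auto simp: avars_def)
  have fl: "flat_tm t" by (rule assms(3)[OF t(1)])
  have "t = Var x" by (cases t) (use fl t(2) in auto)
  then have "sub s x \<in> set_atom (asub (sub s) \<beta>)" using t unfolding set_atom_asub by force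
  then have "flat_tm (sub s x)" "tvars (sub s x) \<subseteq> avars (asub (sub s) \<beta>)"
    using lab_flat[OF assms(1,2)] by (auto simp: avars_def)
  then show ?thesis using avars_vars[OF assms(2)] lvars_vars[OF assms(1)] by blast
qed

text \<open>The three origins of a variable under (MP_e). An old variable keeps its term. If body
  and head coincide, as in tautologies, the witness for a bound variable \<open>x\<close> is the
  term that \<open>x\<close> took in the body. For an existential axiom it is the Skolem term over
  the instance of \<open>vx\<close>.\<close>

lemma orig_MPe:
  assumes "src lv S = (v, xs)" "rsrc lv S = (a, b, c)"
  shows "z \<in> set (lvars xs) \<Longrightarrow> orig lv ts S (ByMPe s m) \<rho> z = ([], v, Var z)"
    and "\<lbrakk>x \<in> set b; inj_on (ren m) (set b); ren m ` set b \<inter> set (lvars xs) = {}; set a = set c\<rbrakk>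
      \<Longrightarrow> orig lv ts S (ByMPe s m) \<rho> (ren m x) = ([], v, sub s x)"
    and "\<lbrakk>x \<in> set b; inj_on (ren m) (set b); ren m ` set b \<inter> set (lvars xs) = {}; set a \<noteq> set c;
       rule_axm ts (a, b, c) = Some (ExR A1 R1 B1)\<rbrakk>
      \<Longrightarrow> orig lv ts S (ByMPe s m) \<rho> (ren m x) = ([Sk A1 R1 B1], v, sub s vx)"
proof -
  have f: "find (\<lambda>y. ren m y = ren m x) b = Some x" if "x \<in> set b" "inj_on (ren m) (set b)" for x
  proof -
    from find_SomeE[OF that(1), of "\<lambda>y. ren m y = ren m x"] obtain y where
      "find (\<lambda>y. ren m y = ren m x) b = Some y" "y \<in> set b" "ren m y = ren m x" by blast
    then show ?thesis using that by (auto dest: inj_onD)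
  qed
  show "z \<in> set (lvars xs) \<Longrightarrow> orig lv ts S (ByMPe s m) \<rho> z = ([], v, Var z)"
    by (simp add: orig_def assms)
  assume x: "x \<in> set b" "inj_on (ren m) (set b)" "ren m ` set b \<inter> set (lvars xs) = {}"
  then have n: "ren m x \<notin> set (lvars xs)" by blast
  show "set a = set c \<Longrightarrow> orig lv ts S (ByMPe s m) \<rho> (ren m x) = ([], v, sub s x)"
    by (simp add: orig_def assms n f[OF x(1,2)])
  show "set a \<noteq> set c \<Longrightarrow> rule_axm ts (a, b, c) = Some (ExR A1 R1 B1) \<Longrightarrow>
      orig lv ts S (ByMPe s m) \<rho> (ren m x) = ([Sk A1 R1 B1], v, sub s vx)"
    by (simp add: orig_def assms n f[OF x(1,2)])
qed

lemma orig_Ce: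
  assumes "ce_src lv S m \<rho> = ((v, xs), (v', ys))"
  shows "z \<in> set (lvars xs) \<Longrightarrow> orig lv ts S (ByCe m) \<rho> z = ([], v, Var z)"
    and "\<lbrakk>y \<in> set (lvars ys); inj_on (ren m) (set (lvars ys)); ren m ` set (lvars ys) \<inter> set (lvars xs) = {}\<rbrakk>
      \<Longrightarrow> orig lv ts S (ByCe m) \<rho> (ren m y) = ([], v', Var y)"
proof -
  show "z \<in> set (lvars xs) \<Longrightarrow> orig lv ts S (ByCe m) \<rho> z = ([], v, Var z)"
    by (simp add: orig_def assms)
  assume y: "y \<in> set (lvars ys)" "inj_on (ren m) (set (lvars ys))" "ren m ` set (lvars ys) \<inter> set (lvars xs) = {}"
  from find_SomeE[OF y(1), of "\<lambda>z. ren m z = ren m y"] obtain z where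
    "find (\<lambda>z. ren m z = ren m y) (lvars ys) = Some z" "z \<in> set (lvars ys)" "ren m z = ren m y" by blast
  moreover from this have "z = y" using y by (auto dest: inj_onD)
  moreover have "ren m y \<notin> set (lvars xs)" using y by blast
  ultimately show "orig lv ts S (ByCe m) \<rho> (ren m y) = ([], v', Var y)" by (simp add: orig_def assms)
qed

lemma ExR_if_bound:
  assumes "rule_of ax = form (LRule a b c)" "x \<in> set b"
  obtains A1 R1 B1 where "ax = ExR A1 R1 B1" "x = vy" "set a = {CA A1 (Var vx)}" "set b = {vy}"
    "set c = {ratom R1 (Var vx) (Var vy), CA B1 (Var vy)}"
proof (cases "\<exists>A1 R1 B1. ax = ExR A1 R1 B1")
  case True
  then obtain A1 R1 B1 where ExR: "ax = ExR A1 R1 B1" by blast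
  with assms(1) have *: "fset_of_list a = {|CA A1 (Var vx)|}" "fset_of_list b = {|vy|}"
    "fset_of_list c = {|ratom R1 (Var vx) (Var vy), CA B1 (Var vy)|}" by simp_all
  from this[THEN arg_cong, of fset] have "set a = {CA A1 (Var vx)}" "set b = {vy}"
    "set c = {ratom R1 (Var vx) (Var vy), CA B1 (Var vy)}" by (simp_all add: fset_of_list.rep_eq)
  then show ?thesis using that[of A1 R1 B1] ExR assms(2) by simp
next
  case False
  then have "fset_of_list b = {||}" using assms(1) by (cases ax) simp_all
  then have "set b = {}" using arg_cong[of _ _ fset] by (fastforce simp: fset_of_list.rep_eq)
  then show ?thesis using assms(2) by simp
qed

text \<open>What keeps the chase going: the origin is a flat term over the variables of a premise,
  so a further lookup again concerns a variable that occurs in the CQ at which it is made.\<close>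

lemma orig_ok:
  assumes e: "(S, d, j, u) \<in> set le" and d: "(d, LCQ \<rho>, w) \<in> set lv" and z: "z \<in> vars (fset_of_list \<rho>)"
  shows "\<exists>gs v t xs. orig lv ts S j \<rho> z = (gs, v, t) \<and> v \<in> set S \<and> (v, LCQ xs, ()) \<in> set lv \<and>
    flat_tm t \<and> tvars t \<subseteq> vars (fset_of_list xs)"
proof -
  obtain \<alpha> where \<alpha>: "\<alpha> \<in> set \<rho>" "z \<in> avars \<alpha>" using z by (auto simp: vars_avars fset_of_list.rep_eq)
  show ?thesis
  proof (cases j)
    case (ByMPe s m)
    obtain v xs a b c where D: "src lv S = (v, xs)" "v \<in> set S" "(v, LCQ xs, ()) \<in> set lv"
      "rsrc lv S = (a, b, c)"
      "form (LRule a b c) \<in> rule_of ` T \<or> taut_rule (form (LRule a b c))"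
      "asub (sub s) ` set a \<subseteq> set xs"
      "inj_on (ren m) (set b)" "ren m ` set b \<inter> set (lvars xs) = {}"
      "set \<rho> \<subseteq> set xs \<union> asub (\<lambda>z. if z \<in> set b then Var (ren m z) else sub s z) ` set c"
      by (rule MPe_data[OF e[unfolded ByMPe] d])
    note O = orig_MPe[OF D(1,4)]
    have V: "set (lvars xs) = vars (fset_of_list xs)" by (rule lvars_vars[OF D(3)])
    have SF: "flat_tm (sub s x) \<and> tvars (sub s x) \<subseteq> set (lvars xs)" if x: "x \<in> vars (fset_of_list a)" for x
    proof -
      obtain \<beta> where \<beta>: "\<beta> \<in> set a" "x \<in> avars \<beta>" using x by (auto simp: vars_avars fset_of_list.rep_eq)
      show ?thesis by (rule sub_flat[OF D(3) _ _ \<beta>(2)]) (use \<beta> D(6) rule_flat[OF D(5)] in auto)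
    qed
    have K: ?thesis if "orig lv ts S j \<rho> z = (gs, v, t)" "flat_tm t" "tvars t \<subseteq> set (lvars xs)" for gs t
      using that D(2,3) V by blast
    consider "z \<in> set (lvars xs)" | "z \<notin> set (lvars xs)" "\<alpha> \<notin> set xs"
      using avars_vars[of \<alpha> xs] \<alpha>(2) V by blast
    then show ?thesis
    proof cases
      case 1
      show ?thesis by (rule K[of "[]" "Var z"]) (use O(1)[OF 1] 1 ByMPe in simp_all)
    next
      case 2
      then obtain \<beta> where \<beta>: "\<beta> \<in> set c" "\<alpha> = asub (\<lambda>z. if z \<in> set b then Var (ren m z) else sub s z) \<beta>"
        using D(9) \<alpha> by auto
      obtain x where x: "x \<in> avars \<beta>" "z \<in> tvars (if x \<in> set b then Var (ren m x) else sub s x)"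
        using \<alpha>(2) unfolding \<beta>(2) avars_asub by blast
      have xv: "x \<in> vars (fset_of_list a) \<union> set b"
        using rule_vars[of "fset_of_list a" "fset_of_list b" "fset_of_list c"] D(5) x(1) avars_vars[OF \<beta>(1)]
        by (auto simp: fset_of_list.rep_eq)
      \<comment> \<open>A variable that is not bound is sent into the old CQ, so a new
        \<open>z\<close> can only come from a bound variable.\<close>
      have xb: "x \<in> set b"
      proof (rule ccontr)
        assume "x \<notin> set b"
        then show False using SF[of x] xv x(2) 2(1) by auto
      qed
      then have zx: "z = ren m x" using x(2) by simp
      show ?thesis
      proof (cases "set a = set c")
        case True
        have "x \<in> vars (fset_of_list a)" using avars_vars[OF \<beta>(1)] x(1) True
          by (auto simp: vars_avars fset_of_list.rep_eq)
        from SF[OF this] show ?thesis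
          by (intro K[of "[]" "sub s x"]) (use O(2)[OF xb D(7,8) True] ByMPe zx in simp_all)
      next
        case False
        obtain ax where ax: "rule_axm ts (a, b, c) = Some ax" "ax \<in> T" "rule_of ax = form (LRule a b c)"
          using rule_axm_ok[OF D(5) False] .
        obtain A1 R1 B1 where E: "ax = ExR A1 R1 B1" "set a = {CA A1 (Var vx)}" using ExR_if_bound[OF ax(3) xb] by metis
        then have "vx \<in> vars (fset_of_list a)" by (auto simp: vars_avars fset_of_list.rep_eq)
        from SF[OF this] show ?thesis
          by (intro K[of "[Sk A1 R1 B1]" "sub s vx"])
            (use O(3)[OF xb D(7,8) False] ax(1) ByMPe zx E(1) in simp_all)
      qed
    qed
  next
    case ByTe
    then show ?thesis using edge_inf[OF e] lv_verts[OF d] by (auto elim!: cq_inf.cases taut_rule.cases)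
  next
    case (ByEe t1 t2)
    obtain v xs where D: "src lv S = (v, xs)" "v \<in> set S" "(v, LCQ xs, ()) \<in> set lv"
        "EqA t1 t2 \<in> set xs" "\<forall>\<beta>\<in>set \<rho>. \<exists>\<alpha>\<in>set xs. repl t1 t2 \<alpha> \<beta>"
      by (rule Ee_data[OF e[unfolded ByEe] d])
    obtain \<beta> where \<beta>: "\<beta> \<in> set xs" "repl t1 t2 \<beta> \<alpha>" using D(5) \<alpha> by blast
    have "avars \<alpha> \<subseteq> avars \<beta> \<union> tvars t2" using \<beta>(2) by (cases \<alpha>; cases \<beta>) (auto simp: repl_def)
    then have "z \<in> vars (fset_of_list xs)" using \<alpha> avars_vars[OF \<beta>(1)] avars_vars[OF D(4)] by auto
    then show ?thesis using D ByEe by (auto simp: orig_def)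
  next
    case (ByCe m)
    obtain v xs v' ys where D: "ce_src lv S m \<rho> = ((v, xs), (v', ys))" "v \<in> set S" "(v, LCQ xs, ()) \<in> set lv"
      "v' \<in> set S" "(v', LCQ ys, ()) \<in> set lv"
      "set \<rho> = set xs \<union> asub (\<lambda>z. Var (ren m z)) ` set ys"
      "inj_on (ren m) (set (lvars ys))" "ren m ` set (lvars ys) \<inter> set (lvars xs) = {}"
      by (rule Ce_data[OF e[unfolded ByCe] d])
    note V = lvars_vars[OF D(3)] lvars_vars[OF D(5)]
    consider "z \<in> set (lvars xs)" | y where "y \<in> set (lvars ys)" "z = ren m y"
    proof -
      have "z \<in> set (lvars xs) \<or> (\<exists>\<beta>\<in>set ys. z \<in> avars (asub (\<lambda>z. Var (ren m z)) \<beta>))"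
        using \<alpha> D(6) avars_vars[of \<alpha> xs] V by auto
      then show ?thesis using that avars_vars[of _ ys] V(2) unfolding avars_asub by auto
    qed
    then show ?thesis
    proof cases
      case 1
      then show ?thesis using orig_Ce(1)[OF D(1) 1] D V ByCe by auto
    next
      case (2 y)
      then show ?thesis using orig_Ce(2)[OF D(1) 2(1) D(7,8)] D V ByCe by auto
    qed
  next
    case (ByGe s)
    obtain v xs where D: "src lv S = (v, xs)" "v \<in> set S" "(v, LCQ xs, ()) \<in> set lv"
        "set xs = asub (ind_sub s) ` set \<rho>"
      by (rule Ge_data[OF e[unfolded ByGe] d])
    have "tvars (ind_sub s z) \<subseteq> avars (asub (ind_sub s) \<alpha>)" using \<alpha>(2) unfolding avars_asub by blast
    also have "\<dots> \<subseteq> vars (fset_of_list xs)" using \<alpha>(1) D(4) by (intro avars_vars) auto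
    finally show ?thesis using D ByGe by (auto simp: orig_def ind_sub_def split: option.split)
  qed
qed

section \<open>The ground terms assigned by the chase\<close>

definition "tb = orig_table lv le ts"

lemma map_of_tb:
  assumes e: "(S, d, j, u) \<in> set le" and d: "(d, LCQ \<rho>, w) \<in> set lv" and z: "z \<in> vars (fset_of_list \<rho>)"
  shows "map_of tb (d, z) = Some (orig lv ts S j \<rho> z)"
proof -
  have lat: "latoms lv d = \<rho>" by (rule latoms[OF d])
  have "((d, z), orig lv ts S j \<rho> z) \<in> set tb"
    using e z lvars_vars[OF d] by (auto simp: tb_def orig_table_def lat intro!: bexI[OF _ e])
  then obtain y where y: "map_of tb (d, z) = Some y" by (meson weak_map_of_SomeI)
  then have "((d, z), y) \<in> set tb" by (rule map_of_SomeD)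
  then obtain S' j' u' where "(S', d, j', u') \<in> set le" "y = orig lv ts S' j' \<rho> z"
    by (auto simp: tb_def orig_table_def lat)
  then show ?thesis using edge_unique[OF e] y by auto
qed

lemma leaf_fact:
  assumes "(v, LCQ xs, w) \<in> set lv" "\<And>S j u. (S, v, j, u) \<notin> set le"
  shows "\<exists>\<alpha>. set xs = {\<alpha>} \<and> avars \<alpha> = {} \<and> CQ {|\<alpha>|} \<in> facts A"
proof -
  have "lab p v \<in> rule_of ` T \<union> facts A" using leaf_lab assms lv_verts by blast
  moreover have "rule_of ax \<noteq> CQ \<phi>" for ax \<phi> by (cases ax) auto
  moreover have l: "lab p v = CQ (fset_of_list xs)" using lv_verts[OF assms(1)] by simp
  ultimately have "CQ (fset_of_list xs) \<in> facts A" by (auto simp: image_iff) metis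
  then obtain \<alpha> where \<alpha>: "\<alpha> \<in> A" "fset_of_list xs = {|\<alpha>|}" by (auto simp: facts_def)
  have "set xs = {\<alpha>}" using \<alpha>(2) by (metis bot_fset.rep_eq finsert.rep_eq fset_of_list.rep_eq)
  moreover have "avars \<alpha> = {}" using abox \<alpha>(1) by (fastforce simp: is_abox_def)
  ultimately show ?thesis using \<alpha> by (auto simp: facts_def)
qed

lemma chase_Ind [simp]: "chase tb n (v, Ind a) = Ind a"
  by (induction n) (simp_all add: base_tm_def nxt_def)

lemma tvars_chase [simp]: "tvars (chase tb n x) = {}"
proof -
  have "tvars (foldr Fn fs t) = tvars t" for fs t by (induction fs) auto
  then show ?thesis by (induction n arbitrary: x) (auto simp: base_tm_def split: tm.split)
qed

text \<open>The recursive equation by which \<open>tau\<close> is used. A round of the chase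
  consumes one unit of fuel, so the equation also needs that the value does not depend on the fuel
  once this exceeds the rank of the vertex.\<close>

lemma tau_Var:
  assumes e: "(S, d, j, u) \<in> set le" and d: "(d, LCQ \<rho>, w) \<in> set lv" and z: "z \<in> vars (fset_of_list \<rho>)"
    and o: "orig lv ts S j \<rho> z = (gs, v, t)"
  shows "tau tb lv d (Var z) = foldr Fn gs (tau tb lv v t)"
proof -
  obtain rank where rank: "\<And>S d j u s. (S, d, j, u) \<in> set le \<Longrightarrow> s \<in> set S \<Longrightarrow> rank s < (rank d :: nat)"
    "\<And>v. v \<in> verts p \<Longrightarrow> rank v < length lv" using ex_rank by metis
  \<comment> \<open>By induction on the rank: the origin lies at a vertex of smaller rank, so both
    amounts of fuel drop by one and still exceed it. The induction ends because leaves hold no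
    variables.\<close>
  have stable: "chase tb n (v, t) = chase tb m (v, t)"
    if "flat_tm t" "(v, LCQ xs, w) \<in> set lv" "tvars t \<subseteq> vars (fset_of_list xs)" "rank v < n" "rank v < m"
    for n m v t xs w
    using that
  proof (induction "rank v" arbitrary: v n m t xs w rule: less_induct)
    case less
    show ?case
    proof (cases t)
      case (Var z)
      then have z: "z \<in> vars (fset_of_list xs)" using less.prems(3) by simp
      have "\<exists>S j u. (S, v, j, u) \<in> set le"
      proof (rule ccontr)
        assume "\<nexists>S j u. (S, v, j, u) \<in> set le"
        then obtain \<alpha> where "set xs = {\<alpha>}" "avars \<alpha> = {}" using leaf_fact[OF less.prems(2)] by blast
        then show False using z by (simp add: vars_avars fset_of_list.rep_eq)
      qed
      then obtain S j u where e: "(S, v, j, u) \<in> set le" by blast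
      obtain gs v' t' ys where o: "orig lv ts S j xs z = (gs, v', t')" "v' \<in> set S" "(v', LCQ ys, ()) \<in> set lv"
        "flat_tm t'" "tvars t' \<subseteq> vars (fset_of_list ys)" using orig_ok[OF e less.prems(2) z] by metis
      have nx: "nxt tb (v, t) = (gs, v', t')" using map_of_tb[OF e less.prems(2) z] o by (simp add: nxt_def Var)
      have r: "rank v' < rank v" using rank(1)[OF e o(2)] .
      obtain n' m' where nm: "n = Suc n'" "m = Suc m'" using less.prems(4,5)
        by (cases n; cases m) auto
      have "chase tb n' (v', t') = chase tb m' (v', t')"
        by (rule less.hyps[OF r o(4,3,5)]) (use less.prems(4,5) r nm in linarith)+
      then show ?thesis by (simp add: nm nx)
    qed (use less.prems(1) in simp_all)
  qed
  obtain ys where ys: "v \<in> set S" "(v, LCQ ys, ()) \<in> set lv" "flat_tm t" "tvars t \<subseteq> vars (fset_of_list ys)"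
    using orig_ok[OF e d z] o by auto
  have r: "rank v < rank d" "rank d < length lv" "rank v < length lv"
    using rank(1)[OF e ys(1)] rank(2) lv_verts[OF d] lv_verts[OF ys(2)] by auto
  then obtain n where n: "length lv = Suc n" by (cases "length lv") auto
  have "nxt tb (d, Var z) = (gs, v, t)" using map_of_tb[OF e d z] o by (simp add: nxt_def)
  moreover have "chase tb n (v, t) = chase tb (length lv) (v, t)"
    by (rule stable[OF ys(3,2,4)]) (use r n in simp_all)
  ultimately show ?thesis by (simp add: tau_def n)
qed

lemma tvars_tau [simp]: "tvars (tau tb lv v t) = {}" and tau_Ind [simp]: "tau tb lv v (Ind a) = Ind a"
  by (simp_all add: tau_def)

lemma avars_gat [simp]: "avars (gat tb lv x) = {}"
  by (cases "snd x") (simp_all add: gat_def)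

text \<open>Used for every copied atom: premise and conclusion are instances of one atom, and
  \<open>tau\<close> makes the two substitutions agree.\<close>

lemma gat_asub:
  assumes "\<And>t. t \<in> set_atom \<beta> \<Longrightarrow> flat_tm t" "\<And>y. y \<in> avars \<beta> \<Longrightarrow> tau tb lv d (\<sigma> y) = tau tb lv v (\<sigma>' y)"
  shows "gat tb lv (d, asub \<sigma> \<beta>) = gat tb lv (v, asub \<sigma>' \<beta>)"
proof -
  have "tau tb lv d (tsub \<sigma> t) = tau tb lv v (tsub \<sigma>' t)" if "t \<in> set_atom \<beta>" for t
    using assms(1)[OF that] assms(2) that by (cases t) (force simp: avars_def)+
  then show ?thesis unfolding gat_def asub_def by (simp add: atom.map_comp cong: atom.map_cong)
qed

end

section \<open>The step inferred for each atom\<close>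

lemma find_Some_bexE:
  assumes "\<exists>x\<in>set xs. P x" obtains y where "find P xs = Some y" "y \<in> set xs" "P y"
  using assms find_SomeE by metis

lemma asub_Var [simp]: "asub Var \<alpha> = \<alpha>"
proof -
  have "tsub Var t = t" for t by (induction t) simp_all
  then show ?thesis by (cases \<alpha>) (simp_all add: asub_def)
qed

lemma sk_inf_copy: "avars \<alpha> = {} \<Longrightarrow> sk_inf T q ByC {CQ {|\<alpha>|}} (CQ {|\<alpha>|})"
  using sk_inf.C[of "{|\<alpha>|}" T q] by (simp add: ground_def vars_avars)

lemma set_atom_ratom: "set_atom (ratom R s t) = {s, t}"
  by (cases R) auto

lemma asub_ratom: "asub \<sigma> (ratom R s t) = ratom R (tsub \<sigma> s) (tsub \<sigma> t)"
  by (cases R) (simp_all add: asub_def)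

lemma vx_neq_vy [simp]: "vx \<noteq> vy" "vy \<noteq> vx"
  by (simp_all add: vx_def vy_def)

lemma rule_body_vars: "rule_of ax = Rule \<psi> X \<chi> \<Longrightarrow> vars \<psi> \<subseteq> {vx, vy} \<and> vars \<chi> \<subseteq> {vx, vy}"
proof -
  have r: "avars (ratom R s t) = tvars s \<union> tvars t" for R s t by (cases R) auto
  assume "rule_of ax = Rule \<psi> X \<chi>"
  from this[symmetric] show ?thesis by (cases ax) (auto simp: vars_avars r)
qed

context cq_input
begin

definition good_step :: "name list \<Rightarrow> name \<times> tm atom \<Rightarrow> step \<Rightarrow> bool" where
  "good_step S x st \<longleftrightarrow> set (fst st) \<subseteq> set (keys lv) \<and> (\<forall>y\<in>set (fst st). fst y \<in> set S) \<and>
     length (snd (snd st)) \<le> 1 \<and> (\<forall>r\<in>set (snd (snd st)). ldistinct r \<and> form r \<in> skolem ` T) \<and>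
     sk_inf T q (fst (snd st)) ((\<lambda>y. CQ {|gat tb lv y|}) ` set (fst st) \<union> form ` set (snd (snd st)))
       (CQ {|gat tb lv x|})"

lemma good_copy:
  assumes "v \<in> set S" "(v, LCQ xs, ()) \<in> set lv" "\<beta> \<in> set xs" "gat tb lv x = gat tb lv (v, \<beta>)"
  shows "good_step S x ([(v, \<beta>)], ByC, [])"
  using assms sk_inf_copy[of "gat tb lv (v, \<beta>)" T q] by (auto simp: good_step_def set_keys)

lemma good_copy_asub:
  assumes v: "v \<in> set S" "(v, LCQ xs, ()) \<in> set lv" "asub \<sigma>' \<beta> \<in> set xs"
    and "\<And>t. t \<in> set_atom \<beta> \<Longrightarrow> flat_tm t"
    and "\<And>y. y \<in> avars \<beta> \<Longrightarrow> tau tb lv d (\<sigma> y) = tau tb lv v (\<sigma>' y)"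
  shows "good_step S (d, asub \<sigma> \<beta>) ([(v, asub \<sigma>' \<beta>)], ByC, [])"
  by (rule good_copy[OF v]) (rule gat_asub[OF assms(4,5)])

text \<open>An atom of the conclusion is old, comes from a rule with equal body and head, or comes
  from an axiom. The first two cases are copies, in the second case of the instance of the same atom
  in the body; the third is an (MP) with the Skolemized axiom.\<close>

lemma step_ok_MP:
  assumes e: "(S, d, ByMPe s m, u) \<in> set le" and d: "(d, LCQ \<rho>, w) \<in> set lv" and \<alpha>: "\<alpha> \<in> set \<rho>"
  shows "good_step S (d, \<alpha>) (prem tb lv ts S (ByMPe s m) \<rho> \<alpha>)"
proof -
  obtain v xs a b c where D: "src lv S = (v, xs)" "v \<in> set S" "(v, LCQ xs, ()) \<in> set lv"
    "rsrc lv S = (a, b, c)"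
    "form (LRule a b c) \<in> rule_of ` T \<or> taut_rule (form (LRule a b c))"
    "asub (sub s) ` set a \<subseteq> set xs"
    "inj_on (ren m) (set b)" "ren m ` set b \<inter> set (lvars xs) = {}"
    "set \<rho> \<subseteq> set xs \<union> asub (\<lambda>z. if z \<in> set b then Var (ren m z) else sub s z) ` set c"
    by (rule MPe_data[OF e d])
  let ?\<sigma> = "\<lambda>z. if z \<in> set b then Var (ren m z) else sub s z"
  note O = orig_MPe[OF D(1,4)]
  have \<alpha>v: "avars \<alpha> \<subseteq> vars (fset_of_list \<rho>)" using avars_vars[OF \<alpha>] .
  have old: "tau tb lv d (Var z) = tau tb lv v (Var z)" if "z \<in> avars \<alpha>" "z \<in> set (lvars xs)" for z
    using tau_Var[OF e d _ O(1)[OF that(2)]] \<alpha>v that(1) by auto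
  have SF: "flat_tm (sub s x) \<and> tvars (sub s x) \<subseteq> set (lvars xs)" if x: "x \<in> vars (fset_of_list a)" for x
  proof -
    obtain \<beta> where \<beta>: "\<beta> \<in> set a" "x \<in> avars \<beta>" using x by (auto simp: vars_avars fset_of_list.rep_eq)
    show ?thesis by (rule sub_flat[OF D(3) _ _ \<beta>(2)]) (use \<beta> D(6) rule_flat[OF D(5)] in auto)
  qed
  \<comment> \<open>Confined to variables whose image occurs in \<alpha>, since the values at
    \<open>d\<close> are known only for variables of the conclusion.\<close>
  have old_sub: "tau tb lv d (sub s y) = tau tb lv v (sub s y)"
    if y: "y \<in> vars (fset_of_list a)" "tvars (sub s y) \<subseteq> avars \<alpha>" for y
  proof (cases "sub s y")
    case (Var z)
    then show ?thesis using SF[OF y(1)] y(2) old by simp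
  qed (use SF[OF y(1)] in simp_all)
  have a1: "asub1 \<sigma> \<beta> = asub \<sigma> \<beta>" if "\<beta> \<in> set a \<union> set c" for \<beta> \<sigma>
    using rule_flat[OF D(5) that] by (rule asub1_flat)
  show ?thesis
  proof (cases "\<alpha> \<in> set xs")
    case True
    have "gat tb lv (d, asub Var \<alpha>) = gat tb lv (v, asub Var \<alpha>)"
      by (rule gat_asub) (use lab_flat[OF D(3) True] old avars_vars[OF True] lvars_vars[OF D(3)] in auto)
    then show ?thesis using good_copy[OF D(2,3) True, of "(d, \<alpha>)"] True by (simp add: prem_def D(1))
  next
    case new: False
    then obtain \<beta>0 where \<beta>0: "\<beta>0 \<in> set c" "\<alpha> = asub ?\<sigma> \<beta>0" using D(9) \<alpha> by auto
    show ?thesis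
    proof (cases "set a = set c")
      case True
      have "\<exists>\<beta>\<in>set a. asub1 ?\<sigma> \<beta> = \<alpha>" using \<beta>0 a1 True by auto
      then obtain \<beta> where \<beta>: "find (\<lambda>\<beta>. asub1 ?\<sigma> \<beta> = \<alpha>) a = Some \<beta>" "\<beta> \<in> set a" "asub1 ?\<sigma> \<beta> = \<alpha>"
        by (rule find_Some_bexE)
      have \<alpha>\<beta>: "\<alpha> = asub ?\<sigma> \<beta>" using \<beta> a1 by auto
      have "good_step S (d, asub ?\<sigma> \<beta>) ([(v, asub (sub s) \<beta>)], ByC, [])"
      proof (rule good_copy_asub[OF D(2,3)])
        show "asub (sub s) \<beta> \<in> set xs" using D(6) \<beta>(2) by blast
        show "flat_tm t" if "t \<in> set_atom \<beta>" for t using rule_flat[OF D(5) _ that] \<beta>(2) by blast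
        show "tau tb lv d (?\<sigma> y) = tau tb lv v (sub s y)" if y: "y \<in> avars \<beta>" for y
        proof -
          have sv: "tvars (?\<sigma> y) \<subseteq> avars \<alpha>" using y unfolding \<alpha>\<beta> avars_asub by blast
          show ?thesis
          proof (cases "y \<in> set b")
            case yb: True
            then have "ren m y \<in> vars (fset_of_list \<rho>)" using sv \<alpha>v by auto
            from tau_Var[OF e d this O(2)[OF yb D(7,8) True]] yb show ?thesis by simp
          next
            case False
            then show ?thesis using old_sub[of y] sv avars_vars[OF \<beta>(2)] y by auto
          qed
        qed
      qed
      then show ?thesis using new True \<beta>(1) a1[of \<beta> "sub s"] \<beta>(2)
        by (simp add: prem_def D(1,4) \<alpha>\<beta>[symmetric])
    next
      case ac: False
      obtain ax where ax: "rule_axm ts (a, b, c) = Some ax" "ax \<in> T" "rule_of ax = form (LRule a b c)"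
        by (rule rule_axm_ok[OF D(5) ac])
      \<comment> \<open>The matching of the rule followed by \<open>tau\<close> at the premise. If
        \<open>vy\<close> is absent from the rule, its entry is just some ground term.\<close>
      let ?s' = "[(vx, tau tb lv v (sub s vx)), (vy, tau tb lv v (sub s vy))]"
      have s': "sub ?s' vx = tau tb lv v (sub s vx)" "sub ?s' vy = tau tb lv v (sub s vy)"
        by (simp_all add: sub_def)
      have abv: "vars (fset_of_list a) \<subseteq> {vx, vy}" "vars (fset_of_list c) \<subseteq> {vx, vy}"
        using rule_body_vars ax(3) by auto
      have inst: "asub (sub ?s') \<beta> = gat tb lv (v, asub (sub s) \<beta>)" if \<beta>: "\<beta> \<in> set a \<union> set c" for \<beta>
      proof -
        have "avars \<beta> \<subseteq> {vx, vy}" using abv avars_vars \<beta> by blast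
        then have "tsub (sub ?s') t = tau tb lv v (tsub (sub s) t)" if t: "t \<in> set_atom \<beta>" for t
          using rule_flat[OF D(5) \<beta> t] t s' by (cases t rule: tm.exhaust) (force simp: avars_def)+
        then show ?thesis
          unfolding gat_def asub_def fst_conv snd_conv atom.map_comp comp_def by (rule atom.map_cong0)
      qed
      obtain \<chi> where sk: "skolem ax = Rule (fset_of_list a) {||} \<chi>"
        "gat tb lv (d, \<alpha>) |\<in>| csub (sub ?s') \<chi>" "vars \<chi> \<subseteq> {vx, vy}"
      proof (cases "set b = {}")
        \<comment> \<open>Without bound variables, Skolemization leaves the rule unchanged.\<close>
        case True
        then have b: "fset_of_list b = {||}" by (simp add: fset_of_list_eq_iff[of _ "[]", simplified])
        have sk: "skolem ax = Rule (fset_of_list a) {||} (fset_of_list c)"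
          using ax(3) b by (cases ax) auto
        have al: "\<alpha> = asub (sub s) \<beta>0" using \<beta>0(2) True by simp
        have "gat tb lv (d, asub (sub s) \<beta>0) = gat tb lv (v, asub (sub s) \<beta>0)"
        proof (rule gat_asub)
          show "flat_tm t" if "t \<in> set_atom \<beta>0" for t using rule_flat[OF D(5) _ that] \<beta>0(1) by blast
          show "tau tb lv d (sub s y) = tau tb lv v (sub s y)" if y: "y \<in> avars \<beta>0" for y
          proof (rule old_sub)
            have "vars (fset_of_list c) \<subseteq> vars (fset_of_list a) \<union> fset (fset_of_list b)"
              by (rule rule_vars[of _ _ _ ax]) (simp add: ax(3))
            then show "y \<in> vars (fset_of_list a)" using avars_vars[OF \<beta>0(1)] y b by auto
            show "tvars (sub s y) \<subseteq> avars \<alpha>" using y unfolding al avars_asub by blast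
          qed
        qed
        then have "gat tb lv (d, \<alpha>) = asub (sub ?s') \<beta>0" using inst[of \<beta>0] \<beta>0(1) al by simp
        then have "gat tb lv (d, \<alpha>) |\<in>| csub (sub ?s') (fset_of_list c)"
          using \<beta>0(1) by (simp add: csub_def fset_of_list.rep_eq)
        then show ?thesis using that sk abv by blast
      next
        case False
        then obtain x where xb: "x \<in> set b" by (metis equals0I)
        obtain A1 R1 B1 where E: "ax = ExR A1 R1 B1" "x = vy" "set a = {CA A1 (Var vx)}" "set b = {vy}"
          "set c = {ratom R1 (Var vx) (Var vy), CA B1 (Var vy)}" by (rule ExR_if_bound[OF ax(3) xb])
        let ?f = "Fn (Sk A1 R1 B1) (Var vx)"
        let ?\<chi> = "{|ratom R1 (Var vx) ?f, CA B1 ?f|}"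
        have fa: "fset_of_list a = {|CA A1 (Var vx)|}" using E(3) by (simp add: fset_eq_iff fset_of_list.rep_eq)
        have sk: "skolem ax = Rule (fset_of_list a) {||} ?\<chi>" by (simp add: E(1) Let_def fa)
        have va: "vx \<in> vars (fset_of_list a)" by (simp add: fa vars_avars)
        have "\<beta>0 = ratom R1 (Var vx) (Var vy) \<or> \<beta>0 = CA B1 (Var vy)" using \<beta>0(1) E(5) by simp
        then have "vy \<in> avars \<beta>0" by (elim disjE; cases R1) simp_all
        then have "ren m vy \<in> avars \<alpha>" unfolding \<beta>0(2) avars_asub using E(4) by force
        \<comment> \<open>The term assigned to the new variable is the very Skolem term that the
          head of the Skolemized axiom yields.\<close>
        then have ty: "tau tb lv d (Var (ren m vy)) = Fn (Sk A1 R1 B1) (tau tb lv v (sub s vx))"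
          using tau_Var[OF e d _ O(3)[OF _ D(7,8) ac ax(1)[unfolded E(1)], of vy]] \<alpha>v E(4) by auto
        consider "\<beta>0 = ratom R1 (Var vx) (Var vy)" | "\<beta>0 = CA B1 (Var vy)" using \<beta>0(1) E(5) by auto
        then have "gat tb lv (d, \<alpha>) |\<in>| csub (sub ?s') ?\<chi>"
        proof cases
          case 1
          have al: "\<alpha> = ratom R1 (sub s vx) (Var (ren m vy))" using \<beta>0(2) 1 E(4) by (simp add: asub_ratom)
          have "tvars (sub s vx) \<subseteq> avars \<alpha>" unfolding al by (cases R1) auto
          then have tx: "tau tb lv d (sub s vx) = tau tb lv v (sub s vx)" using old_sub va by blast
          have "gat tb lv (d, \<alpha>) = ratom R1 (tau tb lv d (sub s vx)) (tau tb lv d (Var (ren m vy)))"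
            unfolding al gat_def by (cases R1) simp_all
          then have "gat tb lv (d, \<alpha>) = asub (sub ?s') (ratom R1 (Var vx) ?f)"
            by (simp add: tx ty asub_ratom s')
          then show ?thesis by (simp add: csub_def)
        next
          case 2
          have al: "\<alpha> = CA B1 (Var (ren m vy))" using \<beta>0(2) 2 E(4) by (simp add: asub_def)
          have "gat tb lv (d, \<alpha>) = asub (sub ?s') (CA B1 ?f)"
            unfolding al gat_def by (simp add: ty asub_def s')
          then show ?thesis by (simp add: csub_def)
        qed
        moreover have "vars ?\<chi> \<subseteq> {vx, vy}" by (cases R1) (simp_all add: vars_avars)
        ultimately show ?thesis using that sk by blast
      qed
      have gr: "ground (csub (sub ?s') \<phi>)" if "vars \<phi> \<subseteq> {vx, vy}" for \<phi>
        using that s' unfolding ground_def vars_csub by fastforce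
      have "sk_inf T q (ByMP ?s') (insert (skolem ax) {CQ {|\<beta>|} |\<beta>. \<beta> |\<in>| csub (sub ?s') (fset_of_list a)})
          (CQ {|gat tb lv (d, \<alpha>)|})"
        by (rule sk_inf.MP[OF ax(2) sk(1) gr[OF abv(1)] gr[OF sk(3)] sk(2)])
      moreover have "{CQ {|\<beta>|} |\<beta>. \<beta> |\<in>| csub (sub ?s') (fset_of_list a)} =
          (\<lambda>y. CQ {|gat tb lv y|}) ` set (map (\<lambda>\<beta>. (v, asub1 (sub s) \<beta>)) a)"
        using inst a1 by (force simp: csub_def fset_of_list.rep_eq)
      moreover have "set (map (\<lambda>\<beta>. (v, asub1 (sub s) \<beta>)) a) \<subseteq> set (keys lv)"
      proof
        fix y assume "y \<in> set (map (\<lambda>\<beta>. (v, asub1 (sub s) \<beta>)) a)"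
        then obtain \<beta> where \<beta>: "\<beta> \<in> set a" "y = (v, asub1 (sub s) \<beta>)" by auto
        then have "asub1 (sub s) \<beta> \<in> set xs" using D(6) a1[of \<beta>] by auto
        then show "y \<in> set (keys lv)" unfolding \<beta>(2) set_keys using D(3) by blast
      qed
      ultimately show ?thesis using new ac ax D(2)
        by (auto simp: prem_def D(1,4) good_step_def)
    qed
  qed
qed

lemma step_ok:
  assumes e: "(S, d, j, u) \<in> set le" and d: "(d, LCQ \<rho>, w) \<in> set lv" and \<alpha>: "\<alpha> \<in> set \<rho>"
  shows "good_step S (d, \<alpha>) (prem tb lv ts S j \<rho> \<alpha>)"
proof (cases j)
  case (ByMPe s m)
  then show ?thesis using step_ok_MP[OF e[unfolded ByMPe] d \<alpha>] by simp
next
  case ByTe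
  then show ?thesis using edge_inf[OF e] lv_verts[OF d] by (auto elim!: cq_inf.cases taut_rule.cases)
next
  case (ByEe t1 t2)
  obtain v xs where D: "src lv S = (v, xs)" "v \<in> set S" "(v, LCQ xs, ()) \<in> set lv"
      "EqA t1 t2 \<in> set xs" "\<forall>\<beta>\<in>set \<rho>. \<exists>\<alpha>\<in>set xs. repl t1 t2 \<alpha> \<beta>"
    by (rule Ee_data[OF e[unfolded ByEe] d])
  obtain \<beta> where \<beta>: "find (\<lambda>\<beta>. repl t1 t2 \<beta> \<alpha>) xs = Some \<beta>" "\<beta> \<in> set xs" "repl t1 t2 \<beta> \<alpha>"
    by (rule find_Some_bexE[OF bspec[OF D(5) \<alpha>]])
  \<comment> \<open>Under (E_e) every variable keeps its term, so the replacement carries over,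
    position by position, to the ground atoms.\<close>
  have O: "orig lv ts S j \<rho> z = ([], v, Var z)" for z by (simp add: orig_def ByEe D(1))
  have tau: "tau tb lv d t = tau tb lv v t" if "t \<in> set_atom \<alpha>" for t
  proof (cases t)
    case (Var z)
    then have "z \<in> vars (fset_of_list \<rho>)" using that avars_vars[OF \<alpha>] by (force simp: avars_def)
    from tau_Var[OF e d this O] show ?thesis by (simp add: Var)
  qed (use lab_flat[OF d \<alpha> that] in simp_all)
  let ?t = "tau tb lv v"
  have "repl (?t t1) (?t t2) (gat tb lv (v, \<beta>)) (gat tb lv (d, \<alpha>))"
    using \<beta>(3) tau by (cases \<alpha>; cases \<beta>) (auto simp: repl_def gat_def)
  moreover have "ground {|gat tb lv (v, \<beta>), EqA (?t t1) (?t t2)|}" by (simp add: ground_def vars_avars)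
  ultimately have "sk_inf T q (ByE (?t t1) (?t t2)) {CQ {|gat tb lv (v, \<beta>)|}, CQ {|EqA (?t t1) (?t t2)|}}
      (CQ {|gat tb lv (d, \<alpha>)|})" by (intro sk_inf.E)
  moreover have "gat tb lv (v, EqA t1 t2) = EqA (?t t1) (?t t2)" by (simp add: gat_def)
  ultimately show ?thesis using D \<beta> by (auto simp: prem_def ByEe good_step_def set_keys)
next
  case (ByCe m)
  obtain v xs v' ys where D: "ce_src lv S m \<rho> = ((v, xs), (v', ys))" "v \<in> set S" "(v, LCQ xs, ()) \<in> set lv"
    "v' \<in> set S" "(v', LCQ ys, ()) \<in> set lv"
    "set \<rho> = set xs \<union> asub (\<lambda>z. Var (ren m z)) ` set ys"
    "inj_on (ren m) (set (lvars ys))" "ren m ` set (lvars ys) \<inter> set (lvars xs) = {}"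
    by (rule Ce_data[OF e[unfolded ByCe] d])
  have \<alpha>v: "avars \<alpha> \<subseteq> vars (fset_of_list \<rho>)" using avars_vars[OF \<alpha>] .
  show ?thesis
  proof (cases "\<alpha> \<in> set xs")
    case True
    have "gat tb lv (d, asub Var \<alpha>) = gat tb lv (v, asub Var \<alpha>)"
    proof (rule gat_asub)
      show "tau tb lv d (Var z) = tau tb lv v (Var z)" if "z \<in> avars \<alpha>" for z
      proof -
        have "z \<in> set (lvars xs)" using that avars_vars[OF True] lvars_vars[OF D(3)] by blast
        from tau_Var[OF e[unfolded ByCe] d _ orig_Ce(1)[OF D(1) this]] show ?thesis using that \<alpha>v by auto
      qed
    qed (rule lab_flat[OF D(3) True])
    then show ?thesis using good_copy[OF D(2,3) True, of "(d, \<alpha>)"] True by (simp add: prem_def ByCe D(1))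
  next
    case False
    have a1: "asub1 \<sigma> \<beta> = asub \<sigma> \<beta>" if "\<beta> \<in> set ys" for \<beta> \<sigma>
      using lab_flat[OF D(5) that] by (rule asub1_flat)
    have "\<exists>\<beta>\<in>set ys. asub1 (\<lambda>z. Var (ren m z)) \<beta> = \<alpha>" using False D(6) \<alpha> a1 by force
    then obtain \<beta> where \<beta>: "find (\<lambda>\<beta>. asub1 (\<lambda>z. Var (ren m z)) \<beta> = \<alpha>) ys = Some \<beta>" "\<beta> \<in> set ys"
        "asub1 (\<lambda>z. Var (ren m z)) \<beta> = \<alpha>" by (rule find_Some_bexE)
    have al: "\<alpha> = asub (\<lambda>z. Var (ren m z)) \<beta>" using \<beta> a1 by simp
    have "good_step S (d, asub (\<lambda>z. Var (ren m z)) \<beta>) ([(v', asub Var \<beta>)], ByC, [])"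
    proof (rule good_copy_asub[OF D(4,5)])
      show "tau tb lv d (Var (ren m y)) = tau tb lv v' (Var y)" if y: "y \<in> avars \<beta>" for y
      proof -
        have "y \<in> set (lvars ys)" using y avars_vars[OF \<beta>(2)] lvars_vars[OF D(5)] by blast
        moreover have "ren m y \<in> vars (fset_of_list \<rho>)" using y \<alpha>v unfolding al avars_asub by auto
        ultimately show ?thesis using tau_Var[OF e[unfolded ByCe] d _ orig_Ce(2)[OF D(1) _ D(7,8)]] by simp
      qed
    qed (use \<beta>(2) lab_flat[OF D(5) \<beta>(2)] in simp_all)
    then show ?thesis using False \<beta>(1) by (simp add: prem_def ByCe D(1) al[symmetric])
  qed
next
  case (ByGe s)
  obtain v xs where D: "src lv S = (v, xs)" "v \<in> set S" "(v, LCQ xs, ()) \<in> set lv"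
      "set xs = asub (ind_sub s) ` set \<rho>" by (rule Ge_data[OF e[unfolded ByGe] d])
  have O: "orig lv ts S j \<rho> z = ([], v, ind_sub s z)" for z by (simp add: orig_def ByGe D(1))
  have fl: "flat_tm t" if "t \<in> set_atom \<alpha>" for t by (rule lab_flat[OF d \<alpha> that])
  have "good_step S (d, asub Var \<alpha>) ([(v, asub (ind_sub s) \<alpha>)], ByC, [])"
  proof (rule good_copy_asub[OF D(2,3) _ fl])
    show "asub (ind_sub s) \<alpha> \<in> set xs" using D(4) \<alpha> by blast
    show "tau tb lv d (Var y) = tau tb lv v (ind_sub s y)" if "y \<in> avars \<alpha>" for y
      using tau_Var[OF e d _ O] avars_vars[OF \<alpha>] that by auto
  qed
  then show ?thesis using asub1_flat[OF fl] by (simp add: prem_def ByGe D(1))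
qed

lemma length_prems: "length (prems tb lv le ts x) \<le> 1"
proof -
  have "length (filter (\<lambda>e. f e = d) es) \<le> 1" if "distinct (map f es)" for f d and es :: "'z list"
    using that by (induction es) (auto simp: filter_empty_conv image_iff)
  from this[of "\<lambda>e. fst (snd e)" le "fst x"] show ?thesis
    using distinct_le by (simp add: prems_def case_prod_unfold)
qed

lemma prems_good:
  assumes "x \<in> set (keys lv)" "st \<in> set (prems tb lv le ts x)"
  obtains S j u where "(S, fst x, j, u) \<in> set le" "good_step S x st"
proof -
  obtain d \<alpha> where x: "x = (d, \<alpha>)" by (cases x)
  obtain xs u where xs: "(d, LCQ xs, u) \<in> set lv" "\<alpha> \<in> set xs" using assms(1) unfolding x set_keys by blast
  obtain S j u where e: "(S, d, j, u) \<in> set le" "st = prem tb lv ts S j (latoms lv d) \<alpha>"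
    using assms(2) by (auto simp: prems_def x)
  then show ?thesis using that[of S j u] step_ok[OF e(1) xs] latoms[OF xs(1)] x by simp
qed

lemma to_sk_correct:
  "sk_proof T A q (mkproof (to_sk ((lv, le), ts))) \<and>
    repr (mkproof (to_sk ((lv, le), ts))) (to_sk ((lv, le), ts))"
proof -
  let ?K = "keys lv" and ?g = "gat tb lv" and ?pf = "prems tb lv le ts"
  obtain f where f: "(sink_vertex lv le, f, ()) \<in> set lv" "form f = CQ q" by (rule sink)
  then obtain lq where lq: "f = LCQ lq" "fset_of_list lq = q" by (cases f) auto
  let ?v = "sink_vertex lv le"
  have vlq: "(?v, LCQ lq, ()) \<in> set lv" using f lq by simp
  \<comment> \<open>The variables of the query receive their terms at the sink, whose label is the
    query itself.\<close>
  let ?s = "map (\<lambda>z. (z, tau tb lv ?v (Var z))) (lvars lq)"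
  obtain rank where rank: "\<And>S d j u s. (S, d, j, u) \<in> set le \<Longrightarrow> s \<in> set S \<Longrightarrow> rank s < (rank d :: nat)"
    "\<And>v. v \<in> verts p \<Longrightarrow> rank v < length lv" using ex_rank by metis
  have qK: "(?v, \<alpha>) \<in> set ?K" if "\<alpha> \<in> set lq" for \<alpha> using vlq that by (auto simp: set_keys)
  have sq: "asub (sub ?s) \<alpha> = ?g (?v, \<alpha>)" if \<alpha>: "\<alpha> \<in> set lq" for \<alpha>
  proof -
    have "tsub (sub ?s) t = tau tb lv ?v t" if t: "t \<in> set_atom \<alpha>" for t
    proof (cases t)
      case (Var z)
      then have "z \<in> set (lvars lq)"
        using t avars_vars[OF \<alpha>] lvars_vars[OF vlq] by (force simp: avars_def)
      then show ?thesis by (simp add: Var sub_def map_of_map_restrict)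
    qed (use lab_flat[OF vlq \<alpha> t] in simp_all)
    then show ?thesis unfolding gat_def asub_def fst_conv snd_conv by (rule atom.map_cong0)
  qed
  have "proof_in (sk_inf T q) (skolem ` T \<union> facts A) q (mkproof (sk_verts ?K ?g ?pf lq, sk_edges ?K ?pf ?s)) \<and>
      repr (mkproof (sk_verts ?K ?g ?pf lq, sk_edges ?K ?pf ?s)) (sk_verts ?K ?g ?pf lq, sk_edges ?K ?pf ?s)"
  proof (rule sk_assemble[where rank = rank and N = "length lv"])
    show "distinct ?K" using distinct_keys[OF distinct_lv] lv_verts by blast
    have "lq \<noteq> []" using bq lq(2) by (auto simp: bcq_def)
    then show "?K \<noteq> []" using qK[of "hd lq"] by (auto simp: hd_in_set)
    show "rank (fst x) < length lv" if "x \<in> set ?K" for x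
    proof -
      have "(fst x, snd x) \<in> set ?K" using that by simp
      then show ?thesis unfolding set_keys using rank(2) lv_verts by blast
    qed
    show "length (?pf x) \<le> 1" for x by (rule length_prems)
    show "set pr \<subseteq> set ?K \<and> (\<forall>y\<in>set pr. rank (fst y) < rank (fst x)) \<and> length rs \<le> 1 \<and>
      (\<forall>r\<in>set rs. ldistinct r \<and> form r \<in> skolem ` T \<union> facts A) \<and>
      sk_inf T q j ((\<lambda>y. CQ {|?g y|}) ` set pr \<union> form ` set rs) (CQ {|?g x|})"
      if x: "x \<in> set ?K" "(pr, j, rs) \<in> set (?pf x)" for x pr j rs
    proof -
      obtain S j' u where e: "(S, fst x, j', u) \<in> set le" "good_step S x (pr, j, rs)"
        by (rule prems_good[OF x])
      then show ?thesis using rank(1)[OF e(1)] unfolding good_step_def fst_conv snd_conv by blast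
    qed
    show "CQ {|?g x|} \<in> skolem ` T \<union> facts A" if x: "x \<in> set ?K" "?pf x = []" for x
    proof -
      obtain d \<alpha> where x': "x = (d, \<alpha>)" by (cases x)
      obtain xs u where xs: "(d, LCQ xs, u) \<in> set lv" "\<alpha> \<in> set xs" using x(1) unfolding x' set_keys by blast
      have "(S, d, j, u) \<notin> set le" for S j u using x(2) by (auto simp: prems_def filter_empty_conv x')
      from leaf_fact[OF xs(1) this] have \<alpha>: "avars \<alpha> = {}" "CQ {|\<alpha>|} \<in> facts A" using xs(2) by auto
      have "tau tb lv d t = t" if t: "t \<in> set_atom \<alpha>" for t
      proof (cases t)
        case (Var z)
        then show ?thesis using \<alpha>(1) t by (force simp: avars_def)
      qed (use lab_flat[OF xs t] in simp_all)
      then have "?g x = map_atom id \<alpha>" unfolding gat_def x' fst_conv snd_conv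
        by (intro atom.map_cong0) simp
      then show ?thesis using \<alpha>(2) by (simp add: atom.map_id)
    qed
    show "ground {|?g x|}" for x by (simp add: ground_def vars_avars)
    show "distinct lq" using lv_verts[OF vlq] by simp
    show "fset_of_list lq = q" by (rule lq(2))
    show "fset (csub (sub ?s) q) \<subseteq> ?g ` set ?K"
      unfolding lq(2)[symmetric] fset_csub using sq qK by auto
  qed
  moreover have "to_sk ((lv, le), ts) = (sk_verts ?K ?g ?pf lq, sk_edges ?K ?pf ?s)"
    by (simp add: to_sk_def Let_def latoms[OF vlq] tb_def)
  ultimately show ?thesis by (simp add: sk_proof_def)
qed

end

theorem cq_to_sk: "polytime_transformable cq_proof enc_cq_just sk_proof enc_sk_just"
  unfolding enc_cq_just_inst[symmetric] enc_sk_just_inst[symmetric]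
proof (rule polytime_transformableI[OF pt_to_sk])
  fix T A q and p :: "cq_just hproof" and l ts
  assume "is_abox A" "bcq q" "cq_proof T A q p" "repr p l" "set ts = T"
  then interpret cq_input T A q p "fst l" "snd l" ts
    by unfold_locales (simp_all add: cq_proof_def)
  show "\<exists>p'. sk_proof T A q p' \<and> repr p' (to_sk (l, ts))" using to_sk_correct by auto
qed

section \<open>From Skolemized proofs to tree proofs on conjunctive queries\<close>

subsection \<open>Linear proofs\<close>

text \<open>An instruction \<open>(new, j, side)\<close> extends the current CQ by the atoms \<open>new\<close>, by an inference
  justified by \<open>j\<close> whose further premises are \<open>side\<close>. Instructions are listed in reverse order, so
  that the states of a computation are the nonempty suffixes of the list.\<close>

type_synonym instr = "tm atom list \<times> cq_just \<times> lformula list"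

definition known :: "instr list \<Rightarrow> tm atom list" where
  "known r = remdups (concat (map fst r))"

lemma set_known: "set (known r) = (\<Union>e\<in>set r. set (fst e))"
  by (auto simp: known_def)

lemma known_Cons: "fset_of_list (known (e # r)) = fset_of_list (known r) |\<union>| fset_of_list (fst e)"
  by (auto simp: fset_eq_iff fset_of_list.rep_eq set_known)

definition chain_name :: "bool \<times> bool \<Rightarrow> instr list \<Rightarrow> name" where
  "chain_name k r = name_of (k, r)"

lemma chain_name_eq_iff [simp]: "chain_name k r = chain_name k' r' \<longleftrightarrow> k = k' \<and> r = r'"
  by (simp add: chain_name_def)

abbreviation "state_vertex \<equiv> chain_name (False, False)"
abbreviation "side_vertex \<equiv> chain_name (False, True)"
abbreviation "taut_vertex \<equiv> chain_name (True, False) []"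
abbreviation "goal_vertex \<equiv> chain_name (True, True) []"

text \<open>An instruction that adds no atom is turned into a copy, by (G_e) with the empty
  substitution. For an existential rule this is forced: once its variable occurs, repeating the rule
  with the same variable would violate freshness.\<close>

definition redundant :: "instr list \<Rightarrow> bool" where
  "redundant r \<longleftrightarrow> set (case r of [] \<Rightarrow> [] | e # r' \<Rightarrow> fst e) \<subseteq>
     set (case r of [] \<Rightarrow> [] | e # r' \<Rightarrow> concat (map fst r'))"

definition tail :: "instr list \<Rightarrow> instr list" where
  "tail r = (case r of [] \<Rightarrow> [] | e # r' \<Rightarrow> r')"

text \<open>The initial state is a leaf labelled with a fact, so it has no side premises, just as a
  redundant instruction has none.\<close>

definition sides :: "instr list \<Rightarrow> lformula list" where
  "sides r = (if redundant r \<or> tail r = [] then [] else case r of [] \<Rightarrow> [] | e # r' \<Rightarrow> snd (snd e))"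

definition chain_just :: "instr list \<Rightarrow> cq_just" where
  "chain_just r = (if redundant r then ByGe [] else case r of [] \<Rightarrow> ByGe [] | e # r' \<Rightarrow> fst (snd e))"

definition chain_verts :: "instr list \<Rightarrow> tm atom list \<Rightarrow> (name \<times> lformula \<times> unit) list" where
  "chain_verts L lq =
     map (\<lambda>r. (state_vertex r, LCQ (known r), ())) (tails L) @
     concat (map (\<lambda>r. map (\<lambda>f. (side_vertex r, f, ())) (sides r)) (tails L)) @
     [(taut_vertex, LRule (remdups (lq @ known L)) (remdups (lvars lq)) (remdups (lq @ known L)), ()),
      (goal_vertex, LCQ lq, ())]"

definition chain_edges :: "instr list \<Rightarrow> (name \<times> tm) list \<Rightarrow> (name list \<times> name \<times> cq_just \<times> unit) list" where
  "chain_edges L s =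
     map (\<lambda>r. (state_vertex (tail r) # map (\<lambda>f. side_vertex r) (sides r), state_vertex r, chain_just r, ()))
       (filter (\<lambda>r. tail r \<noteq> []) (tails L)) @
     [([], taut_vertex, ByTe, ()), ([state_vertex L, taut_vertex], goal_vertex, ByMPe s [], ())]"

lemma set_tails: "r \<in> set (tails L) \<longleftrightarrow> r \<noteq> [] \<and> (\<exists>zs. L = zs @ r)"
  by (induction L) (auto simp: Cons_eq_append_conv)

lemma distinct_tails: "distinct (tails L)"
proof (induction L)
  case (Cons x L)
  then show ?case by (auto simp: set_tails)
qed simp

lemma tails_eqI:
  assumes "r \<in> set (tails L)" "r' \<in> set (tails L)" "length r = length r'" shows "r = r'"
  using assms by (auto simp: set_tails)

text \<open>The shape of the result for an arbitrary list of instructions. A state is a premise of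
  the next state only (the last one of the goal), and side premises are leaves named after the state
  they serve; hence the tree. An instruction has to be an inference only where it adds an
  atom.\<close>

lemma chain_assemble:
  assumes L: "L \<noteq> []"
    and base: "\<And>zs e. L = zs @ [e] \<Longrightarrow> CQ (fset_of_list (fst e)) \<in> U"
    and step: "\<And>zs e r. L = zs @ e # r \<Longrightarrow> r \<noteq> [] \<Longrightarrow> \<not> set (fst e) \<subseteq> set (known r) \<Longrightarrow>
      length (snd (snd e)) \<le> 1 \<and> (\<forall>f\<in>set (snd (snd e)). form f \<in> U \<and> ldistinct f) \<and>
      cq_inf T (fst (snd e)) (insert (CQ (fset_of_list (known r))) (form ` set (snd (snd e))))
        (CQ (fset_of_list (known (e # r))))"
    and bcq: "\<And>zs r. L = zs @ r \<Longrightarrow> r \<noteq> [] \<Longrightarrow> bcq (fset_of_list (known r))"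
    and lq: "distinct lq" "fset_of_list lq = q" "bcq q"
    and fresh: "set (lvars lq) \<inter> vars (fset_of_list (known L)) = {}"
    and s: "fst ` set s \<subseteq> set (lvars lq)" "asub (sub s) ` set lq \<subseteq> set (known L)"
  defines "l \<equiv> (chain_verts L lq, chain_edges L s)"
  shows "proof_in (cq_inf T) U q (mkproof l) \<and> is_tree (mkproof l) \<and> repr (mkproof l) l"
proof -
  let ?lv = "chain_verts L lq" and ?le = "chain_edges L s"
  have tail_lt: "length (tail r) < length r" if "r \<in> set (tails L)" for r
    by (cases r) (use that in \<open>auto simp: set_tails tail_def\<close>)
  have tail_in: "tail r \<in> set (tails L)" if r: "r \<in> set (tails L)" "tail r \<noteq> []" for r
  proof -
    obtain zs e r' where "L = zs @ r" "r = e # r'"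
      using r(1) unfolding set_tails by (metis neq_Nil_conv)
    then have "L = (zs @ [e]) @ tail r" by (simp add: tail_def)
    then show ?thesis using r(2) unfolding set_tails by blast
  qed
  have L_in: "L \<in> set (tails L)" using L by (auto simp: set_tails)
  have step': "length (sides r) \<le> 1 \<and> (\<forall>f\<in>set (sides r). form f \<in> U \<and> ldistinct f \<and> tail r \<noteq> []) \<and>
      (tail r \<noteq> [] \<longrightarrow> cq_inf T (chain_just r) (insert (CQ (fset_of_list (known (tail r)))) (form ` set (sides r)))
        (CQ (fset_of_list (known r))))" if r: "r \<in> set (tails L)" for r
  proof -
    obtain zs e r' where E: "L = zs @ e # r'" "r = e # r'"
      using r unfolding set_tails by (metis neq_Nil_conv)
    show ?thesis
    proof (cases "redundant r \<or> r' = []")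
      case True
      have "cq_inf T (ByGe []) {CQ (fset_of_list (known r'))} (CQ (fset_of_list (known r)))"
        if "redundant r" "r' \<noteq> []"
      proof -
        have "set (known r) = set (known r')" using that(1) by (auto simp: redundant_def E(2) set_known)
        then have k: "fset_of_list (known r) = fset_of_list (known r')" by (simp add: fset_of_list_eq_iff)
        have b: "bcq (fset_of_list (known r'))" using bcq[of "zs @ [e]" r'] E that by simp
        have "ind_sub [] = Var" by (auto simp: ind_sub_def)
        then have "csub (ind_sub []) \<phi> = \<phi>" for \<phi> by (simp add: csub_def fset_eq_iff image_iff)
        then show ?thesis unfolding k using cq_inf.Ge[OF b b] by simp
      qed
      then show ?thesis using True by (auto simp: sides_def chain_just_def E(2) tail_def)
    next
      case False
      then have "\<not> set (fst e) \<subseteq> set (known r')" by (auto simp: redundant_def E(2) set_known)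
      from step[OF E(1) _ this] False show ?thesis
        by (simp add: sides_def chain_just_def E(2) tail_def)
    qed
  qed
  have dv: "distinct (map fst ?lv)"
  proof -
    have "distinct (map fst (concat (map (\<lambda>r. map (\<lambda>f. (side_vertex r, f, ())) (sides r)) (tails L))))"
      by (rule distinct_concat_singletons[where k = side_vertex])
        (use distinct_tails step' in \<open>auto simp: inj_def\<close>)
    moreover have "distinct (map state_vertex (tails L))" using distinct_tails by (simp add: distinct_map inj_on_def)
    ultimately show ?thesis by (auto simp: chain_verts_def comp_def)
  qed
  have de: "distinct (map (\<lambda>(S, d, j, u). d) ?le)"
  proof -
    have "distinct (map state_vertex (filter (\<lambda>r. tail r \<noteq> []) (tails L)))"
      using distinct_tails[of L] by (simp add: distinct_map inj_on_def)
    then show ?thesis by (auto simp: chain_edges_def comp_def)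
  qed
  have dv': "distinct (map fst (fst l))" using dv by (simp add: l_def)
  have edge: "(\<exists>r. r \<in> set (tails L) \<and> tail r \<noteq> [] \<and> d = state_vertex r \<and> j = chain_just r \<and>
        S = state_vertex (tail r) # map (\<lambda>f. side_vertex r) (sides r)) \<or>
      (S = [] \<and> d = taut_vertex \<and> j = ByTe) \<or>
      (S = [state_vertex L, taut_vertex] \<and> d = goal_vertex \<and> j = ByMPe s [])"
    if mem: "(S, d, j, u) \<in> set (snd l)" for S d j u
    using mem unfolding l_def snd_conv chain_edges_def by auto
  have vert: "(\<exists>r. r \<in> set (tails L) \<and> v = state_vertex r \<and> f = LCQ (known r)) \<or>
      (\<exists>r. r \<in> set (tails L) \<and> v = side_vertex r \<and> f \<in> set (sides r)) \<or>
      (v = taut_vertex \<and> f = LRule (remdups (lq @ known L)) (remdups (lvars lq)) (remdups (lq @ known L))) \<or>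
      (v = goal_vertex \<and> f = LCQ lq)"
    if mem: "(v, f, u) \<in> set (fst l)" for v f u
    using mem unfolding l_def fst_conv chain_verts_def by auto
  have v1: "(state_vertex r, LCQ (known r), ()) \<in> set (fst l)" if "r \<in> set (tails L)" for r
    using that by (auto simp: l_def chain_verts_def)
  have v2: "(side_vertex r, f, ()) \<in> set (fst l)" if "r \<in> set (tails L)" "f \<in> set (sides r)" for r f
    using that by (auto simp: l_def chain_verts_def)
  have v3: "(taut_vertex, LRule (remdups (lq @ known L)) (remdups (lvars lq)) (remdups (lq @ known L)), ()) \<in> set (fst l)"
    "(goal_vertex, LCQ lq, ()) \<in> set (fst l)"
    by (auto simp: l_def chain_verts_def)
  have w1: "state_vertex r \<in> fst ` set (fst l)" if "r \<in> set (tails L)" for r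
    using v1[OF that] by (rule image_eqI[rotated]) simp
  have w2: "side_vertex r \<in> fst ` set (fst l)" if "r \<in> set (tails L)" "f \<in> set (sides r)" for r f
    using v2[OF that] by (rule image_eqI[rotated]) simp
  have w3: "taut_vertex \<in> fst ` set (fst l)" "goal_vertex \<in> fst ` set (fst l)"
    using v3 by (auto intro: image_eqI[rotated])
  have e1: "(state_vertex (tail r) # map (\<lambda>f. side_vertex r) (sides r), state_vertex r, chain_just r, ()) \<in> set (snd l)"
    if "r \<in> set (tails L)" "tail r \<noteq> []" for r using that by (auto simp: l_def chain_edges_def)
  have e3: "([], taut_vertex, ByTe, ()) \<in> set (snd l)"
    "([state_vertex L, taut_vertex], goal_vertex, ByMPe s [], ()) \<in> set (snd l)"
    by (auto simp: l_def chain_edges_def)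
  have L1: "lab (mkproof l) (state_vertex r) = CQ (fset_of_list (known r))" if "r \<in> set (tails L)" for r
    using lab_mkproof[OF dv' v1[OF that]] by simp
  have L2: "lab (mkproof l) (side_vertex r) = form f" if "r \<in> set (tails L)" "f \<in> set (sides r)" for r f
    using lab_mkproof[OF dv' v2[OF that]] by simp
  let ?B = "q |\<union>| fset_of_list (known L)"
  have FB: "fset_of_list (lq @ known L) = ?B"
    using lq(2) by (auto simp: fset_eq_iff fset_of_list.rep_eq)
  let ?X = "fset_of_list (lvars lq)"
  have L3: "lab (mkproof l) taut_vertex = Rule ?B ?X ?B" "lab (mkproof l) goal_vertex = CQ q"
    using lab_mkproof[OF dv'] v3 FB lq(2) by fastforce+
  have bL: "bcq (fset_of_list (known L))" using bcq[of "[]" L] L by simp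
  have X: "fset ?X = vars q" using set_lvars[of lq] lq by (simp add: fset_of_list.rep_eq)
  have vB: "fset ?X \<subseteq> vars ?B" unfolding X by (rule vars_mono) simp
  have taut: "taut_rule (Rule ?B ?X ?B)" by (intro taut_rule.intros bcq_funion lq(3) bL vB)
  \<comment> \<open>Let \<Phi> be the last CQ. The body, \<open>q\<close> together with \<Phi>, is
    matched by \<open>s\<close>, which sends \<open>q\<close> into \<Phi> and fixes \<Phi>. The body
    instance is thus all of \<Phi>, so all of it may be removed. In the head the variables of
    \<open>q\<close> are bound and renamed to themselves, so \<open>q\<close> appears there
    literally and is kept alone. With \<open>q\<close> as the whole body, the atoms of \<Phi>
    outside its image would remain.\<close>
  have goal: "cq_inf T (ByMPe s []) {CQ (fset_of_list (known L)), Rule ?B ?X ?B} (CQ q)"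
  proof -
    have ren: "ren [] = id" by (auto simp: ren_def)
    \<comment> \<open>The domain of \<open>s\<close> consists of variables of the query, and by
      \<open>fresh\<close> these do not occur in the CQ.\<close>
    have sub_id: "asub (sub s) \<alpha> = \<alpha>" if "\<alpha> \<in> set (known L)" for \<alpha>
    proof -
      have "tsub (sub s) t = tsub Var t" if t: "t \<in> set_atom \<alpha>" for t
      proof -
        have "tvars t \<subseteq> vars (fset_of_list (known L))"
          using avars_vars[OF \<open>\<alpha> \<in> set (known L)\<close>] t by (auto simp: avars_def)
        then have "\<forall>x\<in>tvars t. x \<notin> fst ` set s" using fresh s(1) by blast
        then show ?thesis
          by (induction t) (auto simp: sub_def split: option.split dest: map_of_SomeD intro: rev_image_eqI)
      qed
      then have "asub (sub s) \<alpha> = asub Var \<alpha>" unfolding asub_def by (rule atom.map_cong0)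
      then show ?thesis by simp
    qed
    have cB: "csub (sub s) ?B = fset_of_list (known L)"
    proof -
      have "asub (sub s) ` set (known L) = set (known L)" using sub_id by force
      then have "asub (sub s) ` set (lq @ known L) = set (known L)" using s(2) by (auto simp: image_Un)
      then have "fset (csub (sub s) ?B) = fset (fset_of_list (known L))"
        unfolding FB[symmetric] fset_csub by (simp add: fset_of_list.rep_eq)
      then show ?thesis by (simp add: fset_inject)
    qed
    let ?\<chi> = "csub (\<lambda>z. if z |\<in>| ?X then Var (ren [] z) else sub s z) ?B"
    have "q |\<subseteq>| ?\<chi>"
    proof
      fix \<alpha> assume \<alpha>: "\<alpha> |\<in>| q"
      have "tsub (\<lambda>z. if z |\<in>| ?X then Var (ren [] z) else sub s z) t = tsub Var t" if t: "t \<in> set_atom \<alpha>" for t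
      proof -
        have "tvars t \<subseteq> fset ?X" unfolding X using \<alpha> t by (auto simp: vars_avars avars_def)
        then show ?thesis by (induction t) (auto simp: ren)
      qed
      then have "asub (\<lambda>z. if z |\<in>| ?X then Var (ren [] z) else sub s z) \<alpha> = asub Var \<alpha>"
        unfolding asub_def by (rule atom.map_cong0)
      then have eq: "asub (\<lambda>z. if z |\<in>| ?X then Var (ren [] z) else sub s z) \<alpha> = \<alpha>"
        unfolding asub_Var .
      have "asub (\<lambda>z. if z |\<in>| ?X then Var (ren [] z) else sub s z) \<alpha> |\<in>| ?\<chi>"
        unfolding csub_def by (rule fimageI) (use \<alpha> in simp)
      then show "\<alpha> |\<in>| ?\<chi>" unfolding eq .
    qed
    moreover have "q = (fset_of_list (known L) |-| fset_of_list (known L)) |\<union>| q" by auto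
    moreover have "ren [] ` fset ?X \<inter> vars (fset_of_list (known L)) = {}"
      using fresh by (simp add: ren fset_of_list.rep_eq)
    ultimately show ?thesis
      using cq_inf.MPe[OF bL disjI2[OF taut] _ _ _ refl, of s "[]" "fset_of_list (known L)" q q T]
      unfolding cB using lq(3) by (simp add: ren)
  qed
  \<comment> \<open>A state is ranked by its length, which is at least 1; side leaves and the
    tautology get 0, the goal \<open>length L + 1\<close>.\<close>
  define r where "r = (\<lambda>((k1, k2), r :: instr list). if k1 then (if k2 then length L + 1 else 0)
      else if k2 then 0 else length r)"
  define f where "f y = r (the_inv name_of y)" for y
  have f: "f (chain_name k x) = r (k, x)" for k x
    by (simp add: f_def chain_name_def the_inv_f_f inj_def)
  have fr: "f (state_vertex x) = length x" "f (side_vertex x) = 0" "f taut_vertex = 0" "f goal_vertex = length L + 1" for x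
    by (simp_all add: f r_def)
  have len: "0 < length x" if "x \<in> set (tails L)" for x using that by (auto simp: set_tails)
  have "proof_in (cq_inf T) U q (mkproof l)"
  proof (rule proof_in_mkproof[where f = f and ?v0.0 = goal_vertex and ?fm0.0 = "LCQ lq" and ?u0.0 = "()"])
    show "distinct (map fst (fst l))" by (rule dv')
    show "distinct (map (\<lambda>(S, d, j, u). d) (snd l))" using de by (simp add: l_def)
    show "set S \<subseteq> fst ` set (fst l) \<and> d \<in> fst ` set (fst l)" if m: "(S, d, j, u) \<in> set (snd l)" for S d j u
      using edge[OF m]
    proof (elim disjE exE conjE)
      fix x assume x: "x \<in> set (tails L)" "tail x \<noteq> []" "d = state_vertex x"
        "S = state_vertex (tail x) # map (\<lambda>f. side_vertex x) (sides x)"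
      then show ?thesis using w1[OF x(1)] w1[OF tail_in[OF x(1,2)]] w2[OF x(1)] by auto
    qed (use w1[OF L_in] w3 in \<open>simp_all del: chain_name_eq_iff\<close>)
    show "f s' < f d" if m: "(S, d, j, u) \<in> set (snd l)" and s': "s' \<in> set S" for S d j u s'
      using edge[OF m]
    proof (elim disjE exE conjE)
      fix x assume x: "x \<in> set (tails L)" "tail x \<noteq> []" "d = state_vertex x"
        "S = state_vertex (tail x) # map (\<lambda>f. side_vertex x) (sides x)"
      then show ?thesis using s' tail_lt[OF x(1)] len[OF x(1)] by (auto simp: fr)
    qed (use s' in \<open>auto simp: fr\<close>)
    show "form fm \<in> U" if m: "(v, fm, u) \<in> set (fst l)" "\<And>S j w. (S, v, j, w) \<notin> set (snd l)" for v fm u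
      using vert[OF m(1)]
    proof (elim disjE exE conjE)
      fix x assume x: "x \<in> set (tails L)" "v = state_vertex x" "fm = LCQ (known x)"
      have "tail x = []" using e1[OF x(1)] m(2) x(2) by blast
      then obtain e zs where "x = [e]" "L = zs @ [e]" using x(1) by (cases x) (auto simp: set_tails tail_def)
      then show ?thesis using base[of zs e] x(3) by (simp add: known_def)
    next
      fix x assume x: "x \<in> set (tails L)" "v = side_vertex x" "fm \<in> set (sides x)"
      then show ?thesis using step' by blast
    qed (use m(2) e3 in blast)+
    show "cq_inf T j (lab (mkproof l) ` set S) (lab (mkproof l) d)" if m: "(S, d, j, u) \<in> set (snd l)" for S d j u
      using edge[OF m]
    proof (elim disjE exE conjE)
      fix x assume x: "x \<in> set (tails L)" "tail x \<noteq> []" "d = state_vertex x" "j = chain_just x"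
        "S = state_vertex (tail x) # map (\<lambda>f. side_vertex x) (sides x)"
      have "lab (mkproof l) ` (\<lambda>f. side_vertex x) ` set (sides x) = form ` set (sides x)"
        unfolding image_image using L2[OF x(1)] by (intro image_cong) auto
      then have "lab (mkproof l) ` set S = insert (CQ (fset_of_list (known (tail x)))) (form ` set (sides x))"
        using L1[OF tail_in[OF x(1,2)]] by (simp add: x(5))
      then show ?thesis using step'[OF x(1)] x(2) L1[OF x(1)] by (simp add: x(3,4))
    next
      assume "S = []" "d = taut_vertex" "j = ByTe"
      then show ?thesis using cq_inf.Te[OF taut] L3 by simp
    next
      assume "S = [state_vertex L, taut_vertex]" "d = goal_vertex" "j = ByMPe s []"
      then show ?thesis using goal L3 L1[OF L_in] by simp
    qed
    show "entails \<Gamma> \<eta>" if "cq_inf T j \<Gamma> \<eta>" for j \<Gamma> \<eta> using that by (rule cq_inf_sound)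
    show "(goal_vertex, LCQ lq, ()) \<in> set (fst l)" by (rule v3)
    show "form (LCQ lq) = CQ q" using lq by simp
    show "goal_vertex \<notin> set S" if m: "(S, d, j, u) \<in> set (snd l)" for S d j u
      using edge[OF m] by auto
    show "\<exists>S d j w. (S, d, j, w) \<in> set (snd l) \<and> v \<in> set S"
      if m: "(v, fm, u) \<in> set (fst l)" "v \<noteq> goal_vertex" for v fm u
      using vert[OF m(1)]
    proof (elim disjE exE conjE)
      fix x assume x: "x \<in> set (tails L)" "v = state_vertex x"
      show ?thesis
      proof (cases "x = L")
        case True
        then have "v \<in> set [state_vertex L, taut_vertex]" using x by simp
        then show ?thesis using e3(2) by blast
      next
        case False
        obtain zs where zs: "L = zs @ x" "x \<noteq> []" using x by (auto simp: set_tails)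
        then obtain ys y where "zs = ys @ [y]" using False by (cases zs rule: rev_cases) auto
        then have "y # x \<in> set (tails L)" "tail (y # x) = x" using zs by (auto simp: set_tails tail_def)
        from e1[OF this(1)] this(2) zs(2) x(2) show ?thesis by (metis list.set_intros(1))
      qed
    next
      fix x assume x: "x \<in> set (tails L)" "v = side_vertex x" "fm \<in> set (sides x)"
      then have "tail x \<noteq> []" using step' by blast
      moreover have "v \<in> set (state_vertex (tail x) # map (\<lambda>f. side_vertex x) (sides x))" using x by auto
      ultimately show ?thesis using e1[OF x(1)] by blast
    next
      assume "v = taut_vertex"
      then have "v \<in> set [state_vertex L, taut_vertex]" by simp
      then show ?thesis using e3(2) by blast
    qed (use m in simp)
  qed
  moreover have "repr (mkproof l) l"
  proof (rule repr_mkproof[OF dv'])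
    show "distinct (map (\<lambda>(S, d, j, u). d) (snd l))" using de by (simp add: l_def)
    show "ldistinct fm" if m: "(v, fm, u) \<in> set (fst l)" for v fm u
      using vert[OF m] step' lq(1) by (auto simp: known_def)
    show "distinct S" if m: "(S, d, j, u) \<in> set (snd l)" for S d j u
      using edge[OF m]
    proof (elim disjE exE conjE)
      fix x assume x: "x \<in> set (tails L)" "S = state_vertex (tail x) # map (\<lambda>f. side_vertex x) (sides x)"
      then show ?thesis using step'[OF x(1)] by (cases "sides x") auto
    qed simp_all
  qed
  moreover have "is_tree (mkproof l)"
    unfolding is_tree_def
  proof (intro ballI impI)
    fix v e e' assume "e \<in> edges (mkproof l)" "e' \<in> edges (mkproof l)" and v: "v \<in> fst e" "v \<in> fst e'"
    then obtain S d j u S' d' j' u' where m: "(S, d, j, u) \<in> set (snd l)" "e = (set S, d)"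
      "(S', d', j', u') \<in> set (snd l)" "e' = (set S', d')"
      by (auto simp: mkproof_simps)
    have vS: "v \<in> set S" "v \<in> set S'" using v m by auto
    have tt: "x = y" if "x \<in> set (tails L)" "y \<in> set (tails L)" "tail x = tail y" for x y
    proof -
      have "length z = Suc (length (tail z))" if z: "z \<in> set (tails L)" for z
        using len[OF z] by (simp add: tail_def split: list.split)
      from this[OF that(1)] this[OF that(2)] that(3) show ?thesis
        by (intro tails_eqI[OF that(1,2)]) simp
    qed
    have tL: "tail x \<noteq> L" if x: "x \<in> set (tails L)" for x
    proof
      obtain zs where "L = zs @ x" using x by (auto simp: set_tails)
      then have "length x \<le> length L" by simp
      moreover assume "tail x = L"
      ultimately show False using tail_lt[OF x] by simp
    qed
    \<comment> \<open>A premise determines its hyperedge: a side leaf through its own name, a state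
      \<open>tail x\<close> through \<open>x\<close>, because a suffix of \<open>L\<close> is
      determined by its length. By \<open>tL\<close>, the last state is no \<open>tail x\<close>, so
      only the goal uses it.\<close>
    have own: "(\<exists>x. x \<in> set (tails L) \<and> d = state_vertex x \<and>
        S = state_vertex (tail x) # map (\<lambda>f. side_vertex x) (sides x) \<and> (v = state_vertex (tail x) \<or> v = side_vertex x)) \<or>
      (S = [state_vertex L, taut_vertex] \<and> d = goal_vertex \<and> (v = state_vertex L \<or> v = taut_vertex))"
      if mm: "(S, d, j, u) \<in> set (snd l)" "v \<in> set S" for S d j u
      using edge[OF mm(1)]
    proof (elim disjE exE conjE)
      fix x assume x: "x \<in> set (tails L)" "d = state_vertex x"
        "S = state_vertex (tail x) # map (\<lambda>f. side_vertex x) (sides x)"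
      have "v = state_vertex (tail x) \<or> v = side_vertex x" using mm(2) unfolding x(3) by auto
      then show ?thesis using x by blast
    qed (use mm(2) in simp_all)
    show "e = e'" using own[OF m(1) vS(1)]
    proof (elim disjE exE conjE)
      fix x assume x: "x \<in> set (tails L)" "d = state_vertex x"
        "S = state_vertex (tail x) # map (\<lambda>f. side_vertex x) (sides x)" "v = state_vertex (tail x)"
      from own[OF m(3) vS(2)] obtain y where "y \<in> set (tails L)" "d' = state_vertex y"
        "S' = state_vertex (tail y) # map (\<lambda>f. side_vertex y) (sides y)" "tail x = tail y"
        using tL[OF x(1)] unfolding x(4) by auto
      then show ?thesis using tt[OF x(1)] x m(2,4) by blast
    next
      fix x assume x: "x \<in> set (tails L)" "d = state_vertex x"
        "S = state_vertex (tail x) # map (\<lambda>f. side_vertex x) (sides x)" "v = side_vertex x"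
      from own[OF m(3) vS(2)] have "d' = state_vertex x"
        "S' = state_vertex (tail x) # map (\<lambda>f. side_vertex x) (sides x)"
        unfolding x(4) by auto
      then show ?thesis using x m(2,4) by blast
    next
      assume x: "S = [state_vertex L, taut_vertex]" "d = goal_vertex" "v = state_vertex L"
      from own[OF m(3) vS(2)] have "S' = [state_vertex L, taut_vertex]" "d' = goal_vertex"
        using tL unfolding x(3) by auto
      then show ?thesis using x m(2,4) by simp
    next
      assume x: "S = [state_vertex L, taut_vertex]" "d = goal_vertex" "v = taut_vertex"
      from own[OF m(3) vS(2)] have "S' = [state_vertex L, taut_vertex]" "d' = goal_vertex"
        unfolding x(3) by auto
      then show ?thesis using x m(2,4) by simp
    qed
  qed
  ultimately show ?thesis by blast
qed

subsection \<open>Names for Skolem terms\<close>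

text \<open>The names contain the query, so that they are longer than all variables of the query.\<close>

definition hterm :: "tm atom list \<Rightarrow> tm \<Rightarrow> tm" where
  "hterm lq t = (case t of Var x \<Rightarrow> Var x | Ind a \<Rightarrow> Ind a | Fn f s \<Rightarrow> Var (name_of (lq, t)))"

definition hat :: "tm atom list \<Rightarrow> tm atom \<Rightarrow> tm atom" where
  "hat lq = map_atom (hterm lq)"

type_synonym sk_edge = "name list \<times> name \<times> sk_just \<times> unit"

definition skolem_axm :: "axm list \<Rightarrow> tm atom list \<times> name list \<times> tm atom list \<Rightarrow> axm option" where
  "skolem_axm ts r = find (\<lambda>ax. form (skolem_l ax) = form (LRule (fst r) (fst (snd r)) (snd (snd r)))) ts"

text \<open>An instruction without atoms is always redundant and becomes a copy. (C) and (G) lead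
  here, since the ground atoms of their conclusions are already atoms of a premise.\<close>

definition skip :: instr where
  "skip = ([], ByGe [], [])"

definition fresh_ren :: "tm atom list \<Rightarrow> axm \<Rightarrow> tm \<Rightarrow> (name \<times> name) list" where
  "fresh_ren lq ax t = (case ax of ExR A R B \<Rightarrow> [(vy, name_of (lq, Fn (Sk A R B) t))] | _ \<Rightarrow> [])"

text \<open>For (MP), all head atoms of the Skolemized axiom are added and not only the inferred
  one, so an existential head always enters as a whole. The axiom is searched in the TBox because
  the premise shows only its Skolemized rule.\<close>

definition instr_of :: "vlist \<Rightarrow> axm list \<Rightarrow> tm atom list \<Rightarrow> sk_edge \<Rightarrow> instr" where
  "instr_of lv ts lq e = (case fst (snd (snd e)) of
     ByMP s \<Rightarrow> (case skolem_axm ts (rsrc lv (fst e)) of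
         None \<Rightarrow> skip
       | Some ax \<Rightarrow> (case skolem_l ax of LCQ xs \<Rightarrow> skip
           | LRule a b c \<Rightarrow> (map (\<lambda>\<alpha>. hat lq (asub1 (sub s) \<alpha>)) c,
               ByMPe [(vx, hterm lq (sub s vx)), (vy, hterm lq (sub s vy))] (fresh_ren lq ax (sub s vx)),
               [rule_of_l ax])))
   | ByE t1 t2 \<Rightarrow> (map (hat lq) (latoms lv (fst (snd e))), ByEe (hterm lq t1) (hterm lq t2), [])
   | ByC \<Rightarrow> skip
   | ByG s \<Rightarrow> skip)"

definition is_target :: "('a \<times> name \<times> 'b) list \<Rightarrow> name \<Rightarrow> bool" where
  "is_target es v \<longleftrightarrow> (\<exists>e\<in>set es. fst (snd e) = v)"

text \<open>Facts have no variables, so (C_e) joins them without renaming. In \<open>to_cq\<close>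
  they stand at the end of the reversed list, that is, they are loaded before all
  inferences.\<close>

definition fact_instrs :: "vlist \<Rightarrow> sk_edge list \<Rightarrow> instr list" where
  "fact_instrs lv le = concat (map (\<lambda>x. case fst (snd x) of
     LCQ xs \<Rightarrow> if is_target le (fst x) then [] else [(xs, ByCe [], [LCQ xs])]
   | LRule a b c \<Rightarrow> []) lv)"

definition insert_ready :: "sk_edge list \<Rightarrow> sk_edge \<Rightarrow> sk_edge list \<Rightarrow> sk_edge list" where
  "insert_ready le e a =
     (if e \<in> set a \<or> (\<exists>v\<in>set (fst e). is_target le v \<and> \<not> is_target a v) then a else e # a)"

text \<open>As many rounds as there are vertices suffice to sort the inferences topologically.\<close>

definition topo :: "vlist \<Rightarrow> sk_edge list \<Rightarrow> sk_edge list" where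
  "topo lv le = foldr (insert_ready le) (concat (map (\<lambda>x. le) lv)) []"

text \<open>If the sink is not the conclusion of (G), its label is a conjunction of ground atoms,
  and the empty substitution serves for the last step.\<close>

definition to_cq :: "sk_just lproof \<times> axm list \<Rightarrow> cq_just lproof" where
  "to_cq x = (let lv = fst (fst x); le = snd (fst x); ts = snd x;
      v = sink_vertex lv le; lq = latoms lv v;
      L = map (instr_of lv ts lq) (topo lv le) @ fact_instrs lv le;
      s = (case find (\<lambda>e. fst (snd e) = v) le of None \<Rightarrow> []
        | Some e \<Rightarrow> (case fst (snd (snd e)) of ByMP s \<Rightarrow> [] | ByE t u \<Rightarrow> [] | ByC \<Rightarrow> []
            | ByG s \<Rightarrow> map (\<lambda>z. (z, hterm lq (sub s z))) (lvars lq)))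
    in (chain_verts L lq, chain_edges L s))"

subsubsection \<open>Polynomial time\<close>

lemma pt_hterm [pt_intros]: "pt f \<Longrightarrow> pt g \<Longrightarrow> pt (\<lambda>x. hterm (f x) (g x))"
  by (rule pt_comp2[of hterm]) (unfold hterm_def, intro pt_intros)

lemma pt_hat [pt_intros]: "pt f \<Longrightarrow> pt g \<Longrightarrow> pt (\<lambda>x. hat (f x) (g x))"
  by (rule pt_comp2[of hat]) (unfold hat_def, intro pt_intros)

lemma pt_skolem_axm [pt_intros]: "pt f \<Longrightarrow> pt g \<Longrightarrow> pt (\<lambda>x. skolem_axm (f x) (g x))"
  by (rule pt_comp2[of skolem_axm]) (unfold skolem_axm_def, intro pt_intros)

lemma pt_fresh_ren [pt_intros]: "pt f \<Longrightarrow> pt g \<Longrightarrow> pt h \<Longrightarrow> pt (\<lambda>x. fresh_ren (f x) (g x) (h x))"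
  by (rule pt_comp3[of fresh_ren]) (unfold fresh_ren_def, intro pt_intros)

lemma pt_instr_of [pt_intros]:
  "pt f \<Longrightarrow> pt g \<Longrightarrow> pt h \<Longrightarrow> pt k \<Longrightarrow> pt (\<lambda>x. instr_of (f x) (g x) (h x) (k x))"
  by (rule pt_comp4[of instr_of]) (unfold instr_of_def skip_def, intro pt_intros)

lemma pt_is_target [pt_intros]: "pt f \<Longrightarrow> pt g \<Longrightarrow> pt (\<lambda>x. is_target (f x) (g x))"
  by (rule pt_comp2[of is_target]) (unfold is_target_def, intro pt_intros)

lemma pt_fact_instrs [pt_intros]: "pt f \<Longrightarrow> pt g \<Longrightarrow> pt (\<lambda>x. fact_instrs (f x) (g x))"
  by (rule pt_comp2[of fact_instrs]) (unfold fact_instrs_def, intro pt_intros)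

lemma pt_topo [pt_intros]: "pt f \<Longrightarrow> pt g \<Longrightarrow> pt (\<lambda>x. topo (f x) (g x))"
proof (rule pt_comp2[of topo])
  have "pt (\<lambda>p :: vlist \<times> sk_edge list. rec_list [] (\<lambda>y ys a. insert_ready (snd p) y a) (concat (map (\<lambda>x. snd p) (fst p))))"
    by (intro pt_rec_list[where D = "\<lambda>p. csz p"])
      (unfold insert_ready_def, (intro pt_intros pbound_intros | simp)+)
  moreover have "rec_list b (\<lambda>y ys a. f y a) l = foldr f l b" for f :: "sk_edge \<Rightarrow> sk_edge list \<Rightarrow> sk_edge list" and b l
    by (induction l) simp_all
  ultimately show "pt (\<lambda>p. topo (fst p) (snd p))" by (simp add: topo_def)
qed

lemma pt_tail [pt_intros]: "pt f \<Longrightarrow> pt (\<lambda>x. tail (f x))"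
  unfolding tail_def by (intro pt_intros) 

lemma pt_known [pt_intros]: "pt f \<Longrightarrow> pt (\<lambda>x. known (f x))"
  unfolding known_def by (intro pt_intros)

lemma pt_redundant: "pt (\<lambda>r. redundant r)"
  unfolding redundant_def by (intro pt_intros)

lemma pt_sides: "pt (\<lambda>r. sides r)"
  unfolding sides_def by (intro pt_intros pt_redundant)

lemma pt_chain_just: "pt (\<lambda>r. chain_just r)"
  unfolding chain_just_def by (intro pt_intros pt_redundant)

lemma pt_chain_name [pt_intros]: "pt f \<Longrightarrow> pt (\<lambda>x. chain_name k (f x))"
  unfolding chain_name_def by (intro pt_intros)

lemma pt_chain_verts [pt_intros]: "pt f \<Longrightarrow> pt g \<Longrightarrow> pt (\<lambda>x. chain_verts (f x) (g x))"
  by (rule pt_comp2[of chain_verts]) (unfold chain_verts_def, intro pt_intros pt_comp[OF pt_sides])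

lemma pt_chain_edges [pt_intros]: "pt f \<Longrightarrow> pt g \<Longrightarrow> pt (\<lambda>x. chain_edges (f x) (g x))"
  by (rule pt_comp2[of chain_edges])
    (unfold chain_edges_def, intro pt_intros pt_comp[OF pt_sides] pt_comp[OF pt_chain_just])

lemma pt_to_cq: "pt to_cq"
  unfolding to_cq_def Let_def by (intro pt_intros)

subsubsection \<open>Topological sorting\<close>

lemma is_target_iff: "is_target le v \<longleftrightarrow> (\<exists>S j u. (S, v, j, u) \<in> set le)"
  by (force simp: is_target_def)

lemma insert_ready_mono: "set a \<subseteq> set (insert_ready le e a)"
  by (auto simp: insert_ready_def)

lemma is_target_mono: "set a \<subseteq> set b \<Longrightarrow> is_target a v \<Longrightarrow> is_target b v"
  by (auto simp: is_target_def)

lemma foldr_insert_ready_mono: "set a \<subseteq> set (foldr (insert_ready le) es a)"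
proof (induction es)
  case (Cons e es)
  then show ?case using insert_ready_mono[of "foldr (insert_ready le) es a" le e] by simp
qed simp

text \<open>Lists run against the order of derivation: premises that are derived at all are targets
  in the rest \<open>r\<close>.\<close>

primrec sorted_edges :: "sk_edge list \<Rightarrow> sk_edge list \<Rightarrow> bool" where
  "sorted_edges le [] \<longleftrightarrow> True"
| "sorted_edges le (e # r) \<longleftrightarrow> sorted_edges le r \<and> e \<in> set le \<and>
     (\<forall>v\<in>set (fst e). is_target le v \<longrightarrow> is_target r v)"

lemma sorted_edges_append: "sorted_edges le (zs @ r) \<Longrightarrow> sorted_edges le r"
  by (induction zs) auto

lemma sorted_foldr: "set es \<subseteq> set le \<Longrightarrow> sorted_edges le a \<Longrightarrow> sorted_edges le (foldr (insert_ready le) es a)"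
  by (induction es) (auto simp: insert_ready_def)

lemma sorted_topo: "sorted_edges le (topo lv le)"
  unfolding topo_def by (rule sorted_foldr) auto

text \<open>Round \<open>n + 1\<close> adds every missing inference whose target has rank
  \<open>n\<close>, as its derived premises have smaller rank and were treated before. Ranks are
  below the number of vertices, so that many rounds miss nothing.\<close>

lemma topo_complete:
  fixes rank :: "name \<Rightarrow> nat"
  assumes rank: "\<And>S d j u s. (S, d, j, u) \<in> set le \<Longrightarrow> s \<in> set S \<Longrightarrow> rank s < rank d"
    and N: "\<And>S d j u. (S, d, j, u) \<in> set le \<Longrightarrow> rank d < length lv"
  shows "set le \<subseteq> set (topo lv le)"
proof -
  have round: "{e \<in> set es. rank (fst (snd e)) < Suc n} \<subseteq> set (foldr (insert_ready le) es a)"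
    if a: "{e \<in> set le. rank (fst (snd e)) < n} \<subseteq> set a" and "set es \<subseteq> set le" for n a es
    using that(2)
  proof (induction es)
    case (Cons e es)
    let ?b = "foldr (insert_ready le) es a"
    have "e \<in> set (insert_ready le e ?b)" if r: "rank (fst (snd e)) < Suc n"
    proof -
      have "is_target ?b v" if v: "v \<in> set (fst e)" "is_target le v" for v
      proof -
        obtain S d j u where e: "e = (S, d, j, u)" by (cases e)
        have "rank v < n" using rank[of S d j u v] Cons.prems v(1) r e by auto
        moreover obtain e' where "e' \<in> set le" "fst (snd e') = v" using v(2) by (auto simp: is_target_def)
        ultimately have "e' \<in> set ?b" using a foldr_insert_ready_mono[of a le es] by auto
        then show ?thesis using \<open>fst (snd e') = v\<close> by (auto simp: is_target_def)
      qed
      then show ?thesis by (auto simp: insert_ready_def)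
    qed
    moreover have "set ?b \<subseteq> set (insert_ready le e ?b)" by (rule insert_ready_mono)
    ultimately show ?case using Cons by auto
  qed simp
  have "{e \<in> set le. rank (fst (snd e)) < length xs} \<subseteq> set (foldr (insert_ready le) (concat (map (\<lambda>x. le) xs)) [])"
    for xs :: vlist
  proof (induction xs)
    case (Cons x xs)
    from round[OF Cons.IH, of le] show ?case by auto
  qed simp
  from this[of lv] show ?thesis unfolding topo_def using N by (auto simp: split_paired_all)
qed

subsubsection \<open>Correctness\<close>

lemma flat_hterm [simp]: "flat_tm (hterm lq t)"
  by (cases t) (simp_all add: hterm_def)

lemma hterm_Ind [simp]: "hterm lq (Ind a) = Ind a" and hterm_Var [simp]: "hterm lq (Var x) = Var x"
  by (simp_all add: hterm_def)

lemma flat_hat: "t \<in> set_atom (hat lq \<alpha>) \<Longrightarrow> flat_tm t"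
  by (auto simp: hat_def atom.set_map)

lemma hat_asub:
  assumes "\<And>t. t \<in> set_atom \<beta> \<Longrightarrow> flat_tm t" "\<And>y. y \<in> avars \<beta> \<Longrightarrow> \<sigma>' y = hterm lq (\<sigma> y)"
  shows "asub \<sigma>' \<beta> = hat lq (asub \<sigma> \<beta>)"
proof -
  have "tsub \<sigma>' t = hterm lq (tsub \<sigma> t)" if t: "t \<in> set_atom \<beta>" for t
  proof (cases t)
    case (Var x)
    then show ?thesis using assms(2)[of x] t by (force simp: avars_def)
  qed (use assms(1)[OF t] in simp_all)
  then show ?thesis unfolding hat_def asub_def atom.map_comp comp_def by (rule atom.map_cong0)
qed

lemma hat_Ind: assumes "\<And>t. t \<in> set_atom \<alpha> \<Longrightarrow> \<exists>a. t = Ind a" shows "hat lq \<alpha> = \<alpha>"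
proof -
  have "hterm lq t = id t" if "t \<in> set_atom \<alpha>" for t using assms[OF that] by auto
  then have "hat lq \<alpha> = map_atom id \<alpha>" unfolding hat_def by (rule atom.map_cong0)
  then show ?thesis by (simp add: atom.map_id)
qed

lemma length_le_csz: "length (x :: name) \<le> csz x"
  by (induction x) auto

lemma csz_mem: "x \<in> set xs \<Longrightarrow> csz x \<le> csz xs"
  by (induction xs) auto

text \<open>With \<open>length_name_of\<close> this separates the names of Skolem terms from the
  variables of the query: \<open>name_of (lq, t)\<close> has the length \<open>csz (lq, t)\<close>,
  which exceeds \<open>csz lq\<close>.\<close>

lemma length_lvars: assumes "x \<in> set (lvars lq)" shows "length x \<le> csz lq"
proof -
  obtain \<alpha> where \<alpha>: "\<alpha> \<in> set lq" "x \<in> set (avars1 \<alpha>)" using assms by (auto simp: lvars_def)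
  have t: "x \<in> set (tvars1 t) \<Longrightarrow> csz x \<le> csz t" for t
    by (cases t) (simp_all add: tvars1_def enc_simps)
  have "csz x \<le> csz \<alpha>" using \<alpha>(2) by (cases \<alpha>) (auto simp: avars1_def enc_simps simp del: enc_atom.simps dest!: t)
  then show ?thesis using csz_mem[OF \<alpha>(1)] length_le_csz[of x] by simp
qed

lemma skolem_rule:
  assumes "skolem ax = Rule \<psi> X \<chi>"
  shows "\<And>\<beta> t. \<beta> |\<in>| \<psi> \<Longrightarrow> t \<in> set_atom \<beta> \<Longrightarrow> flat_tm t"
    and "\<And>\<beta> t. \<beta> |\<in>| \<chi> \<Longrightarrow> t \<in> set_atom \<beta> \<Longrightarrow> shallow t"
    and "vars \<psi> \<subseteq> {vx, vy}" "vars \<chi> \<subseteq> vars \<psi>" "\<psi> \<noteq> {||}"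
proof -
  have r: "avars (ratom R s t) = tvars s \<union> tvars t" for R s t by (cases R) auto
  show "\<And>\<beta> t. \<beta> |\<in>| \<psi> \<Longrightarrow> t \<in> set_atom \<beta> \<Longrightarrow> flat_tm t"
    using assms[symmetric] by (cases ax) (auto simp: set_atom_ratom Let_def)
  show "\<And>\<beta> t. \<beta> |\<in>| \<chi> \<Longrightarrow> t \<in> set_atom \<beta> \<Longrightarrow> shallow t"
    using assms[symmetric] by (cases ax) (auto simp: set_atom_ratom Let_def shallow_def)
  show "vars \<psi> \<subseteq> {vx, vy}" "vars \<chi> \<subseteq> vars \<psi>" "\<psi> \<noteq> {||}"
    using assms[symmetric] by (cases ax; auto simp: vars_avars r Let_def)+
qed

lemma append_split:
  assumes "map f t @ F = zs @ e # r"
  shows "(\<exists>zs' x a. t = zs' @ x # a \<and> e = f x \<and> r = map f a @ F) \<or> (\<exists>zs'. F = zs' @ e # r)"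
  using assms
proof (induction t arbitrary: zs)
  case (Cons y t)
  show ?case
  proof (cases zs)
    case Nil
    then have "y # t = [] @ y # t \<and> e = f y \<and> r = map f t @ F" using Cons.prems by simp
    then show ?thesis by blast
  next
    case (Cons z zs')
    then have "map f t @ F = zs' @ e # r" using Cons.prems by simp
    from Cons.IH[OF this] show ?thesis by (metis append_Cons)
  qed
qed auto

locale sk_input = repr_proof "skolem ` T \<union> facts A" q "sk_inf T q" p lv le
  for T A q p lv le +
  fixes ts :: "axm list"
  assumes abox: "is_abox A" and bq: "bcq q" and ts: "set ts = T"
begin

definition "lq = latoms lv (sink_vertex lv le)"

definition prog :: "sk_edge list \<Rightarrow> instr list" where
  "prog a = map (instr_of lv ts lq) a @ fact_instrs lv le"

abbreviation atoms :: "sk_edge list \<Rightarrow> tm atom set" where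
  "atoms a \<equiv> set (known (prog a))"

lemma query: "(sink_vertex lv le, LCQ lq, ()) \<in> set lv" "fset_of_list lq = q" "distinct lq"
proof -
  obtain f where f: "(sink_vertex lv le, f, ()) \<in> set lv" "form f = CQ q" by (rule sink)
  then obtain xs where "f = LCQ xs" "fset_of_list xs = q" by (cases f) auto
  then show "(sink_vertex lv le, LCQ lq, ()) \<in> set lv" "fset_of_list lq = q" "distinct lq"
    using f latoms lv_verts[OF f(1)] by (auto simp: lq_def)
qed

lemma leaf_fact:
  assumes "(v, LCQ xs, w) \<in> set lv" "\<not> is_target le v"
  shows "\<exists>\<alpha>. set xs = {\<alpha>} \<and> (\<forall>t\<in>set_atom \<alpha>. \<exists>a. t = Ind a) \<and> CQ (fset_of_list xs) \<in> facts A"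
proof -
  have "lab p v \<in> skolem ` T \<union> facts A"
    using leaf_lab assms lv_verts unfolding is_target_iff by blast
  moreover have "skolem ax \<noteq> CQ \<phi>" for ax \<phi> by (cases ax) (auto simp: Let_def)
  moreover have l: "lab p v = CQ (fset_of_list xs)" using lv_verts[OF assms(1)] by simp
  ultimately have f: "CQ (fset_of_list xs) \<in> facts A" by (auto simp: image_iff) metis
  then obtain \<alpha> where \<alpha>: "\<alpha> \<in> A" "fset_of_list xs = {|\<alpha>|}" by (auto simp: facts_def)
  have "set xs = {\<alpha>}" using \<alpha>(2) by (metis bot_fset.rep_eq finsert.rep_eq fset_of_list.rep_eq)
  moreover have "\<forall>t\<in>set_atom \<alpha>. \<exists>a. t = Ind a" using abox \<alpha>(1) by (fastforce simp: is_abox_def)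
  ultimately show ?thesis using f by blast
qed

lemma fact_instrs_iff:
  "e \<in> set (fact_instrs lv le) \<longleftrightarrow>
    (\<exists>v xs u. (v, LCQ xs, u) \<in> set lv \<and> \<not> is_target le v \<and> e = (xs, ByCe [], [LCQ xs]))"
  by (force simp: fact_instrs_def split: lformula.splits if_splits)

lemma sk_prem_cq: "sk_inf T q j \<Gamma> \<eta> \<Longrightarrow> \<exists>\<gamma>. CQ \<gamma> \<in> \<Gamma>"
proof (induction rule: sk_inf.induct)
  case (MP ax \<psi> \<chi> s \<alpha>)
  then obtain \<beta> where "\<beta> |\<in>| \<psi>" using skolem_rule(5) by (metis ex_fin_conv)
  then have "asub (sub s) \<beta> |\<in>| csub (sub s) \<psi>" by (simp add: csub_def)
  then show ?case by blast
next
  case (C \<gamma>)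
  then obtain \<alpha> where "\<alpha> |\<in>| \<gamma>" by (metis ex_fin_conv)
  then show ?case by blast
qed auto

text \<open>Every Skolemized inference has a CQ among its premises, since rule bodies are not empty.
  Descending from the sink through CQs therefore ends at a fact, which provides the initial
  state.\<close>

lemma fact_instrs_nonempty: "fact_instrs lv le \<noteq> []"
proof -
  obtain rank where rank: "\<And>S d j u s. (S, d, j, u) \<in> set le \<Longrightarrow> s \<in> set S \<Longrightarrow> rank s < (rank d :: nat)"
    using ex_rank by metis
  have "\<exists>v xs u. (v, LCQ xs, u) \<in> set lv \<and> \<not> is_target le v" if "(v, LCQ xs, u) \<in> set lv" for v xs u
    using that
  proof (induction "rank v" arbitrary: v xs u rule: less_induct)
    case less
    show ?case
    proof (cases "is_target le v")
      case True
      then obtain S j w where e: "(S, v, j, w) \<in> set le" unfolding is_target_iff by blast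
      from sk_prem_cq[OF edge_inf[OF e]] obtain \<gamma> where "CQ \<gamma> \<in> lab p ` set S" by blast
      then obtain s where s: "s \<in> set S" "lab p s = CQ \<gamma>" by (metis imageE)
      then obtain ys where "(s, LCQ ys, ()) \<in> set lv" using lab_cq edge_verts[OF e] by blast
      then show ?thesis using less.hyps rank[OF e s(1)] by blast
    qed (use less.prems in blast)
  qed
  from this[OF query(1)] show ?thesis using fact_instrs_iff by (metis empty_iff empty_set)
qed

section \<open>The invariant of the growing CQ\<close>

lemma atoms_Cons: "atoms (e # a) = atoms a \<union> set (fst (instr_of lv ts lq e))"
  by (auto simp: prog_def set_known)

lemma atoms_nonempty: "atoms a \<noteq> {}"
proof -
  obtain e where e: "e \<in> set (fact_instrs lv le)" using fact_instrs_nonempty by (cases "fact_instrs lv le") auto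
  then obtain v xs u where xs: "(v, LCQ xs, u) \<in> set lv" "\<not> is_target le v" "e = (xs, ByCe [], [LCQ xs])"
    unfolding fact_instrs_iff by blast
  then have "set (fst e) \<noteq> {}" using leaf_fact[OF xs(1,2)] by auto
  then show ?thesis using e by (auto simp: prog_def set_known)
qed

text \<open>The second clause keeps the variables of the query out of the CQ. By the third, the
  variable of a Skolem term never occurs without both head atoms of its rule, so an application of
  the rule is either redundant or introduces a fresh variable. The fourth says that what has been
  derived is represented; it speaks of ground atoms only because the conclusion \<open>q\<close> of
  (G) may contain variables.\<close>

definition inv :: "sk_edge list \<Rightarrow> bool" where
  "inv a \<longleftrightarrow> (\<forall>\<alpha>\<in>atoms a. \<forall>t\<in>set_atom \<alpha>. flat_tm t) \<and>
     (\<forall>\<alpha>\<in>atoms a. avars \<alpha> \<subseteq> range (\<lambda>t :: tm. name_of (lq, t))) \<and>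
     (\<forall>A1 R1 B1 t. name_of (lq, Fn (Sk A1 R1 B1) t) \<in> \<Union>(avars ` atoms a) \<longrightarrow>
       ratom R1 (hterm lq t) (hterm lq (Fn (Sk A1 R1 B1) t)) \<in> atoms a \<and>
       CA B1 (hterm lq (Fn (Sk A1 R1 B1) t)) \<in> atoms a) \<and>
     (\<forall>v xs u \<alpha>. (v, LCQ xs, u) \<in> set lv \<longrightarrow> (is_target le v \<longrightarrow> is_target a v) \<longrightarrow> \<alpha> \<in> set xs \<longrightarrow>
       avars \<alpha> = {} \<longrightarrow> hat lq \<alpha> \<in> atoms a)"

lemma inv_flat: "inv a \<Longrightarrow> \<alpha> \<in> atoms a \<Longrightarrow> t \<in> set_atom \<alpha> \<Longrightarrow> flat_tm t"
  by (drule inv_def[THEN iffD1, THEN conjunct1]) blast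

lemma inv_range: "inv a \<Longrightarrow> \<alpha> \<in> atoms a \<Longrightarrow> avars \<alpha> \<subseteq> range (\<lambda>t :: tm. name_of (lq, t))"
  by (drule inv_def[THEN iffD1, THEN conjunct2, THEN conjunct1]) blast

lemma inv_fresh:
  "inv a \<Longrightarrow> name_of (lq, Fn (Sk A1 R1 B1) t) \<in> \<Union>(avars ` atoms a) \<Longrightarrow>
    ratom R1 (hterm lq t) (hterm lq (Fn (Sk A1 R1 B1) t)) \<in> atoms a \<and> CA B1 (hterm lq (Fn (Sk A1 R1 B1) t)) \<in> atoms a"
  by (drule inv_def[THEN iffD1, THEN conjunct2, THEN conjunct2, THEN conjunct1]) (elim allE impE)

lemma inv_lab:
  "inv a \<Longrightarrow> (v, LCQ xs, u) \<in> set lv \<Longrightarrow> (is_target le v \<Longrightarrow> is_target a v) \<Longrightarrow> \<alpha> \<in> set xs \<Longrightarrow>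
    avars \<alpha> = {} \<Longrightarrow> hat lq \<alpha> \<in> atoms a"
  by (drule inv_def[THEN iffD1, THEN conjunct2, THEN conjunct2, THEN conjunct2]) blast

lemma inv_Nil: "inv []"
proof -
  have at: "\<alpha> \<in> atoms [] \<longleftrightarrow> (\<exists>v xs u. (v, LCQ xs, u) \<in> set lv \<and> \<not> is_target le v \<and> \<alpha> \<in> set xs)" for \<alpha>
  proof
    assume "\<alpha> \<in> atoms []"
    then obtain e where "e \<in> set (fact_instrs lv le)" "\<alpha> \<in> set (fst e)" by (auto simp: prog_def set_known)
    then show "\<exists>v xs u. (v, LCQ xs, u) \<in> set lv \<and> \<not> is_target le v \<and> \<alpha> \<in> set xs"
      unfolding fact_instrs_iff by (elim exE conjE) (simp, blast)
  next
    assume "\<exists>v xs u. (v, LCQ xs, u) \<in> set lv \<and> \<not> is_target le v \<and> \<alpha> \<in> set xs"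
    then obtain v xs u where "(v, LCQ xs, u) \<in> set lv" "\<not> is_target le v" "\<alpha> \<in> set xs" by blast
    then have "(xs, ByCe [], [LCQ xs]) \<in> set (fact_instrs lv le)" unfolding fact_instrs_iff by blast
    then show "\<alpha> \<in> atoms []" using \<open>\<alpha> \<in> set xs\<close> by (force simp: prog_def set_known)
  qed
  have ind: "\<exists>a. t = Ind a" if "\<alpha> \<in> atoms []" and t: "t \<in> set_atom \<alpha>" for \<alpha> t
  proof -
    from that(1) obtain v xs u where v: "(v, LCQ xs, u) \<in> set lv" "\<not> is_target le v" "\<alpha> \<in> set xs"
      unfolding at by (elim exE conjE)
    from leaf_fact[OF v(1,2)] obtain \<beta> where \<beta>: "set xs = {\<beta>}" "\<forall>t\<in>set_atom \<beta>. \<exists>a. t = Ind a"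
      by (elim exE conjE)
    then show ?thesis using v(3) t by simp
  qed
  have av: "avars \<alpha> = {}" if "\<alpha> \<in> atoms []" for \<alpha> using ind[OF that] by (fastforce simp: avars_def)
  have nt: "\<not> is_target [] v" for v by (simp add: is_target_def)
  show ?thesis
    unfolding inv_def
  proof (intro conjI ballI allI impI)
    show "flat_tm t" if "\<alpha> \<in> atoms []" "t \<in> set_atom \<alpha>" for \<alpha> t using ind[OF that] by auto
    show "avars \<alpha> \<subseteq> range (\<lambda>t :: tm. name_of (lq, t))" if "\<alpha> \<in> atoms []" for \<alpha> using av[OF that] by simp
    fix v xs u \<alpha>
    assume a: "(v, LCQ xs, u) \<in> set lv" "is_target le v \<longrightarrow> is_target [] v" "\<alpha> \<in> set xs"
    then have "\<exists>v xs u. (v, LCQ xs, u) \<in> set lv \<and> \<not> is_target le v \<and> \<alpha> \<in> set xs" using nt by metis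
    then have m: "\<alpha> \<in> atoms []" unfolding at .
    then show "hat lq \<alpha> \<in> atoms []" using hat_Ind[OF ind[OF m]] by simp
  qed (use av in \<open>simp_all add: SUP_bot_conv\<close>)
qed

text \<open>\<open>Z\<close> holds the variables introduced by the step: none, or the single one of
  an existential rule, which has to bring along both head atoms. The hypothesis \<open>lab\<close>
  concerns \<open>d\<close> alone, the only newly derived vertex.\<close>

lemma inv_ext:
  assumes inv: "inv a" and e: "(S, d, j, u) \<in> set le"
    and N: "set (fst (instr_of lv ts lq (S, d, j, u))) = N"
    and flat: "\<And>\<alpha> t. \<alpha> \<in> N \<Longrightarrow> t \<in> set_atom \<alpha> \<Longrightarrow> flat_tm t"
    and vars: "\<And>\<alpha>. \<alpha> \<in> N \<Longrightarrow> avars \<alpha> \<subseteq> \<Union>(avars ` atoms a) \<union> Z"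
    and Z: "\<And>z. z \<in> Z \<Longrightarrow> \<exists>A1 R1 B1 t. z = name_of (lq, Fn (Sk A1 R1 B1) t) \<and>
       ratom R1 (hterm lq t) (hterm lq (Fn (Sk A1 R1 B1) t)) \<in> N \<and> CA B1 (hterm lq (Fn (Sk A1 R1 B1) t)) \<in> N"
    and lab: "\<And>xs \<alpha>. (d, LCQ xs, ()) \<in> set lv \<Longrightarrow> \<alpha> \<in> set xs \<Longrightarrow> avars \<alpha> = {} \<Longrightarrow> hat lq \<alpha> \<in> atoms a \<union> N"
  shows "inv ((S, d, j, u) # a)"
  unfolding inv_def atoms_Cons N
proof (intro conjI ballI allI impI)
  let ?R = "range (\<lambda>t :: tm. name_of (lq, t))"
  have R: "\<Union>(avars ` atoms a) \<subseteq> ?R" using inv_range[OF inv] by blast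
  have RZ: "Z \<subseteq> ?R" using Z by blast
  show "flat_tm t" if "\<alpha> \<in> atoms a \<union> N" "t \<in> set_atom \<alpha>" for \<alpha> t
    using that flat inv_flat[OF inv] by blast
  show "avars \<alpha> \<subseteq> ?R" if "\<alpha> \<in> atoms a \<union> N" for \<alpha> using that vars R RZ by blast
  fix A1 R1 B1 t
  assume "name_of (lq, Fn (Sk A1 R1 B1) t) \<in> \<Union>(avars ` (atoms a \<union> N))"
  then have "name_of (lq, Fn (Sk A1 R1 B1) t) \<in> \<Union>(avars ` atoms a) \<or> name_of (lq, Fn (Sk A1 R1 B1) t) \<in> Z"
    using vars by blast
  then have "ratom R1 (hterm lq t) (hterm lq (Fn (Sk A1 R1 B1) t)) \<in> atoms a \<union> N \<and>
      CA B1 (hterm lq (Fn (Sk A1 R1 B1) t)) \<in> atoms a \<union> N"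
  proof
    assume "name_of (lq, Fn (Sk A1 R1 B1) t) \<in> \<Union>(avars ` atoms a)"
    moreover have "name_of (lq, Fn (Sk A1 R1 B1) t) \<in> \<Union>(avars ` atoms a) \<longrightarrow>
       ratom R1 (hterm lq t) (hterm lq (Fn (Sk A1 R1 B1) t)) \<in> atoms a \<and>
       CA B1 (hterm lq (Fn (Sk A1 R1 B1) t)) \<in> atoms a"
      using inv_fresh[OF inv] by blast
    ultimately show ?thesis by blast
  next
    assume "name_of (lq, Fn (Sk A1 R1 B1) t) \<in> Z"
    from Z[OF this] show ?thesis by auto
  qed
  then show "ratom R1 (hterm lq t) (hterm lq (Fn (Sk A1 R1 B1) t)) \<in> atoms a \<union> N"
    "CA B1 (hterm lq (Fn (Sk A1 R1 B1) t)) \<in> atoms a \<union> N" by simp_all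
next
  fix v xs w \<alpha>
  assume a: "(v, LCQ xs, w) \<in> set lv" "is_target le v \<longrightarrow> is_target ((S, d, j, u) # a) v" "\<alpha> \<in> set xs" "avars \<alpha> = {}"
  show "hat lq \<alpha> \<in> atoms a \<union> N"
  proof (cases "v = d")
    case False
    then have "is_target le v \<longrightarrow> is_target a v" using a(2) by (simp add: is_target_def)
    then show ?thesis using inv_lab[OF inv a(1) _ a(3,4)] by blast
  qed (use a lab in auto)
qed

definition ready :: "name list \<Rightarrow> sk_edge list \<Rightarrow> bool" where
  "ready S a \<longleftrightarrow> (\<forall>v\<in>set S. is_target le v \<longrightarrow> is_target a v)"

lemma premD:
  assumes "inv a" "(S, d, j, u) \<in> set le" "ready S a" "CQ \<gamma> \<in> lab p ` set S" "\<alpha> |\<in>| \<gamma>" "avars \<alpha> = {}"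
  shows "hat lq \<alpha> \<in> atoms a"
proof -
  obtain v where v: "v \<in> set S" "lab p v = CQ \<gamma>" using assms(4) by (auto simp: image_iff)
  then obtain xs where xs: "(v, LCQ xs, ()) \<in> set lv" "fset_of_list xs = \<gamma>" using lab_cq edge_verts[OF assms(2)] by blast
  have "\<alpha> \<in> set xs" using assms(5) xs(2) by (auto simp: fset_of_list.rep_eq)
  then show ?thesis using inv_lab[OF assms(1) xs(1) _ _ assms(6)] assms(3) v(1) unfolding ready_def by blast
qed

lemma inv_bcq: "inv a \<Longrightarrow> bcq (fset_of_list (known (prog a)))"
  using atoms_nonempty[of a] inv_flat[of a]
  by (auto simp: bcq_def fset_of_list.rep_eq fset_of_list_eq_iff[of _ "[]", simplified])

section \<open>Each inference preserves the invariant\<close>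

definition step_ok :: "sk_edge list \<Rightarrow> sk_edge \<Rightarrow> bool" where
  "step_ok a e \<longleftrightarrow> (let i = instr_of lv ts lq e in \<not> set (fst i) \<subseteq> atoms a \<longrightarrow>
     length (snd (snd i)) \<le> 1 \<and> (\<forall>f\<in>set (snd (snd i)). form f \<in> rule_of ` T \<union> facts A \<and> ldistinct f) \<and>
     cq_inf T (fst (snd i)) (insert (CQ (fset_of_list (known (prog a)))) (form ` set (snd (snd i))))
       (CQ (fset_of_list (known (prog (e # a))))))"

lemma lab_atoms: "(d, LCQ xs, ()) \<in> set lv \<Longrightarrow> lab p d = CQ \<gamma> \<Longrightarrow> set xs = fset \<gamma>"
  using lv_verts[of d "LCQ xs"] by (auto simp: fset_of_list.rep_eq)

lemma edge_skip:
  assumes "inv a" "(S, d, j, u) \<in> set le" "instr_of lv ts lq (S, d, j, u) = skip"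
    and "\<And>xs \<alpha>. (d, LCQ xs, ()) \<in> set lv \<Longrightarrow> \<alpha> \<in> set xs \<Longrightarrow> avars \<alpha> = {} \<Longrightarrow> hat lq \<alpha> \<in> atoms a"
  shows "inv ((S, d, j, u) # a) \<and> step_ok a (S, d, j, u)"
  using inv_ext[OF assms(1,2), of "{}" "{}"] assms(3,4) by (auto simp: step_ok_def skip_def)

text \<open>Replacement acts on whole argument positions and \<open>hat\<close> maps each argument
  by \<open>hterm\<close>, so a replacement between ground atoms carries over to their
  representations.\<close>

lemma edge_E:
  assumes inv: "inv a" and e: "(S, d, ByE t1 t2, u) \<in> set le" and r: "ready S a"
  shows "inv ((S, d, ByE t1 t2, u) # a) \<and> step_ok a (S, d, ByE t1 t2, u)"
  using edge_inf[OF e]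
proof cases
  case (E \<alpha> \<beta>)
  let ?h = "hterm lq" and ?N = "{hat lq \<beta>}" and ?\<Phi> = "fset_of_list (known (prog a))"
  have g: "avars \<alpha> = {}" "avars (EqA t1 t2) = {}" using E(3) by (auto simp: ground_def vars_avars)
  have b: "avars \<beta> = {}" using E(4) g by (cases \<alpha>; cases \<beta>) (auto simp: repl_def)
  have p1: "hat lq \<alpha> \<in> atoms a" and p2: "hat lq (EqA t1 t2) \<in> atoms a"
    using premD[OF inv e r, of "{|\<alpha>|}" \<alpha>] premD[OF inv e r, of "{|EqA t1 t2|}" "EqA t1 t2"] g
    by (simp_all add: E(1))
  have p2': "EqA (?h t1) (?h t2) \<in> atoms a" using p2 by (simp add: hat_def)
  have xs: "set (latoms lv d) = {\<beta>}"
    using lab_cq[of d] E(2) edge_verts[OF e] latoms by (metis bot_fset.rep_eq finsert.rep_eq fset_of_list.rep_eq)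
  have i: "instr_of lv ts lq (S, d, ByE t1 t2, u) = (map (hat lq) (latoms lv d), ByEe (?h t1) (?h t2), [])"
    by (simp add: instr_of_def)
  have N: "set (fst (instr_of lv ts lq (S, d, ByE t1 t2, u))) = ?N" using i xs by simp
  have rp: "repl (?h t1) (?h t2) (hat lq \<alpha>) (hat lq \<beta>)"
    using E(4) by (cases \<alpha>; cases \<beta>) (auto simp: repl_def hat_def)
  have "inv ((S, d, ByE t1 t2, u) # a)"
  proof (rule inv_ext[OF inv e N, of "{}"])
    fix \<alpha>' assume "\<alpha>' \<in> ?N"
    then have "avars \<alpha>' \<subseteq> avars (hat lq \<alpha>) \<union> avars (EqA (?h t1) (?h t2))"
      using rp by (cases "hat lq \<alpha>"; cases "hat lq \<beta>") (auto simp: repl_def)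
    then show "avars \<alpha>' \<subseteq> \<Union>(avars ` atoms a) \<union> {}" using p1 p2' by blast
  next
    fix xs' \<alpha>' assume "(d, LCQ xs', ()) \<in> set lv" "\<alpha>' \<in> set xs'"
    then show "hat lq \<alpha>' \<in> atoms a \<union> ?N" using lab_atoms E(2) by fastforce
  qed (auto dest: flat_hat)
  moreover have "cq_inf T (ByEe (?h t1) (?h t2)) {CQ ?\<Phi>} (CQ (fset_of_list (known (prog ((S, d, ByE t1 t2, u) # a)))))"
  proof -
    have k: "fset_of_list (known (prog ((S, d, ByE t1 t2, u) # a))) = ?\<Phi> |\<union>| {|hat lq \<beta>|}"
      using atoms_Cons[of "(S, d, ByE t1 t2, u)" a] N by (auto simp: fset_eq_iff fset_of_list.rep_eq)
    have f: "finsert (EqA (?h t1) (?h t2)) ?\<Phi> = ?\<Phi>" using p2' by (auto simp: fset_of_list.rep_eq)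
    \<comment> \<open>Replacing at no position is one of the allowed selections, so each old atom is
      related to itself and stays in the conclusion next to the new one.\<close>
    have "repl (?h t1) (?h t2) \<gamma> \<gamma>" for \<gamma> by (cases \<gamma>) (auto simp: repl_def)
    then have "rel_fset (repl (?h t1) (?h t2)) ?\<Phi> (?\<Phi> |\<union>| {|hat lq \<beta>|})"
      unfolding rel_fset_alt using rp p1 by (auto simp: fset_of_list.rep_eq)
    then show ?thesis
      using cq_inf.Ee[of "?h t1" "?h t2" ?\<Phi> "?\<Phi> |\<union>| {|hat lq \<beta>|}" T] inv_bcq[OF inv]
        inv_bcq[OF \<open>inv ((S, d, ByE t1 t2, u) # a)\<close>] unfolding f k by simp
  qed
  ultimately show ?thesis unfolding step_ok_def Let_def i by simp
qed

text \<open>A rule without existential head acts on the representation as it does on the ground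
  atoms. For an existential rule both head atoms contain the variable of the Skolem term; if one of
  them is missing, the invariant shows that this variable is fresh.\<close>

lemma edge_MP:
  assumes inv: "inv a" and e: "(S, d, ByMP s, u) \<in> set le" and r: "ready S a"
  shows "inv ((S, d, ByMP s, u) # a) \<and> step_ok a (S, d, ByMP s, u)"
  using edge_inf[OF e]
proof cases
  case (MP ax \<psi> \<chi> \<alpha>)
  let ?e = "(S, d, ByMP s, u)" and ?h = "hterm lq" and ?\<Phi> = "fset_of_list (known (prog a))"
  let ?s = "[(vx, ?h (sub s vx)), (vy, ?h (sub s vy))]"
  obtain a0 b0 c0 where r0: "rsrc lv S = (a0, b0, c0)" "form (LRule a0 b0 c0) = skolem ax"
  proof -
    have "\<exists>a b c. rsrc lv S = (a, b, c) \<and> fset_of_list a = \<psi> \<and> fset_of_list b = {||} \<and> fset_of_list c = \<chi>"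
      by (rule rsrc[OF e]) (auto simp: MP(1,4))
    then show ?thesis using that MP(4) by auto
  qed
  have "ax \<in> set ts" "form (skolem_l ax) = form (LRule a0 b0 c0)" using MP(3) ts r0 by simp_all
  then obtain ax' where f: "find (\<lambda>ax. form (skolem_l ax) = form (LRule a0 b0 c0)) ts = Some ax'"
    "ax' \<in> set ts" "form (skolem_l ax') = form (LRule a0 b0 c0)" by (rule find_SomeE)
  \<comment> \<open>The axiom \<open>ax'\<close> that the search returns need not be
    \<open>ax\<close>, but its Skolemization is the same rule, and this is all that matters.\<close>
  have sk: "skolem ax' = Rule \<psi> {||} \<chi>" using f(3) r0(2) MP(4) by simp
  note SR = skolem_rule[OF sk]
  have ax': "skolem_axm ts (rsrc lv S) = Some ax'" using f(1) by (simp add: skolem_axm_def r0(1))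
  obtain a1 b1 c1 where l1: "skolem_l ax' = LRule a1 b1 c1" using f(3) by (cases "skolem_l ax'") auto
  have c1: "fset_of_list c1 = \<chi>" using form_skolem_l[of ax'] l1 sk by simp
  then have sc1: "set c1 = fset \<chi>" by (simp add: fset_of_list.rep_eq flip: c1)
  define N where "N = (\<lambda>\<beta>. hat lq (asub (sub s) \<beta>)) ` fset \<chi>"
  have i: "instr_of lv ts lq ?e = (map (\<lambda>\<alpha>. hat lq (asub1 (sub s) \<alpha>)) c1, ByMPe ?s (fresh_ren lq ax' (sub s vx)), [rule_of_l ax'])"
    by (simp add: instr_of_def ax' l1)
  have N: "set (fst (instr_of lv ts lq ?e)) = N"
  proof -
    have "asub1 (sub s) \<beta> = asub (sub s) \<beta>" if "\<beta> |\<in>| \<chi>" for \<beta> using SR(2)[OF that] by (rule asub1_asub)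
    then show ?thesis unfolding i N_def fst_conv set_map sc1 by (intro image_cong) simp_all
  qed
  have k: "fset_of_list (known (prog (?e # a))) = ?\<Phi> |\<union>| fset_of_list (map (\<lambda>\<alpha>. hat lq (asub1 (sub s) \<alpha>)) c1)"
    using atoms_Cons[of ?e a] i by (auto simp: fset_eq_iff fset_of_list.rep_eq)
  have sub_s: "sub ?s vx = ?h (sub s vx)" "sub ?s vy = ?h (sub s vy)" by (simp_all add: sub_def)
  have inst: "asub (sub ?s) \<beta> = hat lq (asub (sub s) \<beta>)"
    if "\<And>t. t \<in> set_atom \<beta> \<Longrightarrow> flat_tm t" "avars \<beta> \<subseteq> {vx, vy}" for \<beta>
    by (rule hat_asub[OF that(1)]) (use that(2) sub_s in auto)
  have \<psi>v: "avars \<beta> \<subseteq> {vx, vy}" if "\<beta> |\<in>| \<psi>" for \<beta> using SR(3) that by (auto simp: vars_avars)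
  have \<chi>v: "avars \<beta> \<subseteq> vars \<psi>" if "\<beta> |\<in>| \<chi>" for \<beta> using SR(4) that by (auto simp: vars_avars)
  have body: "asub (sub ?s) \<beta> \<in> atoms a" if \<beta>: "\<beta> |\<in>| \<psi>" for \<beta>
  proof -
    have m: "asub (sub s) \<beta> |\<in>| csub (sub s) \<psi>" using \<beta> by (simp add: csub_def)
    then have "avars (asub (sub s) \<beta>) = {}" using MP(5) by (auto simp: ground_def vars_avars)
    moreover have "CQ {|asub (sub s) \<beta>|} \<in> lab p ` set S" unfolding MP(1) using m by blast
    ultimately have "hat lq (asub (sub s) \<beta>) \<in> atoms a" using premD[OF inv e r] by simp
    then show ?thesis using inst[OF SR(1)[OF \<beta>] \<psi>v[OF \<beta>]] by simp
  qed
  \<comment> \<open>The body is matched inside the CQ, so the images of its variables contribute no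
    new variables.\<close>
  have old: "tvars (?h (sub s y)) \<subseteq> \<Union>(avars ` atoms a)" if yv: "y \<in> vars \<psi>" for y
  proof -
    obtain \<beta> where \<beta>: "\<beta> |\<in>| \<psi>" "y \<in> avars \<beta>" using yv by (auto simp: vars_avars)
    then have "sub ?s y = ?h (sub s y)" using \<psi>v[OF \<beta>(1)] sub_s by auto
    then have "tvars (?h (sub s y)) \<subseteq> avars (asub (sub ?s) \<beta>)" using \<beta>(2) unfolding avars_asub by force
    then show ?thesis using body[OF \<beta>(1)] by blast
  qed
  have b\<psi>: "csub (sub ?s) \<psi> |\<subseteq>| ?\<Phi>" using body by (auto simp: csub_def fset_of_list.rep_eq)
  have labN: "hat lq \<alpha>' \<in> atoms a \<union> N" if "(d, LCQ xs, ()) \<in> set lv" "\<alpha>' \<in> set xs" for xs \<alpha>'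
  proof -
    have "\<alpha>' = \<alpha>" using lab_atoms[OF that(1) MP(2)] that(2) by simp
    then show ?thesis using MP(7) by (auto simp: csub_def N_def)
  qed
  have Nflat: "flat_tm t" if "\<beta> \<in> N" "t \<in> set_atom \<beta>" for \<beta> t using that flat_hat by (auto simp: N_def)
  have bN: "bcq (?\<Phi> |\<union>| Q)" if "fset Q \<subseteq> N" for Q
    using inv_bcq[OF inv] that Nflat by (auto simp: bcq_def)
  have rule: "form (rule_of_l ax') = rule_of ax'" "ax' \<in> T" "rule_of ax' \<in> rule_of ` T"
    using f(2) ts by simp_all
  show ?thesis
  proof (cases "\<exists>A1 R1 B1. ax' = ExR A1 R1 B1")
    case False
    then have ro: "rule_of ax' = Rule \<psi> {||} \<chi>" using sk by (cases ax') auto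
    have fl: "flat_tm t" if "\<beta> |\<in>| \<chi>" "t \<in> set_atom \<beta>" for \<beta> t
      using ro[symmetric] that by (cases ax') (auto simp: set_atom_ratom)
    have inst\<chi>: "asub (sub ?s) \<beta> = hat lq (asub (sub s) \<beta>)" if "\<beta> |\<in>| \<chi>" for \<beta>
      by (rule inst) (use fl that \<chi>v[OF that] SR(3) in auto)
    have NQ: "fset (csub (sub ?s) \<chi>) = N" unfolding N_def csub_def using inst\<chi> by (auto intro!: image_cong)
    have "inv (?e # a)"
    proof (rule inv_ext[OF inv e N, of "{}"])
      fix \<beta> assume "\<beta> \<in> N"
      then obtain \<beta>' where \<beta>': "\<beta>' |\<in>| \<chi>" "\<beta> = asub (sub ?s) \<beta>'" using inst\<chi> by (auto simp: N_def)
      have "tvars (sub ?s y) \<subseteq> \<Union>(avars ` atoms a)" if "y \<in> avars \<beta>'" for y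
        using old[of y] \<chi>v[OF \<beta>'(1)] SR(3) that sub_s by fastforce
      then show "avars \<beta> \<subseteq> \<Union>(avars ` atoms a) \<union> {}" unfolding \<beta>'(2) avars_asub by blast
    qed (use Nflat labN in blast)+
    moreover have "cq_inf T (ByMPe ?s []) {CQ ?\<Phi>, Rule \<psi> {||} \<chi>} (CQ (?\<Phi> |\<union>| csub (sub ?s) \<chi>))"
      by (rule cq_inf.MPe[where P = "{||}" and Q = "csub (sub ?s) \<chi>", OF inv_bcq[OF inv] _ b\<psi> _ _ refl])
        (use rule(2) ro bN NQ in \<open>auto simp: image_iff intro: bexI[of _ ax']\<close>)
    moreover have "fset_of_list (map (\<lambda>\<alpha>. hat lq (asub1 (sub s) \<alpha>)) c1) = csub (sub ?s) \<chi>"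
      using N NQ unfolding i fst_conv by (metis fset_inverse fset_of_list.rep_eq)
    moreover have "fresh_ren lq ax' (sub s vx) = []" using False by (cases ax') (auto simp: fresh_ren_def)
    ultimately show ?thesis
      using rule ro k unfolding step_ok_def i Let_def by (simp add: insert_commute)
  next
    case True
    then obtain A1 R1 B1 where E: "ax' = ExR A1 R1 B1" by blast
    let ?t = "sub s vx" let ?f = "Fn (Sk A1 R1 B1) ?t" let ?z = "name_of (lq, ?f)"
    have sk': "\<psi> = {|CA A1 (Var vx)|}" "\<chi> = {|ratom R1 (Var vx) (Fn (Sk A1 R1 B1) (Var vx)), CA B1 (Fn (Sk A1 R1 B1) (Var vx))|}"
      using sk by (simp_all add: E Let_def)
    have hz: "?h ?f = Var ?z" by (simp add: hterm_def)
    have hr: "hat lq (ratom R1 x y) = ratom R1 (?h x) (?h y)" for x y by (cases R1) (simp_all add: hat_def)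
    have Nx: "N = {ratom R1 (?h ?t) (Var ?z), CA B1 (Var ?z)}"
      unfolding N_def sk'(2) by (simp add: asub_ratom hr hz) (simp add: asub_def hat_def hz)
    have vxv: "vx \<in> vars \<psi>" by (simp add: sk' vars_avars)
    have invC: "inv (?e # a)"
    proof (rule inv_ext[OF inv e N, of "{?z}"])
      fix \<beta> assume "\<beta> \<in> N"
      then have "avars \<beta> \<subseteq> tvars (?h ?t) \<union> {?z}" unfolding Nx by (cases R1) auto
      then show "avars \<beta> \<subseteq> \<Union>(avars ` atoms a) \<union> {?z}" using old[OF vxv] by blast
    next
      fix z assume "z \<in> {?z}"
      then show "\<exists>A1 R1 B1 t. z = name_of (lq, Fn (Sk A1 R1 B1) t) \<and>
       ratom R1 (?h t) (?h (Fn (Sk A1 R1 B1) t)) \<in> N \<and> CA B1 (?h (Fn (Sk A1 R1 B1) t)) \<in> N"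
        by (intro exI[of _ A1] exI[of _ R1] exI[of _ B1] exI[of _ ?t]) (simp add: hz Nx)
    qed (use Nflat labN in blast)+
    let ?m = "[(vy, ?z)]"
    have main: "cq_inf T (ByMPe ?s ?m) {CQ ?\<Phi>, rule_of ax'} (CQ (?\<Phi> |\<union>| {|ratom R1 (?h ?t) (Var ?z), CA B1 (Var ?z)|}))"
      if new: "\<not> N \<subseteq> atoms a"
    proof -
      \<comment> \<open>If the variable occurred already, the invariant would provide both head
        atoms, and the instruction would be redundant.\<close>
      have zn: "?z \<notin> \<Union>(avars ` atoms a)"
      proof
        assume "?z \<in> \<Union>(avars ` atoms a)"
        from inv_fresh[OF inv this] have "N \<subseteq> atoms a" unfolding Nx hz by simp
        with new show False ..
      qed
      have ro: "rule_of ax' = Rule \<psi> {|vy|} {|ratom R1 (Var vx) (Var vy), CA B1 (Var vy)|}"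
        by (simp add: E sk')
      have rm: "ren ?m vy = ?z" by (simp add: ren_def)
      let ?\<chi> = "csub (\<lambda>z. if z |\<in>| {|vy|} then Var (ren ?m z) else sub ?s z) {|ratom R1 (Var vx) (Var vy), CA B1 (Var vy)|}"
      have c: "?\<chi> = {|ratom R1 (?h ?t) (Var ?z), CA B1 (Var ?z)|}"
        by (simp add: csub_def asub_ratom rm sub_s) (simp add: asub_def rm)
      have v: "vars ?\<Phi> = \<Union>(avars ` atoms a)" by (simp add: vars_avars fset_of_list.rep_eq)
      show ?thesis unfolding ro
        by (rule cq_inf.MPe[where P = "{||}" and Q = ?\<chi> and X = "{|vy|}" and \<psi> = \<psi>, OF inv_bcq[OF inv] _ b\<psi> _ _ refl])
          (use rule(2) ro bN[of ?\<chi>] Nx c zn v rm in \<open>auto simp: image_iff intro: bexI[of _ ax']\<close>)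
    qed
    have "fset_of_list (map (\<lambda>\<alpha>. hat lq (asub1 (sub s) \<alpha>)) c1) = {|ratom R1 (?h ?t) (Var ?z), CA B1 (Var ?z)|}"
      using N Nx unfolding i fst_conv by (simp add: fset_eq_iff fset_of_list.rep_eq set_eq_iff)
    moreover have "fresh_ren lq ax' (sub s vx) = ?m" by (simp add: fresh_ren_def E)
    ultimately show ?thesis
      using invC main N rule k unfolding step_ok_def Let_def i by (simp add: insert_commute)
  qed
qed

lemma edge_step:
  assumes inv: "inv a" and e: "(S, d, j, u) \<in> set le" and r: "ready S a"
  shows "inv ((S, d, j, u) # a) \<and> step_ok a (S, d, j, u)"
proof (cases j)
  case (ByMP s)
  then show ?thesis using edge_MP[OF inv _ r] e by blast
next
  case (ByE t1 t2)
  then show ?thesis using edge_E[OF inv _ r] e by blast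
next
  case ByC
  from edge_inf[OF e[unfolded ByC]] show ?thesis
  proof cases
    case (C \<gamma>)
    show ?thesis
    proof (rule edge_skip[OF inv e])
      fix xs \<alpha> assume x: "(d, LCQ xs, ()) \<in> set lv" "\<alpha> \<in> set xs" "avars \<alpha> = {}"
      have "\<alpha> |\<in>| \<gamma>" using lab_atoms[OF x(1) C(2)] x(2) by simp
      then have "CQ {|\<alpha>|} \<in> lab p ` set S" unfolding C(1) by blast
      then show "hat lq \<alpha> \<in> atoms a" using premD[OF inv e r _ _ x(3)] by simp
    qed (simp add: instr_of_def ByC)
  qed
next
  case (ByG s)
  from edge_inf[OF e[unfolded ByG]] show ?thesis
  proof cases
    case (G \<gamma>)
    show ?thesis
    proof (rule edge_skip[OF inv e])
      fix xs \<alpha> assume x: "(d, LCQ xs, ()) \<in> set lv" "\<alpha> \<in> set xs" "avars \<alpha> = {}"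
      have "\<alpha> |\<in>| q" using lab_atoms[OF x(1) G(2)] x(2) by simp
      then have "asub (sub s) \<alpha> |\<in>| \<gamma>" using G(5) by (auto simp: csub_def)
      \<comment> \<open>A ground atom of \<open>q\<close> is fixed by the substitution of (G), so it
        occurs already in the premise.\<close>
      moreover have "asub (sub s) \<alpha> = asub Var \<alpha>"
      proof -
        have "tsub (sub s) t = tsub Var t" if "tvars t = {}" for t using that by (induction t) auto
        then show ?thesis unfolding asub_def using x(3) by (intro atom.map_cong0) (auto simp: avars_def)
      qed
      ultimately show "hat lq \<alpha> \<in> atoms a" using premD[OF inv e r _ _ x(3), of \<gamma>] G(1) by simp
    qed (simp add: instr_of_def ByG)
  qed
qed

lemma inv_sorted: "sorted_edges le a \<Longrightarrow> inv a"
proof (induction a)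
  case (Cons e a)
  obtain S d j u where e: "e = (S, d, j, u)" by (cases e)
  show ?case using edge_step[of a S d j u] Cons by (simp add: e ready_def)
qed (rule inv_Nil)

lemma step_sorted: "sorted_edges le (e # a) \<Longrightarrow> step_ok a e"
proof -
  assume a: "sorted_edges le (e # a)"
  obtain S d j u where e: "e = (S, d, j, u)" by (cases e)
  have "inv a" using inv_sorted a by simp
  moreover have "(S, d, j, u) \<in> set le" "ready S a" using a e by (simp_all add: ready_def)
  ultimately show ?thesis using edge_step e by blast
qed

section \<open>The match of the query in the final CQ\<close>

definition "goal_sub = (case find (\<lambda>e. fst (snd e) = sink_vertex lv le) le of None \<Rightarrow> []
   | Some e \<Rightarrow> (case fst (snd (snd e)) of ByMP s \<Rightarrow> [] | ByE t u \<Rightarrow> [] | ByC \<Rightarrow> []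
       | ByG s \<Rightarrow> map (\<lambda>z. (z, hterm lq (sub s z))) (lvars lq)))"

lemma all_targets: "is_target le v \<Longrightarrow> is_target (topo lv le) v"
proof -
  obtain rank where rank: "\<And>S d j u s. (S, d, j, u) \<in> set le \<Longrightarrow> s \<in> set S \<Longrightarrow> rank s < (rank d :: nat)"
    "\<And>v. v \<in> verts p \<Longrightarrow> rank v < length lv" using ex_rank by metis
  have "set le \<subseteq> set (topo lv le)" by (rule topo_complete[of le rank]) (use rank edge_verts in blast)+
  then show "is_target le v \<Longrightarrow> ?thesis" by (rule is_target_mono)
qed

lemma lq_flat: "\<alpha> \<in> set lq \<Longrightarrow> t \<in> set_atom \<alpha> \<Longrightarrow> flat_tm t"
  using bq query(2) bcq_flat by metis

text \<open>If (G) yields the query, its match followed by \<open>hterm\<close> is a match in the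
  representation. Otherwise \<open>q\<close> is ground, and being flat it contains individual names
  only, which \<open>hat\<close> leaves alone.\<close>

lemma goal_sub_atoms: "asub (sub goal_sub) ` set lq \<subseteq> atoms (topo lv le)"
proof -
  let ?a = "topo lv le" and ?v = "sink_vertex lv le"
  have inv: "inv ?a" by (rule inv_sorted[OF sorted_topo])
  have ground_case: ?thesis if gs: "goal_sub = []" and gr: "\<And>\<alpha>. \<alpha> \<in> set lq \<Longrightarrow> avars \<alpha> = {}"
  proof
    fix \<beta> assume "\<beta> \<in> asub (sub goal_sub) ` set lq"
    then obtain \<alpha> where \<alpha>: "\<alpha> \<in> set lq" "\<beta> = asub (sub []) \<alpha>" unfolding gs by blast
    have "sub [] = Var" by (auto simp: sub_def)
    then have "\<beta> = \<alpha>" using \<alpha>(2) by simp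
    moreover have "hat lq \<alpha> = \<alpha>"
    proof (rule hat_Ind)
      fix t assume t: "t \<in> set_atom \<alpha>"
      then have "tvars t = {}" using gr[OF \<alpha>(1)] by (auto simp: avars_def)
      then show "\<exists>a. t = Ind a" using lq_flat[OF \<alpha>(1) t] by (cases t rule: tm.exhaust) simp_all
    qed
    ultimately show "\<beta> \<in> atoms ?a"
      using inv_lab[OF inv query(1) all_targets \<alpha>(1) gr[OF \<alpha>(1)]] by simp
  qed
  have lab: "lab p ?v = CQ q" using lv_verts[OF query(1)] query(2) by simp
  have lq_q: "\<alpha> |\<in>| q \<longleftrightarrow> \<alpha> \<in> set lq" for \<alpha> by (simp add: query(2)[symmetric] fset_of_list.rep_eq)
  show ?thesis
  proof (cases "is_target le ?v")
    case False
    then have "find (\<lambda>e. fst (snd e) = ?v) le = None" by (auto simp: find_None_iff is_target_def)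
    then have gs: "goal_sub = []" by (simp add: goal_sub_def)
    obtain \<beta> where \<beta>: "set lq = {\<beta>}" "\<forall>t\<in>set_atom \<beta>. \<exists>a. t = Ind a"
      using leaf_fact[OF query(1) False] by (elim exE conjE)
    have "avars \<beta> = {}" using \<beta>(2) by (fastforce simp: avars_def)
    then show ?thesis by (intro ground_case gs) (simp add: \<beta>(1))
  next
    case True
    then obtain e where "e \<in> set le" "fst (snd e) = ?v" by (auto simp: is_target_def)
    then obtain e where f: "find (\<lambda>e. fst (snd e) = ?v) le = Some e" "e \<in> set le" "fst (snd e) = ?v"
      by (rule find_SomeE)
    obtain S j u where e: "e = (S, ?v, j, u)" using f(3) by (cases e) auto
    have e': "(S, ?v, j, u) \<in> set le" using f(2) e by simp
    show ?thesis
    proof (cases j)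
      case (ByG s)
      have gs: "goal_sub = map (\<lambda>z. (z, hterm lq (sub s z))) (lvars lq)"
        by (simp add: goal_sub_def f(1) e ByG)
      from edge_inf[OF e'[unfolded ByG]] show ?thesis
      proof cases
        case (G \<gamma>)
        show ?thesis
        proof
          fix \<beta> assume "\<beta> \<in> asub (sub goal_sub) ` set lq"
          then obtain \<alpha> where \<alpha>: "\<alpha> \<in> set lq" "\<beta> = asub (sub goal_sub) \<alpha>" by blast
          have "\<beta> = hat lq (asub (sub s) \<alpha>)" unfolding \<alpha>(2)
          proof (rule hat_asub[OF lq_flat[OF \<alpha>(1)]])
            fix y assume "y \<in> avars \<alpha>"
            then have "y \<in> set (lvars lq)"
              using avars_vars[OF \<alpha>(1)] set_lvars[of lq] bq query(2) by auto
            then show "sub goal_sub y = hterm lq (sub s y)"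
              by (simp add: gs sub_def map_of_map_restrict)
          qed
          moreover have m: "asub (sub s) \<alpha> |\<in>| csub (sub s) q" using \<alpha>(1) lq_q by (simp add: csub_def)
          moreover have "avars (asub (sub s) \<alpha>) = {}" using m G(4) by (auto simp: ground_def vars_avars)
          moreover have "asub (sub s) \<alpha> |\<in>| \<gamma>" using m G(5) by blast
          moreover have "ready S ?a" using all_targets by (simp add: ready_def)
          ultimately show "\<beta> \<in> atoms ?a" using premD[OF inv e', of \<gamma>] G(1) by simp
        qed
      qed
    next
      case (ByMP s)
      have gs: "goal_sub = []" by (simp add: goal_sub_def f(1) e ByMP)
      from edge_inf[OF e'[unfolded ByMP]] show ?thesis
      proof cases
        case (MP ax \<psi> \<chi> \<alpha>)
        then have "avars \<alpha> = {}" by (auto simp: ground_def vars_avars)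
        moreover have "\<beta> = \<alpha>" if "\<beta> \<in> set lq" for \<beta> using MP(2) lab lq_q[of \<beta>] that by simp
        ultimately show ?thesis by (intro ground_case gs) simp
      qed
    next
      case (ByE t1 t2)
      have gs: "goal_sub = []" by (simp add: goal_sub_def f(1) e ByE)
      from edge_inf[OF e'[unfolded ByE]] show ?thesis
      proof cases
        case (E \<alpha> \<beta>)
        then have "avars \<beta> = {}" by (cases \<alpha>; cases \<beta>) (auto simp: ground_def vars_avars repl_def)
        moreover have "\<gamma> = \<beta>" if "\<gamma> \<in> set lq" for \<gamma> using E(2) lab lq_q[of \<gamma>] that by simp
        ultimately show ?thesis by (intro ground_case gs) simp
      qed
    next
      case ByC
      have gs: "goal_sub = []" by (simp add: goal_sub_def f(1) e ByC)
      from edge_inf[OF e'[unfolded ByC]] show ?thesis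
      proof cases
        case (C \<gamma>)
        have "q = \<gamma>" using C(2) lab by simp
        then show ?thesis using lq_q C(3) by (intro ground_case gs) (auto simp: ground_def vars_avars)
      qed
    qed
  qed
qed

lemma to_cq_correct:
  "cq_proof T A q (mkproof (to_cq ((lv, le), ts))) \<and> is_tree (mkproof (to_cq ((lv, le), ts))) \<and>
    repr (mkproof (to_cq ((lv, le), ts))) (to_cq ((lv, le), ts))"
proof -
  let ?a = "topo lv le" and ?U = "rule_of ` T \<union> facts A"
  let ?L = "prog ?a" and ?F = "fact_instrs lv le"
  have inv: "inv ?a" by (rule inv_sorted[OF sorted_topo])
  have fact: "\<exists>\<alpha>. fst e = xs \<and> snd e = (ByCe [], [LCQ xs]) \<and> set xs = {\<alpha>} \<and> avars \<alpha> = {} \<and>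
      (\<forall>t\<in>set_atom \<alpha>. flat_tm t) \<and> CQ (fset_of_list xs) \<in> facts A \<and> distinct xs"
    if "e \<in> set ?F" "xs = fst e" for e xs
  proof -
    from that(1) obtain v ys u where v: "(v, LCQ ys, u) \<in> set lv" "\<not> is_target le v" "e = (ys, ByCe [], [LCQ ys])"
      unfolding fact_instrs_iff by blast
    obtain \<alpha> where \<alpha>: "set ys = {\<alpha>}" "\<forall>t\<in>set_atom \<alpha>. \<exists>a. t = Ind a" "CQ (fset_of_list ys) \<in> facts A"
      using leaf_fact[OF v(1,2)] by (elim exE conjE)
    have "avars \<alpha> = {}" using \<alpha>(2) by (fastforce simp: avars_def)
    moreover have "\<forall>t\<in>set_atom \<alpha>. flat_tm t" using \<alpha>(2) by fastforce
    moreover have "distinct ys" using lv_verts[OF v(1)] by simp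
    ultimately show ?thesis using \<alpha> v(3) that(2) by simp
  qed
  \<comment> \<open>Every state goes back to a fact, the last element of its reversed list, so none
    of the CQs is empty.\<close>
  have last: "last r \<in> set ?F" if "?L = zs @ r" "r \<noteq> []" for zs r
  proof -
    have "last ?L = last r" using that by simp
    moreover have "last ?L = last ?F" using fact_instrs_nonempty by (simp add: prog_def)
    ultimately show ?thesis using fact_instrs_nonempty by (metis last_in_set)
  qed
  have bcq_suffix: "bcq (fset_of_list (known r))" if r: "?L = zs @ r" "r \<noteq> []" for zs r
  proof -
    have "set (known r) \<subseteq> atoms ?a" using r(1) by (auto simp: set_known)
    then have "flat_tm t" if "\<alpha> \<in> set (known r)" "t \<in> set_atom \<alpha>" for \<alpha> t using inv_flat[OF inv _ that(2)] that(1) by blast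
    moreover have "set (fst (last r)) \<subseteq> set (known r)" using last_in_set[OF r(2)] by (auto simp: set_known)
    then have "set (known r) \<noteq> {}" using fact[OF last[OF r] refl] by auto
    ultimately show ?thesis
      by (auto simp: bcq_def fset_of_list.rep_eq fset_of_list_eq_iff[of _ "[]", simplified])
  qed
  have "proof_in (cq_inf T) ?U q (mkproof (chain_verts ?L lq, chain_edges ?L goal_sub)) \<and>
      is_tree (mkproof (chain_verts ?L lq, chain_edges ?L goal_sub)) \<and>
      repr (mkproof (chain_verts ?L lq, chain_edges ?L goal_sub)) (chain_verts ?L lq, chain_edges ?L goal_sub)"
  proof (rule chain_assemble)
    show "?L \<noteq> []" using fact_instrs_nonempty by (simp add: prog_def)
    show "CQ (fset_of_list (fst e)) \<in> ?U" if "?L = zs @ [e]" for zs e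
      using fact[OF last[OF that] refl] by auto
    show "length (snd (snd e)) \<le> 1 \<and> (\<forall>f\<in>set (snd (snd e)). form f \<in> ?U \<and> ldistinct f) \<and>
      cq_inf T (fst (snd e)) (insert (CQ (fset_of_list (known r))) (form ` set (snd (snd e))))
        (CQ (fset_of_list (known (e # r))))"
      if L: "?L = zs @ e # r" and r: "r \<noteq> []" and new: "\<not> set (fst e) \<subseteq> set (known r)" for zs e r
    proof -
      \<comment> \<open>The instruction stems from an inference, covered by the invariant, or from a
        fact, joined by (C_e).\<close>
      from append_split[OF L[unfolded prog_def]] show ?thesis
      proof (elim disjE exE conjE)
        fix zs' x a assume x: "?a = zs' @ x # a" "e = instr_of lv ts lq x" "r = map (instr_of lv ts lq) a @ ?F"
        have "sorted_edges le (x # a)" using sorted_edges_append[of le zs' "x # a"] sorted_topo[of le lv] unfolding x(1) .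
        then have "step_ok a x" by (rule step_sorted)
        moreover have "prog a = r" "prog (x # a) = e # r" using x by (simp_all add: prog_def)
        ultimately show ?thesis using new unfolding step_ok_def Let_def x(2)[symmetric] by simp
      next
        fix zs' assume F: "?F = zs' @ e # r"
        then have "e \<in> set ?F" by simp
        from fact[OF this refl] obtain \<alpha> where \<alpha>: "snd e = (ByCe [], [LCQ (fst e)])" "set (fst e) = {\<alpha>}"
          "avars \<alpha> = {}" "\<forall>t\<in>set_atom \<alpha>. flat_tm t" "CQ (fset_of_list (fst e)) \<in> facts A" "distinct (fst e)"
          by auto
        have f: "fset_of_list (fst e) = {|\<alpha>|}" using \<alpha>(2) by (simp add: fset_eq_iff fset_of_list.rep_eq)
        have b: "bcq (fset_of_list (known r))" using bcq_suffix[of "zs @ [e]" r] L r by simp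
        have ren: "ren [] = id" by (auto simp: ren_def)
        have "cq_inf T (ByCe []) {CQ (fset_of_list (known r)), CQ {|\<alpha>|}}
            (CQ (fset_of_list (known r) |\<union>| csub (\<lambda>z. Var (ren [] z)) {|\<alpha>|}))"
          by (rule cq_inf.Ce[OF b]) (use \<alpha> in \<open>auto simp: bcq_def vars_avars\<close>)
        moreover have "csub (\<lambda>z. Var (ren [] z)) {|\<alpha>|} = {|\<alpha>|}" by (simp add: ren csub_def)
        ultimately show ?thesis using \<alpha>(1,5,6) f by (simp add: known_Cons insert_commute)
      qed
    qed
    show "bcq (fset_of_list (known r))" if "?L = zs @ r" "r \<noteq> []" for zs r by (rule bcq_suffix[OF that])
    show "distinct lq" "fset_of_list lq = q" "bcq q" by (rule query bq)+
    \<comment> \<open>By length: a variable of the CQ is named by data that contain the query, hence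
      it is longer than every variable of the query.\<close>
    show "set (lvars lq) \<inter> vars (fset_of_list (known ?L)) = {}"
    proof -
      have "x \<notin> set (lvars lq)" if mem: "\<alpha> \<in> atoms ?a" "x \<in> avars \<alpha>" for \<alpha> x
      proof
        assume "x \<in> set (lvars lq)"
        then have "length x \<le> csz lq" by (rule length_lvars)
        moreover obtain t :: tm where "x = name_of (lq, t)" using inv_range[OF inv mem(1)] mem(2) by blast
        ultimately show False by (simp add: length_name_of)
      qed
      then show ?thesis by (auto simp: vars_avars fset_of_list.rep_eq)
    qed
    show "fst ` set goal_sub \<subseteq> set (lvars lq)"
      by (auto simp: goal_sub_def split: option.splits sk_just.splits)
    show "asub (sub goal_sub) ` set lq \<subseteq> atoms ?a" by (rule goal_sub_atoms)
  qed
  moreover have "to_cq ((lv, le), ts) = (chain_verts ?L lq, chain_edges ?L goal_sub)"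
    unfolding to_cq_def Let_def prog_def goal_sub_def lq_def fst_conv snd_conv ..
  ultimately show ?thesis by (simp add: cq_proof_def)
qed

end

theorem sk_to_cq_tree:
  "polytime_transformable sk_proof enc_sk_just (\<lambda>T A q p. cq_proof T A q p \<and> is_tree p) enc_cq_just"
  unfolding enc_cq_just_inst[symmetric] enc_sk_just_inst[symmetric]
proof (rule polytime_transformableI[OF pt_to_cq])
  fix T A q and p :: "sk_just hproof" and l ts
  assume "is_abox A" "bcq q" "sk_proof T A q p" "repr p l" "set ts = T"
  then interpret sk_input T A q p "fst l" "snd l" ts
    by unfold_locales (simp_all add: sk_proof_def)
  show "\<exists>p'. (cq_proof T A q p' \<and> is_tree p') \<and> repr p' (to_cq (l, ts))" using to_cq_correct by auto
qed

text \<open>Both claims on the direction from Skolem terms to CQs are weakenings of the tree-valued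
  transformation.\<close>

lemma polytime_transformable_mono:
  assumes "polytime_transformable P e Q e'" "\<And>T A q p. P' T A q p \<Longrightarrow> P T A q p"
    "\<And>T A q p. Q T A q p \<Longrightarrow> Q' T A q p"
  shows "polytime_transformable P' e Q' e'"
  using assms unfolding polytime_transformable_def by meson

theorem theorem14:
  shows "polytime_transformable cq_proof enc_cq_just sk_proof enc_sk_just \<and>
    polytime_transformable sk_proof enc_sk_just cq_proof enc_cq_just \<and>
    polytime_transformable
      (\<lambda>T A q p. sk_proof T A q p \<and> is_tree p) enc_sk_just
      (\<lambda>T A q p. cq_proof T A q p \<and> is_tree p) enc_cq_just"
  by (intro conjI cq_to_sk polytime_transformable_mono[OF sk_to_cq_tree]) simp_all

end
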